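(* Let $n \ge 3$. Suppose that $A_1 \subseteq A_2 \subseteq \cdots$ and $A'_1 \subseteq A'_2 \subseteq \cdots$ are towers of direct sums of $2n$-cycle algebras, where the inclusions are rigid, and let $\mathcal{A}$, $\mathcal{A}'$ be their norm-closed direct limits. Then the operator algebras $\mathcal{A}$ and $\mathcal{A}'$ are star-extendibly isomorphic if and only if there are indices $m_1<m_2<\cdots$ and $n_1<n_2<\cdots$ and rigid embeddings $\phi_1 : A_1 \to A'_{n_1}$, $\psi_k : A'_{n_k} \to A_{m_k}$ ($k\ge 1$), $\phi_{k+1} : A_{m_k} \to A'_{n_{k+1}}$ ($k\ge 1$) such that the resulting diagram commutes, i.e. all compositions $\psi_k\circ\phi_k$ and $\phi_{k+1}\circ\psi_k$ are the given inclusions of the towers.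
   Context: Digraph algebras. A digraph is a finite directed graph with no multiple directed edges of the same orientation. For a transitive, reflexive digraph $G$ on vertices $v_1,\dots,v_N$, the digraph algebra $A(G)\subseteq M_N(\mathbb{C})$ is the span of the standard matrix units $e_{i,j}$ such that $G$ has an edge from $v_j$ to $v_i$. The reduced digraph $G_r$ is obtained by identifying vertices $v_i,v_j$ whenever both edges $v_i\to v_j$ and $v_j\to v_i$ occur. $D_{2n}$ is the digraph on vertices $1,\dots,2n$ with a loop at each vertex and one further edge between each pair of cyclically successive vertices, with alternating orientations, vertex $1$ (hence each odd vertex) being a range vertex; thus $A(D_{2n})$ is spanned by the $e_{ii}$ and the $e_{ij}$ with $i$ odd, $j$ even, $i,j$ cyclically adjacent. A $2n$-cycle algebra is a digraph algebra $A(G)$ whose reduced digraph is isomorphic to $D_{2n}$. Maps. A star-extendible map $A\to A'$ between (direct sums of) digraph algebras is one that is the restriction of a star-algebra homomorphism $C^*(A)\to C^*(A')$ of the generated star-algebras; embeddings are injective and star-extendible. A multiplicity one embedding $i:A(D_{2n})\to A$ (each $i(e_{jj})$ has rank one) is proper if the projections $i(e_{jj})$, $1\le j\le 2n$, are pairwise inequivalent in $A\cap A^*$. A star-extendible embedding of $A(D_{2n})$ into a (direct sum of) $2n$-cycle algebra(s) is rigid if it is a direct sum of proper multiplicity one embeddings. An embedding $\phi:A\to A'$ between (direct sums of) $2n$-cycle algebras is rigid if $\phi\circ\eta$ is rigid for every proper $\eta:A(D_{2n})\to A$. Limits. $\mathcal{A}$ is the norm closure of $\bigcup_k A_k$ in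 the $C^*$-algebra $\varinjlim C^*(A_k)$, and similarly for $\mathcal{A}'$. A star-extendible isomorphism $\mathcal{A}\to\mathcal{A}'$ is an algebra isomorphism that is the restriction of a star-isomorphism of the generated $C^*$-algebras. *)

theory Defs
  imports
    "HOL-Analysis.L2_Norm"
    "Jordan_Normal_Form.Schur_Decomposition"
    "Jordan_Normal_Form.DL_Rank"
begin

section \<open>Normed star-algebras given by a carrier\<close>

text \<open>
  The algebras occurring here (matrix algebras of varying size, C*-algebraic direct limits) are
  not types, so they are handled through a record of operations on a carrier. No unit is
  recorded: limits of non-unital inclusions need not have one. No axioms are imposed; all
  instances below are explicit.
\<close>

record 'a star_alg =
  car :: "'a set"
  add :: "'a \<Rightarrow> 'a \<Rightarrow> 'a"
  mul :: "'a \<Rightarrow> 'a \<Rightarrow> 'a"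
  scl :: "complex \<Rightarrow> 'a \<Rightarrow> 'a"
  adj :: "'a \<Rightarrow> 'a"
  nrm :: "'a \<Rightarrow> real"

definition ndist :: "'a star_alg \<Rightarrow> 'a \<Rightarrow> 'a \<Rightarrow> real" where
  "ndist M x y = nrm M (add M x (scl M (- 1) y))"

definition nclosure :: "'a star_alg \<Rightarrow> 'a set \<Rightarrow> 'a set" where
  "nclosure M S = {x \<in> car M. \<forall>\<epsilon>>0. \<exists>s\<in>S. ndist M x s < \<epsilon>}"

definition star_subalg :: "'a star_alg \<Rightarrow> 'a set \<Rightarrow> bool" where
  "star_subalg M T \<longleftrightarrow> T \<subseteq> car M \<and> T \<noteq> {} \<and>
     (\<forall>x\<in>T. \<forall>y\<in>T. add M x y \<in> T \<and> mul M x y \<in> T) \<and>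
     (\<forall>c. \<forall>x\<in>T. scl M c x \<in> T) \<and> (\<forall>x\<in>T. adj M x \<in> T)"

text \<open>The star-algebra, respectively the C*-algebra, generated by a subset of \<open>M\<close>.\<close>

definition gen_star :: "'a star_alg \<Rightarrow> 'a set \<Rightarrow> 'a star_alg" where
  "gen_star M S = M\<lparr>car := \<Inter>{T. star_subalg M T \<and> S \<subseteq> T}\<rparr>"

definition gen_cstar :: "'a star_alg \<Rightarrow> 'a set \<Rightarrow> 'a star_alg" where
  "gen_cstar M S = M\<lparr>car := \<Inter>{T. star_subalg M T \<and> nclosure M T \<subseteq> T \<and> S \<subseteq> T}\<rparr>"

text \<open>Homomorphisms are only constrained on the subset \<open>S\<close> and need not preserve units.\<close>

definition alg_hom :: "'a star_alg \<Rightarrow> 'a set \<Rightarrow> 'b star_alg \<Rightarrow> 'b set \<Rightarrow> ('a \<Rightarrow> 'b) \<Rightarrow> bool" where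
  "alg_hom M S M' S' \<theta> \<longleftrightarrow> \<theta> ` S \<subseteq> S' \<and>
     (\<forall>x\<in>S. \<forall>y\<in>S. \<theta> (add M x y) = add M' (\<theta> x) (\<theta> y) \<and> \<theta> (mul M x y) = mul M' (\<theta> x) (\<theta> y)) \<and>
     (\<forall>c. \<forall>x\<in>S. \<theta> (scl M c x) = scl M' c (\<theta> x))"

definition star_hom :: "'a star_alg \<Rightarrow> 'b star_alg \<Rightarrow> ('a \<Rightarrow> 'b) \<Rightarrow> bool" where
  "star_hom M M' \<Theta> \<longleftrightarrow> alg_hom M (car M) M' (car M') \<Theta> \<and>
     (\<forall>x\<in>car M. \<Theta> (adj M x) = adj M' (\<Theta> x))"

section \<open>Digraph algebras and their direct sums\<close>

definition op_norm :: "complex mat \<Rightarrow> real" where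
  "op_norm X = (SUP v\<in>{v \<in> carrier_vec (dim_col X). L2_set (\<lambda>i. cmod (v $ i)) {..<dim_vec v} \<le> 1}.
     L2_set (\<lambda>i. cmod ((X *\<^sub>v v) $ i)) {..<dim_row X})"

definition mat_alg :: "nat \<Rightarrow> complex mat star_alg" where
  "mat_alg N = \<lparr>car = carrier_mat N N, add = (+), mul = (*), scl = (\<cdot>\<^sub>m), adj = mat_adjoint,
     nrm = op_norm\<rparr>"

text \<open>
  A digraph is \<open>(N, E)\<close> with vertices \<open>0, \<dots>, N - 1\<close>; \<open>(a, b) \<in> E\<close> means that there is an edge
  from \<open>a\<close> to \<open>b\<close>.
\<close>

type_synonym digraph = "nat \<times> nat rel"

definition tr_digraph :: "digraph \<Rightarrow> bool" where
  "tr_digraph G \<longleftrightarrow> preorder_on {..<fst G} (snd G)"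

definition munit :: "nat \<Rightarrow> nat \<Rightarrow> nat \<Rightarrow> complex mat" where
  "munit N i k = mat N N (\<lambda>(a, b). if a = i \<and> b = k then 1 else 0)"

text \<open>
  The span of the \<open>munit N i k\<close> with an edge from \<open>k\<close> to \<open>i\<close>, in the form of all matrices with
  arbitrary coefficients \<open>c i k\<close> at these positions.
\<close>

definition digraph_alg :: "digraph \<Rightarrow> complex mat set" where
  "digraph_alg G =
     {mat (fst G) (fst G) (\<lambda>(i, k). if (k, i) \<in> snd G then c i k else 0) | c. True}"

text \<open>
  The direct sum of the digraph algebras of a list of digraphs, as block diagonal matrices inside
  the full matrix algebra of the total size.
\<close>

definition dsum_alg :: "digraph list \<Rightarrow> complex mat set" where
  "dsum_alg Gs = {diag_block_mat Xs | Xs. list_all2 (\<lambda>X G. X \<in> digraph_alg G) Xs Gs}"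

text \<open>A single digraph algebra is the direct sum over a one-element list.\<close>

lemma dsum_alg_single: "dsum_alg [G] = digraph_alg G"
proof -
  have "four_block_mat X (0\<^sub>m (dim_row X) 0) (0\<^sub>m 0 (dim_col X)) (0\<^sub>m 0 0) = X"
    for X :: "complex mat"
    by (rule eq_matI) auto
  then show ?thesis
    by (auto simp: dsum_alg_def list_all2_Cons2 Let_def intro!: exI[of _ "[_]"])
qed

definition dsum_amb :: "digraph list \<Rightarrow> complex mat star_alg" where
  "dsum_amb Gs = mat_alg (sum_list (map fst Gs))"

definition dsum_cstar :: "digraph list \<Rightarrow> complex mat star_alg" where
  "dsum_cstar Gs = gen_star (dsum_amb Gs) (dsum_alg Gs)"

text \<open>
  \<open>D\<^sub>2\<^sub>n\<close>, with the vertices \<open>1, \<dots>, 2 n\<close> renumbered as \<open>0, \<dots>, 2 n - 1\<close>: the range vertices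
  (ends of the non-loop edges) are therefore the even ones.
\<close>

definition cycle_graph :: "nat \<Rightarrow> digraph" where
  "cycle_graph n = (2 * n,
     {(k, i). k < 2 * n \<and> i < 2 * n \<and>
        (k = i \<or> odd k \<and> even i \<and> (k = Suc i mod (2 * n) \<or> i = Suc k mod (2 * n)))})"

definition reduced_verts :: "digraph \<Rightarrow> nat set set" where
  "reduced_verts G = {..<fst G} // (snd G \<inter> (snd G)\<inverse>)"

definition reduced_edges :: "digraph \<Rightarrow> nat set rel" where
  "reduced_edges G = {(V, W). V \<in> reduced_verts G \<and> W \<in> reduced_verts G \<and>
     (\<exists>a\<in>V. \<exists>b\<in>W. (a, b) \<in> snd G)}"

definition is_cycle_digraph :: "nat \<Rightarrow> digraph \<Rightarrow> bool" where
  "is_cycle_digraph n G \<longleftrightarrow> tr_digraph G \<and>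
     (\<exists>f. bij_betw f (reduced_verts G) {..<fst (cycle_graph n)} \<and>
       (\<forall>V\<in>reduced_verts G. \<forall>W\<in>reduced_verts G.
          (V, W) \<in> reduced_edges G \<longleftrightarrow> (f V, f W) \<in> snd (cycle_graph n)))"

definition is_cycle_sum :: "nat \<Rightarrow> digraph list \<Rightarrow> bool" where
  "is_cycle_sum n Gs \<longleftrightarrow> Gs \<noteq> [] \<and> (\<forall>G\<in>set Gs. is_cycle_digraph n G)"

section \<open>Star-extendible and rigid embeddings\<close>

definition star_extendible :: "digraph list \<Rightarrow> digraph list \<Rightarrow> (complex mat \<Rightarrow> complex mat) \<Rightarrow> bool" where
  "star_extendible Gs Hs \<phi> \<longleftrightarrow> \<phi> ` dsum_alg Gs \<subseteq> dsum_alg Hs \<and>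
     (\<exists>\<Phi>. star_hom (dsum_cstar Gs) (dsum_cstar Hs) \<Phi> \<and> (\<forall>x\<in>dsum_alg Gs. \<Phi> x = \<phi> x))"

definition embedding :: "digraph list \<Rightarrow> digraph list \<Rightarrow> (complex mat \<Rightarrow> complex mat) \<Rightarrow> bool" where
  "embedding Gs Hs \<phi> \<longleftrightarrow> star_extendible Gs Hs \<phi> \<and> inj_on \<phi> (dsum_alg Gs)"

text \<open>Equivalence of projections in \<open>A \<inter> A*\<close>, for \<open>A = dsum_alg Hs\<close>.\<close>

definition proj_equiv :: "digraph list \<Rightarrow> complex mat \<Rightarrow> complex mat \<Rightarrow> bool" where
  "proj_equiv Hs p q \<longleftrightarrow> (\<exists>v. v \<in> dsum_alg Hs \<and> mat_adjoint v \<in> dsum_alg Hs \<and>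
     mat_adjoint v * v = p \<and> v * mat_adjoint v = q)"

text \<open>Proper multiplicity one embeddings of \<open>A(D\<^sub>2\<^sub>n)\<close>.\<close>

definition proper_emb :: "nat \<Rightarrow> digraph list \<Rightarrow> (complex mat \<Rightarrow> complex mat) \<Rightarrow> bool" where
  "proper_emb n Hs \<eta> \<longleftrightarrow> embedding [cycle_graph n] Hs \<eta> \<and>
     (\<forall>i<2*n. vec_space.rank (sum_list (map fst Hs)) (\<eta> (munit (2*n) i i)) = 1) \<and>
     (\<forall>i<2*n. \<forall>k<2*n. i \<noteq> k \<longrightarrow>
        \<not> proj_equiv Hs (\<eta> (munit (2*n) i i)) (\<eta> (munit (2*n) k k)))"

text \<open>
  Rigid embeddings of \<open>A(D\<^sub>2\<^sub>n)\<close>. Since the summands are star-extendible, they form a direct sum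
  exactly if the projections onto which they map the identity are pairwise orthogonal.
\<close>

definition rigid_cycle_emb :: "nat \<Rightarrow> digraph list \<Rightarrow> (complex mat \<Rightarrow> complex mat) \<Rightarrow> bool" where
  "rigid_cycle_emb n Hs \<phi> \<longleftrightarrow> embedding [cycle_graph n] Hs \<phi> \<and>
     (let N = sum_list (map fst Hs) in
      \<exists>\<theta>s. (\<forall>\<theta>\<in>set \<theta>s. proper_emb n Hs \<theta>) \<and>
        (\<forall>s<length \<theta>s. \<forall>t<length \<theta>s. s \<noteq> t \<longrightarrow>
           (\<theta>s ! s) (1\<^sub>m (2*n)) * (\<theta>s ! t) (1\<^sub>m (2*n)) = 0\<^sub>m N N) \<and>
        (\<forall>x\<in>dsum_alg [cycle_graph n]. \<phi> x = foldr (\<lambda>\<theta> y. \<theta> x + y) \<theta>s (0\<^sub>m N N)))"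

definition rigid :: "nat \<Rightarrow> digraph list \<Rightarrow> digraph list \<Rightarrow> (complex mat \<Rightarrow> complex mat) \<Rightarrow> bool" where
  "rigid n Gs Hs \<phi> \<longleftrightarrow> embedding Gs Hs \<phi> \<and>
     (\<forall>\<eta>. proper_emb n Gs \<eta> \<longrightarrow> rigid_cycle_emb n Hs (\<phi> \<circ> \<eta>))"

section \<open>Towers and their limits\<close>

text \<open>
  A tower \<open>A\<^sub>0 \<subseteq> A\<^sub>1 \<subseteq> \<dots>\<close> is a direct system: \<open>A\<^sub>k = dsum_alg (G k)\<close>, and \<open>\<iota> k\<close> is the inclusion
  of \<open>C*(A\<^sub>k)\<close> into \<open>C*(A\<^sub>k\<^sub>+\<^sub>1)\<close>, which restricts to the rigid inclusion of \<open>A\<^sub>k\<close> into \<open>A\<^sub>k\<^sub>+\<^sub>1\<close>.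
  As \<open>A\<^sub>k\<close> generates \<open>C*(A\<^sub>k)\<close>, that restriction determines \<open>\<iota> k\<close> on \<open>C*(A\<^sub>k)\<close>.
\<close>

definition rigid_tower :: "nat \<Rightarrow> (nat \<Rightarrow> digraph list) \<Rightarrow> (nat \<Rightarrow> complex mat \<Rightarrow> complex mat) \<Rightarrow> bool" where
  "rigid_tower n G \<iota> \<longleftrightarrow> (\<forall>k. is_cycle_sum n (G k)) \<and>
     (\<forall>k. star_hom (dsum_cstar (G k)) (dsum_cstar (G (Suc k))) (\<iota> k)) \<and>
     (\<forall>k. rigid n (G k) (G (Suc k)) (\<iota> k))"

text \<open>\<open>incl \<iota> k l\<close> is the inclusion of stage \<open>k\<close> into stage \<open>l\<close> (the identity if \<open>l \<le> k\<close>).\<close>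

definition incl :: "(nat \<Rightarrow> 'a \<Rightarrow> 'a) \<Rightarrow> nat \<Rightarrow> nat \<Rightarrow> 'a \<Rightarrow> 'a" where
  "incl \<iota> k l = fold \<iota> [k..<l]"

text \<open>
  The C*-algebraic direct limit of \<open>B\<^sub>0 \<rightarrow> B\<^sub>1 \<rightarrow> \<dots>\<close> is realised in the usual way inside the quotient
  of the product of the \<open>B\<^sub>k\<close> (bounded sequences) by the ideal of null sequences. Elements of
  the quotient are cosets, i.e. sets of sequences, and its norm is the quotient norm.
\<close>

definition bdd_seqs :: "(nat \<Rightarrow> 'a star_alg) \<Rightarrow> (nat \<Rightarrow> 'a) set" where
  "bdd_seqs B = {x. (\<forall>k. x k \<in> car (B k)) \<and> bdd_above (range (\<lambda>k. nrm (B k) (x k)))}"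

definition null_coset :: "(nat \<Rightarrow> 'a star_alg) \<Rightarrow> (nat \<Rightarrow> 'a) \<Rightarrow> (nat \<Rightarrow> 'a) set" where
  "null_coset B y = {x \<in> bdd_seqs B. (\<lambda>k. ndist (B k) (x k) (y k)) \<longlonglongrightarrow> 0}"

definition seq_quotient :: "(nat \<Rightarrow> 'a star_alg) \<Rightarrow> (nat \<Rightarrow> 'a) set star_alg" where
  "seq_quotient B = \<lparr>
     car = null_coset B ` bdd_seqs B,
     add = (\<lambda>X Y. \<Union>x\<in>X. \<Union>y\<in>Y. null_coset B (\<lambda>k. add (B k) (x k) (y k))),
     mul = (\<lambda>X Y. \<Union>x\<in>X. \<Union>y\<in>Y. null_coset B (\<lambda>k. mul (B k) (x k) (y k))),
     scl = (\<lambda>c X. \<Union>x\<in>X. null_coset B (\<lambda>k. scl (B k) c (x k))),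
     adj = (\<lambda>X. \<Union>x\<in>X. null_coset B (\<lambda>k. adj (B k) (x k))),
     nrm = (\<lambda>X. INF x\<in>X. SUP k. nrm (B k) (x k))\<rparr>"

text \<open>
  The image of \<open>a \<in> B\<^sub>K\<close> in the limit. The entries of index \<open>k < K\<close> of the sequence below are
  not in \<open>B\<^sub>k\<close>, but finitely many entries do not affect its coset.
\<close>

definition lim_emb :: "(nat \<Rightarrow> 'a star_alg) \<Rightarrow> (nat \<Rightarrow> 'a \<Rightarrow> 'a) \<Rightarrow> nat \<Rightarrow> 'a \<Rightarrow> (nat \<Rightarrow> 'a) set" where
  "lim_emb B \<iota> K a = null_coset B (\<lambda>k. incl \<iota> K k a)"

definition cstar_limit :: "(nat \<Rightarrow> 'a star_alg) \<Rightarrow> (nat \<Rightarrow> 'a \<Rightarrow> 'a) \<Rightarrow> (nat \<Rightarrow> 'a) set star_alg" where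
  "cstar_limit B \<iota> =
     (seq_quotient B)\<lparr>car := nclosure (seq_quotient B) (\<Union>K. lim_emb B \<iota> K ` car (B K))\<rparr>"

definition tower_cstar ::
  "(nat \<Rightarrow> digraph list) \<Rightarrow> (nat \<Rightarrow> complex mat \<Rightarrow> complex mat) \<Rightarrow> (nat \<Rightarrow> complex mat) set star_alg" where
  "tower_cstar G \<iota> = cstar_limit (\<lambda>k. dsum_cstar (G k)) \<iota>"

definition tower_limit ::
  "(nat \<Rightarrow> digraph list) \<Rightarrow> (nat \<Rightarrow> complex mat \<Rightarrow> complex mat) \<Rightarrow> (nat \<Rightarrow> complex mat) set set" where
  "tower_limit G \<iota> = nclosure (tower_cstar G \<iota>)
     (\<Union>K. lim_emb (\<lambda>k. dsum_cstar (G k)) \<iota> K ` dsum_alg (G K))"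

definition star_ext_isomorphic :: "'a star_alg \<Rightarrow> 'a set \<Rightarrow> 'b star_alg \<Rightarrow> 'b set \<Rightarrow> bool" where
  "star_ext_isomorphic M S M' S' \<longleftrightarrow>
     (\<exists>\<theta> \<Theta>. alg_hom M S M' S' \<theta> \<and> bij_betw \<theta> S S' \<and>
        star_hom (gen_cstar M S) (gen_cstar M' S') \<Theta> \<and>
        bij_betw \<Theta> (car (gen_cstar M S)) (car (gen_cstar M' S')) \<and>
        (\<forall>x\<in>S. \<Theta> x = \<theta> x))"

end

theory Submission
 imports Defs "HOL-Library.Nat_Bijection"
begin

text \<open>
 A rigid embedding is, on each summand, a direct sum of compressions \<open>x \<mapsto> F x F\<^sup>*\<close> by partial isometries \<open>F\<close>
 which map the classes of the source to those of one summand of the target along an automorphism of the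
 cycle. Hence it is determined up to a unitary of \<open>A \<inter> A\<^sup>*\<close> by the numbers of compressions of each type,
 and two embeddings which are close are unitarily equivalent.

 An isomorphism \<open>\<Theta>\<close> of the limits maps the diagonal to the diagonal. For a matrix unit system of a
 stage, the images of its cycle under \<open>\<Theta>\<close> are compared with the projections \<open>P\<^sub>j\<close> onto the \<open>j\<close>-th classes
 in the limit; since two positions of a cycle with \<open>n \<ge> 3\<close> have at most one common neighbour, the relative
 projections at adjacent positions commute and split the image into finitely many cycles, each turned by an
 automorphism. Perturbing these into a late stage gives a rigid embedding close to \<open>\<Theta>\<close>. The
 uniqueness up to unitaries turns the approximate intertwining into an exact one.

 Conversely, a commuting diagram transports representing sequences, as star homomorphisms of finite
 dimensional C*-algebras are contractive.
\<close>

section \<open>C*-normed algebras without unit\<close>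

text \<open>The extension of a star-extendible map is determined by the map, and the star-algebra
  generated by a cycle sum is the full block diagonal algebra, because a cycle is connected. So the
  arguments run with star homomorphisms of the block algebras \<open>bal\<close> that respect the
  subalgebras \<open>dal\<close>. The inclusions need not be unital, so invertibility of 1 - h
  becomes solvability of u = h + u h, and functional calculus is replaced by iterations that
  preserve supports of matrices exactly. An obstacle is that the inclusions may turn the cycles: the
  projections onto the j-th classes then live only in the algebra of all bounded sequences, and are
  useful because the diagonal of the limit commutes with them. Moreover two positions of a source
  cycle must not be sent to one target position; this is ensured by showing that the image of a
  non-diagonal matrix unit has no diagonal part. Multiplicities are integers, so closeness 1/4 on
  matrix units already fixes them.\<close>

abbreviation (input) iff_ascii (infixr "<->" 25) where "A <-> B \<equiv> A \<longleftrightarrow> B"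

abbreviation evt :: "(nat => bool) => bool" (binder "EVT " 10) where "evt P \<equiv> eventually P sequentially"

text \<open>Both instances, the finitely supported matrices and the bounded sequences of them modulo
  null sequences, are without unit, and the former is not complete. \<open>csc\<close> is the
  complex scalar multiplication, tied by \<open>csc_real\<close> to the real one of the
  superclass.\<close>

class cstar = real_normed_algebra +
 fixes st :: "'a => 'a" and csc :: "complex => 'a => 'a"
 assumes st_st [simp]: "st (st x) = x" and st_add: "st (x + y) = st x + st y" and st_mult: "st (x*y) = st y*st x"
  and norm_st_mult: "norm (st x*x) = (norm x)\<^sup>2" and csc_real: "csc (of_real r) x = r *\<^sub>R x"
  and csc_add_left: "csc (a + b) x = csc a x + csc b x" and csc_add_right: "csc a (x + y) = csc a x + csc a y"
  and csc_csc: "csc a (csc b x) = csc (a*b) x" and csc_mult_left: "csc a x*y = csc a (x*y)"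
  and csc_mult_right: "x*csc a y = csc a (x*y)" and st_csc: "st (csc a x) = csc (cnj a) (st x)"

lemma csc_one [simp]: "csc 1 x = (x :: 'a :: cstar)" using csc_real[of 1 x] by simp

lemma csc_zero [simp]: "csc 0 x = (0 :: 'a :: cstar)" using csc_real[of 0 x] by simp

lemma csc_minus_one [simp]: "csc (- 1) x = - (x :: 'a :: cstar)" using csc_real[of "- 1" x] by simp

lemma csc_zero_right [simp]: "csc a 0 = (0 :: 'a :: cstar)" using csc_add_right[of a 0 0] by simp

lemma st_zero [simp]: "st 0 = (0 :: 'a :: cstar)" using st_add[of 0 0] by simp

lemma st_minus: "st (- x) = - st x" using st_add[of x "- x"] by (simp add: minus_unique)

lemma st_diff: "st (x - y) = st x - st y" using st_add[of x "- y"] st_minus by simp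

lemma st_sum: "st (sum f A) = (\<Sum>x\<in>A. st (f x))" by (induction A rule: infinite_finite_induct) (auto simp: st_add)

lemma csc_sum: "csc a (sum f A) = (\<Sum>x\<in>A. csc a (f x))"
 by (induction A rule: infinite_finite_induct) (auto simp: csc_add_right)

lemma csc_minus_right: "csc a (- x) = - csc a x" using csc_add_right[of a x "- x"] by (simp add: minus_unique)

lemma csc_diff_right: "csc a (x - y) = csc a x - csc a y" using csc_add_right[of a x "- y"] csc_minus_right by simp

lemma st_scaleR: "st (r *\<^sub>R x) = r *\<^sub>R st x" using st_csc[of "of_real r" x] by (simp add: csc_real)

lemma norm_st [simp]: "norm (st x) = norm (x :: 'a :: cstar)"
proof -
 have *: "norm y <= norm (st y)" for y :: 'a
 proof (cases "norm y = 0")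
  case False
  have "norm y*norm y <= norm (st y)*norm y"
   using norm_st_mult[of y] norm_mult_ineq[of "st y" y] by (simp add: power2_eq_square)
  then show ?thesis using False norm_ge_zero[of y] by simp
 qed simp
 show ?thesis using *[of x] *[of "st x"] by simp
qed

lemma norm_csc: "norm (csc a x) = cmod a*norm x"
proof -
 have "(norm (csc a x))\<^sup>2 = norm (csc (cnj a*a) (st x*x))"
  by (simp add: norm_st_mult[symmetric] st_csc csc_mult_left csc_mult_right csc_csc mult.commute)
 also have "cnj a*a = of_real ((cmod a)\<^sup>2)" using complex_norm_square[of a] by simp
 also have "norm (csc (of_real ((cmod a)\<^sup>2)) (st x*x)) = (cmod a*norm x)\<^sup>2"
  by (simp add: csc_real norm_st_mult power_mult_distrib del: of_real_power)
 finally show ?thesis by simp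
qed

definition proj :: "'a :: cstar => bool" where "proj p <-> st p = p & p*p = p"

lemma projD: "proj p ==> st p = p" "proj p ==> p*p = p" by (auto simp: proj_def)

lemma proj_norm_le: "proj p ==> norm p <= 1"
proof -
 assume p: "proj p"
 then have "(norm p)\<^sup>2 = norm p" using norm_st_mult[of p] by (simp add: projD)
 then show ?thesis by (auto simp add: power2_eq_square)
qed

lemma partial_isometry_norm_le: "proj (st v*v) ==> norm v <= 1" using proj_norm_le[of "st v*v"] norm_st_mult[of v]
 by (metis abs_norm_cancel abs_square_le_1)

lemma proj_sum:
 assumes "finite I" "!!i. i\<in>I ==> proj (p i)" "!!i j. i\<in>I ==> j\<in>I ==> i ~= j ==> p i*p j = 0" shows "proj (sum p I)"
proof -
 have "sum p I*sum p I = (\<Sum>i\<in>I. \<Sum>j\<in>I. p i*p j)" by (simp add: sum_product)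
 also have "... = (\<Sum>i\<in>I. \<Sum>j\<in>I. if i = j then p i else 0)"
  by (intro sum.cong refl) (use assms in "auto simp: projD")
 finally have "sum p I*sum p I = sum p I" using assms(1) by simp
 then show ?thesis using assms by (simp add: proj_def st_sum)
qed

text \<open>
 Conjugating by the symmetries \<open>1 - 2 p\<close> and \<open>1 - 2 q\<close> and averaging removes the entries of \<open>y\<close>
 between \<open>p\<close>, \<open>q\<close> and their complements; this is done one pair at a time.
\<close>

lemma norm_sum_corners_le:
 fixes y :: "'a :: cstar"
 assumes fin: "finite I" and p: "!!i. i\<in>I ==> proj (p i)" and q: "!!i. i\<in>I ==> proj (q i)"
  and po: "!!i j. i\<in>I ==> j\<in>I ==> i ~= j ==> p i*p j = 0"
  and qo: "!!i j. i\<in>I ==> j\<in>I ==> i ~= j ==> q i*q j = 0" shows "norm (\<Sum>i\<in>I. p i*y*q i) <= norm y"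
proof -
 have refl_l: "norm (x - 2 *\<^sub>R (r*x)) = norm x" if "proj r" for r x :: 'a
 proof -
  have "st (x - 2 *\<^sub>R (r*x))*(x - 2 *\<^sub>R (r*x)) =
   st x*x - 2 *\<^sub>R (st x*(r*x)) - 2 *\<^sub>R (st x*(r*x)) + 4 *\<^sub>R (st x*((r*r)*x))"
   using projD(1)[OF that] by (simp add: st_diff st_scaleR st_mult algebra_simps)
  also have "... = st x*x" using projD[OF that] by (simp add: algebra_simps flip: scaleR_add_left)
  finally have "(norm (x - 2 *\<^sub>R (r*x)))\<^sup>2 = (norm x)\<^sup>2" by (metis norm_st_mult)
  then show ?thesis by simp
 qed
 have refl_r: "norm (x - 2 *\<^sub>R (x*r)) = norm x" if "proj r" for r x :: 'a
  using refl_l[OF that, of "st x"] norm_st[of "x - 2 *\<^sub>R (x*r)"] projD[OF that] by (simp add: st_diff st_scaleR st_mult)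
 \<comment> \<open>The element equals r x s + (1 - r) x (1 - s). It is the average of
   \<open>x\<close> and its image under the two symmetries, so its norm does not exceed that of
   \<open>x\<close>.\<close>
 have step: "norm (x - r*x - x*s + 2 *\<^sub>R (r*x*s)) <= norm x" if "proj r" "proj s" for x r s :: 'a
 proof -
  let ?z = "(x - 2 *\<^sub>R (x*s)) - 2 *\<^sub>R (r*(x - 2 *\<^sub>R (x*s)))"
  have "x - r*x - x*s + 2 *\<^sub>R (r*x*s) = (1/2) *\<^sub>R (x + ?z)" by (simp add: algebra_simps flip: scaleR_add_left)
  also have "norm ... <= (1/2)*(norm x + norm ?z)" using norm_triangle_ineq[of x ?z] by simp
  also have "norm ?z = norm x" using refl_l[OF that(1)] refl_r[OF that(2)] by simp
  finally show ?thesis by simp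
 qed
 \<comment> \<open>Invariant for the set \<open>J\<close> of pairs already treated: row
   \<open>p j\<close> and column \<open>q j\<close> of \<open>z\<close> meet only in their own
   corner, while the corners of the remaining pairs are still those of \<open>y\<close>.\<close>
 have "EX z. norm z <= norm y & (\<forall>j\<in>J. p j*z = p j*y*q j & z*q j = p j*y*q j) &
   (\<forall>i\<in>I-J. \<forall>k\<in>I-J. p i*z*q k = p i*y*q k)" if "J <= I" for J using finite_subset[OF that fin] that
 proof (induction J rule: finite_induct)
  case empty then show ?case by (intro exI[of _ y]) auto
 next
  case (insert r J)
  then obtain z where z: "norm z <= norm y" "!!j. j\<in>J ==> p j*z = p j*y*q j" "!!j. j\<in>J ==> z*q j = p j*y*q j"
   "!!i k. i\<in>I-J ==> k\<in>I-J ==> p i*z*q k = p i*y*q k" by auto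
  have r: "r\<in>I" "r \<notin> J" using insert by auto
  let ?w = "z - p r*z - z*q r + 2 *\<^sub>R (p r*z*q r)"
  have pr: "p r*p r = p r" "q r*q r = q r" using p q r by (auto simp: projD)
  have zr: "p r*z*q r = p r*y*q r" using z(4) r by auto
  have 1: "p r*?w = p r*y*q r"
  proof -
   have "p r*?w = p r*z - (p r*p r)*z - p r*z*q r + 2 *\<^sub>R ((p r*p r)*z*q r)" by (simp add: algebra_simps)
   also have "... = p r*z*q r" unfolding pr by (simp add: scaleR_2)
   finally show ?thesis using zr by simp
  qed
  have 2: "?w*q r = p r*y*q r"
  proof -
   have "?w*q r = z*q r - p r*z*q r - z*(q r*q r) + 2 *\<^sub>R (p r*z*(q r*q r))" by (simp add: algebra_simps)
   also have "... = p r*z*q r" unfolding pr by (simp add: scaleR_2)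
   finally show ?thesis using zr by simp
  qed
  have 3: "p j*?w = p j*y*q j & ?w*q j = p j*y*q j" if j: "j\<in>J" for j
  proof -
   have jr: "j\<in>I" "j ~= r" using j insert by auto
   have o: "p j*p r = 0" "q j*q r = 0" "q r*q j = 0" "p r*p j = 0" using po qo jr r by auto
   have a: "p j*?w = p j*z - (p j*p r)*z - (p j*z)*q r + 2 *\<^sub>R ((p j*p r)*z*q r)" by (simp add: algebra_simps)
   have b: "?w*q j = z*q j - p r*(z*q j) - z*(q r*q j) + 2 *\<^sub>R (p r*z*(q r*q j))" by (simp add: algebra_simps)
   have c: "(p j*z)*q r = 0" unfolding z(2)[OF j] using o by (simp add: mult.assoc)
   have d: "p r*(z*q j) = 0" unfolding z(3)[OF j] using o by (simp flip: mult.assoc)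
   show ?thesis using a b c d o z(2,3)[OF j] by simp
  qed
  have 4: "p i*?w*q k = p i*y*q k" if i: "i\<in>I - insert r J" and k: "k\<in>I - insert r J" for i k
  proof -
   have o: "p i*p r = 0" "q r*q k = 0" using po qo i k r by auto
   have a: "p i*?w*q k = p i*z*q k - (p i*p r)*z*q k - p i*z*(q r*q k)
    + 2 *\<^sub>R ((p i*p r)*z*q r*q k)" by (simp add: algebra_simps)
   then show ?thesis using o z(4) i k by simp
  qed
  show ?case using 1 2 3 4 step[OF p[OF r(1)] q[OF r(1)], of z] z(1) by (intro exI[of _ ?w]) auto
 qed
 from this[of I] obtain z where z: "norm z <= norm y" "!!j. j\<in>I ==> p j*z = p j*y*q j" by auto
 have "(\<Sum>i\<in>I. p i*y*q i) = sum p I*z" using z(2) by (simp add: sum_distrib_right)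
 also have "norm ... <= norm (sum p I)*norm z" by (rule norm_mult_ineq)
 also have "... <= 1*norm y" using proj_norm_le[OF proj_sum[OF fin p po]] z(1) by (intro mult_mono) auto
 finally show ?thesis by simp
qed

section \<open>Finitely supported matrices\<close>

text \<open>Matrices of all sizes in one type: stages of different size, non-unital inclusions and
  rectangular intertwiners can be multiplied without dimension conditions.\<close>

typedef cm = "{A :: nat => nat => complex. \<exists>N. ALL i j. A i j ~= 0 --> i < N & j < N}"
 morphisms ent Cm by (rule exI[of _ "%_ _. 0"]) auto

setup_lifting type_definition_cm

definition bnd :: "nat => cm => bool" where
 "bnd N x <-> (ALL i j. ent x i j ~= 0 --> i < N & j < N)"

lemma bnd_ex: "\<exists>N. bnd N x" using ent[of x] by (auto simp: bnd_def)

lemma bnd_mono: "bnd N x ==> N <= M ==> bnd M x" unfolding bnd_def by fastforce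

lemma bnd_ex2: "\<exists>N. bnd N x & bnd N y" using bnd_ex[of x] bnd_ex[of y] bnd_mono max.cobounded1 max.cobounded2 by metis

lemma bnd_ex3: "\<exists>N. bnd N x & bnd N y & bnd N z"
 using bnd_ex2[of x y] bnd_ex[of z] bnd_mono max.cobounded1 max.cobounded2 by metis

lemma bndD: "bnd N x ==> i >= N | j >= N ==> ent x i j = 0" unfolding bnd_def by (meson not_le)

lemma cm_eqI: "(!!i j. ent x i j = ent y i j) ==> x = y" by (intro ent_inject[THEN iffD1] ext) auto

lift_definition mk :: "nat => (nat => nat => complex) => cm" is
 "%N f i j. if i < N & j < N then f i j else 0" by auto

lemma ent_mk: "ent (mk N f) i j = (if i < N & j < N then f i j else 0)" by transfer auto

lemma bnd_mk: "bnd N (mk N f)" by (simp add: bnd_def ent_mk)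

definition dm :: "cm => nat" where "dm x = (SOME N. bnd N x)"

lemma bnd_dm: "bnd (dm x) x" unfolding dm_def by (rule someI_ex[OF bnd_ex])

instantiation cm :: "{zero, plus, minus, uminus, times}"
begin
definition "0 = mk 0 (%_ _. 0)"
definition "x + y = mk (max (dm x) (dm y)) (%i j. ent x i j + ent y i j)"
definition "x - y = mk (max (dm x) (dm y)) (%i j. ent x i j - ent y i j)"
definition "- x = mk (dm x) (%i j. - ent x i j)"
definition "x*y = mk (max (dm x) (dm y)) (%i j. \<Sum>k<dm x. ent x i k*ent y k j)"
instance ..
end

lemma ent_zero [simp]: "ent 0 i j = 0" by (simp add: zero_cm_def ent_mk)

lemma ent_add: "ent (x + y) i j = ent x i j + ent y i j"
 using bnd_dm[of x] bnd_dm[of y] by (auto simp: plus_cm_def ent_mk bndD not_less)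

lemma ent_diff: "ent (x - y) i j = ent x i j - ent y i j"
 using bnd_dm[of x] bnd_dm[of y] by (auto simp: minus_cm_def ent_mk bndD not_less)

lemma ent_minus: "ent (- x) i j = - ent x i j" using bnd_dm[of x] by (auto simp: uminus_cm_def ent_mk bndD)

lemma ent_mult_gen:
 assumes "!!k. k >= N ==> ent x i k*ent y k j = 0" shows "ent (x*y) i j = (\<Sum>k<N. ent x i k*ent y k j)"
proof -
 have "ent (x*y) i j = (\<Sum>k<dm x. ent x i k*ent y k j)"
  using bnd_dm[of x] bnd_dm[of y] by (auto simp: times_cm_def ent_mk bndD not_less)
 also have "... = (\<Sum>k<max N (dm x). ent x i k*ent y k j)" using bndD[OF bnd_dm[of x]] by (intro sum.mono_neutral_left) auto
 also have "... = (\<Sum>k<N. ent x i k*ent y k j)" using assms by (intro sum.mono_neutral_right) auto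
 finally show ?thesis .
qed

lemma ent_mult: "bnd N x | bnd N y ==> ent (x*y) i j = (\<Sum>k<N. ent x i k*ent y k j)" by (rule ent_mult_gen) (auto simp: bndD)

lemma bnd_mult: "bnd N x ==> bnd N y ==> bnd N (x*y)"
proof -
 assume b: "bnd N x" "bnd N y"
 have "ent (x*y) i j = 0" if "~ (i < N & j < N)" for i j using b that by (auto simp: ent_mult[of N] bndD not_less)
 then show ?thesis unfolding bnd_def by blast
qed

instance cm :: ring
proof
 fix x y z :: cm
 obtain N where N: "bnd N x" "bnd N y" "bnd N z" using bnd_ex3 by blast
 show "x*y*z = x*(y*z)"
 proof (rule cm_eqI)
  fix i j
  have "ent (x*y*z) i j = (\<Sum>k<N. (\<Sum>l<N. ent x i l*ent y l k)*ent z k j)" using N by (simp add: ent_mult[of N])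
  also have "... = (\<Sum>l<N. ent x i l*(\<Sum>k<N. ent y l k*ent z k j))"
   by (simp add: sum_distrib_left sum_distrib_right mult.assoc) (rule sum.swap)
  also have "... = ent (x*(y*z)) i j" using N by (simp add: ent_mult[of N])
  finally show "ent (x*y*z) i j = ent (x*(y*z)) i j" .
 qed
 show "(x + y)*z = x*z + y*z" "x*(y + z) = x*y + x*z" using N by (auto intro!: cm_eqI simp: ent_mult[of N] ent_add algebra_simps)
qed (auto intro!: cm_eqI simp: ent_add ent_diff ent_minus)

lemma ent_sum: "ent (sum f A) i j = (\<Sum>a\<in>A. ent (f a) i j)"
 by (induction A rule: infinite_finite_induct) (auto simp: ent_add)

text \<open>The Frobenius norm. It is submultiplicative and comes from the inner product
  \<open>ip\<close>, so matrices can play the role of vectors in the definition of the operator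
  norm.\<close>

definition fr :: "cm => real" where
 "fr x = L2_set (%(i,j). cmod (ent x i j)) ({..<dm x} \<times> {..<dm x})"

lemma fr_eq:
 assumes "bnd N x" shows "fr x = L2_set (%(i,j). cmod (ent x i j)) ({..<N} \<times> {..<N})"
proof -
 let ?f = "%(i,j). (cmod (ent x i j))\<^sup>2"
 have *: "sum ?f ({..<M} \<times> {..<M}) = sum ?f ({..<max M (dm x)} \<times> {..<max M (dm x)})" if "bnd M x" for M
  using that by (intro sum.mono_neutral_left) (auto simp: bnd_def)
 have **: "sum ?f ({..<dm x} \<times> {..<dm x}) = sum ?f ({..<max M (dm x)} \<times> {..<max M (dm x)})" for M
  using bnd_dm[of x] by (intro sum.mono_neutral_left) (auto simp: bnd_def)
 show ?thesis using *[OF assms] **[of N] unfolding fr_def L2_set_def by (simp add: case_prod_unfold)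
qed

definition ip :: "nat => cm => cm => complex" where
 "ip N x y = (\<Sum>i<N. \<Sum>j<N. cnj (ent x i j)*ent y i j)"

lemma fr_nonneg [simp]: "fr x >= 0" by (simp add: fr_def)

lemma fr_triangle: "fr (x + y) <= fr x + fr y"
proof -
 obtain N where N: "bnd N x" "bnd N y" using bnd_ex2 by blast
 then have N3: "bnd N (x + y)" by (auto simp: bnd_def ent_add) (metis add_0_left)+
 have "fr (x + y) <= L2_set (%(i,j). cmod (ent x i j) + cmod (ent y i j)) ({..<N} \<times> {..<N})"
  unfolding fr_eq[OF N3] by (rule L2_set_mono) (auto simp: ent_add norm_triangle_ineq)
 also have "... <= fr x + fr y" unfolding fr_eq[OF N(1)] fr_eq[OF N(2)]
  using L2_set_triangle_ineq[of "%(i,j). cmod (ent x i j)" "%(i,j). cmod (ent y i j)" "{..<N} \<times> {..<N}"]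
  by (simp add: case_prod_unfold)
 finally show ?thesis .
qed

lemma fr_sq: "bnd N x ==> (fr x)\<^sup>2 = (\<Sum>i<N. \<Sum>j<N. (cmod (ent x i j))\<^sup>2)"
 by (simp add: fr_eq L2_set_def case_prod_unfold sum_nonneg sum.cartesian_product)

lemma ip_self: "bnd N x ==> ip N x x = of_real ((fr x)\<^sup>2)" unfolding fr_sq ip_def
 by (simp add: complex_norm_square mult.commute del: of_real_power)

lemma ip_le:
 assumes "bnd N x" "bnd N y" shows "cmod (ip N x y) <= fr x*fr y"
proof -
 have "cmod (ip N x y) <= (\<Sum>i<N. \<Sum>j<N. cmod (ent x i j)*cmod (ent y i j))"
  unfolding ip_def by (intro sum_norm_le) (auto simp: norm_mult)
 also have "... <= fr x*fr y" unfolding fr_eq[OF assms(1)] fr_eq[OF assms(2)]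
  using L2_set_mult_ineq[of "%(i,j). cmod (ent x i j)" "%(i,j). cmod (ent y i j)" "{..<N} \<times> {..<N}"]
  by (simp add: case_prod_unfold sum.cartesian_product)
 finally show ?thesis .
qed

lemma bnd_add: "bnd N x ==> bnd N y ==> bnd N (x + y)" by (auto simp: bnd_def ent_add) (metis add_0_left)+

lemma bnd_diff: "bnd N x ==> bnd N y ==> bnd N (x - y)" by (auto simp: bnd_def ent_diff) (metis diff_self)+

lemma fr_mult: "fr (x*y) <= fr x*fr y"
proof -
 obtain N where N: "bnd N x" "bnd N y" using bnd_ex2 by blast
 have "(fr (x*y))\<^sup>2 = (\<Sum>i<N. \<Sum>j<N. (cmod (\<Sum>k<N. ent x i k*ent y k j))\<^sup>2)"
  using N by (simp add: fr_sq[OF bnd_mult[OF N]] ent_mult[of N])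
 also have "... <= (\<Sum>i<N. \<Sum>j<N. (\<Sum>k<N. (cmod (ent x i k))\<^sup>2)*(\<Sum>k<N. (cmod (ent y k j))\<^sup>2))"
 proof (intro sum_mono)
  fix i j
  have "cmod (\<Sum>k<N. ent x i k*ent y k j) <= (\<Sum>k<N. cmod (ent x i k)*cmod (ent y k j))"
   by (intro sum_norm_le) (simp add: norm_mult)
  also have "... <= L2_set (%k. cmod (ent x i k)) {..<N}*L2_set (%k. cmod (ent y k j)) {..<N}"
   using L2_set_mult_ineq[of "%k. cmod (ent x i k)" "%k. cmod (ent y k j)"] by simp
  finally have "(cmod (\<Sum>k<N. ent x i k*ent y k j))\<^sup>2 <=
   (L2_set (%k. cmod (ent x i k)) {..<N}*L2_set (%k. cmod (ent y k j)) {..<N})\<^sup>2" by (intro power_mono) auto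
  then show "(cmod (\<Sum>k<N. ent x i k*ent y k j))\<^sup>2 <=
   (\<Sum>k<N. (cmod (ent x i k))\<^sup>2)*(\<Sum>k<N. (cmod (ent y k j))\<^sup>2)"
   by (simp add: L2_set_def power_mult_distrib sum_nonneg)
 qed
 also have "... = (\<Sum>i<N. \<Sum>k<N. (cmod (ent x i k))\<^sup>2)*(\<Sum>j<N. \<Sum>k<N. (cmod (ent y k j))\<^sup>2)"
  by (simp add: sum_product)
 also have "(\<Sum>j<N. \<Sum>k<N. (cmod (ent y k j))\<^sup>2) = (fr y)\<^sup>2" unfolding fr_sq[OF N(2)] by (rule sum.swap)
 also have "(\<Sum>i<N. \<Sum>k<N. (cmod (ent x i k))\<^sup>2) = (fr x)\<^sup>2" unfolding fr_sq[OF N(1)] ..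
 finally have "(fr (x*y))\<^sup>2 <= (fr x*fr y)\<^sup>2" by (simp add: power_mult_distrib)
 then show ?thesis by (rule power2_le_imp_le) simp
qed

text \<open>The norm is that of left multiplication on matrices with the Frobenius norm. Left
  multiplication acts on each column separately, so this is the usual operator norm;
  \<open>op_norm_toc\<close> makes this precise.\<close>

instantiation cm :: cstar
begin
definition "norm x = Sup {fr (x*y) | y. fr y <= 1}"
definition "st x = mk (dm x) (%i j. cnj (ent x j i))"
definition "csc a x = mk (dm x) (%i j. a*ent x i j)"
definition "r *\<^sub>R x = csc (of_real r) (x :: cm)"
definition "dist x y = norm (x - y :: cm)"
definition sgn_cm :: "cm => cm" where "sgn_cm x = scaleR (inverse (norm x)) x"
definition [code del]: "(uniformity :: (cm \<times> cm) filter) = (INF e\<in>{0 <..}. principal {(x, y). dist x y < e})"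
definition [code del]: "open (U :: cm set) <-> (\<forall>x\<in>U. eventually (%(x', y). x' = x --> y\<in>U) uniformity)"

lemma ent_st: "ent (st x) i j = cnj (ent x j i)" using bnd_dm[of x] by (auto simp: st_cm_def ent_mk bndD)

lemma ent_csc: "ent (csc a x) i j = a*ent x i j" using bnd_dm[of x] by (auto simp: csc_cm_def ent_mk bndD)

lemma ent_scaleR: "ent (r *\<^sub>R x) i j = of_real r*ent x i j" by (simp add: scaleR_cm_def ent_csc)

lemma bnd_csc: "bnd N x ==> bnd N (csc a x)" by (auto simp: bnd_def ent_csc)

lemma bnd_st: "bnd N x ==> bnd N (st x)" by (auto simp: bnd_def ent_st)

lemma fr_csc: "fr (csc a x) = cmod a*fr x"
proof -
 obtain N where N: "bnd N x" using bnd_ex by blast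
 have "(fr (csc a x))\<^sup>2 = (cmod a*fr x)\<^sup>2"
  by (simp add: fr_sq[OF bnd_csc[OF N]] fr_sq[OF N] ent_csc norm_mult power_mult_distrib sum_distrib_left)
 then show ?thesis by simp
qed

lemma fr_bdd: "bdd_above {fr (x*y) | y. fr y <= 1}"
proof (rule bdd_aboveI[of _ "fr x"])
 fix r assume "r\<in>{fr (x*y) | y. fr y <= 1}"
 then obtain y where y: "r = fr (x*y)" "fr y <= 1" by auto
 have "fr (x*y) <= fr x*fr y" by (rule fr_mult)
 also have "... <= fr x*1" using y by (intro mult_left_mono) auto
 finally show "r <= fr x" using y by simp
qed

lemma fr_zero [simp]: "fr 0 = 0" by (simp add: fr_def L2_set_def)

lemma norm_cm_least: "(!!y. fr y <= 1 ==> fr (x*y) <= c) ==> norm x <= c"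
 unfolding norm_cm_def by (rule cSup_least) (auto intro!: exI[of _ 0])

lemma fr_le_norm: "fr y <= 1 ==> fr (x*y) <= norm x" unfolding norm_cm_def by (rule cSup_upper[OF _ fr_bdd]) auto

lemma fr_eq_0: "fr x = 0 ==> x = 0"
proof -
 assume a: "fr x = 0"
 obtain N where N: "bnd N x" using bnd_ex by blast
 have "(\<Sum>i<N. \<Sum>j<N. (cmod (ent x i j))\<^sup>2) = 0" using fr_sq[OF N] a by simp
 then have *: "!!i j. i < N ==> j < N ==> ent x i j = 0" by (simp add: sum_nonneg_eq_0_iff sum_nonneg)
 show "x = 0" by (rule cm_eqI) (use*bndD[OF N] in \<open>metis ent_zero not_le\<close>)
qed

lemma csc_mult_cm: "csc a x*y = csc a (x*(y :: cm))" "x*csc a y = csc a (x*y)"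
proof -
 obtain N where N: "bnd N x" "bnd N y" using bnd_ex2 by blast
 then show "csc a x*y = csc a (x*y)" "x*csc a y = csc a (x*y)"
  by (auto intro!: cm_eqI simp: ent_mult[of N] ent_csc sum_distrib_left algebra_simps)
qed

lemma fr_mult_norm: "fr (x*y) <= norm x*fr y"
proof (cases "fr y = 0")
 case True
 then have "y = 0" by (rule fr_eq_0)
 then show ?thesis by simp
next
 case False
 let ?y = "csc (of_real (1 / fr y)) y"
 have "fr (x*?y) <= norm x" by (intro fr_le_norm) (simp add: fr_csc norm_divide)
 moreover have "fr (x*?y) = fr (x*y) / fr y" by (simp add: csc_mult_cm fr_csc norm_divide)
 ultimately have "fr (x*y) / fr y <= norm x" by simp
 moreover have "fr y > 0" using False fr_nonneg[of y] by linarith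
 ultimately show ?thesis by (simp add: pos_divide_le_eq)
qed

lemma norm_cm_nonneg: "norm (x :: cm) >= 0" using fr_le_norm[of 0 x] by simp

lemma ip_adj:
 assumes "bnd N x" "bnd N y" "bnd N z" shows "ip N x (y*z) = ip N (st y*x) z"
proof -
 have "ip N x (y*z) = (\<Sum>i<N. \<Sum>j<N. \<Sum>k<N. cnj (ent x i j)*ent y i k*ent z k j)"
  using assms by (simp add: ip_def ent_mult[of N] sum_distrib_left mult.assoc)
 also have "... = (\<Sum>j<N. \<Sum>i<N. \<Sum>k<N. cnj (ent x i j)*ent y i k*ent z k j)" by (rule sum.swap)
 also have "... = (\<Sum>j<N. \<Sum>k<N. \<Sum>i<N. cnj (ent x i j)*ent y i k*ent z k j)" by (intro sum.cong refl sum.swap)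
 also have "... = (\<Sum>k<N. \<Sum>j<N. \<Sum>i<N. cnj (ent x i j)*ent y i k*ent z k j)" by (rule sum.swap)
 also have "... = ip N (st y*x) z" using assms by (simp add: ip_def ent_mult[of N] bnd_st ent_st sum_distrib_left mult_ac)
 finally show ?thesis .
qed

instance
proof
 fix x y z :: cm and a b :: complex and r s :: real
 have mul: "norm (x*y) <= norm x*norm y" for x y :: cm
 proof (rule norm_cm_least)
  fix z :: cm assume "fr z <= 1"
  have "fr (x*y*z) <= norm x*fr (y*z)" using fr_mult_norm[of x "y*z"] by (simp add: mult.assoc)
  also have "... <= norm x*norm y" using \<open>fr z <= 1\<close> by (intro mult_left_mono fr_le_norm norm_cm_nonneg)
  finally show "fr (x*y*z) <= norm x*norm y" .
 qed
 show "norm (x*y) <= norm x*norm y" by (rule mul)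
 have tri: "norm (x + y) <= norm x + norm y" for x y :: cm
 proof (rule norm_cm_least)
  fix z :: cm assume z: "fr z <= 1"
  show "fr ((x + y)*z) <= norm x + norm y" using fr_triangle[of "x*z" "y*z"] fr_le_norm[OF z, of x] fr_le_norm[OF z, of y]
   by (simp add: distrib_right)
 qed
 show "norm (x + y) <= norm x + norm y" by (rule tri)
 show "(norm x = 0) = (x = 0)"
 proof
  assume a: "norm x = 0"
  obtain N where N: "bnd N x" using bnd_ex by blast
  let ?e = "mk N (%i j. if i = j then 1 else 0)"
  have "x*?e = x"
  proof (rule cm_eqI)
   fix i j show "ent (x*?e) i j = ent x i j"
   proof (cases "j < N")
    case True
    have "ent (x*?e) i j = (\<Sum>k<N. ent x i k*ent ?e k j)" using N by (simp add: ent_mult[of N])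
    also have "... = (\<Sum>k<N. if k = j then ent x i k else 0)" by (intro sum.cong refl) (simp add: ent_mk)
    finally have "ent (x*?e) i j = (\<Sum>k<N. if k = j then ent x i k else 0)" .
    then show ?thesis using True by simp
   next
    case False
    then show ?thesis using N by (simp add: ent_mult[of N] ent_mk bndD)
   qed
  qed
  then have "fr x <= 0" using fr_mult_norm[of x ?e] a by simp
  then show "x = 0" using fr_eq_0 fr_nonneg[of x] by simp
 next
  assume "x = 0" then show "norm x = 0" using norm_cm_least[of 0 0] norm_cm_nonneg[of 0] by simp
 qed
 have csc_norm: "norm (csc a x) = cmod a*norm x" for a and x :: cm
 proof -
  have le: "norm (csc a x) <= cmod a*norm x" for a and x :: cm
   by (rule norm_cm_least) (simp add: csc_mult_cm fr_csc fr_le_norm mult_left_mono)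
  show ?thesis
  proof (cases "a = 0")
   case True then show ?thesis using le[of a x] norm_cm_nonneg[of "csc a x"] by simp
  next
   case False
   have "csc (1/a) (csc a x) = x" using False by (intro cm_eqI) (simp add: ent_csc)
   then have "norm x = norm (csc (1/a) (csc a x))" by simp
   also have "... <= cmod (1/a)*norm (csc a x)" by (rule le)
   finally have "cmod a*norm x <= norm (csc a x)" using False by (simp add: norm_divide divide_simps mult.commute)
   then show ?thesis using le[of a x] by simp
  qed
 qed
 show "norm (r *\<^sub>R x) = \<bar>r\<bar>*norm x" by (simp add: scaleR_cm_def csc_norm)
 show "st (x*y) = st y*st x"
 proof -
  obtain N where N: "bnd N x" "bnd N y" using bnd_ex2 by blast
  then show ?thesis by (auto intro!: cm_eqI simp: ent_mult[of N] bnd_st ent_st mult.commute)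
 qed
 show "norm (st x*x) = (norm x)\<^sup>2"
 proof -
  \<comment> \<open>The squared Frobenius norm of x y is the inner product of x* x y with y, so the
    Cauchy-Schwarz inequality \<open>ip_le\<close> applies.\<close>
  have le: "(norm x)\<^sup>2 <= norm (st x*x)" for x :: cm
  proof -
   have "norm x <= sqrt (norm (st x*x))"
   proof (rule norm_cm_least)
    fix y :: cm assume y: "fr y <= 1"
    obtain N where N: "bnd N x" "bnd N y" using bnd_ex2 by blast
    have "of_real ((fr (x*y))\<^sup>2) = ip N (x*y) (x*y)" using N by (simp add: ip_self bnd_mult)
    also have "... = ip N (st x*(x*y)) y" using N by (intro ip_adj bnd_mult)
    finally have "(fr (x*y))\<^sup>2 = cmod (ip N (st x*(x*y)) y)" by (metis abs_of_nonneg norm_of_real zero_le_power2)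
    also have "... <= fr (st x*(x*y))*fr y" using N by (intro ip_le bnd_mult bnd_st)
    also have "... <= norm (st x*x)*1"
     using y fr_le_norm[OF y, of "st x*x"] by (intro mult_mono) (auto simp: mult.assoc norm_cm_nonneg)
    finally show "fr (x*y) <= sqrt (norm (st x*x))" by (simp add: real_le_rsqrt)
   qed
   then show ?thesis by (metis norm_cm_nonneg real_sqrt_le_iff real_sqrt_power real_sqrt_unique)
  qed
  have stst: "st (st x) = x" for x :: cm by (rule cm_eqI) (simp add: ent_st)
  have le2: "norm x <= norm (st x)" for x :: cm
  proof (cases "norm x = 0")
   case False
   have "norm x*norm x <= norm (st x)*norm x" using le[of x] mul[of "st x" x] by (simp add: power2_eq_square)
   then show ?thesis using False norm_cm_nonneg[of x] by simp
  qed (simp add: norm_cm_nonneg)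
  have "norm (st x) = norm x" using le2[of x] le2[of "st x"] stst by simp
  then show ?thesis using le[of x] mul[of "st x" x] by (simp add: power2_eq_square)
 qed
qed (auto intro!: cm_eqI simp: ent_add ent_csc ent_st ent_scaleR algebra_simps dist_cm_def sgn_cm_def
 uniformity_cm_def open_cm_def scaleR_cm_def csc_mult_cm)

end

text \<open>Multiplication by a matrix unit, which has Frobenius norm 1, isolates a column.\<close>

lemma ent_le_norm: "cmod (ent x i j) <= norm x"
proof -
 define y where "y = mk (Suc j) (%a b. if a = j & b = j then 1 else 0)"
 have "(fr y)\<^sup>2 = (\<Sum>a<Suc j. \<Sum>b<Suc j. if a = j then if b = j then 1 else 0 else 0)"
  unfolding fr_sq[OF bnd_mk[of "Suc j", folded y_def]] y_def by (intro sum.cong refl) (auto simp: y_def ent_mk)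
 then have y1: "fr y = 1" using fr_nonneg[of y] by (simp add: power2_eq_1_iff)
 obtain N0 where N0: "bnd N0 x" "bnd N0 y" "bnd N0 (x*y)" using bnd_ex3 by blast
 define N where "N = N0 + i + j + 1"
 have N: "bnd N x" "bnd N y" "bnd N (x*y)" "i < N" "j < N"
  using bnd_mono[OF N0(1)] bnd_mono[OF N0(2)] bnd_mono[OF N0(3)] by (auto simp: N_def)
 have "ent (x*y) i j = (\<Sum>k<N. ent x i k*ent y k j)" using N by (simp add: ent_mult[of N])
 also have "... = (\<Sum>k<N. if k = j then ent x i k else 0)" by (intro sum.cong refl) (simp add: y_def ent_mk)
 finally have e: "ent (x*y) i j = ent x i j" using N by simp
 have "(cmod (ent (x*y) i j))\<^sup>2 <= (\<Sum>b<N. (cmod (ent (x*y) i b))\<^sup>2)" using N by (intro member_le_sum) auto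
 also have "... <= (\<Sum>a<N. \<Sum>b<N. (cmod (ent (x*y) a b))\<^sup>2)"
  using N by (intro member_le_sum[of i "{..<N}" "%a. \<Sum>b<N. (cmod (ent (x*y) a b))\<^sup>2"]) (auto intro: sum_nonneg)
 also have "... = (fr (x*y))\<^sup>2" using fr_sq[OF N(3)] by simp
 finally have "cmod (ent (x*y) i j) <= fr (x*y)" by (rule power2_le_imp_le) simp
 then show ?thesis using e fr_mult_norm[of x y] y1 by simp
qed

lemma norm_le_fr: "norm x <= fr x"
proof (rule norm_cm_least)
 fix y assume y: "fr y <= 1"
 have "fr (x*y) <= fr x*fr y" by (rule fr_mult)
 also have "... <= fr x*1" using y by (intro mult_left_mono) auto
 finally show "fr (x*y) <= fr x" by simp
qed

text \<open>Together with \<open>ent_le_norm\<close>: for matrices with a common bound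
  \<open>N\<close>, convergence in norm is convergence of entries.\<close>

lemma norm_le_sum_ent: "bnd N x ==> norm x <= (\<Sum>i<N. \<Sum>j<N. cmod (ent x i j))"
 using norm_le_fr[of x] L2_set_le_sum[of "{..<N} \<times> {..<N}" "%(i,j). cmod (ent x i j)"]
 by (simp add: fr_eq sum.cartesian_product case_prod_unfold)

lemma null_comparison:
 fixes f :: "'a => 'b :: real_normed_vector"
 assumes "\<forall>\<^sub>F x in F. norm (f x) <= g x" "(g \<longlongrightarrow> 0) F" shows "(f \<longlongrightarrow> 0) F"
 by (rule tendsto_0_le[OF assms(2), of f 1]) (use assms(1) in \<open>auto elim!: eventually_mono\<close>)

lemma tendsto_ent: "(X \<longlongrightarrow> L) F ==> ((%n. ent (X n) i j) \<longlongrightarrow> ent L i j) F"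
proof -
 assume "(X \<longlongrightarrow> L) F"
 then have "((%n. norm (X n - L)) \<longlongrightarrow> 0) F" by (simp add: tendsto_norm_zero LIM_zero)
 then have "((%n. ent (X n) i j - ent L i j) \<longlongrightarrow> 0) F"
  by (rule null_comparison[rotated]) (use ent_le_norm in "auto simp flip: ent_diff")
 then show ?thesis by (simp add: LIM_zero_iff)
qed

text \<open>The common bound \<open>N\<close> keeps the limit finitely supported. The limit is
  formed entrywise, and the error is the tail of a geometric series.\<close>

lemma geometric_steps_converge:
 fixes X :: "nat => cm"
 assumes b: "!!n. bnd N (X n)" and s: "!!n. norm (X (Suc n) - X n) <= c*q ^ n" and q: "0 <= q" "q < 1"
 obtains L where "bnd N L" "X \<longlonglongrightarrow> L" "!!n. norm (L - X n) <= c*q ^ n / (1 - q)"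
proof -
 have "convergent (%n. ent (X n) i j)" for i j
 proof -
  have "summable (%n. ent (X (Suc n)) i j - ent (X n) i j)"
  proof (rule summable_comparison_test)
   show "\<exists>K. \<forall>n\<ge>K. norm (ent (X (Suc n)) i j - ent (X n) i j) <= c*q ^ n"
    using s ent_le_norm by (metis ent_diff order_trans)
   show "summable (%n. c*q ^ n)" using q by (intro summable_mult summable_geometric) auto
  qed
  then have "convergent (%n. \<Sum>k<n. ent (X (Suc k)) i j - ent (X k) i j)" by (simp add: summable_iff_convergent)
  then have "convergent (%n. ent (X n) i j - ent (X 0) i j)" by (simp only: sum_lessThan_telescope[of "%n. ent (X n) i j"])
  then show ?thesis using convergent_diff_const_right_iff[of "%n. ent (X n) i j" "ent (X 0) i j"] by blast
 qed
 then have l: "(%n. ent (X n) i j) \<longlonglongrightarrow> lim (%n. ent (X n) i j)" for i j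
  by (simp add: convergent_LIMSEQ_iff)
 define L where "L = mk N (%i j. lim (%n. ent (X n) i j))"
 have bL: "bnd N L" by (simp add: L_def bnd_mk)
 have "(%n. \<Sum>i<N. \<Sum>j<N. cmod (ent (X n - L) i j)) \<longlonglongrightarrow> (\<Sum>i<N. \<Sum>j<N. 0)"
 proof (intro tendsto_sum)
  fix i j assume "i\<in>{..<N}" "j\<in>{..<N}"
  then show "(%n. cmod (ent (X n - L) i j)) \<longlonglongrightarrow> 0"
   using l[of i j] by (auto simp: ent_diff L_def ent_mk intro!: tendsto_norm_zero LIM_zero)
 qed
 then have z: "(%n. \<Sum>i<N. \<Sum>j<N. cmod (ent (X n - L) i j)) \<longlonglongrightarrow> 0" by simp
 have "(%n. norm (X n - L)) \<longlonglongrightarrow> 0"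
  by (rule null_comparison[OF always_eventually z]) (use norm_le_sum_ent[OF bnd_diff[OF b bL]] in auto)
 then have XL: "X \<longlonglongrightarrow> L" by (simp add: LIM_zero_iff tendsto_norm_zero_iff)
 have "norm (L - X n) <= c*q ^ n / (1 - q)" for n
 proof -
  have "norm (X (n + m) - X n) <= (\<Sum>k<m. c*q ^ (n + k))" for m
  proof (induction m)
   case (Suc m)
   have "norm (X (n + Suc m) - X n) <= norm (X (Suc (n + m)) - X (n + m)) + norm (X (n + m) - X n)"
    using norm_triangle_ineq[of "X (Suc (n + m)) - X (n + m)" "X (n + m) - X n"] by simp
   then show ?case using Suc s[of "n + m"] by simp
  qed simp
  moreover have "(\<Sum>k<m. c*q ^ (n + k)) <= c*q ^ n / (1 - q)" for m
  proof -
   have "0 <= c*q ^ 0" using s[of 0] norm_ge_zero order_trans by blast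
   then have c: "0 <= c" by simp
   have "(\<Sum>k<m. c*q ^ (n + k)) = c*q ^ n*(\<Sum>k<m. q ^ k)" by (simp add: power_add sum_distrib_left mult.assoc)
   also have "(\<Sum>k<m. q ^ k) <= 1 / (1 - q)" using q by (subst sum_gp_strict) (auto simp: divide_simps)
   finally show ?thesis using c q by (simp add: mult_left_mono)
  qed
  ultimately have "norm (X (n + m) - X n) <= c*q ^ n / (1 - q)" for m by (meson order_trans)
  moreover have "(%m. norm (X (n + m) - X n)) \<longlonglongrightarrow> norm (L - X n)"
   using LIMSEQ_ignore_initial_segment[OF XL, of n] by (intro tendsto_intros) (simp add: add.commute)
  ultimately show ?thesis by (intro LIMSEQ_le_const2) auto
 qed
 with bL XL show thesis by (rule that)
qed

text \<open>The limit is \<open>(1 - h)\<^sup>-\<^sup>1 - 1\<close>, by the geometric series.\<close>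

lemma quasi_inverse:
 assumes h: "bnd N h" and q: "norm h < 1"
 obtains u s where "u = h + u*h" "s (0 :: nat) = 0" "!!n. s (Suc n) = h + s n*h" "s \<longlonglongrightarrow> u" "bnd N u"
  "!!n. norm (u - s n) <= norm h ^ Suc n / (1 - norm h)"
proof -
 \<comment> \<open>The partial sums of h + h^2 + h^3 + ... are part of the conclusion, because
   membership in subalgebras is checked on them.\<close>
 define s where "s = rec_nat 0 (%_ z. h + z*h)"
 have s: "s 0 = 0" "!!n. s (Suc n) = h + s n*h" by (simp_all add: s_def)
 have b: "bnd N (s n)" for n by (induction n) (auto simp: s h bnd_add bnd_mult, simp add: bnd_def)
 have st: "norm (s (Suc n) - s n) <= norm h*norm h ^ n" for n
 proof (induction n)
  case (Suc n)
  have "s (Suc (Suc n)) - s (Suc n) = (s (Suc n) - s n)*h" by (simp add: s algebra_simps)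
  also have "norm ... <= norm (s (Suc n) - s n)*norm h" by (rule norm_mult_ineq)
  also have "... <= (norm h*norm h ^ n)*norm h" using Suc by (intro mult_right_mono) auto
  finally show ?case by (simp add: mult_ac)
 qed (simp add: s)
 obtain u where u: "bnd N u" "s \<longlonglongrightarrow> u" "!!n. norm (u - s n) <= norm h*norm h ^ n / (1 - norm h)"
  using geometric_steps_converge[OF b st] q by auto
 have "(%n. h + s n*h) \<longlonglongrightarrow> h + u*h" by (intro tendsto_intros u)
 moreover have "(%n. h + s n*h) \<longlonglongrightarrow> u" using LIMSEQ_Suc[OF u(2)] by (simp add: s)
 ultimately have "u = h + u*h" by (metis LIMSEQ_unique)
 with u s show thesis by (intro that[of u s]) auto
qed

section \<open>Support conditions under algebra operations and limits\<close>

definition spt :: "(nat => nat => bool) => cm => bool" where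
 "spt R x <-> (ALL i j. ent x i j ~= 0 --> R i j)"

lemma sptI: "(!!i j. ent x i j ~= 0 ==> R i j) ==> spt R x" by (auto simp: spt_def)

lemma sptD: "spt R x ==> ent x i j ~= 0 ==> R i j" by (auto simp: spt_def)

lemma spt_mono: "spt R x ==> (!!i j. R i j ==> R' i j) ==> spt R' x" by (auto simp: spt_def)

lemma spt_zero [simp]: "spt R 0" by (simp add: spt_def)

lemma spt_add: "spt R x ==> spt R y ==> spt R (x + y)" by (auto simp: spt_def ent_add) (metis add_0)

lemma spt_diff: "spt R x ==> spt R y ==> spt R (x - y)" by (auto simp: spt_def ent_diff) (metis diff_self)

lemma spt_csc: "spt R x ==> spt R (csc a x)" by (auto simp: spt_def ent_csc)

lemma spt_scaleR: "spt R x ==> spt R (r *\<^sub>R x)" by (auto simp: spt_def ent_scaleR)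

lemma spt_st: "spt R x ==> spt (%i j. R j i) (st x)" by (auto simp: spt_def ent_st)

lemma spt_sum: "(!!a. a\<in>A ==> spt R (f a)) ==> spt R (sum f A)"
 by (induction A rule: infinite_finite_induct) (auto simp: spt_add)

lemma spt_mult:
 assumes "spt R x" "spt R' y" "!!i j k. R i k ==> R' k j ==> R'' i j" shows "spt R'' (x*y)"
proof (rule sptI)
 fix i j assume "ent (x*y) i j ~= 0"
 moreover obtain N where "bnd N x" using bnd_ex by blast
 ultimately have "(\<Sum>k<N. ent x i k*ent y k j) ~= 0" by (simp add: ent_mult[of N])
 then obtain k where "ent x i k*ent y k j ~= 0" by (meson sum.neutral)
 then have "R i k" "R' k j" using assms by (auto simp: spt_def)
 then show "R'' i j" by (rule assms(3))
qed

lemma spt_mult_0: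
 assumes "spt R x" "spt R' y" "!!i j k. R i k ==> R' k j ==> False" shows "x*y = 0"
 using spt_mult[OF assms(1,2), of "%_ _. False"] assms(3) by (intro cm_eqI) (auto simp: spt_def)

lemma spt_lim: "(!!n. spt R (X n)) ==> X \<longlonglongrightarrow> L ==> spt R L"
proof (rule sptI, rule ccontr)
 fix i j assume a: "!!n. spt R (X n)" "X \<longlonglongrightarrow> L" "ent L i j ~= 0" "~ R i j"
 then have "!!n. ent (X n) i j = 0" by (auto simp: spt_def)
 then have "(%n. 0) \<longlonglongrightarrow> ent L i j" using tendsto_ent[OF a(2), of i j] by simp
 then show False using a(3) by (simp add: LIMSEQ_const_iff)
qed

section \<open>Matrix units and coordinate projections\<close>

definition mu :: "nat => nat => cm" where
 "mu a b = mk (Suc (max a b)) (%i j. if i = a & j = b then 1 else 0)"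

lemma ent_mu: "ent (mu a b) i j = (if i = a & j = b then 1 else 0)" by (auto simp: mu_def ent_mk)

lemma spt_mu: "R a b ==> spt R (mu a b)" by (auto simp: spt_def ent_mu)

lemma ent_mult_mu: "ent (x*mu a b) i j = (if j = b then ent x i a else 0)"
proof -
 obtain N0 where "bnd N0 x" using bnd_ex by blast
 then have N: "bnd (N0 + Suc a) x" by (rule bnd_mono) simp
 have "ent (x*mu a b) i j = (\<Sum>k<N0 + Suc a. ent x i k*ent (mu a b) k j)" using N by (simp add: ent_mult[of "N0 + Suc a"])
 also have "... = (\<Sum>k<N0 + Suc a. if k = a then (if j = b then ent x i k else 0) else 0)"
  by (intro sum.cong refl) (simp add: ent_mu)
 finally show ?thesis by simp
qed

lemma st_mu [simp]: "st (mu a b) = mu b a" by (rule cm_eqI) (auto simp: ent_st ent_mu)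

lemma ent_mu_mult: "ent (mu a b*x) i j = (if i = a then ent x b j else 0)"
proof -
 have "mu a b*x = st (st x*mu b a)" by (simp add: st_mult)
 then show ?thesis by (simp only: ent_st ent_mult_mu) (simp add: ent_st)
qed

lemma mu_mult_mu: "mu a b*mu c d = (if b = c then mu a d else 0)" by (rule cm_eqI) (auto simp: ent_mult_mu ent_mu)

lemma mu_mult_mu_assoc: "mu a b*(mu c d*x) = (if b = c then mu a d*x else 0)" by (simp add: mu_mult_mu flip: mult.assoc)

lemma mu_neq_0 [simp]: "mu a b ~= 0" by (metis ent_mu ent_zero zero_neq_one)

lemma mu_sandwich: "mu a b*x*mu c d = csc (ent x b c) (mu a d)"
 by (rule cm_eqI) (auto simp: ent_mult_mu ent_mu_mult ent_csc ent_mu)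

lemma mu_expand: "bnd N x ==> x = (\<Sum>a<N. \<Sum>b<N. csc (ent x a b) (mu a b))"
proof (rule cm_eqI)
 fix i j assume N: "bnd N x"
 have "(\<Sum>a<N. \<Sum>b<N. ent (csc (ent x a b) (mu a b)) i j) =
   (\<Sum>a<N. if a = i then \<Sum>b<N. if b = j then ent x a b else 0 else 0)"
  by (intro sum.cong refl) (auto simp: ent_csc ent_mu if_distrib[of "(*) _"] cong: if_cong)
 then show "ent x i j = ent (\<Sum>a<N. \<Sum>b<N. csc (ent x a b) (mu a b)) i j"
  using bndD[OF N, of i j] by (auto simp: ent_sum)
qed

definition idm :: "nat set => cm" where "idm S = (\<Sum>s\<in>S. mu s s)"

lemma ent_idm: "finite S ==> ent (idm S) i j = (if i = j & i\<in>S then 1 else 0)"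
proof -
 assume S: "finite S"
 have "ent (idm S) i j = (\<Sum>s\<in>S. if s = i then if i = j then 1 else 0 else 0)"
  unfolding idm_def ent_sum by (intro sum.cong) (auto simp: ent_mu)
 then show ?thesis using S by auto
qed

lemma spt_idm: "finite S ==> spt (%i j. i = j & i\<in>S) (idm S)" by (auto simp: spt_def ent_idm)

lemma ent_mult_idm: "finite S ==> ent (x*idm S) i j = (if j\<in>S then ent x i j else 0)"
proof -
 assume S: "finite S"
 have "ent (x*idm S) i j = (\<Sum>s\<in>S. if s = j then ent x i j else 0)"
  unfolding idm_def sum_distrib_left ent_sum by (intro sum.cong) (auto simp: ent_mult_mu)
 then show ?thesis using S by auto
qed

lemma ent_idm_mult: "finite S ==> ent (idm S*x) i j = (if i\<in>S then ent x i j else 0)"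
proof -
 assume S: "finite S"
 have "ent (idm S*x) i j = (\<Sum>s\<in>S. if s = i then ent x i j else 0)"
  unfolding idm_def sum_distrib_right ent_sum by (intro sum.cong) (auto simp: ent_mu_mult)
 then show ?thesis using S by auto
qed

lemma proj_idm: "proj (idm S)"
proof (cases "finite S")
 case True
 then show ?thesis unfolding idm_def by (intro proj_sum) (auto simp: proj_def mu_mult_mu)
qed (simp add: idm_def proj_def)

lemma idm_mult_idm: "finite S ==> finite T ==> idm S*idm T = idm (S \<inter> T)"
 by (rule cm_eqI) (auto simp: ent_mult_idm ent_idm)

lemma idm_mult: "finite S ==> spt (%i j. i\<in>S) x ==> idm S*x = x" by (rule cm_eqI) (auto simp: ent_idm_mult spt_def)

lemma mult_idm: "finite S ==> spt (%i j. j\<in>S) x ==> x*idm S = x" by (rule cm_eqI) (auto simp: ent_mult_idm spt_def)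

lemma norm_mu [simp]: "norm (mu a b) = 1"
proof -
 have p: "proj (mu b b)" by (simp add: proj_def mu_mult_mu)
 have "norm (mu b b) ~= 0" by simp
 then have "norm (mu b b) = 1" using norm_st_mult[of "mu b b"] by (simp add: mu_mult_mu power2_eq_square)
 moreover have "(norm (mu a b))\<^sup>2 = norm (mu b b)" by (simp add: mu_mult_mu flip: norm_st_mult)
 ultimately show ?thesis by (simp add: power2_eq_1_iff) (metis norm_ge_zero neg_0_le_iff_le not_one_le_zero)
qed

section \<open>Perturbing almost isometries and almost projections\<close>

text \<open>The Newton-Schulz iteration \<open>Y \<mapsto> Y (3 - Y\<^sup>* Y) / 2\<close> converges quadratically to the polar part.\<close>

definition nstep :: "cm => cm" where
 "nstep Y = (3/2) *\<^sub>R Y - (1/2) *\<^sub>R (Y*(st Y*Y))"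

text \<open>A closed property that the iteration preserves passes to its limit. Supports,
  self-adjointness and one-sided units of the polar part are obtained in this way.\<close>

lemma nstep_limit_induct:
 assumes "Y 0 = X" "!!n. Y (Suc n) = nstep (Y n)" "Y \<longlonglongrightarrow> U"
  "P X" "!!Y. P Y ==> P (nstep Y)" "!!Y L. (!!n. P (Y n)) ==> Y \<longlonglongrightarrow> L ==> P L" shows "P U"
proof -
 have "P (Y n)" for n by (induction n) (auto simp: assms)
 then show ?thesis by (rule assms(6)[OF _ assms(3)])
qed

text \<open>\<open>J\<close> is the unit of the source corner. The defect D = J - Y* Y turns into
  3/4 D^2 + 1/4 D^3 in one step, so a norm of at most 1/2 is at least halved. A step moves
  \<open>Y\<close> by 1/2 Y D, of norm at most d / 2^n since \<open>Y\<close> has norm at most 2;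
  summing gives 2 d.\<close>

lemma polar_part:
 assumes J: "proj J" and XJ: "X*J = X" and d: "norm (st X*X - J) <= d" "d <= 1/2" and b: "bnd N X"
 obtains U Y where "st U*U = J" "norm (U - X) <= 2*d" "Y 0 = X" "!!n. Y (Suc n) = nstep (Y n)" "Y \<longlonglongrightarrow> U"
proof -
 define Y where "Y = rec_nat X (%_. nstep)"
 have Y: "Y 0 = X" "!!n. Y (Suc n) = nstep (Y n)" by (simp_all add: Y_def)
 have bY: "bnd N (Y n)" for n by (induction n) (auto simp: Y b nstep_def scaleR_cm_def intro!: bnd_diff bnd_csc bnd_mult bnd_st)
 have YJ: "Y n*J = Y n" for n by (induction n) (simp_all add: Y XJ nstep_def algebra_simps)
 note JJ = projD[OF J]
 have JY: "J*st (Y n) = st (Y n)" for n using arg_cong[OF YJ[of n], of st] by (simp add: st_mult JJ)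
 define D where "D n = J - st (Y n)*Y n" for n
 have DJ: "D n*J = D n" "J*D n = D n" for n by (simp_all add: D_def algebra_simps JJ YJ) (simp flip: mult.assoc add: JY)
 have step: "Y (Suc n) = Y n + (1/2) *\<^sub>R (Y n*D n)" for n
 proof -
  have "(1/2) *\<^sub>R Y n + Y n = (3/2) *\<^sub>R Y n"
   by (metis (no_types) add_divide_distrib field_sum_of_halves numeral_Bit1 numeral_One one_add_one scaleR_left.add scaleR_one add.assoc)
  then show ?thesis by (simp add: Y nstep_def D_def right_diff_distrib YJ scaleR_diff_right add.commute)
 qed
 have D': "D (Suc n) = (3/4) *\<^sub>R (D n*D n) + (1/4) *\<^sub>R (D n*D n*D n)" for n
 proof -
  have sD: "st (D n) = D n" by (simp add: D_def st_diff st_mult JJ)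
  have H: "st (Y n)*Y n = J - D n" by (simp add: D_def)
  have H': "st (Y n)*(Y n*z) = (J - D n)*z" for z by (simp add: H flip: mult.assoc)
  have JD: "J*(D n*z) = D n*z" for z by (simp flip: mult.assoc add: DJ)
  have "D (Suc n) = J - (st (Y n) + (1/2) *\<^sub>R (D n*st (Y n)))*(Y n + (1/2) *\<^sub>R (Y n*D n))"
   unfolding D_def[of "Suc n"] step by (simp add: st_add st_scaleR st_mult sD)
  also have "... = J - ((J - D n) + (1/2) *\<^sub>R ((J - D n)*D n) + (1/2) *\<^sub>R (D n*(J - D n))
    + (1/4) *\<^sub>R (D n*((J - D n)*D n)))" by (simp add: distrib_right distrib_left mult.assoc H H' scaleR_add_right)
  also have "... = (3/4) *\<^sub>R (D n*D n) + (1/4) *\<^sub>R (D n*D n*D n)"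
  proof -
   have "J - ((J - a) + (1/2) *\<^sub>R (a - e) + (1/2) *\<^sub>R (a - e) + (1/4) *\<^sub>R (e - f))
    = (3/4) *\<^sub>R e + (1/4) *\<^sub>R f" for a e f :: cm
    by (rule cm_eqI) (simp add: ent_add ent_diff ent_scaleR field_simps)
   then show ?thesis by (simp add: left_diff_distrib right_diff_distrib DJ mult.assoc)
  qed
  finally show ?thesis .
 qed
 have d0: "0 <= d" using d(1) norm_ge_zero order_trans by blast
 have nD: "norm (D n) <= d*(1/2) ^ n" for n
 proof (induction n)
  case 0
  then show ?case using d by (simp add: D_def Y norm_minus_commute)
 next
  case (Suc n)
  let ?x = "norm (D n)"
  have "d*(1/2) ^ n <= d*1" using d0 by (intro mult_left_mono) (auto simp: power_le_one)
  then have x: "?x <= 1/2" using Suc d by linarith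
  have DD: "norm (D n*D n) <= ?x*?x" by (rule norm_mult_ineq)
  also have DD2: "... <= 1/2*?x" using x by (intro mult_right_mono) auto
  finally have a: "norm (D n*D n) <= 1/2*?x" .
  have "norm (D n*D n*D n) <= norm (D n*D n)*?x" by (rule norm_mult_ineq)
  also have "... <= (1/2*?x)*1" using a x by (intro mult_mono) auto
  finally have b: "norm (D n*D n*D n) <= 1/2*?x" by simp
  have "norm (D (Suc n)) <= 3/4*norm (D n*D n) + 1/4*norm (D n*D n*D n)"
   unfolding D' using norm_triangle_ineq[of "(3/4) *\<^sub>R (D n*D n)" "(1/4) *\<^sub>R (D n*D n*D n)"] by simp
  also have "... <= 1/2*?x" using a b by simp
  finally show ?case using Suc by simp
 qed
 have nY: "norm (Y n) <= 2" for n
 proof -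
  have "(norm (Y n))\<^sup>2 = norm (J - D n)" by (simp add: D_def flip: norm_st_mult)
  also have "... <= norm J + norm (D n)" by (rule norm_triangle_ineq4)
  also have "... <= 1 + d*(1/2) ^ n" using proj_norm_le[OF J] nD[of n] by simp
  also have "d*(1/2) ^ n <= d*1" using d0 by (intro mult_left_mono) (auto simp: power_le_one)
  finally have "(norm (Y n))\<^sup>2 <= 2\<^sup>2" using d by simp
  then show ?thesis by (rule power2_le_imp_le) simp
 qed
 have inc: "norm (Y (Suc n) - Y n) <= d*(1/2) ^ n" for n
 proof -
  have "norm (Y (Suc n) - Y n) = 1/2*norm (Y n*D n)" by (simp add: step)
  also have "norm (Y n*D n) <= norm (Y n)*norm (D n)" by (rule norm_mult_ineq)
  also have "... <= 2*(d*(1/2) ^ n)" using nY nD by (intro mult_mono) auto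
  finally show ?thesis by simp
 qed
 obtain U where U: "Y \<longlonglongrightarrow> U" "!!n. norm (U - Y n) <= d*(1/2) ^ n / (1 - 1/2)"
  using geometric_steps_converge[OF bY inc] by auto
 have cst: "(%n. st (Y n)) \<longlonglongrightarrow> st U"
 proof -
  have "(%n. norm (st (Y n - U))) \<longlonglongrightarrow> 0" using U(1) by (simp add: tendsto_norm_zero LIM_zero)
  then show ?thesis by (simp add: st_diff tendsto_norm_zero_iff LIM_zero_iff)
 qed
 have "D \<longlonglongrightarrow> J - st U*U" unfolding D_def by (intro tendsto_intros cst U)
 moreover have "D \<longlonglongrightarrow> 0"
 proof (rule null_comparison)
  show "EVT n. norm (D n) <= d*(1/2) ^ n" using nD by simp
  show "(%n. d*(1/2) ^ n) \<longlonglongrightarrow> 0" by (intro tendsto_mult_right_zero LIMSEQ_power_zero) simp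
 qed
 ultimately have "st U*U = J" by (metis LIMSEQ_unique eq_iff_diff_eq_0)
 moreover have "norm (U - X) <= 2*d" using U(2)[of 0] by (simp add: Y)
 ultimately show thesis using U(1) Y that by blast
qed

text \<open>The hypothesis is closure of \<open>R\<close> under composing it with its converse and
  itself again. It holds for rectangular patterns, where rows and columns carry different labels and
  \<open>R\<close> is not transitive.\<close>

lemma spt_nstep:
 assumes "spt R Y" "!!i j k l. R i k ==> R l k ==> R l j ==> R i j" shows "spt R (nstep Y)"
proof -
 have "spt (%k j. EX l. R l k & R l j) (st Y*Y)" by (rule spt_mult[OF spt_st[OF assms(1)] assms(1)]) auto
 then have "spt R (Y*(st Y*Y))" by (rule spt_mult[OF assms(1)]) (use assms(2) in blast)
 then show ?thesis unfolding nstep_def by (intro spt_diff spt_scaleR assms)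
qed

text \<open>X = 2 h - J is almost a symmetry: X* X - J = 4 (h h - h), which explains the bound 1/8.
  Its polar part \<open>U\<close> is a symmetry of the corner \<open>J\<close>, and (J + U) / 2 is
  the projection. It differs from \<open>h\<close> by (U - X) / 2, hence by at most 4 d.\<close>

lemma projection_near:
 assumes J: "proj J" and hJ: "h*J = h" and sa: "st h = h" and d: "norm (h*h - h) <= d" "d <= 1/8"
  and s: "spt R h" "spt R J" and R: "!!i j k l. R i k ==> R l k ==> R l j ==> R i j"
 obtains p where "proj p" "norm (p - h) <= 4*d" "spt R p"
proof -
 define X where "X = 2 *\<^sub>R h - J"
 have Jh: "J*h = h" using arg_cong[OF hJ, of st] by (simp add: st_mult projD[OF J] sa)
 have sX: "st X = X" by (simp add: X_def st_diff st_scaleR projD[OF J] sa)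
 have XJ: "X*J = X" by (simp add: X_def left_diff_distrib projD[OF J] hJ)
 have "st X*X - J = 4 *\<^sub>R (h*h - h)" unfolding sX unfolding X_def
  by (rule cm_eqI) (simp add: left_diff_distrib right_diff_distrib hJ Jh projD[OF J] ent_diff ent_scaleR)
 then have n: "norm (st X*X - J) <= 4*d" using d by simp
 obtain N where N: "bnd N X" using bnd_ex by blast
 obtain U Y where U: "st U*U = J" "norm (U - X) <= 2*(4*d)" and
  "Y 0 = X" "!!n. Y (Suc n) = nstep (Y n)" "Y \<longlonglongrightarrow> U" using polar_part[OF J XJ n _ N] d(2) by auto
 note P = nstep_limit_induct[OF this(3-5)]
 have "st U = U"
 proof (rule P[of "%Y. st Y = Y"])
  fix Y :: cm assume "st Y = Y" then show "st (nstep Y) = nstep Y" by (simp add: nstep_def st_diff st_scaleR st_mult mult.assoc)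
 next
  fix Y :: "nat => cm" and L assume Y: "!!n. st (Y n) = Y n" "Y \<longlonglongrightarrow> L"
  show "st L = L"
  proof (rule cm_eqI)
   fix i j
   have "(%n. ent (Y n) i j) \<longlonglongrightarrow> ent L i j" "(%n. cnj (ent (Y n) j i)) \<longlonglongrightarrow> cnj (ent L j i)"
    using tendsto_ent[OF Y(2)] by (auto intro: tendsto_cnj)
   moreover have "cnj (ent (Y n) j i) = ent (Y n) i j" for n using Y(1)[of n] by (metis ent_st)
   ultimately show "ent (st L) i j = ent L i j" by (simp add: ent_st LIMSEQ_unique)
  qed
 qed (simp add: sX)
 moreover have "U*J = U"
 proof (rule P[of "%Y. Y*J = Y"])
  fix Y :: cm assume "Y*J = Y" then show "nstep Y*J = nstep Y" by (simp add: nstep_def algebra_simps)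
 next
  fix Y :: "nat => cm" and L assume Y: "!!n. Y n*J = Y n" "Y \<longlonglongrightarrow> L"
  have "(%n. Y n*J) \<longlonglongrightarrow> L*J" by (intro tendsto_intros Y)
  then show "L*J = L" using Y by (simp add: LIMSEQ_unique)
 qed (simp add: XJ)
 moreover have sU: "spt R U" by (rule P) (auto intro: spt_nstep[OF _ R] spt_lim simp: X_def intro!: spt_diff spt_scaleR s)
 moreover have JU: "J*U = U" using arg_cong[OF calculation(2), of st] calculation(1) by (simp add: st_mult projD[OF J])
 ultimately have "proj ((1/2) *\<^sub>R (J + U))" using U(1) projD[OF J]
  by (auto simp: proj_def st_scaleR st_add distrib_left distrib_right scaleR_2[symmetric] intro!: cm_eqI)
   (simp add: ent_scaleR ent_add field_simps)
 moreover have "norm ((1/2) *\<^sub>R (J + U) - h) <= 4*d"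
 proof -
  have "(1/2) *\<^sub>R (J + U) - h = (1/2) *\<^sub>R (U - X)"
   by (rule cm_eqI) (simp add: X_def ent_scaleR ent_add ent_diff field_simps)
  then show ?thesis using U(2) by simp
 qed
 moreover have "spt R ((1/2) *\<^sub>R (J + U))" by (intro spt_scaleR spt_add s sU)
 ultimately show thesis by (rule that)
qed

section \<open>Orthonormal columns\<close>

text \<open>Vectors are matrices supported in column \<open>0\<close>.\<close>

definition onf :: "nat set => (nat => cm) => nat set => bool" where
 "onf I f S <-> finite I & finite S & (\<forall>i\<in>I. spt (%a b. a\<in>S & b = 0) (f i)) &
  (\<forall>i\<in>I. \<forall>j\<in>I. st (f i)*f j = (if i = j then mu 0 0 else 0))"

definition range_proj :: "nat set => (nat => cm) => cm" where
 "range_proj I f = (\<Sum>i\<in>I. f i*st (f i))"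

lemma column_mu00: "spt (%a b. a\<in>S & b = 0) v ==> v*mu 0 0 = v" by (rule cm_eqI) (auto simp: ent_mult_mu spt_def)

lemma onfD:
 assumes "onf I f S" shows "finite I" "finite S" "!!i. i\<in>I ==> spt (%a b. a\<in>S & b = 0) (f i)"
  "!!i j. i\<in>I ==> j\<in>I ==> st (f i)*f j = (if i = j then mu 0 0 else 0)" "!!i. i\<in>I ==> f i*mu 0 0 = f i"
  "!!i. i\<in>I ==> mu 0 0*st (f i) = st (f i)" using assms column_mu00[of S] unfolding onf_def by auto
  (metis st_mult st_mu column_mu00)

lemma onf_mult_assoc:
 assumes "onf I f S" "i\<in>I" "j\<in>I" shows "st (f i)*(f j*z) = (if i = j then mu 0 0*z else 0)"
 using onfD(4)[OF assms] by (simp flip: mult.assoc)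

lemma range_proj_proj: "onf I f S ==> proj (range_proj I f)"
proof -
 assume o: "onf I f S"
 have "proj (f i*st (f i))" if "i\<in>I" for i
  using onf_mult_assoc[OF o that that] onfD[OF o] that by (simp add: proj_def st_mult mult.assoc)
 moreover have "(f i*st (f i))*(f j*st (f j)) = 0" if "i\<in>I" "j\<in>I" "i ~= j" for i j
  using onf_mult_assoc[OF o that(1,2)] that by (simp add: mult.assoc)
 ultimately show ?thesis unfolding range_proj_def by (intro proj_sum onfD[OF o])
qed

lemma range_proj_mult: "onf I f S ==> i\<in>I ==> range_proj I f*f i = f i"
proof -
 assume o: "onf I f S" and i: "i\<in>I"
 have "range_proj I f*f i = (\<Sum>j\<in>I. if j = i then f i else 0)" unfolding range_proj_def sum_distrib_right
  by (intro sum.cong refl) (use onfD[OF o] i in "simp add: mult.assoc")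
 then show ?thesis using i onfD(1)[OF o] by simp
qed

lemma range_proj_spt: "onf I f S ==> spt (%a b. a\<in>S & b\<in>S) (range_proj I f)" unfolding range_proj_def
 by (intro spt_sum spt_mult[OF onfD(3) spt_st[OF onfD(3)]]) auto

lemma proj_diag:
 assumes "proj p"
 obtains r where "ent p s s = of_real r" "0 <= r" "r <= 1"
proof -
 obtain N where N: "bnd N p" using bnd_ex by blast
 have "ent p s s = ent (p*st p) s s" using projD[OF assms] by simp
 also have "... = (\<Sum>k<N. ent p s k*cnj (ent p s k))" using N by (simp add: ent_mult[of N] ent_st)
 also have "... = of_real (\<Sum>k<N. (cmod (ent p s k))\<^sup>2)" by (simp add: complex_norm_square del: of_real_power)
 finally have e: "ent p s s = of_real (\<Sum>k<N. (cmod (ent p s k))\<^sup>2)" .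
 moreover have "0 <= (\<Sum>k<N. (cmod (ent p s k))\<^sup>2)" by (simp add: sum_nonneg)
 moreover have "cmod (ent p s s) <= 1" using ent_le_norm[of p s s] proj_norm_le[OF assms] by simp
 ultimately show thesis using that by (metis abs_of_nonneg norm_of_real)
qed

text \<open>The trace of v v* equals v* v. A scalar is here a multiple of
  \<open>mu 0 0\<close>.\<close>

lemma column_norm_ent:
 assumes "spt (%a b. a\<in>S & b = 0) v" "finite S" shows "st v*v = csc (\<Sum>s\<in>S. ent (v*st v) s s) (mu 0 0)"
proof (rule cm_eqI)
 fix i j
 obtain N0 where "bnd N0 v" using bnd_ex by blast
 define N where "N = N0 + Max (insert 0 S) + 1"
 have N: "bnd N v" "S <= {..<N}"
  using \<open>bnd N0 v\<close> bnd_mono[of N0 v N] assms(2) Max_ge[of "insert 0 S"] unfolding N_def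
  by (auto simp: less_Suc_eq_le intro!: trans_le_add2)
 have e: "ent (v*st v) s s = ent v s 0*cnj (ent v s 0)" for s
  using assms(1) by (subst ent_mult_gen[of 1]) (auto simp: ent_st spt_def)
 have "ent (st v*v) i j = (\<Sum>k<N. cnj (ent v k i)*ent v k j)" using N by (simp add: ent_mult[of N] ent_st)
 also have "... = (\<Sum>k\<in>S. cnj (ent v k i)*ent v k j)"
  using N assms by (intro sum.mono_neutral_right) (auto simp: spt_def)
 also have "... = (if i = 0 & j = 0 then \<Sum>s\<in>S. ent (v*st v) s s else 0)"
  unfolding e using assms(1) by (auto simp: spt_def mult.commute intro!: sum.neutral) blast+
 finally show "ent (st v*v) i j = ent (csc (\<Sum>s\<in>S. ent (v*st v) s s) (mu 0 0)) i j" by (simp add: ent_csc ent_mu)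
qed

lemma onf_trace:
 assumes o: "onf I f S" shows "(\<Sum>s\<in>S. ent (range_proj I f) s s) = of_nat (card I)"
proof -
 have "(\<Sum>s\<in>S. ent (f i*st (f i)) s s) = 1" if "i\<in>I" for i
  using column_norm_ent[OF onfD(3)[OF o that] onfD(2)[OF o]] onfD(4)[OF o that that]
  by (metis (no_types, lifting) ent_csc ent_mu mult.right_neutral)
 then have "(\<Sum>i\<in>I. \<Sum>s\<in>S. ent (f i*st (f i)) s s) = of_nat (card I)" by simp
 then show ?thesis unfolding range_proj_def ent_sum by (subst sum.swap)
qed

text \<open>A dimension count by traces: the diagonal entries of a projection lie in [0, 1], so its
  trace is at most the number of coordinates.\<close>

lemma onf_card_le: assumes o: "onf I f S" shows "card I <= card S"
proof -
 have "real (card I) = Re (\<Sum>s\<in>S. ent (range_proj I f) s s)" using onf_trace[OF o] by simp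
 also have "... = (\<Sum>s\<in>S. Re (ent (range_proj I f) s s))" by simp
 also have "... <= (\<Sum>s\<in>S. 1)"
 proof (rule sum_mono)
  fix s show "Re (ent (range_proj I f) s s) <= 1" using proj_diag[OF range_proj_proj[OF o], of s] by (metis Re_complex_of_real)
 qed
 finally show ?thesis by simp
qed

lemma normalize_column:
 assumes "spt (%a b. a\<in>S & b = 0) v" "st v*v = csc (of_real r) (mu 0 0)" "r > 0"
 obtains c where "spt (%a b. a\<in>S & b = 0) (c *\<^sub>R v)" "st (c *\<^sub>R v)*(c *\<^sub>R v) = mu 0 0"
proof
 let ?c = "1 / sqrt r"
 show "spt (%a b. a\<in>S & b = 0) (?c *\<^sub>R v)" using assms by (intro spt_scaleR)
 have "st (?c *\<^sub>R v)*(?c *\<^sub>R v) = (?c*?c) *\<^sub>R (st v*v)" by (simp add: st_scaleR)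
 also have "... = mu 0 0" using assms by (simp add: csc_real)
 finally show "st (?c *\<^sub>R v)*(?c *\<^sub>R v) = mu 0 0" .
qed

text \<open>The squared length of the part of the \<open>s\<close>-th coordinate vector orthogonal
  to the range of \<open>p\<close>.\<close>

lemma complement_column:
 assumes "proj p" shows "st (mu s 0 - p*mu s 0)*(mu s 0 - p*mu s 0) = csc (1 - ent p s s) (mu 0 0)"
proof -
 have pp: "p*(p*z) = p*z" for z using projD[OF assms] by (simp flip: mult.assoc)
 have "mu 0 s*p*mu s 0 = csc (ent p s s) (mu 0 0)" by (rule mu_sandwich)
 then have "st (mu s 0 - p*mu s 0)*(mu s 0 - p*mu s 0) = mu 0 0 - csc (ent p s s) (mu 0 0)"
  by (simp add: st_diff st_mult projD[OF assms] left_diff_distrib right_diff_distrib mult.assoc pp mu_mult_mu)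
 also have "... = csc (1 - ent p s s) (mu 0 0)" by (rule cm_eqI) (simp add: ent_diff ent_csc ent_mu)
 finally show ?thesis .
qed

text \<open>The trace of the range projection is \<open>card I\<close> and smaller than
  \<open>card S\<close>, so some diagonal entry is below 1. The normalized residual of that
  coordinate vector is orthogonal to the family.\<close>

lemma onf_extend:
 assumes o: "onf I f S" and c: "card I < card S"
 obtains g where "spt (%a b. a\<in>S & b = 0) g" "st g*g = mu 0 0" "!!i. i\<in>I ==> st (f i)*g = 0"
proof -
 let ?p = "range_proj I f"
 note pr = range_proj_proj[OF o]
 have "\<exists>s\<in>S. ent ?p s s ~= 1"
 proof (rule ccontr)
  assume "~ ?thesis"
  then have "(\<Sum>s\<in>S. ent ?p s s) = (\<Sum>s\<in>S. 1)" by (intro sum.cong) auto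
  then have "complex_of_nat (card I) = of_nat (card S)" using onf_trace[OF o] by simp
  then show False using c by simp
 qed
 then obtain s where s: "s\<in>S" "ent ?p s s ~= 1" by blast
 obtain r where r: "ent ?p s s = of_real r" "r <= 1" using proj_diag[OF pr] by auto
 let ?g = "mu s 0 - ?p*mu s 0"
 have sp: "spt (%a b. a\<in>S & b = 0) ?g"
  using s by (intro spt_diff spt_mu spt_mult[OF range_proj_spt[OF o] spt_mu[of "%a b. b = 0"]]) simp_all
 have "st ?g*?g = csc (of_real (1 - r)) (mu 0 0)" using complement_column[OF pr, of s] r by simp
 moreover have "1 - r > 0" using s r by (cases "r = 1") auto
 ultimately obtain d where d: "spt (%a b. a\<in>S & b = 0) (d *\<^sub>R ?g)" "st (d *\<^sub>R ?g)*(d *\<^sub>R ?g) = mu 0 0"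
  using normalize_column[OF sp] by blast
 moreover have "st (f i)*(d *\<^sub>R ?g) = 0" if "i\<in>I" for i
 proof -
  have "st (f i)*?p = st (f i)" using arg_cong[OF range_proj_mult[OF o that], of st] by (simp add: st_mult projD[OF pr])
  then show ?thesis by (simp add: right_diff_distrib flip: mult.assoc)
 qed
 ultimately show thesis by (rule that)
qed

lemma onf_insert:
 assumes o: "onf I f S" and g: "spt (%a b. a\<in>S & b = 0) g" "st g*g = mu 0 0" "!!i. i\<in>I ==> st (f i)*g = 0"
  and k: "k \<notin> I" shows "onf (insert k I) (f(k := g)) S"
proof -
 have "st g*f i = 0" if "i\<in>I" for i using arg_cong[OF g(3)[OF that], of st] by (simp add: st_mult)
 then show ?thesis using o g k unfolding onf_def by auto
qed

lemma onf_full: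
 assumes o: "onf I f S" and c: "card I = card S" shows "range_proj I f = idm S"
proof -
 let ?p = "range_proj I f"
 note pr = range_proj_proj[OF o]
 have "(\<Sum>s\<in>S. 1 - Re (ent ?p s s)) = 0" using arg_cong[OF onf_trace[OF o], of Re] c by (simp add: sum_subtractf)
 moreover have "0 <= 1 - Re (ent ?p s s)" for s using proj_diag[OF pr, of s] by (metis Re_complex_of_real diff_ge_0_iff_ge)
 ultimately have "Re (ent ?p s s) = 1" if "s\<in>S" for s using that onfD(2)[OF o] by (subst (asm) sum_nonneg_eq_0_iff) auto
 then have one: "ent ?p s s = 1" if "s\<in>S" for s using proj_diag[OF pr, of s] that by (metis Re_complex_of_real of_real_1)
 \<comment> \<open>A diagonal entry 1 leaves a residual of length 0.\<close>
 have "?p*mu s 0 = mu s 0" if "s\<in>S" for s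
 proof -
  have "(norm (mu s 0 - ?p*mu s 0))\<^sup>2 = 0"
   unfolding norm_st_mult[symmetric] complement_column[OF pr] using one[OF that] by simp
  then show ?thesis by simp
 qed
 then have "ent ?p i s = (if i = s then 1 else 0)" if "s\<in>S" for i s
  using that ent_mult_mu[of ?p s 0 i 0] by (simp add: ent_mu)
 moreover have "ent ?p i s = 0" if "s \<notin> S" for i s using range_proj_spt[OF o] that by (auto simp: spt_def)
 ultimately show ?thesis using onfD(2)[OF o] by (intro cm_eqI) (metis ent_idm)
qed

text \<open>Both families are enlarged simultaneously until they are bases; then the sum of the
  products of \<open>g i\<close> with the adjoint of \<open>f i\<close> is the required unitary. The
  induction is on the number of missing vectors.\<close>

lemma onf_unitary:
 assumes "onf I f S" "onf I g T" "card S = card T"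
 shows "EX u. spt (%a b. a\<in>T & b\<in>S) u & st u*u = idm S & u*st u = idm T & (\<forall>i\<in>I. u*f i = g i)" using assms
proof (induction "card S - card I" arbitrary: I f g)
 case 0
 have c: "card I = card S" using 0 onf_card_le[OF 0(2)] by simp
 note o = 0(2) and o' = 0(3)
 define u where "u = (\<Sum>i\<in>I. g i*st (f i))"
 have uf: "u*f i = g i" if i: "i\<in>I" for i
 proof -
  have "u*f i = (\<Sum>j\<in>I. if j = i then g i else 0)" unfolding u_def sum_distrib_right
   by (intro sum.cong refl) (use onfD[OF o] onfD[OF o'] i in "simp add: mult.assoc")
  then show ?thesis using i onfD(1)[OF o] by simp
 qed
 have uf': "st u*g i = f i" if i: "i\<in>I" for i
 proof -
  have "st u*g i = (\<Sum>j\<in>I. if j = i then f i else 0)" unfolding u_def sum_distrib_right st_sum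
   by (intro sum.cong refl) (use onfD[OF o] onfD[OF o'] i in "simp add: mult.assoc st_mult")
  then show ?thesis using i onfD(1)[OF o] by simp
 qed
 have "st u*u = (\<Sum>i\<in>I. (st u*g i)*st (f i))" by (simp add: u_def sum_distrib_left mult.assoc)
 also have "... = range_proj I f" by (simp add: uf' range_proj_def)
 also have "... = idm S" by (rule onf_full[OF o c])
 finally have 1: "st u*u = idm S" .
 have "u*st u = (\<Sum>i\<in>I. (u*f i)*st (g i))" by (simp add: u_def st_sum st_mult sum_distrib_left mult.assoc)
 also have "... = range_proj I g" by (simp add: uf range_proj_def)
 also have "... = idm T" using onf_full[OF o'] c 0 by simp
 finally have 2: "u*st u = idm T" .
 have "spt (%a b. a\<in>T & b\<in>S) u" unfolding u_def
  by (intro spt_sum spt_mult[OF onfD(3)[OF o'] spt_st[OF onfD(3)[OF o]]]) auto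
 then show ?case using 1 2 uf by blast
next
 case (Suc n)
 note o = Suc(3) and o' = Suc(4)
 have c: "card I < card S" "card I < card T" using Suc by auto
 obtain v where v: "spt (%a b. a\<in>S & b = 0) v" "st v*v = mu 0 0" "!!i. i\<in>I ==> st (f i)*v = 0"
  using onf_extend[OF o c(1)] by auto
 obtain w where w: "spt (%a b. a\<in>T & b = 0) w" "st w*w = mu 0 0" "!!i. i\<in>I ==> st (g i)*w = 0"
  using onf_extend[OF o' c(2)] by auto
 obtain k where k: "k \<notin> I" using onfD(1)[OF o] infinite_UNIV_nat ex_new_if_finite by auto
 have "n = card S - card (insert k I)" using k Suc(2) onfD(1)[OF o] by simp
 from Suc(1)[OF this onf_insert[OF o v k] onf_insert[OF o' w k] Suc(5)]
 obtain u where "spt (%a b. a\<in>T & b\<in>S) u" "st u*u = idm S" "u*st u = idm T"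
  "\<forall>i\<in>insert k I. u*(f(k := v)) i = (g(k := w)) i" by blast
 then show ?case using k by (intro exI[of _ u]) (auto split: if_splits)
qed

text \<open>A maximal orthonormal family in the range of \<open>p\<close> whose members each live in
  one block of \<open>c\<close>. If it did not span the range, a nonzero column of the difference
  \<open>d\<close> could be added: the support of \<open>d\<close> is block diagonal, so each column
  lies in one block.\<close>

lemma proj_eq_range_proj:
 assumes S: "finite S" and p: "proj p" and sp: "spt (%a b. a\<in>S & b\<in>S & c a = c b) p"
 obtains I f t where "onf I f S" "p = range_proj I f" "!!i. i\<in>I ==> spt (%a b. c a = t i & b = 0) (f i)"
  "!!i. i\<in>I ==> t i\<in>c ` S"
proof -
 define Q where "Q I <-> (EX f t. onf I f S & (\<forall>i\<in>I. p*f i = f i & t i\<in>c ` S & spt (%a b. c a = t i & b = 0) (f i)))" for I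
 have "Q {}" using S by (auto simp: Q_def onf_def)
 moreover have "\<forall>I. Q I --> card I <= card S" by (auto simp: Q_def onf_card_le)
 ultimately obtain I where I: "Q I" "!!J. Q J ==> card J <= card I"
  using ex_has_greatest_nat[of Q "{}" card "Suc (card S)"] by (metis less_Suc_eq_le)
 then obtain f t where o: "onf I f S" and ft: "!!i. i\<in>I ==> p*f i = f i" "!!i. i\<in>I ==> t i\<in>c ` S"
  "!!i. i\<in>I ==> spt (%a b. c a = t i & b = 0) (f i)" unfolding Q_def by blast
 let ?q = "range_proj I f"
 note q = range_proj_proj[OF o]
 have pq: "p*?q = ?q" using ft(1) by (simp add: range_proj_def sum_distrib_left flip: mult.assoc)
 have qp: "?q*p = ?q" using arg_cong[OF pq, of st] by (simp add: st_mult projD[OF p] projD[OF q])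
 define d where "d = p - ?q"
 have d: "proj d" by (simp add: proj_def d_def st_diff projD[OF p] projD[OF q] left_diff_distrib right_diff_distrib pq qp)
 have sq: "spt (%a b. a\<in>S & b\<in>S & c a = c b) ?q" unfolding range_proj_def
 proof (rule spt_sum)
  fix i assume i: "i\<in>I"
  have sf: "spt (%a b. a\<in>S & c a = t i & b = 0) (f i)" using ft(3)[OF i] onfD(3)[OF o i] by (auto simp: spt_def)
  show "spt (%a b. a\<in>S & b\<in>S & c a = c b) (f i*st (f i))" by (rule spt_mult[OF sf spt_st[OF sf]]) auto
 qed
 have sd: "spt (%a b. a\<in>S & b\<in>S & c a = c b) d" unfolding d_def by (intro spt_diff sp sq)
 have "d = 0"
 proof (rule ccontr)
  assume "d ~= 0"
  then obtain a s where as: "ent d a s ~= 0" by (metis cm_eqI ent_zero)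
  have s: "s\<in>S" using sd as by (auto simp: spt_def)
  let ?g = "d*mu s 0"
  have dd: "d*(d*z) = d*z" for z using projD[OF d] by (simp flip: mult.assoc)
  have gg: "st ?g*?g = csc (ent d s s) (mu 0 0)"
   using mu_sandwich[of 0 s d s 0] by (simp add: st_mult projD[OF d] mult.assoc dd)
  obtain r where r: "ent d s s = of_real r" "0 <= r" using proj_diag[OF d] by auto
  have "r ~= 0"
  proof
   assume "r = 0"
   then have "(norm ?g)\<^sup>2 = 0" using gg r by (simp flip: norm_st_mult)
   then show False using as ent_mult_mu[of d s 0 a 0] by simp
  qed
  moreover have sg: "spt (%a b. (a\<in>S & c a = c s) & b = 0) ?g"
   by (rule spt_mult[OF sd spt_mu[of "%a b. a = s & b = 0"]]) auto
  then have sg1: "spt (%a b. a\<in>S & b = 0) ?g" and sg2: "spt (%a b. c a = c s & b = 0) ?g" by (auto elim: spt_mono)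
  ultimately obtain k where k: "spt (%a b. a\<in>S & b = 0) (k *\<^sub>R ?g)" "st (k *\<^sub>R ?g)*(k *\<^sub>R ?g) = mu 0 0"
   using normalize_column[OF sg1] gg r by (metis order_le_less)
  obtain m where m: "m \<notin> I" using onfD(1)[OF o] infinite_UNIV_nat ex_new_if_finite by auto
  have "st (f i)*(k *\<^sub>R ?g) = 0" if i: "i\<in>I" for i
  proof -
   have "st (f i)*?q = st (f i)" "st (f i)*p = st (f i)"
    using arg_cong[OF range_proj_mult[OF o i], of st] arg_cong[OF ft(1)[OF i], of st]
    by (simp_all add: st_mult projD[OF q] projD[OF p])
   then have "st (f i)*d = 0" by (simp add: d_def right_diff_distrib)
   then show ?thesis by (simp flip: mult.assoc)
  qed
  from onf_insert[OF o k this m] have "onf (insert m I) (f(m := k *\<^sub>R ?g)) S" .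
  moreover have "p*(k *\<^sub>R ?g) = k *\<^sub>R ?g"
  proof -
   have "p*d = d" by (simp add: d_def right_diff_distrib projD[OF p] pq)
   then show ?thesis by (simp flip: mult.assoc)
  qed
  ultimately have "Q (insert m I)" unfolding Q_def
   using ft s spt_scaleR[OF sg2] by (intro exI[of _ "f(m := k *\<^sub>R ?g)"] exI[of _ "t(m := c s)"]) auto
  from I(2)[OF this] show False using m onfD(1)[OF o] by simp
 qed
 then have "p = ?q" by (simp add: d_def)
 with o ft show thesis by (intro that[of I f t])
qed

text \<open>\<open>G\<close> maps the coordinates \<open>I\<close> isometrically onto the range of
  the first projection. Compressed by the second projection \<open>?E\<close> it stays an isometry
  up to 1/2, exactly what \<open>polar_part\<close> tolerates. The polar part has range inside that
  of \<open>?E\<close>, which gives \<open>card I\<close> orthonormal vectors in the coordinates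
  \<open>J\<close>.\<close>

lemma onf_close_card_le:
 assumes o: "onf I f S" and o': "onf J g T" and d: "norm (range_proj I f - range_proj J g) <= 1/2" shows "card I <= card J"
proof -
 let ?E = "range_proj J g"
 note pr = range_proj_proj[OF o']
 define G where "G = (\<Sum>i\<in>I. f i*mu 0 i)"
 define H where "H = (\<Sum>j\<in>J. g j*mu 0 j)"
 have fin: "finite I" "finite J" using onfD(1) o o' by auto
 have sum_iso: "st (\<Sum>i\<in>K. k i*mu 0 i)*(\<Sum>i\<in>K. k i*mu 0 i) = idm K" if k: "onf K k U" for K k U
 proof -
  have "st (\<Sum>i\<in>K. k i*mu 0 i)*(\<Sum>i\<in>K. k i*mu 0 i) = (\<Sum>i\<in>K. \<Sum>j\<in>K. mu i 0*(st (k i)*k j)*mu 0 j)"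
   by (simp add: st_sum st_mult sum_product mult.assoc)
  also have "... = (\<Sum>i\<in>K. \<Sum>j\<in>K. if i = j then mu i i else 0)"
   by (intro sum.cong refl) (auto simp: onfD(4)[OF k] mu_mult_mu)
  finally show ?thesis using onfD(1)[OF k] by (simp add: idm_def)
 qed
 have G: "st G*G = idm I" and H: "st H*H = idm J" unfolding G_def H_def using sum_iso o o' by auto
 have HH: "H*st H = ?E"
 proof -
  have "H*st H = (\<Sum>i\<in>J. \<Sum>j\<in>J. g i*(mu 0 i*mu j 0)*st (g j))"
   unfolding H_def st_sum sum_product by (simp add: st_mult mult.assoc)
  also have "... = (\<Sum>i\<in>J. \<Sum>j\<in>J. if i = j then g i*st (g i) else 0)"
   by (intro sum.cong refl) (auto simp: mu_mult_mu onfD(5)[OF o'])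
  finally show ?thesis using fin by (simp add: range_proj_def)
 qed
 have EG: "range_proj I f*G = G"
  unfolding G_def sum_distrib_left by (intro sum.cong refl) (simp add: range_proj_mult[OF o] flip: mult.assoc)
 have GI: "G*idm I = G" unfolding G_def sum_distrib_right 
  by (intro sum.cong refl) (simp add: idm_def sum_distrib_left mult.assoc mu_mult_mu fin if_distrib[of "(*) _"] cong: if_cong)
 have nG: "norm G <= 1" using partial_isometry_norm_le[of G] G proj_idm by simp
 define X where "X = ?E*G"
 have "st X*X - idm I = st G*((?E - range_proj I f)*G)"
 proof -
  have "st X*X = st G*(?E*G)" by (simp add: X_def st_mult mult.assoc) (simp add: projD[OF pr] flip: mult.assoc)
  moreover have "st G*(range_proj I f*G) = idm I" using EG G by simp
  ultimately show ?thesis by (simp add: left_diff_distrib right_diff_distrib)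
 qed
 also have "norm ... <= norm (st G)*(norm (?E - range_proj I f)*norm G)"
  by (meson norm_mult_ineq mult_left_mono norm_ge_zero order_trans)
 also have "... <= 1*(1/2*1)" using d nG by (intro mult_mono) (auto simp: norm_minus_commute)
 finally have n: "norm (st X*X - idm I) <= 1/2" by simp
 obtain N where N: "bnd N X" using bnd_ex by blast
 have XI: "X*idm I = X" by (simp add: X_def mult.assoc GI)
 obtain U Y where U: "st U*U = idm I" and
  "Y 0 = X" "!!n. Y (Suc n) = nstep (Y n)" "Y \<longlonglongrightarrow> U" using polar_part[OF proj_idm XI n _ N] by blast
 note P = nstep_limit_induct[OF this(2-4)]
 have EU: "?E*U = U"
 proof (rule P[of "%Y. ?E*Y = Y"])
  show "?E*X = X" by (simp add: X_def projD[OF pr] flip: mult.assoc)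
 next
  fix Y :: cm assume "?E*Y = Y" then show "?E*nstep Y = nstep Y" by (simp add: nstep_def right_diff_distrib flip: mult.assoc)
 next
  fix Y :: "nat => cm" and L assume Y: "!!n. ?E*Y n = Y n" "Y \<longlonglongrightarrow> L"
  have "(%n. ?E*Y n) \<longlonglongrightarrow> ?E*L" by (intro tendsto_intros Y)
  then show "?E*L = L" using Y by (simp add: LIMSEQ_unique)
 qed
 define W where "W = st H*U"
 have "st W*W = st U*((H*st H)*U)" by (simp add: W_def st_mult mult.assoc)
 then have W: "st W*W = idm I" using HH EU U by simp
 have "onf I (%i. W*mu i 0) J" unfolding onf_def
 proof (intro conjI ballI fin)
  fix i assume "i\<in>I"
  have "spt (%a b. b\<in>J) H" unfolding H_def
   by (intro spt_sum spt_mult[of "%_ _. True" _ "%a b. b\<in>J"] spt_mu) (auto simp: spt_def)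
  from spt_st[OF this] have "spt (%a b. a\<in>J) W" unfolding W_def by (rule spt_mult[of _ _ "%_ _. True"]) (auto simp: spt_def)
  then show "spt (%a b. a\<in>J & b = 0) (W*mu i 0)" by (rule spt_mult[OF _ spt_mu[of "%a b. b = 0"]]) auto
 next
  fix i j assume ij: "i\<in>I" "j\<in>I"
  have "st (W*mu i 0)*(W*mu j 0) = mu 0 i*(st W*W)*mu j 0" by (simp add: st_mult mult.assoc)
  also have "... = csc (ent (idm I) i j) (mu 0 0)" unfolding W by (rule mu_sandwich)
  finally show "st (W*mu i 0)*(W*mu j 0) = (if i = j then mu 0 0 else 0)" using fin ij by (auto simp: ent_idm)
 qed
 then show ?thesis by (rule onf_card_le)
qed

section \<open>No quasi-inverse on the unit sphere\<close>

text \<open>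
 If \<open>\<parallel>b\<parallel>\<close> is close to \<open>1\<close>, then \<open>1 - b\<^sup>* b\<close> is small on some unit vector, so that a bounded
 \<open>1 + c\<close> cannot invert it.
\<close>

lemma quasi_inverse_bound:
 fixes b c :: cm
 assumes "b ~= 0" shows "1 <= (1 + norm c)*\<bar>1 - (norm b)\<^sup>2\<bar> + norm (c - st b*b - c*(st b*b))"
proof -
 define \<beta> where "\<beta> = norm b"
 define e where "e = c - st b*b - c*(st b*b)"
 have \<beta>: "\<beta> > 0" using assms by (simp add: \<beta>_def)
 \<comment> \<open>Vectors on which the norm of \<open>b\<close> is almost attained.\<close>
 have "EX y. fr y <= 1 & \<beta> - 1 / Suc n < fr (b*y)" for n
 proof (rule ccontr)
  assume "~ ?thesis"
  then have "norm b <= \<beta> - 1 / Suc n" by (intro norm_cm_least) force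
  then show False by (simp add: \<beta>_def)
 qed
 then obtain y where y: "!!n. fr (y n) <= 1" "!!n. \<beta> - 1 / Suc n < fr (b*y n)" by metis
 define T where "T n = fr (b*y n)" for n
 have T\<beta>: "T n <= \<beta>" for n using fr_le_norm[OF y(1)] by (simp add: T_def \<beta>_def)
 have Tl: "T \<longlonglongrightarrow> \<beta>"
 proof (rule tendsto_sandwich[of "%n. \<beta> - 1 / Suc n" _ _ "%_. \<beta>"])
  show "(%n. \<beta> - 1 / real (Suc n)) \<longlonglongrightarrow> \<beta>"
   using LIMSEQ_inverse_real_of_nat_add_minus[of \<beta>] by (simp add: inverse_eq_divide)
 qed (use y T\<beta> in "auto simp: T_def less_imp_le")
 \<comment> \<open>For z = y - b* b y, expanding the square gives |z|^2 at most 1 - 2 T^2 +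
   \<beta>^2 T^2, which tends to (1 - \<beta>^2)^2 as T tends to \<beta>. If \<open>c\<close> almost
   inverts, then \<open>y\<close> is almost z + c z.\<close>
 have le: "T n <= \<beta>*((1 + norm c)*sqrt (1 - 2*(T n)\<^sup>2 + \<beta>\<^sup>2*(T n)\<^sup>2) + norm e)" for n
 proof -
  let ?y = "y n" and ?h = "st b*b"
  define z where "z = ?y - ?h*?y"
  obtain N where N: "bnd N b" "bnd N ?y" using bnd_ex2 by blast
  have bN: "bnd N (b*?y)" "bnd N (?h*?y)" "bnd N z" using N by (auto simp: z_def intro!: bnd_mult bnd_st bnd_diff)
  have i1: "ip N ?y (?h*?y) = of_real ((T n)\<^sup>2)"
  proof -
   have "ip N ?y (?h*?y) = ip N ?y (st b*(b*?y))" by (simp add: mult.assoc)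
   also have "... = ip N (st (st b)*?y) (b*?y)" using N by (intro ip_adj bnd_st bnd_mult)
   finally show ?thesis using ip_self[OF bN(1)] by (simp add: T_def)
  qed
  have i2: "ip N (?h*?y) ?y = of_real ((T n)\<^sup>2)"
  proof -
   have "ip N (?h*?y) ?y = cnj (ip N ?y (?h*?y))" by (simp add: ip_def mult.commute)
   then show ?thesis using i1 by simp
  qed
  have "ip N z z = ip N ?y ?y - ip N ?y (?h*?y) - ip N (?h*?y) ?y + ip N (?h*?y) (?h*?y)"
   by (simp add: ip_def z_def ent_diff algebra_simps sum_subtractf)
  then have "of_real ((fr z)\<^sup>2) = (of_real ((fr ?y)\<^sup>2 - 2*(T n)\<^sup>2 + (fr (?h*?y))\<^sup>2) :: complex)"
   using ip_self[OF bN(3)] ip_self[OF N(2)] ip_self[OF bN(2)] i1 i2 by simp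
  then have "(fr z)\<^sup>2 = (fr ?y)\<^sup>2 - 2*(T n)\<^sup>2 + (fr (?h*?y))\<^sup>2" by (simp only: of_real_eq_iff)
  moreover have "(fr ?y)\<^sup>2 <= 1" using y(1) by (simp add: power_le_one)
  moreover have "fr (?h*?y) <= \<beta>*T n" using fr_mult_norm[of "st b" "b*?y"] by (simp add: T_def \<beta>_def mult.assoc)
  then have "(fr (?h*?y))\<^sup>2 <= (\<beta>*T n)\<^sup>2" by (intro power_mono) auto
  ultimately have "(fr z)\<^sup>2 <= 1 - 2*(T n)\<^sup>2 + \<beta>\<^sup>2*(T n)\<^sup>2" by (simp add: power_mult_distrib)
  then have z: "fr z <= sqrt (1 - 2*(T n)\<^sup>2 + \<beta>\<^sup>2*(T n)\<^sup>2)" by (rule real_le_rsqrt)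
  have hy: "?h*?y = c*z + csc (- 1) (e*?y)" by (simp add: z_def e_def algebra_simps)
  have "fr (?h*?y) <= fr (c*z) + fr (e*?y)"
   unfolding hy using fr_triangle[of "c*z" "csc (- 1) (e*?y)"] by (simp only: fr_csc) simp
  also have "... <= norm c*fr z + norm e" by (intro add_mono fr_mult_norm fr_le_norm y)
  finally have "fr (z + ?h*?y) <= fr z + (norm c*fr z + norm e)" using fr_triangle[of z "?h*?y"] by simp
  then have "fr ?y <= (1 + norm c)*fr z + norm e" by (simp add: z_def algebra_simps)
  also have "... <= (1 + norm c)*sqrt (1 - 2*(T n)\<^sup>2 + \<beta>\<^sup>2*(T n)\<^sup>2) + norm e"
   using z by (intro add_mono mult_left_mono) auto
  finally have "\<beta>*fr ?y <= \<beta>*((1 + norm c)*sqrt (1 - 2*(T n)\<^sup>2 + \<beta>\<^sup>2*(T n)\<^sup>2) + norm e)"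
   using \<beta> by (intro mult_left_mono) auto
  moreover have "T n <= \<beta>*fr ?y" unfolding T_def \<beta>_def by (rule fr_mult_norm)
  ultimately show ?thesis by simp
 qed
 have "\<beta> <= \<beta>*((1 + norm c)*sqrt (1 - 2*\<beta>\<^sup>2 + \<beta>\<^sup>2*\<beta>\<^sup>2) + norm e)"
 proof (rule LIMSEQ_le[OF Tl])
  show "(%n. \<beta>*((1 + norm c)*sqrt (1 - 2*(T n)\<^sup>2 + \<beta>\<^sup>2*(T n)\<^sup>2) + norm e)) \<longlonglongrightarrow>
   \<beta>*((1 + norm c)*sqrt (1 - 2*\<beta>\<^sup>2 + \<beta>\<^sup>2*\<beta>\<^sup>2) + norm e)" by (intro tendsto_intros Tl)
 qed (use le in blast)
 moreover have "1 - 2*\<beta>\<^sup>2 + \<beta>\<^sup>2*\<beta>\<^sup>2 = (1 - \<beta>\<^sup>2)\<^sup>2" by (simp add: power2_eq_square algebra_simps)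
 ultimately have "\<beta>*1 <= \<beta>*((1 + norm c)*\<bar>1 - \<beta>\<^sup>2\<bar> + norm e)" by simp
 then have "1 <= (1 + norm c)*\<bar>1 - \<beta>\<^sup>2\<bar> + norm e" using \<beta> by simp
 then show ?thesis by (simp add: \<beta>_def e_def)
qed

section \<open>Star homomorphisms are contractive\<close>

definition ssub :: "'a :: cstar set => bool" where
 "ssub B <-> 0\<in>B & (\<forall>x\<in>B. \<forall>y\<in>B. x + y\<in>B & x*y\<in>B) & (ALL c. \<forall>x\<in>B. csc c x\<in>B) & (\<forall>x\<in>B. st x\<in>B)"

lemma ssubD:
 assumes "ssub B"
 shows "0\<in>B" "x\<in>B ==> y\<in>B ==> x + y\<in>B" "x\<in>B ==> y\<in>B ==> x*y\<in>B" "x\<in>B ==> csc c x\<in>B"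
  "x\<in>B ==> st x\<in>B" "x\<in>B ==> r *\<^sub>R x\<in>B" "x\<in>B ==> - x\<in>B" "x\<in>B ==> y\<in>B ==> x - y\<in>B"
proof -
 have a: "x + y\<in>B" "csc c x\<in>B" if "x\<in>B" "y\<in>B" for x y c using assms that by (auto simp: ssub_def)
 show "x\<in>B ==> - x\<in>B" using a(2)[of x x "- 1"] by simp
 show "x\<in>B ==> r *\<^sub>R x\<in>B" using a(2)[of x x "of_real r"] by (simp only: csc_real)
 show "x\<in>B ==> y\<in>B ==> x - y\<in>B" using a(1)[of x "- y"] a(2)[of y y "- 1"] by simp
qed (use assms in "auto simp: ssub_def")

definition shom :: "'a :: cstar set => ('a => 'b :: cstar) => bool" where
 "shom B \<Theta> <-> (\<forall>x\<in>B. \<forall>y\<in>B. \<Theta> (x + y) = \<Theta> x + \<Theta> y & \<Theta> (x*y) = \<Theta> x*\<Theta> y) &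
  (ALL c. \<forall>x\<in>B. \<Theta> (csc c x) = csc c (\<Theta> x)) & (\<forall>x\<in>B. \<Theta> (st x) = st (\<Theta> x))"

lemma shomD:
 assumes "shom B \<Theta>" "ssub B"
 shows "x\<in>B ==> y\<in>B ==> \<Theta> (x + y) = \<Theta> x + \<Theta> y" "x\<in>B ==> y\<in>B ==> \<Theta> (x*y) = \<Theta> x*\<Theta> y"
  "x\<in>B ==> \<Theta> (csc c x) = csc c (\<Theta> x)" "x\<in>B ==> \<Theta> (st x) = st (\<Theta> x)"
  "x\<in>B ==> \<Theta> (r *\<^sub>R x) = r *\<^sub>R \<Theta> x" "x\<in>B ==> \<Theta> (- x) = - \<Theta> x"
  "x\<in>B ==> y\<in>B ==> \<Theta> (x - y) = \<Theta> x - \<Theta> y" "\<Theta> 0 = 0"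
proof -
 have a: "\<Theta> (x + y) = \<Theta> x + \<Theta> y" "\<Theta> (csc c x) = csc c (\<Theta> x)" if "x\<in>B" "y\<in>B" for x y c
  using assms that by (auto simp: shom_def)
 have n: "\<Theta> (- x) = - \<Theta> x" if "x\<in>B" for x using a(2)[OF that that, of "- 1"] by simp
 then show "x\<in>B ==> \<Theta> (- x) = - \<Theta> x" .
 show "x\<in>B ==> \<Theta> (r *\<^sub>R x) = r *\<^sub>R \<Theta> x" using a(2)[of x x "of_real r"] by (simp only: csc_real)
 show "x\<in>B ==> y\<in>B ==> \<Theta> (x - y) = \<Theta> x - \<Theta> y" using a(1)[of x "- y"] n[of y] ssubD(7)[OF assms(2)] by simp
 show "\<Theta> 0 = 0" using a(2)[of 0 0 0] ssubD(1)[OF assms(2)] by simp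
qed (use assms in "auto simp: shom_def")

lemma shom_sum:
 assumes "shom B \<Theta>" "ssub B" "!!a. a\<in>I ==> f a\<in>B"
 shows "\<Theta> (sum f I) = (\<Sum>a\<in>I. \<Theta> (f a))" "sum f I\<in>B"
proof -
 have "\<Theta> (sum f I) = (\<Sum>a\<in>I. \<Theta> (f a)) & sum f I\<in>B" using assms(3)
  by (induction I rule: infinite_finite_induct) (auto simp: shomD[OF assms(1,2)] ssubD[OF assms(2)])
 then show "\<Theta> (sum f I) = (\<Sum>a\<in>I. \<Theta> (f a))" "sum f I\<in>B" by auto
qed

text \<open>If the norm of \<open>y\<close> increased, a multiple \<open>z\<close> would have norm
  below 1 and an image of norm 1. The quasi-inverse belonging to \<open>z\<close> would be mapped to
  one belonging to the image, which \<open>ninv\<close> excludes. The hypotheses \<open>inv\<close>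
  and \<open>ninv\<close> are abstract so that the lemma serves for the stages and for the
  limit.\<close>

lemma shom_contractive:
 fixes \<Theta> :: "'a :: cstar => 'b :: cstar"
 assumes B: "ssub B" and h: "shom B \<Theta>"
  and inv: "!!y. y\<in>B ==> norm y < 1 ==> \<exists>u\<in>B. u = st y*y + u*(st y*y)"
  and ninv: "!!b c :: 'b. norm b = 1 ==> c ~= st b*b + c*(st b*b)" and y: "y\<in>B" shows "norm (\<Theta> y) <= norm y"
proof (rule ccontr)
 assume a: "~ ?thesis"
 define r where "r = norm (\<Theta> y)"
 have r: "r > 0" "norm y < r" using a norm_ge_zero[of y] by (auto simp: r_def)
 define z where "z = (1 / r) *\<^sub>R y"
 have z: "z\<in>B" "norm z < 1" using r y by (auto simp: z_def ssubD[OF B])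
 then obtain u where u: "u\<in>B" "u = st z*z + u*(st z*z)" using inv by blast
 have "\<Theta> u = \<Theta> (st z*z + u*(st z*z))" using u(2) by simp
 also have "... = st (\<Theta> z)*\<Theta> z + \<Theta> u*(st (\<Theta> z)*\<Theta> z)"
  using z u(1) by (simp add: shomD[OF h B] ssubD[OF B])
 finally have "\<Theta> u = st (\<Theta> z)*\<Theta> z + \<Theta> u*(st (\<Theta> z)*\<Theta> z)" .
 moreover have "norm (\<Theta> z) = 1" using r y by (simp add: z_def shomD[OF h B] r_def)
 ultimately show False using ninv by blast
qed

lemma no_quasi_inverse_cm: "norm (b :: cm) = 1 ==> c ~= st b*b + c*(st b*b)"
proof
 assume "norm b = 1" "c = st b*b + c*(st b*b)"
 moreover have "c - st b*b - c*(st b*b) = c - (st b*b + c*(st b*b))" by simp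
 ultimately have "c - st b*b - c*(st b*b) = 0" by simp
 moreover have "b ~= 0" using \<open>norm b = 1\<close> by auto
 ultimately show False using quasi_inverse_bound[of b c] \<open>norm b = 1\<close> by simp
qed

section \<open>Bounded sequences of matrices modulo null sequences\<close>

definition bd :: "(nat => cm) => bool" where "bd x <-> (\<exists>C. ALL k. norm (x k) <= C)"

lemma bdI: "(!!k. norm (x k) <= C) ==> bd x" by (auto simp: bd_def)

lemma bdE: assumes "bd x" obtains C where "C >= 0" "!!k. norm (x k) <= C"
 using assms norm_ge_zero order_trans unfolding bd_def by blast

lemma bd_eventually: "(EVT k. norm (x k) <= C) ==> bd x"
proof -
 assume "EVT k. norm (x k) <= C"
 then obtain K where K: "!!k. k >= K ==> norm (x k) <= C" by (auto simp: eventually_sequentially)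
 show ?thesis
 proof (rule bdI)
  fix k show "norm (x k) <= max C (\<Sum>i<K. norm (x i))"
  proof (cases "k < K")
   case True
   then have "norm (x k) <= (\<Sum>i<K. norm (x i))" by (intro member_le_sum) auto
   then show ?thesis by simp
  next
   case False
   then show ?thesis using K[of k] by simp
  qed
 qed
qed

lemma bd_add: "bd x ==> bd y ==> bd (%k. x k + y k)"
proof -
 assume "bd x" "bd y"
 then obtain C D where "!!k. norm (x k) <= C" "!!k. norm (y k) <= D" by (metis bdE)
 then show ?thesis by (intro bdI[of _ "C + D"]) (auto intro: norm_triangle_mono)
qed

lemma bd_minus: "bd x ==> bd (%k. - x k)" by (simp add: bd_def)

lemma bd_diff: "bd x ==> bd y ==> bd (%k. x k - y k)" using bd_add[of x "%k. - y k"] bd_minus[of y] by simp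

lemma bd_mult: "bd x ==> bd y ==> bd (%k. x k*y k)"
proof -
 assume "bd x" "bd y"
 then obtain C D where C: "C >= 0" "!!k. norm (x k) <= C" "!!k. norm (y k) <= D" by (metis bdE)
 have "norm (x k*y k) <= C*D" for k
  using norm_mult_ineq[of "x k" "y k"] mult_mono[OF C(2,3) C(1) norm_ge_zero] by (rule order_trans)
 then show ?thesis by (rule bdI)
qed

lemma bd_csc: "bd x ==> bd (%k. csc a (x k))"
proof -
 assume "bd x"
 then obtain C where "!!k. norm (x k) <= C" by (metis bdE)
 then show ?thesis by (intro bdI[of _ "cmod a*C"]) (simp add: norm_csc mult_left_mono)
qed

lemma bd_st: "bd x ==> bd (%k. st (x k))" by (simp add: bd_def)

lemma bd_zero: "bd (%_. 0)" by (auto simp: bd_def)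

definition lrel :: "(nat => cm) => (nat => cm) => bool" where
 "lrel x y <-> bd x & bd y & (%k. x k - y k) \<longlonglongrightarrow> 0"

lemma null_bd_mult:
 assumes "x \<longlonglongrightarrow> 0" "bd y" shows "(%k. x k*y k) \<longlonglongrightarrow> 0" "(%k. y k*x k) \<longlonglongrightarrow> 0"
proof -
 obtain C where C: "C >= 0" "!!k. norm (y k) <= C" using assms(2) by (metis bdE)
 have z: "(%k. norm (x k)*C) \<longlonglongrightarrow> 0" using assms(1) by (intro tendsto_mult_left_zero tendsto_norm_zero)
 show "(%k. x k*y k) \<longlonglongrightarrow> 0" by (rule null_comparison[OF always_eventually z])
   (meson C mult_left_mono norm_mult_ineq norm_ge_zero order_trans)
 show "(%k. y k*x k) \<longlonglongrightarrow> 0" by (rule null_comparison[OF always_eventually z])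
   (metis C(2) mult.commute mult_right_mono norm_mult_ineq norm_ge_zero order_trans)
qed

lemma null_csc: "x \<longlonglongrightarrow> 0 ==> (%k. csc a (x k :: cm)) \<longlonglongrightarrow> 0"
 by (rule tendsto_norm_zero_cancel) (simp add: norm_csc tendsto_mult_right_zero tendsto_norm_zero)

lemma null_st: "x \<longlonglongrightarrow> 0 ==> (%k. st (x k :: cm)) \<longlonglongrightarrow> 0"
 by (rule tendsto_norm_zero_cancel) (simp add: tendsto_norm_zero)

text \<open>The limit superior of the norms, in a form that gives eventual bounds directly.
  \<open>Q_nrm\<close> identifies it with the quotient norm modulo null sequences.\<close>

definition lnorm :: "(nat => cm) => real" where
 "lnorm x = Inf {r. EVT k. norm (x k) <= r}"

lemma lnorm_bdd: "bdd_below {r. EVT k. norm (x k) <= r}"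
proof (rule bdd_belowI[of _ 0])
 fix r assume "r\<in>{r. EVT k. norm (x k) <= r}"
 then obtain k where "norm (x k) <= r" by fastforce
 then show "0 <= r" using norm_ge_zero order_trans by blast
qed

lemma lnorm_le: "(EVT k. norm (x k) <= r) ==> lnorm x <= r" unfolding lnorm_def by (rule cInf_lower[OF _ lnorm_bdd]) simp

lemma lnorm_less: 
 assumes "bd x" "lnorm x < r" shows "EVT k. norm (x k) < r"
proof -
 have "{r. EVT k. norm (x k) <= r} ~= {}" using assms(1) by (auto simp: bd_def intro: always_eventually)
 then obtain s where "EVT k. norm (x k) <= s" "s < r"
  using cInf_lessD[of "{r. EVT k. norm (x k) <= r}" r] assms(2) by (auto simp: lnorm_def)
 then show ?thesis by (auto elim: eventually_mono)
qed

lemma lnorm_le_lrel: assumes "lrel x y" shows "lnorm x <= lnorm y"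
proof (rule field_le_epsilon)
 fix e :: real assume e: "e > 0"
 have "EVT k. norm (y k) < lnorm y + e / 2" using assms e by (intro lnorm_less) (auto simp: lrel_def)
 moreover have "EVT k. norm (x k - y k) < e / 2"
  using assms e tendstoD[of "%k. x k - y k" 0 sequentially "e/2"] by (auto simp: lrel_def)
 ultimately have "EVT k. norm (x k) <= lnorm y + e"
 proof eventually_elim
  fix k assume "norm (y k) < lnorm y + e / 2" "norm (x k - y k) < e / 2"
  then show "norm (x k) <= lnorm y + e" using norm_triangle_sub[of "x k" "y k"] by simp
 qed
 then show "lnorm x <= lnorm y + e" by (rule lnorm_le)
qed

lemma lrel_sym: "lrel x y ==> lrel y x" using tendsto_minus[of "%k. x k - y k" 0 sequentially] by (auto simp: lrel_def)

\<comment> \<open>The quotient is partial because \<open>lrel\<close> admits bounded sequences only.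
  The entries are not yet tied to the stages of a tower, so one type contains the limits of all
  towers; a tower selects the subset \<open>seqs\<close>.\<close>
quotient_type lmat = "nat => cm" / partial: lrel
proof (rule part_equivpI)
 show "EX x. lrel x x" by (rule exI[of _ "%_. 0"]) (auto simp: lrel_def bd_zero)
 show "symp lrel" by (auto intro!: sympI lrel_sym)
 show "transp lrel"
 proof (rule transpI)
  fix x y z assume a: "lrel x y" "lrel y z"
  then have "(%k. (x k - y k) + (y k - z k)) \<longlonglongrightarrow> 0 + 0" unfolding lrel_def by (intro tendsto_intros) auto
  then show "lrel x z" using a by (auto simp: lrel_def)
 qed
qed

instantiation lmat :: cstar
begin

lift_definition zero_lmat :: lmat is "%_. 0" by (simp add: lrel_def bd_zero)

lift_definition plus_lmat :: "lmat => lmat => lmat" is "%x y k. x k + y k"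
proof -
 fix x x' y y' assume a: "lrel x x'" "lrel y y'"
 then have "(%k. (x k - x' k) + (y k - y' k)) \<longlonglongrightarrow> 0 + 0" unfolding lrel_def by (intro tendsto_intros) auto
 then show "lrel (%k. x k + y k) (%k. x' k + y' k)" using a by (auto simp: lrel_def algebra_simps intro!: bd_add)
qed

lift_definition uminus_lmat :: "lmat => lmat" is "%x k. - x k" unfolding lrel_def by (auto intro!: bd_minus dest: tendsto_minus)

lift_definition minus_lmat :: "lmat => lmat => lmat" is "%x y k. x k - y k"
proof -
 fix x x' y y' assume a: "lrel x x'" "lrel y y'"
 then have "(%k. (x k - x' k) - (y k - y' k)) \<longlonglongrightarrow> 0 - 0" unfolding lrel_def by (intro tendsto_intros) auto
 then show "lrel (%k. x k - y k) (%k. x' k - y' k)" using a by (auto simp: lrel_def algebra_simps intro!: bd_diff)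
qed

lift_definition times_lmat :: "lmat => lmat => lmat" is "%x y k. x k*y k"
proof -
 fix x x' y y' assume a: "lrel x x'" "lrel y y'"
 then have "(%k. (x k - x' k)*y k + x' k*(y k - y' k)) \<longlonglongrightarrow> 0 + 0"
  unfolding lrel_def by (intro tendsto_add null_bd_mult) auto
 then show "lrel (%k. x k*y k) (%k. x' k*y' k)" using a by (auto simp: lrel_def algebra_simps intro!: bd_mult)
qed

lift_definition csc_lmat :: "complex => lmat => lmat" is "%a x k. csc a (x k)"
 unfolding lrel_def by (auto intro!: bd_csc simp flip: csc_diff_right intro: null_csc)

lift_definition st_lmat :: "lmat => lmat" is "%x k. st (x k)"
 unfolding lrel_def by (auto intro!: bd_st simp flip: st_diff intro: null_st)

lift_definition norm_lmat :: "lmat => real" is lnorm by (auto intro!: antisym lnorm_le_lrel lrel_sym)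

definition scaleR_lmat :: "real => lmat => lmat" where "scaleR_lmat r x = csc (of_real r) x"
definition dist_lmat :: "lmat => lmat => real" where "dist_lmat x y = norm (x - y)"
definition sgn_lmat :: "lmat => lmat" where "sgn_lmat x = scaleR (inverse (norm x)) x"
definition [code del]: "(uniformity :: (lmat \<times> lmat) filter) = (INF e\<in>{0 <..}. principal {(x, y). dist x y < e})"
definition [code del]: "open (U :: lmat set) <-> (\<forall>x\<in>U. eventually (%(x', y). x' = x --> y\<in>U) uniformity)"

lemma lrel_eq: "bd x ==> x = y ==> lrel x y" by (auto simp: lrel_def)

lemma lrel_bd: "lrel x x <-> bd x" by (auto simp: lrel_def)

lemma lnorm_nonneg: "bd x ==> 0 <= lnorm x"
proof (rule ccontr)
 assume a: "bd x" "~ 0 <= lnorm x"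
 then obtain k where "norm (x k) < 0" using lnorm_less[of x 0] by fastforce
 then show False by simp
qed

lemma lnorm_ev: "bd x ==> e > 0 ==> EVT k. norm (x k) < lnorm x + e" by (rule lnorm_less) auto

lemma at_right_le:
 fixes f :: "real => real"
 assumes "!!e. e > 0 ==> c <= f e" "(f \<longlongrightarrow> l) (at_right 0)" shows "c <= l"
 by (rule tendsto_lowerbound[OF assms(2)]) (auto simp: eventually_at_filter assms(1))

instance
proof
 fix x y z :: lmat and a b :: complex and r s :: real
 show "norm (x*y) <= norm x*norm y"
 proof (transfer, unfold lrel_bd)
  fix x y assume a: "bd x" "bd y"
  have "lnorm (%k. x k*y k) <= (lnorm x + e)*(lnorm y + e)" if "e > 0" for e using lnorm_ev[OF a(1) that] lnorm_ev[OF a(2) that]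
   by (intro lnorm_le, eventually_elim) (meson less_imp_le mult_mono norm_ge_zero norm_mult_ineq order_trans)
  moreover have "((%e. (lnorm x + e)*(lnorm y + e)) \<longlongrightarrow> (lnorm x + 0)*(lnorm y + 0)) (at_right 0)"
   by (intro tendsto_intros)
  ultimately have "lnorm (%k. x k*y k) <= (lnorm x + 0)*(lnorm y + 0)" by (rule at_right_le)
  then show "lnorm (%k. x k*y k) <= lnorm x*lnorm y" by simp
 qed
 show "norm (x + y) <= norm x + norm y"
 proof (transfer, unfold lrel_bd)
  fix x y assume a: "bd x" "bd y"
  show "lnorm (%k. x k + y k) <= lnorm x + lnorm y"
  proof (rule field_le_epsilon)
   fix e :: real assume "e > 0"
   then have e: "e/2 > 0" by simp
   show "lnorm (%k. x k + y k) <= lnorm x + lnorm y + e"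
   proof (rule lnorm_le)
    show "EVT k. norm (x k + y k) <= lnorm x + lnorm y + e" using lnorm_ev[OF a(1) e] lnorm_ev[OF a(2) e]
    proof eventually_elim
     fix k assume "norm (x k) < lnorm x + e / 2" "norm (y k) < lnorm y + e / 2"
     then show "norm (x k + y k) <= lnorm x + lnorm y + e" using norm_triangle_ineq[of "x k" "y k"] by simp
    qed
   qed
  qed
 qed
 show "(norm x = 0) = (x = 0)"
 proof (transfer, unfold lrel_bd)
  fix x assume a: "bd x"
  show "(lnorm x = 0) = lrel x (%_. 0)"
  proof
   assume z: "lnorm x = 0"
   have "x \<longlonglongrightarrow> 0"
   proof (rule tendstoI)
    fix e :: real assume "e > 0"
    then show "EVT k. dist (x k) 0 < e" using lnorm_less[OF a, of e] z by simp
   qed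
   then show "lrel x (%_. 0)" using a by (auto simp: lrel_def bd_zero)
  next
   assume "lrel x (%_. 0)"
   then have "lnorm x <= lnorm (%_. 0)" by (rule lnorm_le_lrel)
   also have "... <= 0" by (rule lnorm_le) simp
   finally show "lnorm x = 0" using lnorm_nonneg[OF a] by simp
  qed
 qed
 have csc_le: "norm (csc a x) <= cmod a*norm x" for a and x :: lmat
 proof (transfer, unfold lrel_bd)
  fix a x assume a: "bd x"
  have "lnorm (%k. csc a (x k)) <= cmod a*(lnorm x + e)" if "e > 0" for e using lnorm_ev[OF a that]
   by (intro lnorm_le, eventually_elim) (auto simp: norm_csc intro: mult_left_mono)
  moreover have "((%e. cmod a*(lnorm x + e)) \<longlongrightarrow> cmod a*(lnorm x + 0)) (at_right 0)" by (intro tendsto_intros)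
  ultimately have "lnorm (%k. csc a (x k)) <= cmod a*(lnorm x + 0)" by (rule at_right_le)
  then show "lnorm (%k. csc a (x k)) <= cmod a*lnorm x" by simp
 qed
 show cc: "csc a (csc b x) = csc (a*b) x" for a b and x :: lmat by transfer (simp add: lrel_def bd_csc csc_csc)
 show "norm (r *\<^sub>R x) = \<bar>r\<bar>*norm x"
 proof (cases "r = 0")
  case True
  have "0 <= norm (csc 0 x)" by (transfer, unfold lrel_bd) (rule lnorm_nonneg[OF bd_csc])
  then show ?thesis using csc_le[of 0 x] True by (simp add: scaleR_lmat_def)
 next
  case False
  have "csc (of_real (1 / r)) (csc (of_real r) x) = csc 1 x" using False by (simp add: cc)
  also have "csc 1 x = x" by transfer (simp add: lrel_def)
  finally have "norm x <= cmod (of_real (1 / r))*norm (csc (of_real r) x)"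
   using csc_le[of "of_real (1 / r)" "csc (of_real r) x"] by simp
  then have "\<bar>r\<bar>*norm x <= norm (r *\<^sub>R x)"
   using False by (simp add: scaleR_lmat_def norm_divide divide_simps mult.commute)
  then show ?thesis using csc_le[of "of_real r" x] by (simp add: scaleR_lmat_def)
 qed
 show "norm (st x*x) = (norm x)\<^sup>2"
 proof (transfer, unfold lrel_bd)
  fix x assume a: "bd x"
  let ?y = "%k. st (x k)*x k"
  have b: "bd ?y" using a by (intro bd_mult bd_st)
  have "lnorm ?y <= (lnorm x + e)\<^sup>2" if "e > 0" for e using lnorm_ev[OF a that]
   by (intro lnorm_le, eventually_elim) (auto simp: norm_st_mult intro: power_mono)
  moreover have "((%e. (lnorm x + e)\<^sup>2) \<longlongrightarrow> (lnorm x + 0)\<^sup>2) (at_right 0)"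
   by (intro tendsto_intros)
  ultimately have 1: "lnorm ?y <= (lnorm x + 0)\<^sup>2" by (rule at_right_le)
  have "lnorm x <= sqrt (lnorm ?y + e)" if "e > 0" for e using lnorm_ev[OF b that]
   by (intro lnorm_le, eventually_elim) (auto simp: norm_st_mult intro: real_le_rsqrt)
  moreover have "((%e. sqrt (lnorm ?y + e)) \<longlongrightarrow> sqrt (lnorm ?y + 0)) (at_right 0)" by (intro tendsto_intros)
  ultimately have "lnorm x <= sqrt (lnorm ?y + 0)" by (rule at_right_le)
  then have "(lnorm x)\<^sup>2 <= (sqrt (lnorm ?y))\<^sup>2" using lnorm_nonneg[OF a] by (intro power_mono) auto
  then show "lnorm ?y = (lnorm x)\<^sup>2" using 1 lnorm_nonneg[OF b] by simp
 qed
 show "x + y + z = x + (y + z)" "x + y = y + x" "0 + x = x" "- x + x = 0"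
  "x - y = x + - y" "x*y*z = x*(y*z)" "(x + y)*z = x*z + y*z" "x*(y + z) = x*y + x*z"
  "st (st x) = x" "st (x + y) = st x + st y" "st (x*y) = st y*st x" "st (csc a x) = csc (cnj a) (st x)"
  by (transfer; rule lrel_eq; auto simp: lrel_bd algebra_simps distrib_left distrib_right mult.assoc st_add st_mult st_csc
   intro!: bd_add bd_diff bd_mult bd_csc bd_st bd_zero)+
 show ca: "csc (a + b) x = csc a x + csc b x" for a b
  by transfer (rule lrel_eq, auto simp: lrel_bd csc_add_left intro!: bd_csc bd_add)
 show cb: "csc a (x + y) = csc a x + csc a y" for a
  by transfer (rule lrel_eq, auto simp: lrel_bd csc_add_right intro!: bd_csc bd_add)
 show cl: "csc a x*y = csc a (x*y)" for a by transfer (rule lrel_eq, auto simp: lrel_bd csc_mult_left intro!: bd_csc bd_mult)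
 show cr: "x*csc a y = csc a (x*y)" for a by transfer (rule lrel_eq, auto simp: lrel_bd csc_mult_right intro!: bd_csc bd_mult)
 show "1 *\<^sub>R x = x" unfolding scaleR_lmat_def by transfer (rule lrel_eq, auto simp: lrel_bd)
 show "r *\<^sub>R (x + y) = r *\<^sub>R x + r *\<^sub>R y" "(r + s) *\<^sub>R x = r *\<^sub>R x + s *\<^sub>R x" "r *\<^sub>R (s *\<^sub>R x) = (r*s) *\<^sub>R x"
  "r *\<^sub>R x*y = r *\<^sub>R (x*y)" "x*r *\<^sub>R y = r *\<^sub>R (x*y)" "csc (of_real r) x = r *\<^sub>R x"
  by (simp_all add: scaleR_lmat_def ca cb cc cl cr)
qed (simp_all only: dist_lmat_def sgn_lmat_def uniformity_lmat_def open_lmat_def)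

end

definition cls :: "(nat => cm) => lmat" where "cls = abs_lmat"

lemma cls_cases: obtains x where "bd x" "X = cls x" by (metis Quotient_lmat Quotient_abs_rep Quotient_rep_reflp cls_def lrel_bd)

lemma cls_eq_iff: "bd x ==> bd y ==> cls x = cls y <-> (%k. x k - y k) \<longlonglongrightarrow> 0"
 using Quotient_rel[OF Quotient_lmat, of x y] by (auto simp: cls_def lrel_def)

lemma cls_simps:
 "bd x ==> bd y ==> cls x + cls y = cls (%k. x k + y k)" "bd x ==> bd y ==> cls x - cls y = cls (%k. x k - y k)"
 "bd x ==> bd y ==> cls x*cls y = cls (%k. x k*y k)" "bd x ==> csc a (cls x) = cls (%k. csc a (x k))"
 "bd x ==> st (cls x) = cls (%k. st (x k))" "cls (%_. 0) = 0" unfolding cls_def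
 by (simp_all add: plus_lmat.abs_eq minus_lmat.abs_eq times_lmat.abs_eq csc_lmat.abs_eq st_lmat.abs_eq zero_lmat.abs_eq lrel_bd)

lemma norm_cls: "bd x ==> norm (cls x) = lnorm x" unfolding cls_def by (simp add: norm_lmat.abs_eq lrel_bd)

lemma norm_cls_le: "(EVT k. norm (x k) <= r) ==> norm (cls x) <= r" using lnorm_le bd_eventually by (simp add: norm_cls)

lemma norm_cls_less: "bd x ==> norm (cls x) < r ==> EVT k. norm (x k) < r" by (simp add: norm_cls lnorm_less)

text \<open>Norm 1 of a class means that the norms of a representative have limit superior 1. So
  there is an index where the norm is within \<open>d\<close> of 1 and the equation holds up to 1/4,
  and \<open>quasi_inverse_bound\<close> is violated there.\<close>

lemma no_quasi_inverse_lmat: "norm (b :: lmat) = 1 ==> c ~= st b*b + c*(st b*b)"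
proof
 assume n: "norm b = 1" and e: "c = st b*b + c*(st b*b)"
 obtain x where x: "bd x" "b = cls x" by (rule cls_cases)
 obtain y where y: "bd y" "c = cls y" by (rule cls_cases)
 obtain C where C: "C >= 0" "!!k. norm (y k) <= C" using bdE[OF y(1)] by auto
 \<comment> \<open>With this value (1 + C) 3 d = 3/8, and together with the error 1/4 the bound
   stays below 1.\<close>
 define d where "d = 1 / (8*(1 + C))"
 have d: "0 < d" "d <= 1/8" "(1 + C)*(3*d) < 1/2" using C by (auto simp: d_def)
 let ?z = "%k. st (x k)*x k + y k*(st (x k)*x k)"
 have "cls ?z = cls y" using e x y by (simp add: cls_simps bd_mult bd_st)
 then have "(%k. ?z k - y k) \<longlonglongrightarrow> 0" using x y by (simp add: cls_eq_iff bd_add bd_mult bd_st)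
 then have "EVT k. norm (?z k - y k) < 1/4" by (auto dest: tendstoD[of _ _ _ "1/4"])
 moreover have "EVT k. norm (x k) < 1 + d" using x n d by (intro norm_cls_less) auto
 ultimately have ev: "EVT k. norm (?z k - y k) < 1/4 & norm (x k) < 1 + d" by eventually_elim auto
 \<comment> \<open>Otherwise the norms would eventually be at most 1 - d, and so would the norm of
   the class.\<close>
 have "\<exists>\<^sub>F k in sequentially. ~ norm (x k) <= 1 - d"
  unfolding frequently_def using norm_cls_le[of x "1 - d"] x n d by auto
 then obtain k where k: "norm (?z k - y k) < 1/4" "norm (x k) < 1 + d" "norm (x k) > 1 - d"
  using frequently_ex[OF frequently_eventually_frequently[OF _ ev]] by (meson not_le)
 have "norm (y k - st (x k)*x k - y k*(st (x k)*x k)) < 1/4"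
  using k(1) norm_minus_cancel[of "?z k - y k"] by (simp add: algebra_simps)
 moreover have "\<bar>1 - (norm (x k))\<^sup>2\<bar> <= 3*d"
 proof -
  have "\<bar>1 - (norm (x k))\<^sup>2\<bar> = \<bar>1 - norm (x k)\<bar>*\<bar>1 + norm (x k)\<bar>"
   by (subst abs_mult[symmetric]) (simp add: power2_eq_square algebra_simps)
  also have "... <= d*3" using k d by (intro mult_mono) auto
  finally show ?thesis by simp
 qed
 then have "(1 + norm (y k))*\<bar>1 - (norm (x k))\<^sup>2\<bar> <= (1 + C)*(3*d)" using C by (intro mult_mono) auto
 moreover have "x k ~= 0" using k d by auto
 ultimately show False using quasi_inverse_bound[of "x k" "y k"] d by simp
qed

section \<open>Cycle sums as labelled index sets\<close>

text \<open>
 A stage consists of a size, the summand of each index and the position of its class in the cycle.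
\<close>

type_synonym stage = "nat \<times> (nat => nat) \<times> (nat => nat)"

abbreviation sz :: "stage => nat" where "sz S \<equiv> fst S"
abbreviation cp :: "stage => nat => nat" where "cp S \<equiv> fst (snd S)"
abbreviation lb :: "stage => nat => nat" where "lb S \<equiv> snd (snd S)"

definition ed :: "nat => nat rel" where "ed n = snd (cycle_graph n)"

definition stage :: "nat => stage => bool" where
 "stage n S <-> (\<forall>u<sz S. lb S u < 2*n) & (\<forall>u<sz S. \<forall>j<2*n. \<exists>v<sz S. cp S v = cp S u & lb S v = j)"

definition same_cp :: "stage => nat => nat => bool" where
 "same_cp S i j <-> i < sz S & j < sz S & cp S i = cp S j"

text \<open>One full matrix block for each summand. By \<open>dal_generates\<close> this is the
  star-algebra generated by \<open>dal n S\<close>.\<close>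

definition bal :: "stage => cm set" where "bal S = {x. spt (same_cp S) x}"

definition dal :: "nat => stage => cm set" where
 "dal n S = {x. spt (%i j. same_cp S i j & (lb S j, lb S i)\<in>ed n) x}"

text \<open>The pattern of the diagonal, that is of the elements of \<open>dal n S\<close> whose
  adjoints also lie there (\<open>dal_same_class\<close>).\<close>

definition same_class :: "stage => nat => nat => bool" where
 "same_class S i j <-> same_cp S i j & lb S i = lb S j"

definition zc :: "stage => nat => cm" where "zc S t = idm {a. a < sz S & cp S a = t}"
definition one :: "stage => cm" where "one S = idm {..<sz S}"
definition pl :: "stage => nat => cm" where "pl S j = idm {a. a < sz S & lb S a = j}"

definition aut :: "nat => (nat => nat) => bool" where
 "aut n \<sigma> <-> bij_betw \<sigma> {..<2*n} {..<2*n} & (ALL k i. (k, i)\<in>ed n --> (\<sigma> k, \<sigma> i)\<in>ed n)"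

text \<open>The unitaries of the diagonal; conjugation by them preserves the normal form
  below.\<close>

definition dun :: "stage => cm => bool" where
 "dun T u <-> spt (same_class T) u & st u*u = one T & u*st u = one T"

lemma ed_iff: "(k, i)\<in>ed n <-> k < 2*n & i < 2*n &
  (k = i | odd k & even i & (k = Suc i mod (2*n) | i = Suc k mod (2*n)))" by (simp add: ed_def cycle_graph_def)

lemma ed_antisym: "(k, i)\<in>ed n ==> (i, k)\<in>ed n ==> k = i" by (auto simp: ed_iff)

lemma Suc_mod_inj: "Suc x mod m = Suc y mod m ==> x < m ==> y < m ==> x = y"
 by (metis mod_Suc mod_less mod_self nat.distinct(1) nat.inject)

section \<open>Neighbours and automorphisms of the cycle\<close>

definition nbr :: "nat => nat => nat => bool" where
 "nbr n i j <-> i ~= j & ((i, j)\<in>ed n | (j, i)\<in>ed n)"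

lemma nbr_sym: "nbr n i j <-> nbr n j i" by (auto simp: nbr_def)

lemma nbr_step: "nbr n i j ==> i < 2*n & j < 2*n & (j = Suc i mod (2*n) | i = Suc j mod (2*n))" by (auto simp: nbr_def ed_iff)

lemma nbr_Suc: "n >= 1 ==> i < 2*n ==> nbr n i (Suc i mod (2*n))"
proof -
 assume n: "n >= 1" and i: "i < 2*n"
 then have "even (Suc i mod (2*n)) <-> odd i" by (cases "Suc i = 2*n") (auto, presburger)
 then show ?thesis using i by (auto simp: nbr_def ed_iff)
qed

lemma nbr_three: "nbr n c x ==> nbr n c y ==> nbr n c z ==> x = y | y = z | x = z" by (auto dest!: nbr_step intro: Suc_mod_inj)

lemma aut_less: "aut n \<sigma> ==> i < 2*n ==> \<sigma> i < 2*n" by (auto simp: aut_def bij_betw_def)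

lemma aut_inj: "aut n \<sigma> ==> i < 2*n ==> j < 2*n ==> \<sigma> i = \<sigma> j <-> i = j"
 by (auto simp: aut_def bij_betw_def inj_on_def)

lemma aut_ed: "aut n \<sigma> ==> (k, i)\<in>ed n ==> (\<sigma> k, \<sigma> i)\<in>ed n" by (auto simp: aut_def)

lemma aut_nbr: "aut n \<sigma> ==> nbr n i j ==> nbr n (\<sigma> i) (\<sigma> j)"
 using nbr_step[of n i j] unfolding nbr_def by (auto simp: aut_inj dest: aut_ed)

lemma aut_id: "aut n (%i. i)" by (auto simp: aut_def bij_betw_def)

lemma aut_comp: "aut n \<sigma> ==> aut n \<tau> ==> aut n (%i. \<sigma> (\<tau> i))"
 unfolding aut_def using bij_betw_trans[of \<tau> _ _ \<sigma>] by (auto simp: comp_def)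

text \<open>An automorphism cannot turn back along the cycle, so two adjacent values determine it.\<close>

lemma aut_eqI:
 assumes "aut n \<sigma>" "aut n \<tau>" "\<sigma> 0 = \<tau> 0" "\<sigma> 1 = \<tau> 1" "n >= 2" "i < 2*n"
 shows "\<sigma> i = \<tau> i"
proof -
 have "Suc i < 2*n ==> \<sigma> i = \<tau> i & \<sigma> (Suc i) = \<tau> (Suc i)" for i
 proof (induction i)
  case (Suc i)
  then have IH: "\<sigma> i = \<tau> i" "\<sigma> (Suc i) = \<tau> (Suc i)" by auto
  have a: "nbr n i (Suc i)" "nbr n (Suc i) (Suc (Suc i))" using nbr_Suc[of n i] nbr_Suc[of n "Suc i"] Suc.prems by auto
  have b: "nbr n (\<sigma> (Suc i)) (\<sigma> i)" "nbr n (\<sigma> (Suc i)) (\<sigma> (Suc (Suc i)))" "nbr n (\<sigma> (Suc i)) (\<tau> (Suc (Suc i)))"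
   using aut_nbr[OF assms(1)] aut_nbr[OF assms(2)] a IH nbr_sym by metis+
  have "\<sigma> (Suc (Suc i)) ~= \<sigma> i" "\<tau> (Suc (Suc i)) ~= \<tau> i"
   using Suc.prems by (simp_all add: aut_inj[OF assms(1)] aut_inj[OF assms(2)])
  then show ?case using nbr_three[OF b] IH by simp
 qed (use assms in auto)
 from this[of i] this[of "i - 1"] assms show ?thesis by (cases "Suc i < 2*n") auto
qed

lemma same_cp_trans: "same_cp S i j ==> same_cp S j k ==> same_cp S i k" by (auto simp: same_cp_def)

lemma same_cp_sym: "same_cp S i j ==> same_cp S j i" by (auto simp: same_cp_def)

lemma balD: "x\<in>bal S ==> spt (same_cp S) x" by (simp add: bal_def)

lemma bnd_bal: "x\<in>bal S ==> bnd (sz S) x" by (auto simp: bal_def bnd_def spt_def same_cp_def)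

lemma ssub_bal: "ssub (bal S)"
proof -
 have "x*y\<in>bal S" if "x\<in>bal S" "y\<in>bal S" for x y
  using spt_mult[OF balD[OF that(1)] balD[OF that(2)], of "same_cp S"] by (auto simp: bal_def intro: same_cp_trans)
 moreover have "st x\<in>bal S" if "x\<in>bal S" for x
  using spt_st[OF balD[OF that]] by (auto simp: bal_def elim!: spt_mono intro: same_cp_sym)
 ultimately show ?thesis by (auto simp: ssub_def bal_def intro: spt_add spt_csc)
qed

lemma dal_bal: "x\<in>dal n S ==> x\<in>bal S" by (auto simp: dal_def bal_def elim: spt_mono)

lemma mu_bal: "same_cp S a b ==> mu a b\<in>bal S" by (auto simp: bal_def intro: spt_mu)

lemma mu_dal: "same_cp S a b ==> (lb S b, lb S a)\<in>ed n ==> mu a b\<in>dal n S" by (auto simp: dal_def intro: spt_mu)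

lemma bal_expand:
 assumes "x\<in>bal S" shows "x = (\<Sum>a<sz S. \<Sum>b<sz S. if cp S a = cp S b then csc (ent x a b) (mu a b) else 0)"
proof -
 have "x = (\<Sum>a<sz S. \<Sum>b<sz S. csc (ent x a b) (mu a b))" by (rule mu_expand[OF bnd_bal[OF assms]])
 also have "... = (\<Sum>a<sz S. \<Sum>b<sz S. if cp S a = cp S b then csc (ent x a b) (mu a b) else 0)"
  using assms by (intro sum.cong refl) (auto simp: bal_def spt_def same_cp_def, metis csc_zero)
 finally show ?thesis .
qed

lemma finite_class [simp]: "finite {a. a < (N :: nat) & P a}" by simp

lemma zc_central: "x\<in>bal S ==> zc S t*x = x*zc S t"
 by (rule cm_eqI) (auto simp: zc_def ent_idm_mult ent_mult_idm bal_def spt_def same_cp_def, metis+)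

lemma one_bal: "one S\<in>bal S" unfolding bal_def mem_Collect_eq one_def by (rule spt_mono[OF spt_idm]) (auto simp: same_cp_def)

lemma one_unit: "x\<in>bal S ==> one S*x = x" "x\<in>bal S ==> x*one S = x"
 unfolding one_def by (auto intro!: idm_mult mult_idm elim!: spt_mono simp: bal_def same_cp_def)

lemma sum_idm:
 assumes "finite I" "!!i. i\<in>I ==> finite (A i)" "!!i j. i\<in>I ==> j\<in>I ==> i ~= j ==> A i \<inter> A j = {}"
 shows "(\<Sum>i\<in>I. idm (A i)) = idm (\<Union>i\<in>I. A i)"
 unfolding idm_def by (rule sum.UNION_disjoint[symmetric]) (use assms in auto)

lemma one_eq_sum_zc: "one S = (\<Sum>t\<in>cp S ` {..<sz S}. zc S t)"
 unfolding one_def zc_def by (subst sum_idm) (auto intro!: arg_cong[where f=idm])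

text \<open>The partial sums are recorded together with an error bound depending only on the norm of
  \<open>y\<close>: the limit algebra needs the approximation uniformly in the stage.\<close>

lemma quasi_inverse_bal:
 assumes y: "y\<in>bal S" and n: "norm y < 1"
 obtains u s where "u\<in>bal S" "u = st y*y + u*(st y*y)"
  "s (0 :: nat) = 0" "!!m. s (Suc m) = st y*y + s m*(st y*y)" "!!m. s m\<in>bal S"
  "!!m. norm (u - s m) <= ((norm y)\<^sup>2) ^ Suc m / (1 - (norm y)\<^sup>2)"
proof -
 let ?h = "st y*y"
 have h: "?h\<in>bal S" using y by (intro ssubD[OF ssub_bal])
 have "norm ?h < 1" using n by (simp add: norm_st_mult power_less_one_iff)
 then obtain u s where u: "u = ?h + u*?h" "s (0 :: nat) = 0" "!!m. s (Suc m) = ?h + s m*?h" "s \<longlonglongrightarrow> u" "bnd (sz S) u"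
  "!!m. norm (u - s m) <= norm ?h ^ Suc m / (1 - norm ?h)" using quasi_inverse[OF bnd_bal[OF h]] by blast
 have s: "s m\<in>bal S" for m by (induction m) (auto simp: u(2,3) h intro!: ssubD[OF ssub_bal] y)
 have "u\<in>bal S" using spt_lim[OF balD[OF s] u(4)] by (simp add: bal_def)
 with u s show thesis by (intro that[of u s]) (auto simp: norm_st_mult)
qed

lemma shom_bal_contractive:
 fixes \<phi> :: "cm => cm"
 assumes "shom (bal S) \<phi>" "x\<in>bal S" shows "norm (\<phi> x) <= norm x"
 by (rule shom_contractive[OF ssub_bal assms(1) _ no_quasi_inverse_cm assms(2)]) (metis quasi_inverse_bal)

section \<open>Normal form of rigid embeddings\<close>

text \<open>Each \<open>F r\<close> carries a whole source summand isometrically into one target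
  summand and moves positions by the automorphism \<open>sg r\<close>. The vanishing mixed products
  make the ranges orthogonal, and the clause that every summand occurs as some \<open>src r\<close>
  makes the sum injective.\<close>

definition nfd :: "nat => stage => stage => (cm => cm) => nat set => (nat => cm) => (nat => nat) => (nat => nat) =>
  (nat => nat => nat) => bool" where
 "nfd n S T \<phi> R F src tgt sg <-> finite R &
  (\<forall>r\<in>R. aut n (sg r) & src r\<in>cp S ` {..<sz S} &
   spt (%v a. a < sz S & v < sz T & cp S a = src r & cp T v = tgt r & lb T v = sg r (lb S a)) (F r)) &
  (\<forall>r\<in>R. \<forall>q\<in>R. st (F r)*F q = (if r = q then zc S (src r) else 0)) &
  (\<forall>a<sz S. \<exists>r\<in>R. src r = cp S a) &
  (\<forall>x\<in>bal S. \<phi> x = (\<Sum>r\<in>R. F r*x*st (F r)))"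

definition nf :: "nat => stage => stage => (cm => cm) => bool" where
 "nf n S T \<phi> <-> (\<exists>(R :: nat set) F src tgt sg. nfd n S T \<phi> R F src tgt sg)"

context
 fixes n :: nat and S T :: stage and \<phi> :: "cm => cm" and R :: "nat set"
  and F :: "nat => cm" and src tgt :: "nat => nat" and sg :: "nat => nat => nat"
 assumes nfd: "nfd n S T \<phi> R F src tgt sg"
begin

lemma nfdD: shows "finite R" "!!r. r\<in>R ==> aut n (sg r)" "!!r. r\<in>R ==> src r\<in>cp S ` {..<sz S}"
  "!!r. r\<in>R ==> spt (%v a. a < sz S & v < sz T & cp S a = src r & cp T v = tgt r & lb T v = sg r (lb S a)) (F r)"
  "!!r. r\<in>R ==> st (F r)*F r = zc S (src r)" "!!r q. r\<in>R ==> q\<in>R ==> r ~= q ==> st (F r)*F q = 0"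
  "!!a. a < sz S ==> \<exists>r\<in>R. src r = cp S a" "!!x. x\<in>bal S ==> \<phi> x = (\<Sum>r\<in>R. F r*x*st (F r))"
 using nfd unfolding nfd_def by auto

lemma F_zc: "r\<in>R ==> F r*zc S (src r) = F r" unfolding zc_def by (rule mult_idm) (auto intro!: spt_mono[OF nfdD(4)])

lemma F_mid:
 assumes "r\<in>R" "q\<in>R" shows "st (F r)*(F q*z) = (if r = q then zc S (src r)*z else 0)"
 using nfdD(5)[OF assms(1)] nfdD(6)[OF assms] by (auto simp flip: mult.assoc)

lemma nf_spt:
 assumes x: "spt Q x" "x\<in>bal S"
  and R: "!!v w a b r. r\<in>R ==> Q a b ==> same_cp S a b ==> same_cp T v w ==> lb T v = sg r (lb S a) ==>
   lb T w = sg r (lb S b) ==> Q' v w" shows "spt Q' (\<phi> x)" unfolding nfdD(8)[OF x(2)]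
proof (rule spt_sum)
 fix r assume r: "r\<in>R"
 have xx: "spt (%a b. Q a b & same_cp S a b) x" using x by (auto simp: spt_def bal_def)
 have s1: "spt (%v b. EX a. Q a b & same_cp S a b & v < sz T & cp T v = tgt r & lb T v = sg r (lb S a)) (F r*x)"
  by (rule spt_mult[OF nfdD(4)[OF r] xx]) auto
 show "spt Q' (F r*x*st (F r))" by (rule spt_mult[OF s1 spt_st[OF nfdD(4)[OF r]]]) (auto intro: R[OF r] simp: same_cp_def)
qed

lemma nf_bal: "x\<in>bal S ==> \<phi> x\<in>bal T" using nf_spt[of "%_ _. True" x "same_cp T"] by (auto simp: bal_def spt_def)

lemma nf_dal: "x\<in>dal n S ==> \<phi> x\<in>dal n T"
 using nf_spt[of "%i j. same_cp S i j & (lb S j, lb S i)\<in>ed n" x "%i j. same_cp T i j & (lb T j, lb T i)\<in>ed n"] dal_bal[of x n S]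
 by (auto simp: dal_def intro: aut_ed nfdD(2))

lemma nf_same_class: "spt (same_class S) x ==> spt (same_class T) (\<phi> x)"
 by (rule nf_spt[of "same_class S"]) (auto simp: same_class_def bal_def elim!: spt_mono)

lemma nf_diff_label:
 assumes "stage n S" "spt (%i j. same_cp S i j & lb S i ~= lb S j) x"
 shows "spt (%i j. same_cp T i j & lb T i ~= lb T j) (\<phi> x)"
proof (rule nf_spt[OF assms(2)])
 show "x\<in>bal S" using assms(2) by (auto simp: bal_def elim!: spt_mono)
 fix v w a b r assume a: "r\<in>R" "same_cp S a b & lb S a ~= lb S b" "same_cp T v w" "lb T v = sg r (lb S a)" "lb T w = sg r (lb S b)"
 then have "lb S a < 2*n" "lb S b < 2*n" using assms(1) by (auto simp: stage_def same_cp_def)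
 then have "sg r (lb S a) ~= sg r (lb S b)" using aut_inj[OF nfdD(2)[OF a(1)]] a(2) by simp
 then show "same_cp T v w & lb T v ~= lb T w" using a by simp
qed

lemma nf_shom: "shom (bal S) \<phi>" unfolding shom_def
proof (intro conjI ballI allI)
 fix x y assume xy: "x\<in>bal S" "y\<in>bal S"
 have e: "x + y\<in>bal S" "x*y\<in>bal S" using xy by (auto intro: ssubD[OF ssub_bal])
 show "\<phi> (x + y) = \<phi> x + \<phi> y" by (simp add: nfdD(8) xy e distrib_left distrib_right sum.distrib)
 have "\<phi> x*\<phi> y = (\<Sum>r\<in>R. \<Sum>q\<in>R. F r*(x*(st (F r)*(F q*(y*st (F q))))))"
  by (simp add: nfdD(8) xy sum_product mult.assoc)
 also have "... = (\<Sum>r\<in>R. \<Sum>q\<in>R. if r = q then F r*(x*y)*st (F r) else 0)"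
 proof (intro sum.cong refl)
  fix r q assume rq: "r\<in>R" "q\<in>R"
  have "F r*(x*(zc S (src r)*(y*st (F r)))) = F r*zc S (src r)*(x*y)*st (F r)"
   using zc_central[OF xy(1), of "src r"] by (simp add: mult.assoc) (simp flip: mult.assoc)
  then show "F r*(x*(st (F r)*(F q*(y*st (F q))))) = (if r = q then F r*(x*y)*st (F r) else 0)"
   using rq by (cases "r = q") (simp_all add: F_mid F_zc)
 qed
 finally show "\<phi> (x*y) = \<phi> x*\<phi> y" using nfdD(1) by (simp add: nfdD(8) e)
next
 fix c x assume x: "x\<in>bal S"
 show "\<phi> (csc c x) = csc c (\<phi> x)"
  using x by (simp add: nfdD(8) ssubD[OF ssub_bal] csc_sum csc_mult_left csc_mult_right)
next
 fix x assume x: "x\<in>bal S"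
 show "\<phi> (st x) = st (\<phi> x)" using x by (simp add: nfdD(8) ssubD[OF ssub_bal] st_sum st_mult mult.assoc)
qed

text \<open>One inequality is contractivity. For the other, one compression is chosen for each
  source summand; their sum \<open>W\<close> satisfies W* W = one and W* \<phi>(x) W = x.\<close>

lemma nf_norm: assumes x: "x\<in>bal S" shows "norm (\<phi> x) = norm x"
proof (rule antisym)
 show "norm (\<phi> x) <= norm x" by (rule shom_bal_contractive[OF nf_shom x])
 have "\<forall>t\<in>cp S ` {..<sz S}. EX r. r\<in>R & src r = t" using nfdD(7) by auto
 then obtain f where f: "!!t. t\<in>cp S ` {..<sz S} ==> f t\<in>R" "!!t. t\<in>cp S ` {..<sz S} ==> src (f t) = t" by metis
 let ?I = "cp S ` {..<sz S}"
 define W where "W = (\<Sum>t\<in>?I. F (f t))"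
 have inj: "f t = f t' <-> t = t'" if "t\<in>?I" "t'\<in>?I" for t t' using f that by metis
 have "st W*W = (\<Sum>t\<in>?I. \<Sum>t'\<in>?I. st (F (f t))*F (f t'))" by (simp add: W_def st_sum sum_product)
 also have "... = (\<Sum>t\<in>?I. \<Sum>t'\<in>?I. if t = t' then zc S t else 0)"
  by (intro sum.cong refl) (auto simp: nfdD(5,6) f inj)
 finally have WW: "st W*W = one S" by (simp add: one_eq_sum_zc)
 have nW: "norm W <= 1" by (rule partial_isometry_norm_le) (simp add: WW one_def proj_idm)
 have WF: "st W*F r = (if r\<in>f ` ?I then zc S (src r) else 0)" if r: "r\<in>R" for r
 proof -
  have "st W*F r = (\<Sum>t\<in>?I. if f t = r then zc S (src r) else 0)" unfolding W_def st_sum sum_distrib_right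
   by (intro sum.cong refl) (auto simp: nfdD(5,6) f r)
  also have "... = (\<Sum>t\<in>?I. if t = src r then (if f (src r) = r then zc S (src r) else 0) else 0)"
   using f by (intro sum.cong refl) auto
  also have "... = (if f (src r) = r then zc S (src r) else 0)" using nfdD(3)[OF r] by simp
  finally show ?thesis using f nfdD(3)[OF r] by auto
 qed
 have "st W*\<phi> x*W = (\<Sum>r\<in>R. (st W*F r)*x*st (st W*F r))"
  by (simp add: nfdD(8) x sum_distrib_left sum_distrib_right st_mult mult.assoc)
 also have "... = (\<Sum>r\<in>R. if r\<in>f ` ?I then zc S (src r)*x else 0)"
 proof (intro sum.cong refl)
  fix r assume r: "r\<in>R"
  have "zc S (src r)*x*zc S (src r) = zc S (src r)*x"
   using zc_central[OF x, of "src r"] projD[OF proj_idm] by (simp add: zc_def mult.assoc)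
  then show "(st W*F r)*x*st (st W*F r) = (if r\<in>f ` ?I then zc S (src r)*x else 0)"
   using projD[OF proj_idm] by (simp add: WF[OF r] zc_def)
 qed
 also have "... = (\<Sum>r\<in>f ` ?I. zc S (src r)*x)" using f nfdD(1) by (simp add: sum.If_cases) (rule sum.cong, auto)
 also have "... = (\<Sum>t\<in>?I. zc S t*x)" using f inj by (subst sum.reindex) (auto simp: inj_on_def)
 also have "... = x" using one_unit(1)[OF x] by (simp add: one_eq_sum_zc sum_distrib_right)
 finally have "norm x = norm (st W*\<phi> x*W)" by simp
 also have "... <= norm (st W)*norm (\<phi> x)*norm W" by (meson norm_mult_ineq mult_right_mono norm_ge_zero order_trans)
 also have "... <= 1*norm (\<phi> x)*1" using nW by (intro mult_mono) auto
 finally show "norm x <= norm (\<phi> x)" by simp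
qed

lemma nf_tgt: "r\<in>R ==> \<exists>v<sz T. cp T v = tgt r"
proof -
 assume r: "r\<in>R"
 then obtain a where a: "a < sz S" "cp S a = src r" using nfdD(3) by force
 have "ent (zc S (src r)) a a = 1" using a by (simp add: zc_def ent_idm)
 then have "F r ~= 0" using nfdD(5)[OF r] by auto
 then obtain v b where "ent (F r) v b ~= 0" by (metis cm_eqI ent_zero)
 then show ?thesis using sptD[OF nfdD(4)[OF r]] by blast
qed

lemma nf_conj:
 assumes u: "dun T u" shows "nfd n S T (%x. u*\<phi> x*st u) R (%r. u*F r) src tgt sg" unfolding nfd_def
proof (intro conjI ballI allI impI)
 have oF: "one T*F r = F r" if "r\<in>R" for r unfolding one_def by (rule idm_mult) (auto intro!: spt_mono[OF nfdD(4)[OF that]])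
 fix r assume r: "r\<in>R"
 show "spt (%v a. a < sz S & v < sz T & cp S a = src r & cp T v = tgt r & lb T v = sg r (lb S a)) (u*F r)"
  by (rule spt_mult[OF _ nfdD(4)[OF r], of "same_class T"])
   (use u in "auto simp: dun_def same_class_def same_cp_def")
 fix q assume q: "q\<in>R"
 have "st (u*F r)*(u*F q) = st (F r)*((st u*u)*F q)" by (simp add: st_mult mult.assoc)
 then show "st (u*F r)*(u*F q) = (if r = q then zc S (src r) else 0)" using u q r nfdD(5,6) by (simp add: dun_def oF)
qed (use nfdD in "auto simp: sum_distrib_left sum_distrib_right mult.assoc st_mult")

end

lemma nfI: "nfd n S T \<phi> R F src tgt sg ==> nf n S T \<phi>" unfolding nf_def by blast

lemma nf_conj': "nf n S T \<phi> ==> dun T u ==> nf n S T (%x. u*\<phi> x*st u)" unfolding nf_def by (metis nf_conj)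

lemma nf_cong: "nf n S T \<phi> ==> (!!x. x\<in>bal S ==> \<phi> x = \<psi> x) ==> nf n S T \<psi>"
proof -
 assume "nf n S T \<phi>" and e: "!!x. x\<in>bal S ==> \<phi> x = \<psi> x"
 then obtain R F src tgt sg where "nfd n S T \<phi> R F src tgt sg" by (auto simp: nf_def)
 then have "nfd n S T \<psi> R F src tgt sg" unfolding nfd_def using e by auto
 then show ?thesis by (rule nfI)
qed

lemma nf_ident: "nf n S S (%x. x)"
proof (rule nfI)
 have zz: "zc S t*zc S t' = (if t = t' then zc S t else 0)" for t t' by (rule cm_eqI) (auto simp: zc_def ent_mult_idm ent_idm)
 have "x = (\<Sum>t\<in>cp S ` {..<sz S}. zc S t*x*st (zc S t))" if x: "x\<in>bal S" for x
 proof -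
  have "zc S t*x*st (zc S t) = zc S t*x" for t
   using zc_central[OF x, of t] zz[of t t] projD(1)[OF proj_idm] by (simp add: zc_def mult.assoc)
  then show ?thesis using one_unit(1)[OF x] by (simp add: one_eq_sum_zc sum_distrib_right)
 qed
 then show "nfd n S S (%x. x) (cp S ` {..<sz S}) (zc S) (%t. t) (%t. t) (%_ i. i)"
  unfolding nfd_def using aut_id by (auto simp: projD(1)[OF proj_idm] zc_def intro!: spt_mono[OF spt_idm]) (auto simp flip: zc_def simp: zz)
qed

text \<open>A product of compressions vanishes unless the target summand of the first is the source
  summand of the second. The remaining pairs are coded as numbers, since the index set of a normal
  form consists of naturals.\<close>

lemma nf_comp:
 assumes "nf n S T \<phi>" "nf n T U \<psi>" shows "nf n S U (%x. \<psi> (\<phi> x))"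
proof -
 obtain R :: "nat set" and F src tgt sg where 1: "nfd n S T \<phi> R F src tgt sg" using assms(1) by (auto simp: nf_def)
 obtain R' :: "nat set" and F' src' tgt' sg' where 2: "nfd n T U \<psi> R' F' src' tgt' sg'" using assms(2) by (auto simp: nf_def)
 note D = nfdD[OF 1] and D' = nfdD[OF 2]
 define I where "I = {(q, r). q\<in>R' & r\<in>R & src' q = tgt r}"
 have fI: "finite I" by (rule finite_subset[of _ "R' \<times> R"]) (auto simp: I_def D(1) D'(1))
 have zF: "zc T (tgt r)*F r = F r" if "r\<in>R" for r
  unfolding zc_def by (rule idm_mult) (auto intro!: spt_mono[OF D(4)[OF that]])
 have FF0: "F' q*F r = 0" if "q\<in>R'" "r\<in>R" "src' q ~= tgt r" for q r
  by (rule spt_mult_0[OF D'(4)[OF that(1)] D(4)[OF that(2)]]) (use that in auto)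
 have "nfd n S U (%x. \<psi> (\<phi> x)) (prod_encode ` I) (%p. F' (fst (prod_decode p))*F (snd (prod_decode p)))
   (%p. src (snd (prod_decode p))) (%p. tgt' (fst (prod_decode p)))
   (%p i. sg' (fst (prod_decode p)) (sg (snd (prod_decode p)) i))" unfolding nfd_def
 proof (intro conjI ballI allI impI)
  show "finite (prod_encode ` I)" using fI by simp
  fix p assume "p\<in>prod_encode ` I"
  then obtain q r where p: "p = prod_encode (q, r)" "q\<in>R'" "r\<in>R" "src' q = tgt r" by (auto simp: I_def)
  show "aut n (%i. sg' (fst (prod_decode p)) (sg (snd (prod_decode p)) i))" using p by (simp add: aut_comp D D')
  show "src (snd (prod_decode p))\<in>cp S ` {..<sz S}" using p D(3) by simp
  show "spt (%v a. a < sz S & v < sz U & cp S a = src (snd (prod_decode p)) &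
    cp U v = tgt' (fst (prod_decode p)) & lb U v = sg' (fst (prod_decode p)) (sg (snd (prod_decode p)) (lb S a)))
    (F' (fst (prod_decode p))*F (snd (prod_decode p)))" unfolding p(1) prod_encode_inverse fst_conv snd_conv
   by (rule spt_mult[OF D'(4)[OF p(2)] D(4)[OF p(3)]]) (use p(4) in auto)
  fix p' assume "p'\<in>prod_encode ` I"
  then obtain q' r' where p': "p' = prod_encode (q', r')" "q'\<in>R'" "r'\<in>R" "src' q' = tgt r'" by (auto simp: I_def)
  have "st (F' q*F r)*(F' q'*F r') = st (F r)*(st (F' q)*(F' q'*F r'))" by (simp add: st_mult mult.assoc)
  also have "... = (if q = q' & r = r' then zc S (src r) else 0)"
   using F_mid[OF 2 p(2) p'(2), of "F r'"] D(5)[OF p(3)] D(6)[OF p(3) p'(3)] zF[OF p'(3)] p' by auto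
  finally show "st (F' (fst (prod_decode p))*F (snd (prod_decode p)))*(F' (fst (prod_decode p'))*F (snd (prod_decode p'))) =
    (if p = p' then zc S (src (snd (prod_decode p))) else 0)" using p p' by simp
 next
  fix a assume "a < sz S"
  then obtain r where r: "r\<in>R" "src r = cp S a" using D(7) by blast
  then obtain v where v: "v < sz T" "cp T v = tgt r" using nf_tgt[OF 1] by blast
  then obtain q where q: "q\<in>R'" "src' q = tgt r" using D'(7) by metis
  show "\<exists>p\<in>prod_encode ` I. src (snd (prod_decode p)) = cp S a"
   using q r by (intro bexI[of _ "prod_encode (q, r)"]) (auto simp: I_def)
 next
  fix x assume x: "x\<in>bal S"
  have "\<psi> (\<phi> x) = (\<Sum>q\<in>R'. \<Sum>r\<in>R. F' q*F r*x*st (F' q*F r))"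
   using D'(8)[OF nf_bal[OF 1 x]] D(8)[OF x] by (simp add: sum_distrib_left sum_distrib_right st_mult mult.assoc)
  also have "... = (\<Sum>(q, r)\<in>R' \<times> R. F' q*F r*x*st (F' q*F r))" by (simp add: sum.cartesian_product)
  also have "... = (\<Sum>(q, r)\<in>I. F' q*F r*x*st (F' q*F r))"
   by (rule sum.mono_neutral_right) (auto simp: I_def D(1) D'(1), metis FF0 mult_zero_left)
  also have "... = (\<Sum>p\<in>prod_encode ` I. F' (fst (prod_decode p))*F (snd (prod_decode p))*x *
    st (F' (fst (prod_decode p))*F (snd (prod_decode p))))"
   by (subst sum.reindex) (auto simp: inj_on_def prod_encode_eq case_prod_unfold)
  finally show "\<psi> (\<phi> x) = (\<Sum>p\<in>prod_encode ` I. F' (fst (prod_decode p))*F (snd (prod_decode p))*x *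
    st (F' (fst (prod_decode p))*F (snd (prod_decode p))))" .
 qed
 then show ?thesis by (rule nfI)
qed

section \<open>Uniqueness of rigid embeddings up to unitary equivalence\<close>

lemma bij_betw_fibers:
 assumes fin: "finite A" "finite B" and c: "!!c. card {a\<in>A. f a = c} = card {b\<in>B. g b = c}"
 obtains \<beta> where "bij_betw \<beta> A B" "!!a. a\<in>A ==> g (\<beta> a) = f a"
proof -
 have "EX h. bij_betw h {a\<in>A. f a = c} {b\<in>B. g b = c}" for c
  using finite_same_card_bij[of "{a\<in>A. f a = c}" "{b\<in>B. g b = c}"] fin c by simp
 then obtain h where h: "!!c. bij_betw (h c) {a\<in>A. f a = c} {b\<in>B. g b = c}" by metis
 have m: "h (f a) a\<in>B & g (h (f a) a) = f a" if "a\<in>A" for a using bij_betwE[OF h[of "f a"]] that by blast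
 have "bij_betw (%a. h (f a) a) A B" unfolding bij_betw_def
 proof
  show "inj_on (%a. h (f a) a) A"
  proof (rule inj_onI)
   fix a a' assume a: "a\<in>A" "a'\<in>A" "h (f a) a = h (f a') a'"
   then have "f a = f a'" using m by metis
   then show "a = a'" using a bij_betw_imp_inj_on[OF h[of "f a"]] by (auto simp: inj_on_def)
  qed
  show "(%a. h (f a) a) ` A = B"
  proof
   show "B <= (%a. h (f a) a) ` A"
   proof
    fix b assume b: "b\<in>B"
    then have "b\<in>h (g b) ` {a\<in>A. f a = g b}" using bij_betw_imp_surj_on[OF h[of "g b"]] by simp
    then obtain x where "x\<in>A" "f x = g b" "b = h (g b) x" by blast
    then show "b\<in>(%a. h (f a) a) ` A" by (intro image_eqI[of _ _ x]) simp_all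
   qed
  qed (use m in auto)
 qed
 with m show thesis by (intro that[of "%a. h (f a) a"]) auto
qed

definition cell :: "stage => nat \<times> nat => nat set" where
 "cell T c = {v. v < sz T & cp T v = fst c & lb T v = snd c}"

definition cells :: "stage => (nat \<times> nat) set" where
 "cells T = (%v. (cp T v, lb T v)) ` {..<sz T}"

lemma finite_cell [simp]: "finite (cell T c)" "finite (cells T)" by (auto simp: cell_def cells_def)

lemma glue_cells:
 assumes u: "!!c. c\<in>cells T ==> spt (%a b. a\<in>cell T c & b\<in>cell T c) (u c)"
  "!!c. c\<in>cells T ==> st (u c)*u c = idm (cell T c)" "!!c. c\<in>cells T ==> u c*st (u c) = idm (cell T c)"
 shows "dun T (\<Sum>c\<in>cells T. u c)"
  "!!c x. c\<in>cells T ==> spt (%a b. a\<in>cell T c) x ==> (\<Sum>c\<in>cells T. u c)*x = u c*x"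
proof -
 have s: "spt (%a b. a\<in>cell T c & b\<in>cell T c) (st (u c))" if "c\<in>cells T" for c
  using spt_st[OF u(1)[OF that]] by (auto elim: spt_mono)
 have 0: "st (u c)*u d = 0" "u c*st (u d) = 0" if "c\<in>cells T" "d\<in>cells T" "c ~= d" for c d
  using that by (auto intro!: spt_mult_0[OF s u(1)] spt_mult_0[OF u(1) s] simp: cell_def prod_eq_iff)
 have one: "(\<Sum>c\<in>cells T. idm (cell T c)) = one T"
 proof -
  have "(\<Sum>c\<in>cells T. idm (cell T c)) = idm (\<Union>c\<in>cells T. cell T c)"
   by (rule sum_idm) (auto simp: cell_def prod_eq_iff)
  also have "(\<Union>c\<in>cells T. cell T c) = {..<sz T}" by (auto simp: cell_def cells_def)
  finally show ?thesis by (simp add: one_def)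
 qed
 have "st (sum u (cells T))*sum u (cells T) = (\<Sum>c\<in>cells T. \<Sum>d\<in>cells T. if c = d then idm (cell T c) else 0)"
  unfolding st_sum sum_product by (intro sum.cong refl) (use 0 u in auto)
 moreover have "sum u (cells T)*st (sum u (cells T)) = (\<Sum>c\<in>cells T. \<Sum>d\<in>cells T. if c = d then idm (cell T c) else 0)"
  unfolding st_sum sum_product by (intro sum.cong refl) (use 0 u in auto)
 moreover have "spt (same_class T) (sum u (cells T))"
  by (intro spt_sum spt_mono[OF u(1)]) (auto simp: cell_def same_class_def same_cp_def)
 ultimately show "dun T (\<Sum>c\<in>cells T. u c)" by (simp add: dun_def one)
 fix c x assume c: "c\<in>cells T" and x: "spt (%a b. a\<in>cell T c) x"
 have "sum u (cells T)*x = (\<Sum>d\<in>cells T. if d = c then u c*x else 0)" unfolding sum_distrib_right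
 proof (intro sum.cong refl)
  fix d assume d: "d\<in>cells T"
  show "u d*x = (if d = c then u c*x else 0)"
  proof (cases "d = c")
   case False
   then show ?thesis using spt_mult_0[OF u(1)[OF d] x] by (auto simp: cell_def prod_eq_iff)
  qed simp
 qed
 then show "(\<Sum>c\<in>cells T. u c)*x = u c*x" using c by simp
qed

context
 fixes n :: nat and S T :: stage and \<phi> :: "cm => cm" and R :: "nat set"
  and F :: "nat => cm" and src tgt :: "nat => nat" and sg :: "nat => nat => nat"
 assumes nfd: "nfd n S T \<phi> R F src tgt sg"
begin

lemma nf_col_spt:
 assumes "r\<in>R" shows "spt (%v b. v < sz T & cp T v = tgt r & lb T v = sg r (lb S a) & b = c) (F r*mu a c)"
 by (rule spt_mult[OF nfdD(4)[OF nfd assms] spt_mu[of "%i j. i = a & j = c"]]) auto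

lemma nf_col_inner:
 assumes "r\<in>R" "q\<in>R" "a < sz S" "cp S a = src r"
 shows "st (F r*mu a 0)*(F q*mu b 0) = (if r = q & a = b then mu 0 0 else 0)"
proof -
 have "st (F r*mu a 0)*(F q*mu b 0) = mu 0 a*(st (F r)*F q)*mu b 0" by (simp add: st_mult mult.assoc)
 also have "... = (if r = q then csc (ent (zc S (src r)) a b) (mu 0 0) else 0)"
  using nfdD(5)[OF nfd assms(1)] nfdD(6)[OF nfd assms(1,2)] by (auto simp: mu_sandwich)
 also have "... = (if r = q & a = b then mu 0 0 else 0)" using assms by (auto simp: zc_def ent_idm)
 finally show ?thesis .
qed

lemma nf_F_mu: "r\<in>R ==> cp S a ~= src r ==> F r*mu a b = 0"
 by (rule spt_mult_0[OF nfdD(4)[OF nfd] spt_mu[of "%i j. i = a"]]) auto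

lemma F_eq_sum_cols:
 assumes "r\<in>R" shows "F r = (\<Sum>a\<in>{a. a < sz S & cp S a = src r}. F r*mu a 0*mu 0 a)"
proof -
 have "F r = F r*zc S (src r)" by (simp add: F_zc[OF nfd assms])
 also have "... = (\<Sum>a\<in>{a. a < sz S & cp S a = src r}. F r*mu a 0*mu 0 a)"
  unfolding zc_def idm_def sum_distrib_left by (simp add: mult.assoc mu_mult_mu)
 finally show ?thesis .
qed

text \<open>The rank of this projection counts the summands of a given type.\<close>

lemma type_projection:
 assumes ab: "same_cp S a b" "lb S a = 0" "lb S b = 1" and X: "X = idm (cell T (t, j))*\<phi> (mu a b)*pl T k"
 shows "X*st X = range_proj {r\<in>R. (src r, tgt r, sg r 0, sg r 1) = (cp S a, t, j, k)} (%r. F r*mu a 0)"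
  "norm X <= 1" "onf {r\<in>R. (src r, tgt r, sg r 0, sg r 1) = (cp S a, t, j, k)} (%r. F r*mu a 0) {..<sz T}"
proof -
 let ?Q = "{r\<in>R. (src r, tgt r, sg r 0, sg r 1) = (cp S a, t, j, k)}"
 have m: "mu a b\<in>bal S" using ab by (intro mu_bal)
 have a: "a < sz S" "b < sz S" "cp S b = cp S a" using ab by (auto simp: same_cp_def)
 have X1: "X = (\<Sum>r\<in>R. idm (cell T (t, j))*(F r*mu a b)*st (F r)*pl T k)"
  by (simp add: X nfdD(8)[OF nfd m] sum_distrib_left sum_distrib_right mult.assoc)
 also have "... = (\<Sum>r\<in>R. if r\<in>?Q then F r*mu a b*st (F r) else 0)"
 proof (intro sum.cong refl)
  fix r assume r: "r\<in>R"
  have L: "idm (cell T (t, j))*(F r*mu a b) = (if tgt r = t & sg r 0 = j then F r*mu a b else 0)"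
   using nf_col_spt[OF r, of a b] ab
   by (auto intro!: idm_mult spt_mult_0[OF spt_idm nf_col_spt[OF r]] elim!: spt_mono simp: cell_def)
  have "spt (%b' v. lb T v = sg r 1 & v < sz T) (mu b b*st (F r))"
   using spt_st[OF nf_col_spt[OF r, of b b]] ab by (auto elim!: spt_mono simp: st_mult)
  note sp = this
  have "mu b b*st (F r)*pl T k = (if sg r 1 = k then mu b b*st (F r) else 0)"
  proof (cases "sg r 1 = k")
   case True
   then show ?thesis unfolding pl_def by (auto intro!: mult_idm spt_mono[OF sp])
  next
   case False
   then show ?thesis unfolding pl_def by (auto intro!: spt_mult_0[OF sp spt_idm])
  qed
  then have "mu a b*(mu b b*st (F r)*pl T k) = (if sg r 1 = k then mu a b*(mu b b*st (F r)) else 0)" by simp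
  then have M: "mu a b*(st (F r)*pl T k) = (if sg r 1 = k then mu a b*st (F r) else 0)"
   by (simp add: mult.assoc mu_mult_mu_assoc)
  show "idm (cell T (t, j))*(F r*mu a b)*st (F r)*pl T k = (if r\<in>?Q then F r*mu a b*st (F r) else 0)"
  proof (cases "src r = cp S a")
   case True
   then show ?thesis unfolding L using r by (auto simp: mult.assoc M)
  next
   case False
   then have "F r*mu a b = 0" using nf_F_mu[OF r] by simp
   then show ?thesis by simp
  qed
 qed
 also have "... = (\<Sum>r\<in>?Q. F r*mu a b*st (F r))"
  using nfdD(1)[OF nfd] by (subst sum.inter_filter[symmetric]) (auto intro!: sum.cong)
 finally have X2: "X = (\<Sum>r\<in>?Q. F r*mu a b*st (F r))" .
 have "X*st X = (\<Sum>r\<in>?Q. \<Sum>q\<in>?Q. F r*mu a b*(st (F r)*(F q*(mu b a*st (F q)))))"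
  unfolding X2 st_sum sum_product by (simp add: st_mult mult.assoc)
 also have "... = (\<Sum>r\<in>?Q. \<Sum>q\<in>?Q. if r = q then F r*mu a 0*st (F r*mu a 0) else 0)"
 proof (intro sum.cong refl)
  fix r q assume rq: "r\<in>?Q" "q\<in>?Q"
  have z: "zc S (src r)*(mu b a*z) = mu b a*z" for z
   using a rq by (subst mult.assoc[symmetric], subst idm_mult[of "{x. x < sz S & cp S x = src r}", folded zc_def])
    (auto intro!: spt_mu)
  show "F r*mu a b*(st (F r)*(F q*(mu b a*st (F q)))) = (if r = q then F r*mu a 0*st (F r*mu a 0) else 0)"
   using rq F_mid[OF nfd, of r q "mu b a*st (F q)"] z by (auto simp: mult.assoc mu_mult_mu_assoc st_mult)
 qed
 also have "... = range_proj ?Q (%r. F r*mu a 0)" using nfdD(1)[OF nfd] by (simp add: range_proj_def)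
 finally show "X*st X = range_proj ?Q (%r. F r*mu a 0)" .
 have "norm X <= norm (idm (cell T (t, j)))*norm (\<phi> (mu a b))*norm (pl T k)"
  unfolding X by (meson norm_mult_ineq mult_right_mono norm_ge_zero order_trans)
 also have "... <= 1*1*1" using proj_norm_le[OF proj_idm] nf_norm[OF nfd m] by (intro mult_mono) (auto simp: pl_def)
 finally show "norm X <= 1" by simp
 show "onf ?Q (%r. F r*mu a 0) {..<sz T}" unfolding onf_def using nfdD(1)[OF nfd] a
  by (auto simp: nf_col_inner intro!: spt_mono[OF nf_col_spt])
qed

end

text \<open>By \<open>type_projection\<close> the summands of type (s, t, j, k) are counted by the
  rank of the projection X X*. Cutting \<open>\<phi> (mu a b)\<close> and
  \<open>\<psi> (mu a b)\<close> yields X and Y of norm at most 1 at distance at most 1/4, so the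
  projections differ by at most 1/4 + 1/4, the tolerance of
  \<open>onf_close_card_le\<close>.\<close>

lemma nf_type_count:
 assumes S: "stage n S" "n >= 2" and 1: "nfd n S T \<phi> R F src tgt sg" and 2: "nfd n S T \<psi> R' F' src' tgt' sg'"
  and d: "!!a b. same_cp S a b ==> norm (\<phi> (mu a b) - \<psi> (mu a b)) <= 1/4"
 shows "card {r\<in>R. (src r, tgt r, sg r 0, sg r 1) = c} <= card {r\<in>R'. (src' r, tgt' r, sg' r 0, sg' r 1) = c}"
proof (cases "{r\<in>R. (src r, tgt r, sg r 0, sg r 1) = c} = {}")
 case True
 show ?thesis unfolding True by simp
next
 case False
 obtain s t j k where c: "c = (s, t, j, k)" by (cases c)
 from False obtain r where "r\<in>R" "src r = s" using c by auto
 then obtain x where "x < sz S" "cp S x = s" using nfdD(3)[OF 1] by force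
 then obtain a b where ab: "a < sz S" "cp S a = s" "lb S a = 0" "b < sz S" "cp S b = s" "lb S b = 1"
 proof -
  have "\<exists>v<sz S. cp S v = s & lb S v = j" if "j < 2*n" for j
   using S(1) \<open>x < sz S\<close> \<open>cp S x = s\<close> that unfolding stage_def by blast
  from this[of 0] this[of 1] S(2) that show ?thesis by auto
 qed
 then have s: "same_cp S a b" by (simp add: same_cp_def)
 define X where "X = idm (cell T (t, j))*\<phi> (mu a b)*pl T k"
 define Y where "Y = idm (cell T (t, j))*\<psi> (mu a b)*pl T k"
 note x = type_projection[OF 1 s ab(3,6) X_def] and y = type_projection[OF 2 s ab(3,6) Y_def]
 have "norm (X - Y) <= norm (idm (cell T (t, j)))*norm (\<phi> (mu a b) - \<psi> (mu a b))*norm (pl T k)"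
  unfolding X_def Y_def left_diff_distrib[symmetric] right_diff_distrib[symmetric]
  by (meson norm_mult_ineq mult_right_mono norm_ge_zero order_trans)
 also have "... <= 1*(1/4)*1" using proj_norm_le[OF proj_idm] d[OF s] by (intro mult_mono) (auto simp: pl_def)
 finally have XY: "norm (X - Y) <= 1/4" by simp
 have "X*st X - Y*st Y = X*st (X - Y) + (X - Y)*st Y" by (simp add: st_diff left_diff_distrib right_diff_distrib)
 also have "norm ... <= norm X*norm (X - Y) + norm (X - Y)*norm Y"
  by (intro norm_triangle_mono order_trans[OF norm_mult_ineq]) auto
 also have "... <= 1*(1/4) + (1/4)*1" using XY x(2) y(2) by (intro add_mono mult_mono) auto
 finally show ?thesis using onf_close_card_le[OF x(3) y(3)] x(1) y(1) ab(2) c by simp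
qed

text \<open>
 Two close normal forms have equally many summands of each type; matching them up gives the
 unitary, cell by cell.
\<close>

theorem nf_unique:
 assumes S: "stage n S" "n >= 2" and "nf n S T \<phi>" "nf n S T \<psi>"
  and d: "!!a b. same_cp S a b ==> norm (\<phi> (mu a b) - \<psi> (mu a b)) <= 1/4"
 obtains u where "dun T u" "!!x. x\<in>bal S ==> \<psi> x = u*\<phi> x*st u"
proof -
 obtain R F src tgt sg where 1: "nfd n S T \<phi> R F src tgt sg" using assms(3) by (auto simp: nf_def)
 obtain R' F' src' tgt' sg' where 2: "nfd n S T \<psi> R' F' src' tgt' sg'" using assms(4) by (auto simp: nf_def)
 note D = nfdD[OF 1] and D' = nfdD[OF 2]
 have d': "norm (\<psi> (mu a b) - \<phi> (mu a b)) <= 1/4" if "same_cp S a b" for a b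
  using d[OF that] by (simp add: norm_minus_commute)
 obtain \<beta> where \<beta>: "bij_betw \<beta> R R'"
  "!!r. r\<in>R ==> (src' (\<beta> r), tgt' (\<beta> r), sg' (\<beta> r) 0, sg' (\<beta> r) 1) = (src r, tgt r, sg r 0, sg r 1)"
  using bij_betw_fibers[OF D(1) D'(1), of "%r. (src r, tgt r, sg r 0, sg r 1)" "%r. (src' r, tgt' r, sg' r 0, sg' r 1)"]
   nf_type_count[OF S 1 2 d] nf_type_count[OF S 2 1 d'] by (metis (no_types, lifting) order_antisym)
 have bR: "\<beta> r\<in>R'" if "r\<in>R" for r using \<beta>(1) that by (auto simp: bij_betw_def)
 have binj: "\<beta> r = \<beta> q <-> r = q" if "r\<in>R" "q\<in>R" for r q using \<beta>(1) that by (auto simp: bij_betw_def inj_on_def)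
 \<comment> \<open>Types record an automorphism only through its values at 0 and 1, which determine
   it.\<close>
 have sgb: "sg' (\<beta> r) i = sg r i" if "r\<in>R" "i < 2*n" for r i
  using aut_eqI[OF D'(2)[OF bR[OF that(1)]] D(2)[OF that(1)] _ _ S(2) that(2)] \<beta>(2)[OF that(1)] by simp
 \<comment> \<open>All columns, of all compressions, that land in the class \<open>c\<close>. The
   family \<open>f\<close> consists of those of \<phi>, and \<open>g\<close> of their partners under
   \<beta>.\<close>
 define I where "I c = prod_encode ` {(r, a). r\<in>R & a < sz S & cp S a = src r & (tgt r, sg r (lb S a)) = c}" for c
 define f where "f p = F (fst (prod_decode p))*mu (snd (prod_decode p)) 0" for p
 define g where "g p = F' (\<beta> (fst (prod_decode p)))*mu (snd (prod_decode p)) 0" for p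
 have finI: "finite (I c)" for c
  unfolding I_def by (rule finite_imageI, rule finite_subset[of _ "R \<times> {..<sz S}"]) (auto simp: D(1))
 have of: "onf (I c) f (cell T c)" for c unfolding onf_def
 proof (intro conjI ballI finI)
  fix p assume "p\<in>I c"
  then obtain r a where p: "p = prod_encode (r, a)" "r\<in>R" "a < sz S" "cp S a = src r" "(tgt r, sg r (lb S a)) = c"
   by (auto simp: I_def)
  show "spt (%a b. a\<in>cell T c & b = 0) (f p)" using p by (auto simp: f_def cell_def intro!: spt_mono[OF nf_col_spt[OF 1]])
  fix q assume "q\<in>I c"
  then obtain r' a' where q: "q = prod_encode (r', a')" "r'\<in>R" by (auto simp: I_def)
  show "st (f p)*f q = (if p = q then mu 0 0 else 0)" using p q nf_col_inner[OF 1 p(2) q(2) p(3,4)] by (simp add: f_def)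
 qed simp
 have og: "onf (I c) g (cell T c)" for c unfolding onf_def
 proof (intro conjI ballI finI)
  fix p assume "p\<in>I c"
  then obtain r a where p: "p = prod_encode (r, a)" "r\<in>R" "a < sz S" "cp S a = src r" "(tgt r, sg r (lb S a)) = c"
   by (auto simp: I_def)
  have "lb S a < 2*n" using S p by (auto simp: stage_def)
  then have c: "(tgt' (\<beta> r), sg' (\<beta> r) (lb S a)) = c" using p sgb \<beta>(2)[OF p(2)] by auto
  show "spt (%a b. a\<in>cell T c & b = 0) (g p)"
   using p c bR by (auto simp: g_def cell_def intro!: spt_mono[OF nf_col_spt[OF 2]])
  fix q assume "q\<in>I c"
  then obtain r' a' where q: "q = prod_encode (r', a')" "r'\<in>R" by (auto simp: I_def)
  show "st (g p)*g q = (if p = q then mu 0 0 else 0)"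
   using p q nf_col_inner[OF 2 bR[OF p(2)] bR[OF q(2)] p(3)] \<beta>(2)[OF p(2)] by (simp add: g_def binj)
 qed simp
 have "EX u. spt (%a b. a\<in>cell T c & b\<in>cell T c) u & st u*u = idm (cell T c) & u*st u = idm (cell T c) &
   (\<forall>p\<in>I c. u*f p = g p)" for c by (rule onf_unitary[OF of og refl])
 then obtain u where u: "!!c. spt (%a b. a\<in>cell T c & b\<in>cell T c) (u c)"
  "!!c. st (u c)*u c = idm (cell T c)" "!!c. u c*st (u c) = idm (cell T c)" "!!c p. p\<in>I c ==> u c*f p = g p" by metis
 define U where "U = (\<Sum>c\<in>cells T. u c)"
 note G = glue_cells[of T u, OF u(1-3), folded U_def]
 have UF: "U*F r = F' (\<beta> r)" if r: "r\<in>R" for r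
 proof -
  have Uc: "U*(F r*mu a 0) = F' (\<beta> r)*mu a 0" if a: "a < sz S" "cp S a = src r" for a
  proof -
   let ?c = "(tgt r, sg r (lb S a))" and ?p = "prod_encode (r, a)"
   have p: "?p\<in>I ?c" using r a by (auto simp: I_def)
   have fp: "f ?p = F r*mu a 0" "g ?p = F' (\<beta> r)*mu a 0" by (simp_all add: f_def g_def)
   have s: "spt (%v b. v\<in>cell T ?c) (F r*mu a 0)" by (rule spt_mono[OF nf_col_spt[OF 1 r]]) (auto simp: cell_def)
   have "F r*mu a 0 ~= 0" using nf_col_inner[OF 1 r r a, of a] by auto
   then obtain v b where "ent (F r*mu a 0) v b ~= 0" by (metis cm_eqI ent_zero)
   then have "v\<in>cell T ?c" using s by (auto simp: spt_def)
   then have "?c\<in>cells T" unfolding cells_def by (intro image_eqI[of _ _ v]) (auto simp: cell_def)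
   then show ?thesis using G(2)[OF _ s] u(4)[OF p] fp by simp
  qed
  have "U*F r = (\<Sum>a\<in>{a. a < sz S & cp S a = src r}. U*(F r*mu a 0)*mu 0 a)"
   by (subst F_eq_sum_cols[OF 1 r]) (simp add: sum_distrib_left mult.assoc)
  also have "... = (\<Sum>a\<in>{a. a < sz S & cp S a = src' (\<beta> r)}. F' (\<beta> r)*mu a 0*mu 0 a)"
   using \<beta>(2)[OF r] by (intro sum.cong) (auto simp: Uc)
  also have "... = F' (\<beta> r)" by (rule F_eq_sum_cols[OF 2 bR[OF r], symmetric])
  finally show ?thesis .
 qed
 have "\<psi> x = U*\<phi> x*st U" if x: "x\<in>bal S" for x
 proof -
  have "\<psi> x = (\<Sum>r\<in>R. F' (\<beta> r)*x*st (F' (\<beta> r)))"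
   unfolding D'(8)[OF x] using \<beta>(1) by (rule sum.reindex_bij_betw[symmetric])
  also have "... = (\<Sum>r\<in>R. (U*F r)*x*st (U*F r))" by (simp add: UF)
  also have "... = U*\<phi> x*st U" by (simp add: D(8)[OF x] sum_distrib_left sum_distrib_right st_mult mult.assoc)
  finally show ?thesis .
 qed
 with G(1) show thesis by (rule that)
qed

section \<open>Towers and their limits\<close>

lemma incl_self [simp]: "incl \<iota> k k a = a" by (simp add: incl_def)

lemma incl_Suc: "k <= l ==> incl \<iota> k (Suc l) a = \<iota> l (incl \<iota> k l a)" by (simp add: incl_def)

lemma incl_trans: "k <= l ==> l <= m ==> incl \<iota> l m (incl \<iota> k l a) = incl \<iota> k m a"
proof -
 assume "k <= l" "l <= m"
 then have "[k..<m] = [k..<l] @ [l..<m]" using upt_add_eq_append[of k l "m - l"] by simp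
 then show ?thesis by (simp add: incl_def)
qed

text \<open>The conditional expectation of \<open>bal T\<close> onto the diagonal.\<close>

definition dg :: "nat => stage => cm => cm" where
 "dg n T w = (\<Sum>j<2*n. pl T j*w*pl T j)"

lemma ent_pl_mult_pl: "ent (pl T i*w*pl T j) a b =
  (if a < sz T & b < sz T & lb T a = i & lb T b = j then ent w a b else 0)" by (auto simp: pl_def ent_mult_idm ent_idm_mult)

lemma ent_dg:
 assumes "stage n T" "w\<in>bal T" shows "ent (dg n T w) a b = (if lb T a = lb T b then ent w a b else 0)"
proof (cases "a < sz T & b < sz T")
 case True
 then have "ent (dg n T w) a b = (\<Sum>j<2*n. if j = lb T a then (if lb T a = lb T b then ent w a b else 0) else 0)"
  unfolding dg_def ent_sum ent_pl_mult_pl by (intro sum.cong) auto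
 also have "lb T a < 2*n" using assms(1) True by (auto simp: stage_def)
 then have "(\<Sum>j<2*n. if j = lb T a then (if lb T a = lb T b then ent w a b else 0) else 0) =
  (if lb T a = lb T b then ent w a b else 0)" by simp
 finally show ?thesis .
next
 case False
 then have "ent w a b = 0" using bndD[OF bnd_bal[OF assms(2)], of a b] by auto
 then show ?thesis using False unfolding dg_def ent_sum ent_pl_mult_pl by auto
qed

lemma dg_same_class: "stage n T ==> w\<in>bal T ==> spt (same_class T) (dg n T w)"
 by (auto simp: spt_def ent_dg same_class_def bal_def)

lemma dg_dal: 
 assumes "stage n T" "w\<in>bal T" shows "dg n T w\<in>dal n T" "st (dg n T w)\<in>dal n T"
proof -
 have "spt (%i j. same_cp T i j & (lb T j, lb T i)\<in>ed n) x" if "spt (same_class T) x" for x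
  using that by (rule spt_mono) (use assms(1) in \<open>auto simp: same_class_def ed_iff stage_def same_cp_def\<close>)
 moreover have "spt (same_class T) (st (dg n T w))"
  using spt_st[OF dg_same_class[OF assms]] by (rule spt_mono) (auto simp: same_class_def same_cp_def)
 ultimately show "dg n T w\<in>dal n T" "st (dg n T w)\<in>dal n T" using dg_same_class[OF assms] by (auto simp: dal_def)
qed

lemma pl_bal: "pl T j\<in>bal T" unfolding bal_def mem_Collect_eq pl_def by (rule spt_mono[OF spt_idm]) (auto simp: same_cp_def)

lemma pl_orth: "i ~= j ==> pl T i*pl T j = 0"
proof -
 assume "i ~= j"
 then have "{a. a < sz T & lb T a = i} \<inter> {a. a < sz T & lb T a = j} = {}" by auto
 then show ?thesis by (simp only: pl_def idm_mult_idm finite_class) (simp add: idm_def)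
qed

lemma sum_pl: "stage n T ==> (\<Sum>j<2*n. pl T j) = one T"
 unfolding one_def pl_def by (subst sum_idm) (auto simp: stage_def intro!: arg_cong[where f=idm])

locale tower =
 fixes n :: nat and S :: "nat => stage" and \<iota> :: "nat => cm => cm"
 assumes n3: "n >= 3" and stage: "!!k. stage n (S k)" and nf_step: "!!k. nf n (S k) (S (Suc k)) (\<iota> k)"
begin

lemma nf_incl: "k <= l ==> nf n (S k) (S l) (incl \<iota> k l)"
proof (induction l)
 case (Suc l)
 show ?case
 proof (cases "k = Suc l")
  case True
  show ?thesis unfolding True by (rule nf_cong[OF nf_ident]) simp
 next
  case False
  then have "nf n (S k) (S (Suc l)) (%x. \<iota> l (incl \<iota> k l x))" using Suc by (intro nf_comp[OF _ nf_step]) auto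
  then show ?thesis by (rule nf_cong) (use False Suc in "simp add: incl_Suc")
 qed
next
 case 0
 then have "k = 0" by simp
 show ?case unfolding \<open>k = 0\<close> by (rule nf_cong[OF nf_ident]) simp
qed

lemma incl_facts:
 assumes "k <= l" shows "shom (bal (S k)) (incl \<iota> k l)" "x\<in>bal (S k) ==> incl \<iota> k l x\<in>bal (S l)"
  "x\<in>dal n (S k) ==> incl \<iota> k l x\<in>dal n (S l)" "x\<in>bal (S k) ==> norm (incl \<iota> k l x) = norm x"
proof -
 obtain R F src tgt sg where f: "nfd n (S k) (S l) (incl \<iota> k l) R F src tgt sg"
  using nf_incl[OF assms] by (auto simp: nf_def)
 show "shom (bal (S k)) (incl \<iota> k l)" "x\<in>bal (S k) ==> incl \<iota> k l x\<in>bal (S l)"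
  "x\<in>dal n (S k) ==> incl \<iota> k l x\<in>dal n (S l)" "x\<in>bal (S k) ==> norm (incl \<iota> k l x) = norm x"
  using nf_shom[OF f] nf_bal[OF f] nf_dal[OF f] nf_norm[OF f] by auto
qed

text \<open>Entries before stage \<open>k\<close> are set to 0, so that every entry lies in its
  stage.\<close>

definition eseq :: "nat => cm => nat => cm" where
 "eseq k a m = (if m < k then 0 else incl \<iota> k m a)"

definition emb :: "nat => cm => lmat" where "emb k a = cls (eseq k a)"

lemma eseq_bal: "a\<in>bal (S k) ==> eseq k a m\<in>bal (S m)" by (auto simp: eseq_def incl_facts ssubD[OF ssub_bal])

lemma eseq_bd: "a\<in>bal (S k) ==> bd (eseq k a)" by (rule bdI[of _ "norm a"]) (auto simp: eseq_def incl_facts not_less)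

lemma cls_cong_ev:
 assumes "bd x" "bd y" "EVT k. x k = y k" shows "cls x = cls y" unfolding cls_eq_iff[OF assms(1,2)]
 by (rule tendsto_eventually) (use assms(3) in \<open>auto elim: eventually_mono\<close>)

lemma emb_incl: "k <= l ==> a\<in>bal (S k) ==> emb l (incl \<iota> k l a) = emb k a" unfolding emb_def
 by (rule cls_cong_ev) (auto intro!: eseq_bd incl_facts eventually_sequentiallyI[of l] simp: eseq_def incl_trans)

lemma norm_emb: "a\<in>bal (S k) ==> norm (emb k a) = norm a"
proof (rule antisym)
 assume a: "a\<in>bal (S k)"
 have e: "EVT m. norm (eseq k a m) = norm a" by (rule eventually_sequentiallyI[of k]) (auto simp: eseq_def incl_facts a)
 show "norm (emb k a) <= norm a" unfolding emb_def by (rule norm_cls_le) (use e in "auto elim: eventually_mono")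
 show "norm a <= norm (emb k a)"
 proof (rule ccontr)
  assume "~ ?thesis"
  then have "EVT m. norm (eseq k a m) < norm a" unfolding emb_def using norm_cls_less[OF eseq_bd[OF a]] by simp
  with e have "EVT m. False" by eventually_elim simp
  then show False by simp
 qed
qed

lemma emb_shom: "shom (bal (S k)) (emb k)" unfolding shom_def emb_def
 by (auto simp: cls_simps eseq_bd eseq_def shomD[OF incl_facts(1) ssub_bal] not_less intro!: arg_cong[where f=cls])

lemmas embD = shomD[OF emb_shom ssub_bal]

section \<open>The limits inside the algebra of bounded sequences\<close>

definition seqs :: "lmat set" where "seqs = {cls x | x. bd x & (ALL k. x k\<in>bal (S k))}"

lemma seqsE: assumes "X\<in>seqs" obtains x where "X = cls x" "bd x" "!!k. x k\<in>bal (S k)" using assms by (auto simp: seqs_def)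

lemma seqsI: "bd x ==> (!!k. x k\<in>bal (S k)) ==> cls x\<in>seqs" by (auto simp: seqs_def)

lemma ssub_seqs: "ssub seqs"
proof -
 have "0\<in>seqs" unfolding cls_simps(6)[symmetric] by (intro seqsI bd_zero ssubD[OF ssub_bal])
 moreover have "x + y\<in>seqs & x*y\<in>seqs" if "x\<in>seqs" "y\<in>seqs" for x y
  using that by (auto elim!: seqsE simp: cls_simps intro!: seqsI bd_add bd_mult ssubD[OF ssub_bal])
 moreover have "csc c x\<in>seqs" "st x\<in>seqs" if "x\<in>seqs" for c x
  using that by (auto elim!: seqsE simp: cls_simps intro!: seqsI bd_csc bd_st ssubD[OF ssub_bal])
 ultimately show ?thesis by (auto simp: ssub_def)
qed

definition lim_of :: "(nat => cm set) => lmat set" where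
 "lim_of D = {X\<in>seqs. \<forall>e>0. \<exists>K. \<exists>a\<in>D K. norm (X - emb K a) < e}"

definition limB :: "lmat set" where "limB = lim_of (%K. bal (S K))"
definition limA :: "lmat set" where "limA = lim_of (%K. dal n (S K))"

lemma limA_limB: "X\<in>limA ==> X\<in>limB" unfolding limA_def limB_def lim_of_def using dal_bal by blast

lemma limB_seqs: "X\<in>limB ==> X\<in>seqs" by (simp add: limB_def lim_of_def)

lemma emb_seqs: "a\<in>bal (S k) ==> emb k a\<in>seqs" unfolding emb_def by (intro seqsI eseq_bd eseq_bal)

lemma emb_limB: "a\<in>bal (S k) ==> emb k a\<in>limB"
 unfolding limB_def lim_of_def using emb_seqs[of a k] by auto (metis diff_self norm_zero)

lemma emb_limA: "a\<in>dal n (S k) ==> emb k a\<in>limA"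
 unfolding limA_def lim_of_def using emb_seqs[of a k] dal_bal[of a n] by auto (metis diff_self norm_zero)

lemma limB_approx: "X\<in>limB ==> e > 0 ==> \<exists>K. \<exists>a\<in>bal (S K). norm (X - emb K a) < e"
 by (simp add: limB_def lim_of_def)

lemma limA_approx: "X\<in>limA ==> e > 0 ==> \<exists>K. \<exists>a\<in>dal n (S K). norm (X - emb K a) < e"
 by (simp add: limA_def lim_of_def)

lemma approx_later:
 assumes "a\<in>bal (S K)" "norm (X - emb K a) < e" "K <= L" shows "norm (X - emb L (incl \<iota> K L a)) < e"
 using assms by (simp add: emb_incl)

lemma limB_approx_ge: "X\<in>limB ==> e > 0 ==> \<exists>K\<ge>L. \<exists>a\<in>bal (S K). norm (X - emb K a) < e"
 by (metis limB_approx approx_later incl_facts(2) linorder_linear)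

lemma limA_approx_ge: "X\<in>limA ==> e > 0 ==> \<exists>K\<ge>L. \<exists>a\<in>dal n (S K). norm (X - emb K a) < e"
 by (metis limA_approx approx_later incl_facts(3) dal_bal linorder_linear)

lemma limB_closed:
 assumes "X\<in>seqs" "!!e. e > 0 ==> \<exists>Y\<in>limB. norm (X - Y) < e" shows "X\<in>limB" unfolding limB_def lim_of_def
proof (intro CollectI conjI assms allI impI)
 fix e :: real assume "e > 0"
 then have e: "e / 2 > 0" by simp
 obtain Y where Y: "Y\<in>limB" "norm (X - Y) < e / 2" using assms(2)[OF e] by blast
 obtain K a where a: "a\<in>bal (S K)" "norm (Y - emb K a) < e / 2" using limB_approx[OF Y(1) e] by blast
 have "norm (X - emb K a) <= norm (X - Y) + norm (Y - emb K a)" using norm_triangle_ineq[of "X - Y" "Y - emb K a"] by simp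
 then show "\<exists>K. \<exists>a\<in>bal (S K). norm (X - emb K a) < e" using a Y(2) by (intro exI[of _ K] bexI[of _ a]) auto
qed

lemma limB_ops:
 assumes X: "X\<in>limB" and Y: "Y\<in>limB" shows "X + Y\<in>limB" "X*Y\<in>limB" "csc c X\<in>limB" "st X\<in>limB"
proof -
 note s = ssubD[OF ssub_seqs] limB_seqs[OF X] limB_seqs[OF Y]
 have two: "\<exists>K a b. a\<in>bal (S K) & b\<in>bal (S K) & norm (X - emb K a) < e & norm (Y - emb K b) < e" if e: "e > 0" for e
 proof -
  obtain K a where a: "a\<in>bal (S K)" "norm (X - emb K a) < e" using limB_approx[OF X e] by blast
  obtain L b where b: "L >= K" "b\<in>bal (S L)" "norm (Y - emb L b) < e" using limB_approx_ge[OF Y e] by blast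
  show ?thesis using b approx_later[OF a b(1)] incl_facts(2)[OF b(1) a(1)] by blast
 qed
 show "X + Y\<in>limB"
 proof (rule limB_closed)
  fix e :: real assume "e > 0"
  then obtain K a b where ab: "a\<in>bal (S K)" "b\<in>bal (S K)" "norm (X - emb K a) < e / 2" "norm (Y - emb K b) < e / 2"
   using two[of "e / 2"] by auto
  have "norm (X + Y - emb K (a + b)) = norm ((X - emb K a) + (Y - emb K b))" by (simp add: embD ab algebra_simps)
  also have "... < e" using ab norm_triangle_ineq[of "X - emb K a" "Y - emb K b"] by simp
  finally show "\<exists>Z\<in>limB. norm (X + Y - Z) < e" using emb_limB ab ssubD[OF ssub_bal] by meson
 qed (use s in auto)
 show "X*Y\<in>limB"
 proof (rule limB_closed)
  fix e :: real assume e: "e > 0"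
  define d where "d = min 1 (e / (norm X + norm Y + 2))"
  have den: "norm X + norm Y + 2 > 0" by (simp add: add_nonneg_pos)
  have d: "d > 0" "d <= 1" "d*(norm X + norm Y + 1) < e"
  proof -
   have "d <= e / (norm X + norm Y + 2)" by (simp add: d_def)
   then have "d*(norm X + norm Y + 2) <= e" using den by (simp add: pos_le_divide_eq)
   moreover show "d > 0" using e den by (simp add: d_def)
   ultimately show "d*(norm X + norm Y + 1) < e" by (simp add: algebra_simps)
  qed (simp add: d_def)
  obtain K a b where ab: "a\<in>bal (S K)" "b\<in>bal (S K)" "norm (X - emb K a) < d" "norm (Y - emb K b) < d"
   using two[OF d(1)] by auto
  let ?a = "emb K a" and ?b = "emb K b"
  have "norm ?a <= norm X + 1" using norm_triangle_ineq2[of ?a X] ab d by (simp add: norm_minus_commute)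
  have "X*Y - emb K (a*b) = (X - ?a)*Y + ?a*(Y - ?b)" by (simp add: embD ab algebra_simps)
  also have "norm ... <= norm (X - ?a)*norm Y + norm ?a*norm (Y - ?b)" by (intro norm_triangle_mono norm_mult_ineq)
  also have "... <= d*norm Y + (norm X + 1)*d"
   using ab d(1) \<open>norm ?a <= norm X + 1\<close> by (intro add_mono mult_mono) auto
  also have "... < e" using d by (simp add: algebra_simps)
  finally show "\<exists>Z\<in>limB. norm (X*Y - Z) < e" using emb_limB ab ssubD[OF ssub_bal] by meson
 qed (use s in auto)
 show "csc c X\<in>limB"
 proof (rule limB_closed)
  fix e :: real assume "e > 0"
  then have "e / (cmod c + 1) > 0" by (simp add: add_nonneg_pos)
  then obtain K a where a: "a\<in>bal (S K)" "norm (X - emb K a) < e / (cmod c + 1)" using limB_approx[OF X] by blast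
  have "norm (csc c X - emb K (csc c a)) = cmod c*norm (X - emb K a)" by (simp add: embD a norm_csc flip: csc_diff_right)
  also have "... <= (cmod c + 1)*norm (X - emb K a)" by (intro mult_right_mono) auto
  also have "... < e" using a by (simp add: pos_less_divide_eq mult.commute add_nonneg_pos)
  finally show "\<exists>Z\<in>limB. norm (csc c X - Z) < e" using emb_limB a ssubD[OF ssub_bal] by meson
 qed (use s in auto)
 show "st X\<in>limB"
 proof (rule limB_closed)
  fix e :: real assume "e > 0"
  then obtain K a where a: "a\<in>bal (S K)" "norm (X - emb K a) < e" using limB_approx[OF X] by blast
  have "norm (st X - emb K (st a)) = norm (X - emb K a)" by (metis embD(4) a(1) norm_st st_diff)
  then show "\<exists>Z\<in>limB. norm (st X - Z) < e" using emb_limB a ssubD(5)[OF ssub_bal] by metis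
 qed (use s in auto)
qed

lemma ssub_limB: "ssub limB"
proof -
 have "0\<in>limB" using emb_limB[of 0 0] embD(8) ssubD(1)[OF ssub_bal] by simp
 then show ?thesis by (auto simp: ssub_def limB_ops)
qed

text \<open>Quasi-inverses are taken stage by stage. Their partial sums are polynomials in the
  representative, so their classes lie in \<open>limB\<close>. As all norms are bounded by one r <
  1, the partial sums converge uniformly in the stage, and the class of the stagewise quasi-inverses
  lies in the closed set \<open>limB\<close>.\<close>

lemma limB_quasi_inverse:
 assumes Y: "Y\<in>limB" and n1: "norm Y < 1" shows "\<exists>U\<in>limB. U = st Y*Y + U*(st Y*Y)"
proof -
 obtain x where x: "Y = cls x" "bd x" "!!k. x k\<in>bal (S k)" using limB_seqs[OF Y] by (metis seqsE)
 obtain r where r: "norm Y < r" "r < 1" using n1 dense by blast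
 have r0: "r > 0" using r norm_ge_zero[of Y] by linarith
 \<comment> \<open>Changing finitely many entries of the representative brings all norms below
   \<open>r\<close>.\<close>
 define y where "y k = (if norm (x k) < r then x k else 0)" for k
 have yb: "y k\<in>bal (S k)" for k using x(3) ssubD(1)[OF ssub_bal] by (auto simp: y_def)
 have yr: "norm (y k) <= r" for k using r0 by (auto simp: y_def)
 have bdy: "bd y" using yr by (rule bdI)
 have Yy: "Y = cls y" unfolding x(1)
  by (rule cls_cong_ev[OF x(2) bdy]) (use norm_cls_less[OF x(2), of r] r x(1) in \<open>auto simp: y_def elim: eventually_mono\<close>)
 have "EX u s. u\<in>bal (S k) & u = st (y k)*y k + u*(st (y k)*y k) & s (0 :: nat) = 0 &
  (ALL m. s (Suc m) = st (y k)*y k + s m*(st (y k)*y k)) & (ALL m. s m\<in>bal (S k)) &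
  (ALL m. norm (u - s m) <= ((norm (y k))\<^sup>2) ^ Suc m / (1 - (norm (y k))\<^sup>2))" for k
 proof -
  have "norm (y k) < 1" using yr[of k] r by simp
  from quasi_inverse_bal[OF yb this] show ?thesis by metis
 qed
 then obtain u s where u: "!!k. u k\<in>bal (S k)" "!!k. u k = st (y k)*y k + u k*(st (y k)*y k)"
  "!!k. s k (0 :: nat) = 0" "!!k m. s k (Suc m) = st (y k)*y k + s k m*(st (y k)*y k)" "!!k m. s k m\<in>bal (S k)"
  "!!k m. norm (u k - s k m) <= ((norm (y k))\<^sup>2) ^ Suc m / (1 - (norm (y k))\<^sup>2)" by metis
 have r2: "r\<^sup>2 < 1" using r r0 by (simp add: power_less_one_iff)
 have us: "norm (u k - s k m) <= (r\<^sup>2) ^ Suc m / (1 - r\<^sup>2)" for k m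
 proof -
  have "(norm (y k))\<^sup>2 <= r\<^sup>2" using yr by (intro power_mono) auto
  then have "((norm (y k))\<^sup>2) ^ Suc m / (1 - (norm (y k))\<^sup>2) <= (r\<^sup>2) ^ Suc m / (1 - r\<^sup>2)"
   using r2 by (intro frac_le power_mono[of "(norm (y k))\<^sup>2"]) auto
  then show ?thesis using u(6) order_trans by blast
 qed
 have bdu: "bd u" by (rule bdI[of _ "(r\<^sup>2) ^ Suc 0 / (1 - r\<^sup>2)"]) (use us[of _ 0] u(3) in auto)
 have bds: "bd (%k. s k m)" for m by (induction m) (auto simp: u(3,4) bdy bd_zero intro!: bd_add bd_mult bd_st)
 have hB: "st Y*Y\<in>limB" using Y by (intro limB_ops)
 have h: "st Y*Y = cls (%k. st (y k)*y k)" by (simp add: Yy cls_simps bdy bd_st)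
 have sB: "cls (%k. s k m)\<in>limB" for m
 proof (induction m)
  case 0
  then show ?case using ssubD(1)[OF ssub_limB] by (simp add: u(3) cls_simps)
 next
  case (Suc m)
  have "cls (%k. s k (Suc m)) = st Y*Y + cls (%k. s k m)*(st Y*Y)" by (simp add: h u(4) cls_simps bdy bds bd_st bd_mult)
  then show ?case using Suc hB by (simp add: limB_ops)
 qed
 have "cls u\<in>limB"
 proof (rule limB_closed)
  show "cls u\<in>seqs" by (intro seqsI bdu u)
  fix e :: real assume e: "e > 0"
  have "(%m. (r\<^sup>2) ^ Suc m / (1 - r\<^sup>2)) \<longlonglongrightarrow> 0"
   using r2 by (intro tendsto_divide_zero LIMSEQ_Suc LIMSEQ_power_zero) simp
  then have "EVT m. (r\<^sup>2) ^ Suc m / (1 - r\<^sup>2) < e" using e by (simp add: order_tendstoD)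
  then obtain m where m: "(r\<^sup>2) ^ Suc m / (1 - r\<^sup>2) < e" by fastforce
  have "norm (cls u - cls (%k. s k m)) <= (r\<^sup>2) ^ Suc m / (1 - r\<^sup>2)"
   unfolding cls_simps(2)[OF bdu bds] by (rule norm_cls_le) (use us in auto)
  then show "\<exists>Z\<in>limB. norm (cls u - Z) < e" using m sB by (meson le_less_trans)
 qed
 moreover have "cls u = st Y*Y + cls u*(st Y*Y)"
 proof -
  have "u = (%k. st (y k)*y k + u k*(st (y k)*y k))" using u(2) by simp
  then show ?thesis by (simp add: h cls_simps bdy bdu bd_st bd_mult)
 qed
 ultimately show ?thesis by blast
qed

lemma limB_contractive:
 fixes \<Theta> :: "lmat => lmat"
 assumes "shom limB \<Theta>" "X\<in>limB" shows "norm (\<Theta> X) <= norm X"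
 by (rule shom_contractive[OF ssub_limB assms(1) limB_quasi_inverse no_quasi_inverse_lmat assms(2)])

text \<open>The projection onto the \<open>j\<close>-th positions of all stages. It need not lie in
  \<open>limB\<close>, because the inclusions may permute the positions.\<close>

definition PP :: "nat => lmat" where "PP j = cls (%k. pl (S k) j)"

lemma bd_pl: "bd (%k. pl (S k) j)" by (rule bdI[of _ 1]) (simp add: pl_def proj_norm_le proj_idm)

lemma PP_seqs: "PP j\<in>seqs" unfolding PP_def by (intro seqsI bd_pl pl_bal)

lemma PP_proj: "proj (PP j)" using projD[OF proj_idm] by (simp add: proj_def PP_def cls_simps bd_pl) (simp add: pl_def)

lemma PP_orth: "i ~= j ==> PP i*PP j = 0" by (simp add: PP_def cls_simps bd_pl pl_orth)

lemma sum_cls: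
 assumes "finite I" "!!i. i\<in>I ==> bd (x i)"
 shows "(\<Sum>i\<in>I. cls (x i)) = cls (%k. \<Sum>i\<in>I. x i k)" "bd (%k. \<Sum>i\<in>I. x i k)"
proof -
 have "(\<Sum>i\<in>I. cls (x i)) = cls (%k. \<Sum>i\<in>I. x i k) & bd (%k. \<Sum>i\<in>I. x i k)"
  using assms by (induction I rule: finite_induct) (auto simp: cls_simps bd_zero intro!: bd_add)
 then show "(\<Sum>i\<in>I. cls (x i)) = cls (%k. \<Sum>i\<in>I. x i k)" "bd (%k. \<Sum>i\<in>I. x i k)" by auto
qed

lemma sum_PP: "X\<in>seqs ==> (\<Sum>j<2*n. PP j)*X = X" "X\<in>seqs ==> X*(\<Sum>j<2*n. PP j) = X"
proof -
 assume "X\<in>seqs"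
 then obtain x where x: "X = cls x" "bd x" "!!k. x k\<in>bal (S k)" by (metis seqsE)
 have e: "(\<Sum>j<2*n. PP j) = cls (%k. one (S k))" "bd (%k. one (S k))"
  unfolding PP_def using sum_cls[of "{..<2*n}" "%j k. pl (S k) j"] bd_pl by (simp_all add: sum_pl[OF stage])
 show "(\<Sum>j<2*n. PP j)*X = X" "X*(\<Sum>j<2*n. PP j) = X" by (simp_all add: e x cls_simps one_unit)
qed

lemma limA_corner:
 assumes X: "X\<in>limA" and ij: "(j, i) \<notin> ed n" shows "PP i*X*PP j = 0"
proof -
 have "norm (PP i*X*PP j) < e" if e: "e > 0" for e
 proof -
  obtain K a where a: "a\<in>dal n (S K)" "norm (X - emb K a) < e" using limA_approx[OF X e] by blast
  have z: "pl (S k) i*eseq K a k*pl (S k) j = 0" for k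
  proof (rule cm_eqI)
   fix v w
   have "eseq K a k\<in>dal n (S k)" using incl_facts(3)[of K k a] a by (auto simp: eseq_def dal_def)
   then show "ent (pl (S k) i*eseq K a k*pl (S k) j) v w = ent 0 v w" using ij by (auto simp: ent_pl_mult_pl dal_def spt_def)
  qed
  have "PP i*emb K a*PP j = 0" by (simp add: PP_def emb_def cls_simps bd_pl bd_mult eseq_bd[OF dal_bal[OF a(1)]] z)
  then have "PP i*X*PP j = PP i*(X - emb K a)*PP j" by (simp add: left_diff_distrib right_diff_distrib)
  also have "norm ... <= norm (PP i)*norm (X - emb K a)*norm (PP j)"
   by (meson norm_mult_ineq mult_right_mono norm_ge_zero order_trans)
  also have "... <= 1*norm (X - emb K a)*1" using proj_norm_le[OF PP_proj] by (intro mult_mono) auto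
  finally show ?thesis using a by simp
 qed
 then have "norm (PP i*X*PP j) <= 0" by (meson less_le not_le leI less_irrefl)
 then show ?thesis by simp
qed

text \<open>Distinct positions are joined by an edge in at most one direction, so each corner
  between them vanishes by \<open>limA_corner\<close>, applied to \<open>X\<close> or to its
  adjoint.\<close>

lemma PP_commute:
 assumes "X\<in>limA" "st X\<in>limA" "j < 2*n" shows "PP j*X = X*PP j"
proof -
 have z: "PP i*X*PP k = 0" if "i ~= k" for i k
 proof (cases "(k, i)\<in>ed n")
  case True
  then have "PP k*st X*PP i = 0" using that ed_antisym assms(2) by (intro limA_corner) blast+
  then show ?thesis using arg_cong[of _ _ st] by (metis PP_proj projD(1) st_mult st_st st_zero mult.assoc)
 qed (rule limA_corner[OF assms(1)])
 note s = limB_seqs[OF limA_limB[OF assms(1)]]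
 have "PP j*X = PP j*(X*(\<Sum>k<2*n. PP k))" by (simp add: sum_PP s)
 also have "... = (\<Sum>k<2*n. if k = j then PP j*X*PP j else 0)"
  unfolding sum_distrib_left by (intro sum.cong refl) (auto simp: z simp flip: mult.assoc)
 also have "... = (\<Sum>k<2*n. PP k*X*PP j)" by (intro sum.cong refl) (auto simp: z)
 also have "... = (\<Sum>k<2*n. PP k)*X*PP j" by (simp add: sum_distrib_right)
 also have "... = X*PP j" by (simp add: sum_PP s)
 finally show ?thesis .
qed

definition EE :: "lmat => lmat" where "EE X = (\<Sum>j<2*n. PP j*X*PP j)"

lemma EE_norm: "norm (EE X) <= norm X" unfolding EE_def by (rule norm_sum_corners_le) (auto simp: PP_proj PP_orth)

lemma EE_diff: "EE (X - Y) = EE X - EE Y" by (simp add: EE_def left_diff_distrib right_diff_distrib sum_subtractf)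

text \<open>The inclusions may move positions, but they preserve equality and distinctness of
  positions. Hence the expectation of a stage is the restriction of the expectation in the
  limit.\<close>

lemma EE_emb: assumes z: "z\<in>bal (S K)" shows "EE (emb K z) = emb K (dg n (S K) z)"
proof -
 define d where "d = dg n (S K) z"
 have d: "d\<in>bal (S K)" "spt (same_class (S K)) d"
  using dg_dal[OF stage z] dal_bal dg_same_class[OF stage z] by (auto simp: d_def)
 have zd: "z - d\<in>bal (S K)" using z d by (intro ssubD[OF ssub_bal])
 have o: "spt (%i j. same_cp (S K) i j & lb (S K) i ~= lb (S K) j) (z - d)"
  using balD[OF z] unfolding d_def by (auto simp: spt_def ent_diff ent_dg[OF stage z] split: if_splits)
 have e: "(\<Sum>j<2*n. pl (S k) j*eseq K z k*pl (S k) j) = eseq K d k" for k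
 proof (cases "k < K")
  case True
  then show ?thesis by (simp add: eseq_def)
 next
  case False
  then have Kk: "K <= k" by simp
  obtain R F src tgt sg where f: "nfd n (S K) (S k) (incl \<iota> K k) R F src tgt sg"
   using nf_incl[OF Kk] by (auto simp: nf_def)
  have "incl \<iota> K k z = incl \<iota> K k d + incl \<iota> K k (z - d)"
   using shomD(1)[OF incl_facts(1)[OF Kk] ssub_bal d(1) zd] by simp
  moreover have "ent (incl \<iota> K k d) a b = 0" if "lb (S k) a ~= lb (S k) b" for a b
   using nf_same_class[OF f d(2)] that by (auto simp: spt_def same_class_def)
  moreover have "ent (incl \<iota> K k (z - d)) a b = 0" if "lb (S k) a = lb (S k) b" for a b
   using nf_diff_label[OF f stage o] that by (auto simp: spt_def)
  ultimately have "dg n (S k) (incl \<iota> K k z) = incl \<iota> K k d"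
   using incl_facts(2)[OF Kk z] by (intro cm_eqI) (simp add: ent_dg[OF stage] ent_add)
  then show ?thesis using False by (simp add: eseq_def dg_def)
 qed
 have "EE (emb K z) = (\<Sum>j<2*n. cls (%k. pl (S k) j*eseq K z k*pl (S k) j))"
  unfolding EE_def PP_def emb_def by (simp add: cls_simps bd_pl bd_mult eseq_bd[OF z])
 also have "... = cls (%k. \<Sum>j<2*n. pl (S k) j*eseq K z k*pl (S k) j)"
  by (rule sum_cls) (auto intro!: bd_mult bd_pl eseq_bd[OF z])
 finally show ?thesis by (simp add: e emb_def d_def)
qed

end

section \<open>Families of projections indexed by the cycle\<close>

text \<open>There is no closed walk through four distinct positions: going around would give b + 4 =
  b modulo 2 n, which is impossible for 2 n at least 6.\<close>

lemma nbr_square: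
 assumes "n >= 3" "nbr n a b" "nbr n b c" "nbr n c d" "nbr n d a" "a ~= c" "b ~= d" shows False
proof -
 have *: False if h: "a = Suc b mod (2*n)" "b = Suc c mod (2*n)" "nbr n c d" "nbr n d a" "a ~= c" "b ~= d"
  "a < 2*n" "b < 2*n" "c < 2*n" "d < 2*n" for a c
 proof -
  have d: "d = Suc a mod (2*n)" using nbr_step[OF h(4)] h(1,6,7,8,10) Suc_mod_inj[of b "2*n" d] by auto
  have c: "c = Suc d mod (2*n)" using nbr_step[OF h(3)] d h Suc_mod_inj[of a "2*n" c] by auto
  have "d = Suc (Suc b) mod (2*n)" by (metis d h(1) mod_Suc_eq)
  then have "c = Suc (Suc (Suc b)) mod (2*n)" by (metis c mod_Suc_eq)
  then have b: "(b + 4) mod (2*n) = b" using h(2) mod_Suc_eq[of "Suc (Suc (Suc b))" "2*n"] by (simp add: eval_nat_numeral)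
  show False
  proof (cases "b + 4 < 2*n")
   case False
   then have "(b + 4) mod (2*n) = (b + 4 - 2*n) mod (2*n)" by (simp add: le_mod_geq)
   also have "... = b + 4 - 2*n" using h(8) assms(1) by simp
   finally show False using b False assms(1) by simp
  qed (use b in simp)
 qed
 note s = nbr_step[OF assms(2)] nbr_step[OF assms(3)] nbr_step[OF assms(4)] nbr_step[OF assms(5)]
 show False
 proof (cases "a = Suc b mod (2*n)")
  case True
  then have "b = Suc c mod (2*n)" using s assms(6) by auto
  then show ?thesis using *[of a c] assms s by blast
 next
  case False
  then have "b = Suc a mod (2*n)" "c = Suc b mod (2*n)" using s assms(6) Suc_mod_inj[of a "2*n" c] by auto
  then show ?thesis using *[of c a] assms s nbr_sym by metis
 qed
qed

section \<open>Automorphisms with prescribed values\<close>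

lemma aut_inj_ed:
 assumes "!!i j. i < 2*n ==> j < 2*n ==> \<sigma> i = \<sigma> j ==> i = j" "!!i. i < 2*n ==> \<sigma> i < 2*n"
  "!!k i. (k, i)\<in>ed n ==> (\<sigma> k, \<sigma> i)\<in>ed n" shows "aut n \<sigma>"
proof -
 have "inj_on \<sigma> {..<2*n}" using assms(1) by (auto simp: inj_on_def)
 moreover have "\<sigma> ` {..<2*n} = {..<2*n}" by (rule endo_inj_surj) (use calculation assms(2) in auto)
 ultimately show ?thesis using assms(3) by (auto simp: aut_def bij_betw_def)
qed

text \<open>An injective map of the finite edge set into itself is onto, so automorphisms also
  reflect edges.\<close>

lemma aut_ed_iff:
 assumes "aut n \<sigma>" "k < 2*n" "i < 2*n" shows "(\<sigma> k, \<sigma> i)\<in>ed n <-> (k, i)\<in>ed n"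
proof
 have sub: "ed n <= {..<2*n} \<times> {..<2*n}" by (auto simp: ed_iff)
 then have fin: "finite (ed n)" by (rule finite_subset) simp
 have inj: "inj_on (map_prod \<sigma> \<sigma>) ({..<2*n} \<times> {..<2*n})" using assms(1) by (auto simp: inj_on_def aut_inj)
 have "map_prod \<sigma> \<sigma> ` ed n = ed n"
  by (rule endo_inj_surj[OF fin _ inj_on_subset[OF inj sub]]) (use assms(1) in \<open>auto simp: aut_ed\<close>)
 moreover assume "(\<sigma> k, \<sigma> i)\<in>ed n"
 ultimately obtain k' i' where "(k', i')\<in>ed n" "\<sigma> k' = \<sigma> k" "\<sigma> i' = \<sigma> i" by force
 then show "(k, i)\<in>ed n" using assms sub aut_inj[OF assms(1)] by auto
qed (rule aut_ed[OF assms(1)])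

lemma ed_Suc: "n >= 1 ==> i < 2*n ==> 
 (if odd i then (i, Suc i mod (2*n))\<in>ed n else (Suc i mod (2*n), i)\<in>ed n)"
 using nbr_Suc[of n i] by (auto simp: nbr_def ed_iff)

lemma aut_rot: assumes "even j" "n >= 1" shows "aut n (%i. (j + i) mod (2*n))"
proof (rule aut_inj_ed)
 fix i i' assume a: "i < 2*n" "i' < 2*n" "(j + i) mod (2*n) = (j + i') mod (2*n)"
 have *: "x = y" if "x <= y" "y < 2*n" "(j + x) mod (2*n) = (j + y) mod (2*n)" for x y
  using that mod_eq_dvd_iff_nat[of "j + x" "j + y" "2*n"] by (auto dest!: dvd_imp_le)
 show "i = i'" using *[of i i'] *[of i' i] a by (cases "i <= i'") auto
next
 have par: "even ((j + i) mod (2*n)) <-> even i" for i using assms by (simp add: dvd_mod_iff)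
 have sh: "(j + Suc i mod (2*n)) mod (2*n) = Suc ((j + i) mod (2*n)) mod (2*n)" for i by (simp add: mod_simps)
 have lt: "x mod (2*n) < 2*n" for x using assms by simp
 fix k i assume "(k, i)\<in>ed n"
 then consider "k = i" | "odd k" "even i" "k = Suc i mod (2*n)" | "odd k" "even i" "i = Suc k mod (2*n)"
  unfolding ed_iff by blast
 then show "((j + k) mod (2*n), (j + i) mod (2*n))\<in>ed n" unfolding ed_iff par using lt sh by cases blast+
qed (use assms in auto)

lemma aut_refl: assumes "n >= 1" shows "aut n (%i. (2*n - i) mod (2*n))"
proof (rule aut_inj_ed)
 have v: "(2*n - i) mod (2*n) = (if i = 0 then 0 else 2*n - i)" if "i < 2*n" for i using that by auto
 fix i j assume "i < 2*n" "j < 2*n" "(2*n - i) mod (2*n) = (2*n - j) mod (2*n)"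
 then show "i = j" by (auto simp: v split: if_splits)
next
 have par: "even ((2*n - i) mod (2*n)) <-> even i" if "i < 2*n" for i using that by (simp add: dvd_mod_iff)
 have nb: "Suc ((2*n - Suc i mod (2*n)) mod (2*n)) mod (2*n) = (2*n - i) mod (2*n)" if "i < 2*n" for i
 proof (cases "Suc i = 2*n")
  case True
  then have "2*n - i = 1" by simp
  then show ?thesis using True by simp
 next
  case False
  then have "Suc (2*n - Suc i) = 2*n - i" "2*n - Suc i < 2*n" using that by auto
  then show ?thesis using False by simp
 qed
 have lt: "x mod (2*n) < 2*n" for x using assms by simp
 fix k i assume e: "(k, i)\<in>ed n"
 then have kl: "k < 2*n" "i < 2*n" by (auto simp: ed_iff)
 from e consider "k = i" | "odd k" "even i" "k = Suc i mod (2*n)" | "odd k" "even i" "i = Suc k mod (2*n)"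
  unfolding ed_iff by blast
 then show "((2*n - k) mod (2*n), (2*n - i) mod (2*n))\<in>ed n"
  unfolding ed_iff par[OF kl(1)] par[OF kl(2)] using lt nb[OF kl(1)] nb[OF kl(2)] by cases metis+
qed (use assms in auto)

text \<open>The rotation that takes 0 to \<open>j\<close>, preceded by the reflection fixing 0 if
  \<open>k\<close> lies on the other side of \<open>j\<close>. A rotation by an even number keeps
  range and source vertices apart.\<close>

lemma aut_ex:
 assumes "nbr n j k" "even j" "n >= 1" obtains \<sigma> where "aut n \<sigma>" "\<sigma> 0 = j" "\<sigma> 1 = k"
proof (cases "k = Suc j mod (2*n)")
 case True
 then show ?thesis using that[OF aut_rot[OF assms(2,3)]] nbr_step[OF assms(1)] by auto
next
 case False
 then have k: "j = Suc k mod (2*n)" "j < 2*n" "k < 2*n" using nbr_step[OF assms(1)] by auto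
 have "(j + (2*n - 1) mod (2*n)) mod (2*n) = (Suc k + (2*n - 1)) mod (2*n)" by (simp add: k(1) mod_simps)
 also have "... = (k + 2*n) mod (2*n)" using assms(3) by simp
 also have "... = k" using k by simp
 finally show ?thesis using k(2) by (intro that[OF aut_comp[OF aut_rot[OF assms(2,3)] aut_refl[OF assms(3)]]]) auto
qed

text \<open>\<open>Q i j\<close> stands for the part of position \<open>i\<close> of a source cycle
  that is carried to position \<open>j\<close> of the target, transported to a common corner with
  unit \<open>I\<close>. The condition \<open>edge\<close> says that edges go to edges, and
  \<open>distinct\<close> that images of non-diagonal matrix units have no diagonal part.\<close>

locale cycle_projections =
 fixes n :: nat and Q :: "nat => nat => 'a :: cstar" and I :: 'a
 assumes n3: "n >= 3" and pr: "!!i j. i < 2*n ==> j < 2*n ==> proj (Q i j)"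
  and orth: "!!i j k. i < 2*n ==> j ~= k ==> Q i j*Q i k = 0" and total: "!!i. i < 2*n ==> (\<Sum>j<2*n. Q i j) = I"
  and edge: "!!i i' j j'. (i, i')\<in>ed n ==> j < 2*n ==> j' < 2*n ==> (j, j') \<notin> ed n ==> Q i' j'*Q i j = 0"
  and distinct: "!!i i' j. i < 2*n ==> i' < 2*n ==> j < 2*n ==> i ~= i' ==> Q i' j*Q i j = 0"
begin

lemma prD: "i < 2*n ==> j < 2*n ==> st (Q i j) = Q i j" "i < 2*n ==> j < 2*n ==> Q i j*Q i j = Q i j" using pr projD by auto

lemma total_mult:
 assumes "i < 2*n" "k < 2*n" "j < 2*n" shows "(\<Sum>m<2*n. Q k m*Q i j) = Q i j" "(\<Sum>m<2*n. Q i j*Q k m) = Q i j"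
proof -
 have "I*Q i j = (\<Sum>m<2*n. if m = j then Q i j else 0)" unfolding total[OF assms(1), symmetric] sum_distrib_right
  by (intro sum.cong refl) (use assms in "auto simp: orth prD")
 moreover have "Q i j*I = (\<Sum>m<2*n. if m = j then Q i j else 0)" unfolding total[OF assms(1), symmetric] sum_distrib_left
  by (intro sum.cong refl) (use assms in "auto simp: orth prD")
 ultimately show "(\<Sum>m<2*n. Q k m*Q i j) = Q i j" "(\<Sum>m<2*n. Q i j*Q k m) = Q i j"
  using assms by (simp_all add: total flip: sum_distrib_left sum_distrib_right)
qed

lemma flip_zero:
 assumes "i < 2*n" "k < 2*n" "j < 2*n" "m < 2*n" shows "Q i j*Q k m = 0 <-> Q k m*Q i j = 0"
 using assms by (metis prD(1) st_mult st_zero)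

lemma nonzero_nbr:
 assumes "nbr n i i'" "j < 2*n" "j' < 2*n" "Q i' j'*Q i j ~= 0" shows "nbr n j j'"
proof -
 note b = nbr_step[OF assms(1)]
 have ne: "j ~= j'" using distinct[of i i' j] assms b by (auto simp: nbr_def)
 show ?thesis
 proof (cases "(i, i')\<in>ed n")
  case True
  then show ?thesis using edge[of i i' j j'] assms ne by (auto simp: nbr_def)
 next
  case False
  then have "(i', i)\<in>ed n" using assms(1) by (auto simp: nbr_def)
  moreover have "Q i j*Q i' j' ~= 0" using flip_zero assms b by blast
  ultimately show ?thesis using edge[of i' i j' j] assms ne by (auto simp: nbr_def)
 qed
qed

text \<open>At odd \<open>i\<close> the edge to its successor leaves \<open>i\<close>, at even
  \<open>i\<close> it enters. A nonzero product with the family of the successor needs a non-loop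
  edge at \<open>j\<close> in the same direction, hence equal parity; and the family of the
  successor sums to the unit.\<close>

lemma parity: assumes "i < 2*n" "j < 2*n" "even i ~= even j" shows "Q i j = 0"
proof -
 let ?k = "Suc i mod (2*n)"
 have n1: "n >= 1" using n3 by simp
 have k: "?k < 2*n" using n1 by simp
 have "Q ?k m*Q i j = 0" if m: "m < 2*n" for m
 proof (rule ccontr)
  assume nz: "Q ?k m*Q i j ~= 0"
  then have ne: "m ~= j" using distinct[of i ?k j] nbr_Suc[OF n1 assms(1)] assms by (auto simp: nbr_def)
  show False
  proof (cases "odd i")
   case True
   then have "(i, ?k)\<in>ed n" using ed_Suc[OF n1 assms(1)] by simp
   then have "(j, m)\<in>ed n" using edge[of i ?k j m] nz assms m by blast
   then show False using ne True assms(3) by (auto simp: ed_iff)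
  next
   case False
   then have "(?k, i)\<in>ed n" using ed_Suc[OF n1 assms(1)] by simp
   moreover have "Q i j*Q ?k m ~= 0" using nz flip_zero assms k m by blast
   ultimately have "(m, j)\<in>ed n" using edge[of ?k i m j] assms m by blast
   then show False using ne False assms(3) by (auto simp: ed_iff)
  qed
 qed
 then show ?thesis using total_mult(1)[OF assms(1) k assms(2)] by simp
qed

text \<open>Two distinct positions have at most one common neighbour since \<open>n \<ge> 3\<close>; this forces adjacent families to commute.\<close>

lemma commute:
 assumes nb: "nbr n i i'" and j: "j < 2*n" "j' < 2*n" shows "Q i j*Q i' j' = Q i' j'*Q i j"
proof -
 have i: "i < 2*n" "i' < 2*n" using nbr_step[OF nb] by auto
 have nb': "nbr n i' i" using nb nbr_sym by blast
 \<comment> \<open>A nonzero product gives a path from \<open>j\<close> over \<open>j'\<close> to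
   \<open>m\<close>. Another middle position \<open>l\<close> would close a square, so in the sum
   over all middle positions only \<open>j'\<close> survives. That sum is
   \<open>Q i m*Q i j\<close>, which is 0.\<close>
 have z: "Q i m*Q i' j'*Q i j = 0" if m: "m < 2*n" "m ~= j" for m
 proof (rule ccontr)
  assume nz: "Q i m*Q i' j'*Q i j ~= 0"
  then have "Q i' j'*Q i j ~= 0" "Q i m*Q i' j' ~= 0" by (metis mult.assoc mult_zero_right, metis mult_zero_left)
  then have jj: "nbr n j j'" "nbr n j' m" using nonzero_nbr[OF nb] nonzero_nbr[OF nb'] j m by auto
  have "Q i m*Q i' l*Q i j = 0" if l: "l < 2*n" "l ~= j'" for l
  proof (rule ccontr)
   assume "Q i m*Q i' l*Q i j ~= 0"
   then have "Q i' l*Q i j ~= 0" "Q i m*Q i' l ~= 0" by (metis mult.assoc mult_zero_right, metis mult_zero_left)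
   then have "nbr n j l" "nbr n l m" using nonzero_nbr[OF nb] nonzero_nbr[OF nb'] j m l by auto
   then show False using nbr_square[OF n3 jj] m l nbr_sym by auto
  qed
  then have "(\<Sum>l<2*n. Q i m*Q i' l*Q i j) = (\<Sum>l<2*n. if l = j' then Q i m*Q i' j'*Q i j else 0)"
   by (intro sum.cong) auto
  then have "Q i m*Q i' j'*Q i j = (\<Sum>l<2*n. Q i m*Q i' l)*Q i j" using j by (simp add: sum_distrib_right)
  also have "... = 0" using total_mult(2)[OF i(1,2) m(1)] orth[OF i(1) m(2)] by simp
  finally show False using nz by simp
 qed
 have "Q i' j'*Q i j = (\<Sum>m<2*n. Q i m)*(Q i' j'*Q i j)"
  using total_mult(1)[OF i(2,1) j(2)] by (simp add: sum_distrib_right flip: mult.assoc)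
 also have "... = (\<Sum>m<2*n. if m = j then Q i j*Q i' j'*Q i j else 0)"
  unfolding sum_distrib_right by (intro sum.cong refl) (use z in "auto simp: mult.assoc")
 finally have e: "Q i' j'*Q i j = Q i j*Q i' j'*Q i j" using j by simp
 have "Q i j*Q i' j' = st (Q i' j'*Q i j)" using i j by (simp add: st_mult prD)
 also have "... = Q i j*Q i' j'*Q i j" unfolding e using i j by (simp add: st_mult prD mult.assoc)
 finally show ?thesis using e by simp
qed

text \<open>The part on which position 0 goes to \<open>j\<close> and position 1 to
  \<open>k\<close>. These two values determine an automorphism, and \<open>E_le\<close> shows that
  all other positions follow it.\<close>

definition E :: "nat => nat => 'a" where "E j k = Q 0 j*Q 1 k"

lemma nbr01: "nbr n 0 1" using nbr_Suc[of n 0] n3 by simp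

lemma E_proj: assumes "j < 2*n" "k < 2*n" shows "proj (E j k)"
proof -
 have c: "Q 0 j*Q 1 k = Q 1 k*Q 0 j" by (rule commute[OF nbr01 assms])
 have l: "(0 :: nat) < 2*n" "1 < 2*n" using n3 by auto
 have "Q 0 j*Q 1 k*(Q 0 j*Q 1 k) = Q 0 j*(Q 1 k*Q 0 j)*Q 1 k" by (simp add: mult.assoc)
 also have "... = (Q 0 j*Q 0 j)*(Q 1 k*Q 1 k)" unfolding c[symmetric] by (simp add: mult.assoc)
 finally show ?thesis unfolding proj_def E_def using c l assms by (simp add: st_mult prD)
qed

lemma E_orth: assumes "j < 2*n" "k < 2*n" "j' < 2*n" "k' < 2*n" "(j, k) ~= (j', k')" shows "E j k*E j' k' = 0"
proof -
 have l: "(0 :: nat) < 2*n" "1 < 2*n" using n3 by auto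
 have "E j k*E j' k' = Q 0 j*(Q 1 k*Q 0 j')*Q 1 k'" by (simp add: E_def mult.assoc)
 also have "... = (Q 0 j*Q 0 j')*(Q 1 k*Q 1 k')" unfolding commute[OF nbr01 assms(3,2), symmetric] by (simp add: mult.assoc)
 also have "... = 0" using assms(5) orth[OF l(1)] orth[OF l(2)] by (cases "j = j'") auto
 finally show ?thesis .
qed

definition turns :: "(nat \<times> nat) set" where "turns = {(j, k). nbr n j k & even j}"

lemma turnsD: "(j, k)\<in>turns ==> j < 2*n & k < 2*n" using nbr_step by (auto simp: turns_def)

lemma finite_turns: "finite turns" by (rule finite_subset[of _ "{..<2*n} \<times> {..<2*n}"]) (use turnsD in auto)

lemma E_sum: "(\<Sum>(j, k)\<in>turns. E j k) = I"
proof -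
 have l: "(0 :: nat) < 2*n" "1 < 2*n" using n3 by auto
 have "E j k = 0" if "j < 2*n" "k < 2*n" "(j, k) \<notin> turns" for j k
 proof (rule ccontr)
  assume "E j k ~= 0"
  then have "Q 1 k*Q 0 j ~= 0" "Q 0 j ~= 0" using commute[OF nbr01 that(1,2)] by (auto simp: E_def)
  then show False using nonzero_nbr[OF nbr01 that(1,2)] parity[OF l(1) that(1)] that(3) by (auto simp: turns_def)
 qed
 then have "(\<Sum>(j, k)\<in>turns. E j k) = (\<Sum>(j, k)\<in>{..<2*n} \<times> {..<2*n}. E j k)"
  by (intro sum.mono_neutral_left) (use turnsD in auto)
 also have "... = (\<Sum>j<2*n. \<Sum>k<2*n. Q 0 j*Q 1 k)" by (simp add: sum.cartesian_product E_def)
 also have "... = (\<Sum>j<2*n. Q 0 j)" by (intro sum.cong refl total_mult(2)) (use l in auto)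
 finally show ?thesis using total[OF l(1)] by simp
qed

text \<open>Induction along the cycle. Under \<open>?E\<close>, position i + 2 can only go to a
  neighbour of \<sigma>(i + 1), that is to \<sigma>(i) or \<sigma>(i + 2). The first is taken by
  position i, and \<open>distinct\<close> excludes it after commuting adjacent projections.\<close>

lemma E_le:
 assumes \<sigma>: "aut n \<sigma>" "(\<sigma> 0, \<sigma> 1)\<in>turns" and i: "i < 2*n"
 shows "Q i (\<sigma> i)*E (\<sigma> 0) (\<sigma> 1) = E (\<sigma> 0) (\<sigma> 1)"
proof -
 let ?E = "E (\<sigma> 0) (\<sigma> 1)"
 have l: "(0 :: nat) < 2*n" "1 < 2*n" using n3 by auto
 note s = aut_less[OF \<sigma>(1)]
 have "Suc i < 2*n ==> ?E*Q i (\<sigma> i) = ?E & ?E*Q (Suc i) (\<sigma> (Suc i)) = ?E" for i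
 proof (induction i)
  case 0
  have "?E*Q 0 (\<sigma> 0) = Q 0 (\<sigma> 0)*(Q 0 (\<sigma> 0)*Q 1 (\<sigma> 1))"
   by (simp only: E_def mult.assoc commute[OF nbr01 s[OF l(1)] s[OF l(2)], symmetric])
  then have "?E*Q 0 (\<sigma> 0) = ?E" using l s by (simp add: E_def prD flip: mult.assoc)
  moreover have "?E*Q 1 (\<sigma> 1) = ?E" using l s by (simp add: E_def prD mult.assoc)
  ultimately show ?case by simp
 next
  case (Suc i)
  then have IH: "?E*Q i (\<sigma> i) = ?E" "?E*Q (Suc i) (\<sigma> (Suc i)) = ?E" by auto
  have lt: "i < 2*n" "Suc i < 2*n" "Suc (Suc i) < 2*n" using Suc.prems by auto
  have nb: "nbr n i (Suc i)" "nbr n (Suc i) (Suc (Suc i))" using nbr_Suc[of n i] nbr_Suc[of n "Suc i"] lt by auto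
  have "?E*Q (Suc (Suc i)) m = 0" if m: "m < 2*n" "m ~= \<sigma> (Suc (Suc i))" for m
  proof (rule ccontr)
   assume nz: "?E*Q (Suc (Suc i)) m ~= 0"
   have e: "?E*Q (Suc (Suc i)) m = ?E*(Q i (\<sigma> i)*Q (Suc i) (\<sigma> (Suc i))*Q (Suc (Suc i)) m)"
    by (simp only: IH mult.assoc[symmetric])
   have "Q (Suc i) (\<sigma> (Suc i))*Q (Suc (Suc i)) m ~= 0" using nz e by (auto simp: mult.assoc)
   then have "nbr n m (\<sigma> (Suc i))" using nonzero_nbr[of "Suc (Suc i)" "Suc i"] nb nbr_sym m s lt by blast
   then have n1: "nbr n (\<sigma> (Suc i)) m" using nbr_sym by blast
   moreover have n2: "nbr n (\<sigma> (Suc i)) (\<sigma> i)" "nbr n (\<sigma> (Suc i)) (\<sigma> (Suc (Suc i)))"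
    using aut_nbr[OF \<sigma>(1)] nb nbr_sym by auto
   moreover have "\<sigma> i ~= \<sigma> (Suc (Suc i))" using aut_inj[OF \<sigma>(1)] lt by simp
   ultimately have mi: "m = \<sigma> i" using nbr_three[OF n1 n2] m by auto
   have "Q i (\<sigma> i)*Q (Suc i) (\<sigma> (Suc i))*Q (Suc (Suc i)) m =
     Q (Suc i) (\<sigma> (Suc i))*(Q i (\<sigma> i)*Q (Suc (Suc i)) (\<sigma> i))"
    using commute[OF nb(1) s[OF lt(1)] s[OF lt(2)]] mi by (simp add: mult.assoc)
   also have "... = 0" using distinct[of "Suc (Suc i)" i "\<sigma> i"] lt s by simp
   finally show False using nz e by simp
  qed
  then have "(\<Sum>m<2*n. ?E*Q (Suc (Suc i)) m) = (\<Sum>m<2*n. if m = \<sigma> (Suc (Suc i)) then ?E*Q (Suc (Suc i)) (\<sigma> (Suc (Suc i))) else 0)"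
   by (intro sum.cong) auto
  moreover have "(\<Sum>m<2*n. ?E*Q (Suc (Suc i)) m) = ?E"
  proof -
   have "(\<Sum>m<2*n. Q 1 (\<sigma> 1)*Q (Suc (Suc i)) m) = Q 1 (\<sigma> 1)" using total_mult(2) l lt s by blast
   then show ?thesis by (simp add: E_def mult.assoc flip: sum_distrib_left)
  qed
  ultimately show ?case using IH s[OF lt(3)] by simp
 qed
 from this[of i] this[of "i - 1"] i l have "?E*Q i (\<sigma> i) = ?E" by (cases "Suc i < 2*n") auto
 then have "st (Q i (\<sigma> i))*st ?E = st ?E" by (metis st_mult)
 then show ?thesis using i s projD(1)[OF E_proj] l by (simp add: prD)
qed

end

section \<open>An isomorphism of limits respects the cycle structure\<close>

locale tower_iso = A: tower n S \<iota> + B: tower n S' \<iota>' for n S \<iota> S' \<iota>' +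
 fixes \<Theta> \<Psi> :: "lmat => lmat"
 assumes Th: "shom A.limB \<Theta>" and Ps: "shom B.limB \<Psi>"
  and ThB: "!!X. X\<in>A.limB ==> \<Theta> X\<in>B.limB" and PsB: "!!Y. Y\<in>B.limB ==> \<Psi> Y\<in>A.limB"
  and ThA: "!!X. X\<in>A.limA ==> \<Theta> X\<in>B.limA" and PsA: "!!Y. Y\<in>B.limA ==> \<Psi> Y\<in>A.limA"
  and PsTh: "!!X. X\<in>A.limB ==> \<Psi> (\<Theta> X) = X" and ThPs: "!!Y. Y\<in>B.limB ==> \<Theta> (\<Psi> Y) = Y"
begin

lemmas ThD = shomD[OF Th A.ssub_limB]

lemma diag_commute:
 assumes "a\<in>dal n (S k)" "st a\<in>dal n (S k)" "j < 2*n" shows "B.PP j*\<Theta> (A.emb k a) = \<Theta> (A.emb k a)*B.PP j"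
proof (rule B.PP_commute)
 show "\<Theta> (A.emb k a)\<in>B.limA" using assms by (intro ThA A.emb_limA)
 have "st (\<Theta> (A.emb k a)) = \<Theta> (A.emb k (st a))" using dal_bal[OF assms(1)] by (simp add: ThD A.emb_limB A.embD)
 also have "...\<in>B.limA" using assms by (intro ThA A.emb_limA)
 finally show "st (\<Theta> (A.emb k a))\<in>B.limA" .
qed (rule assms)

text \<open>
 The compression \<open>w \<mapsto> \<Sum> p\<^sub>r w q\<^sub>r\<close> below kills every late stage of \<open>A\<close>, hence \<open>A\<close>, and fixes the matrix
 unit; transported by \<open>\<Theta>\<close> it commutes with the diagonal expectation, whose values lie in the image of \<open>A\<close>.
\<close>

lemma offdiag_aux:
 assumes ab: "same_cp (S k) a b" "(lb (S k) b, lb (S k) a) \<notin> ed n" shows "B.EE (\<Theta> (A.emb k (mu a b))) = 0"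
proof -
 let ?x = "A.emb k (mu a b)"
 have m: "mu a b\<in>bal (S k)" using ab by (intro mu_bal)
 have x: "?x\<in>A.limB" by (rule A.emb_limB[OF m])
 have lt: "a < sz (S k)" "b < sz (S k)" "cp (S k) a = cp (S k) b" using ab by (auto simp: same_cp_def)
 have "norm (B.EE (\<Theta> ?x)) <= 2*e" if e: "e > 0" for e
 proof -
  \<comment> \<open>The diagonal part of \<open>\<Theta> ?x\<close> is approximated by a diagonal
    element \<open>d\<close> of the second algebra. Its preimage \<open>w\<close> lies in the first
    algebra and is approximated at some stage \<open>K\<close> by \<open>\<alpha>\<close>, where
    edges can be inspected.\<close>
  obtain L z where z: "z\<in>bal (S' L)" "norm (\<Theta> ?x - B.emb L z) < e" using B.limB_approx[OF ThB[OF x] e] by blast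
  define d where "d = B.emb L (dg n (S' L) z)"
  have dA: "d\<in>B.limA" unfolding d_def by (intro B.emb_limA dg_dal B.stage z)
  have dB: "d\<in>B.limB" by (rule B.limA_limB[OF dA])
  have Ed: "norm (B.EE (\<Theta> ?x) - d) < e"
   using B.EE_norm[of "\<Theta> ?x - B.emb L z"] z by (simp add: B.EE_diff B.EE_emb[OF z(1)] d_def)
  define w where "w = \<Psi> d"
  have wA: "w\<in>A.limA" unfolding w_def by (intro PsA dA)
  have wB: "w\<in>A.limB" by (rule A.limA_limB[OF wA])
  have Tw: "\<Theta> w = d" unfolding w_def by (rule ThPs[OF dB])
  obtain K \<alpha> where K: "K >= k" "\<alpha>\<in>dal n (S K)" "norm (w - A.emb K \<alpha>) < e"
   using A.limA_approx_ge[OF wA e, of k] by blast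
  obtain R F src tgt sg where f: "nfd n (S k) (S K) (incl \<iota> k K) R F src tgt sg"
   using A.nf_incl[OF K(1)] by (auto simp: nf_def)
  note D = nfdD[OF f]
  define R0 where "R0 = {r\<in>R. src r = cp (S k) a}"
  have R0: "r\<in>R" "src r = cp (S k) a" if "r\<in>R0" for r using that by (auto simp: R0_def)
  have fin: "finite R0" using D(1) by (simp add: R0_def)
  \<comment> \<open>The image of the diagonal unit at \<open>c\<close> under the single compression
    \<open>r\<close>. The cases of \<open>a\<close> and \<open>b\<close> give the projections
    between which \<open>C\<close> compresses.\<close>
  define pp where "pp c r = F r*mu c c*st (F r)" for c r
  have zm: "zc (S k) (cp (S k) a)*mu c c' = mu c c'" if "c < sz (S k)" "cp (S k) c = cp (S k) a" for c c'
   unfolding zc_def using that by (intro idm_mult) (auto intro!: spt_mu)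
  have mid: "st (F r)*(F q*(mu c c'*y)) = (if r = q then mu c c'*y else 0)"
   if "r\<in>R0" "q\<in>R0" "c < sz (S k)" "cp (S k) c = cp (S k) a" for r q c c' y
   using F_mid[OF f, of r q "mu c c'*y"] R0 that zm[OF that(3,4), of c'] by (auto simp flip: mult.assoc)
  have pp_proj: "proj (pp c r)" if "r\<in>R0" "c < sz (S k)" "cp (S k) c = cp (S k) a" for c r
   using mid[OF that(1,1) that(2,3)] by (simp add: proj_def pp_def st_mult mult.assoc mu_mult_mu_assoc)
  have pp_orth: "pp c r*pp c q = 0" if "r\<in>R0" "q\<in>R0" "r ~= q" "c < sz (S k)" "cp (S k) c = cp (S k) a" for c r q
   using mid[OF that(1,2) that(4,5)] that(3) by (simp add: pp_def mult.assoc)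
  have pp_spt: "spt (%v u. same_class (S K) v u & lb (S K) v = sg r (lb (S k) c)) (pp c r)"
   if "r\<in>R0" "c < sz (S k)" "cp (S k) c = cp (S k) a" for c r
  proof -
   note s = nf_col_spt[OF f R0(1)[OF that(1)], of c 0]
   have "pp c r = (F r*mu c 0)*st (F r*mu c 0)" by (simp add: pp_def st_mult mult.assoc mu_mult_mu_assoc)
   then show ?thesis using spt_mult[OF s spt_st[OF s]] by (auto simp: same_class_def same_cp_def)
  qed
  have pp_dal: "pp c r\<in>dal n (S K)" if "r\<in>R0" "c < sz (S k)" "cp (S k) c = cp (S k) a" for c r
   using pp_spt[OF that] A.stage[of K] unfolding dal_def
   by (auto simp: same_class_def same_cp_def ed_iff stage_def elim!: spt_mono)
  define P where "P c r = A.emb K (pp c r)" for c r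
  have PB: "P c r\<in>A.limB" if "r\<in>R0" "c < sz (S k)" "cp (S k) c = cp (S k) a" for c r
   unfolding P_def by (intro A.emb_limB dal_bal[OF pp_dal] that)
  have ppB: "pp c r\<in>bal (S K)" if "r\<in>R0" "c < sz (S k)" "cp (S k) c = cp (S k) a" for c r
   by (rule dal_bal[OF pp_dal[OF that]])
  have hom_proj: "proj (P c r)" "proj (\<Theta> (P c r))" if "r\<in>R0" "c < sz (S k)" "cp (S k) c = cp (S k) a" for c r
  proof -
   have "proj (A.emb K (pp c r))" using pp_proj[OF that] ppB[OF that] unfolding proj_def by (metis A.embD(2,4))
   then show "proj (P c r)" by (simp add: P_def)
   then show "proj (\<Theta> (P c r))" using PB[OF that] unfolding proj_def by (metis ThD(2,4))
  qed
  have hom_orth: "P c r*P c q = 0" "\<Theta> (P c r)*\<Theta> (P c q) = 0"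
   if "r\<in>R0" "q\<in>R0" "r ~= q" "c < sz (S k)" "cp (S k) c = cp (S k) a" for c r q
  proof -
   have "A.emb K (pp c r)*A.emb K (pp c q) = A.emb K (pp c r*pp c q)" using ppB that by (simp add: A.embD)
   then show "P c r*P c q = 0" using pp_orth[OF that] by (simp add: P_def A.embD)
   then show "\<Theta> (P c r)*\<Theta> (P c q) = 0" using PB that by (metis ThD(2,8))
  qed
  have comm: "B.PP j*\<Theta> (P c r) = \<Theta> (P c r)*B.PP j" if "r\<in>R0" "c < sz (S k)" "cp (S k) c = cp (S k) a" "j < 2*n" for c r j
   unfolding P_def using pp_dal[OF that(1-3)] projD(1)[OF pp_proj[OF that(1-3)]] that(4) by (intro diag_commute) auto
  define C where "C y = (\<Sum>r\<in>R0. \<Theta> (P a r)*y*\<Theta> (P b r))" for y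
  have Cn: "norm (C y) <= norm y" for y unfolding C_def by (rule norm_sum_corners_le[OF fin]) (use hom_proj hom_orth lt in auto)
  have Cx: "C (\<Theta> ?x) = \<Theta> ?x"
  proof -
   have "incl \<iota> k K (mu a b) = (\<Sum>r\<in>R. F r*mu a b*st (F r))" by (rule D(8)[OF m])
   also have "... = (\<Sum>r\<in>R0. F r*mu a b*st (F r))"
    unfolding R0_def by (rule sum.mono_neutral_right) (use D(1) in auto, metis nf_F_mu[OF f] mult_zero_left)
   finally have i: "incl \<iota> k K (mu a b) = (\<Sum>r\<in>R0. F r*mu a b*st (F r))" .
   have "pp a r*incl \<iota> k K (mu a b)*pp b r = F r*mu a b*st (F r)" if r: "r\<in>R0" for r
   proof -
    have "pp a r*incl \<iota> k K (mu a b) = (\<Sum>q\<in>R0. if q = r then F r*mu a b*st (F r) else 0)"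
     unfolding i sum_distrib_left using mid[OF r _ lt(1)]
     by (intro sum.cong refl) (auto simp: pp_def mult.assoc mu_mult_mu_assoc)
    then have "pp a r*incl \<iota> k K (mu a b) = F r*mu a b*st (F r)" using r fin by simp
    then show ?thesis using mid[OF r r, of b] lt by (simp add: pp_def mult.assoc mu_mult_mu_assoc)
   qed
   then have i2: "(\<Sum>r\<in>R0. pp a r*incl \<iota> k K (mu a b)*pp b r) = incl \<iota> k K (mu a b)"
    unfolding i by (intro sum.cong) auto
   have iB: "incl \<iota> k K (mu a b)\<in>bal (S K)" by (rule A.incl_facts(2)[OF K(1) m])
   have xe: "?x = A.emb K (incl \<iota> k K (mu a b))" by (rule A.emb_incl[OF K(1) m, symmetric])
   have "C (\<Theta> ?x) = (\<Sum>r\<in>R0. \<Theta> (P a r*?x*P b r))"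
    unfolding C_def using PB lt x A.limB_ops by (intro sum.cong refl) (simp add: ThD)
   also have "... = (\<Sum>r\<in>R0. \<Theta> (A.emb K (pp a r*incl \<iota> k K (mu a b)*pp b r)))"
    unfolding xe P_def using ppB lt iB by (intro sum.cong refl) (simp add: A.embD ssubD[OF ssub_bal])
   also have "... = \<Theta> (\<Sum>r\<in>R0. A.emb K (pp a r*incl \<iota> k K (mu a b)*pp b r))"
    by (rule shom_sum(1)[OF Th A.ssub_limB, symmetric]) (use ppB lt iB in "auto intro!: A.emb_limB ssubD[OF ssub_bal]")
   also have "(\<Sum>r\<in>R0. A.emb K (pp a r*incl \<iota> k K (mu a b)*pp b r)) = A.emb K (\<Sum>r\<in>R0. pp a r*incl \<iota> k K (mu a b)*pp b r)"
    by (rule shom_sum(1)[OF A.emb_shom ssub_bal, symmetric]) (use ppB lt iB in "auto intro!: ssubD[OF ssub_bal]")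
   finally show ?thesis by (simp add: i2 xe)
  qed
  have EC: "B.EE (C y) = C (B.EE y)" for y
  proof -
   have "B.EE (C y) = (\<Sum>j<2*n. \<Sum>r\<in>R0. (B.PP j*\<Theta> (P a r))*y*(\<Theta> (P b r)*B.PP j))"
    by (simp add: B.EE_def C_def sum_distrib_left sum_distrib_right mult.assoc)
   also have "... = (\<Sum>j<2*n. \<Sum>r\<in>R0. (\<Theta> (P a r)*B.PP j)*y*(B.PP j*\<Theta> (P b r)))"
    using comm lt by (intro sum.cong refl) simp
   also have "... = C (B.EE y)" by (subst sum.swap) (simp add: B.EE_def C_def sum_distrib_left sum_distrib_right mult.assoc)
   finally show ?thesis .
  qed
  have Cd: "norm (C d) <= e"
  proof -
   \<comment> \<open>The two projections sit at the positions to which \<open>sg r\<close> takes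
     those of \<open>a\<close> and \<open>b\<close>. Automorphisms reflect edges, so no entry of
     \<open>\<alpha>\<close> joins these positions.\<close>
   have p0: "pp a r*\<alpha>*pp b r = 0" if r: "r\<in>R0" for r
   proof -
    have s1: "spt (%v u. EX v'. lb (S K) v' = sg r (lb (S k) a) & (lb (S K) u, lb (S K) v')\<in>ed n) (pp a r*\<alpha>)"
     by (rule spt_mult[OF pp_spt[OF r lt(1) refl], of "%i j. same_cp (S K) i j & (lb (S K) j, lb (S K) i)\<in>ed n"])
      (use K(2) in \<open>auto simp: dal_def same_class_def\<close>)
    have n: "(sg r (lb (S k) b), sg r (lb (S k) a)) \<notin> ed n"
     using ab(2) aut_ed_iff[OF D(2)[OF R0(1)[OF r]]] lt A.stage[of k] by (auto simp: stage_def)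
    show ?thesis by (rule spt_mult_0[OF s1 pp_spt[OF r lt(2)]]) (use n lt in auto)
   qed
   define V where "V y = (\<Sum>r\<in>R0. P a r*y*P b r)" for y
   have "C d = \<Theta> (V w)" unfolding C_def V_def Tw[symmetric] using PB lt wB A.limB_ops
    by (subst shom_sum(1)[OF Th A.ssub_limB]) (auto simp: ThD)
   moreover have "V w\<in>A.limB" unfolding V_def using PB lt wB A.limB_ops by (intro shom_sum(2)[OF Th A.ssub_limB]) auto
   ultimately have "norm (C d) <= norm (V w)" using A.limB_contractive[OF Th] by simp
   also have "V w = V (w - A.emb K \<alpha>)"
   proof -
    have "P a r*A.emb K \<alpha>*P b r = 0" if r: "r\<in>R0" for r
    proof -
     have "P a r*A.emb K \<alpha>*P b r = A.emb K (pp a r*\<alpha>*pp b r)"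
      using ppB[OF r] lt dal_bal[OF K(2)] by (simp add: P_def A.embD ssubD[OF ssub_bal])
     then show ?thesis by (simp add: p0[OF r] A.embD)
    qed
    then show ?thesis by (simp add: V_def left_diff_distrib right_diff_distrib)
   qed
   also have "norm ... <= norm (w - A.emb K \<alpha>)"
    unfolding V_def by (rule norm_sum_corners_le[OF fin]) (use hom_proj hom_orth lt in auto)
   finally show ?thesis using K(3) by simp
  qed
  \<comment> \<open>\<open>C\<close> fixes \<open>\<Theta> ?x\<close> and commutes with the
    expectation, so it fixes the diagonal part. That part is close to \<open>d\<close>, and
    \<open>C d\<close> is small.\<close>
  have "B.EE (\<Theta> ?x) = C (B.EE (\<Theta> ?x) - d) + C d"
   using EC[of "\<Theta> ?x"] Cx by (simp add: C_def left_diff_distrib right_diff_distrib sum_subtractf)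
  then have "norm (B.EE (\<Theta> ?x)) <= norm (C (B.EE (\<Theta> ?x) - d)) + norm (C d)" by (metis norm_triangle_ineq)
  then show ?thesis using Cn[of "B.EE (\<Theta> ?x) - d"] Ed Cd by simp
 qed
 note bound = this
 have "norm (B.EE (\<Theta> ?x)) <= 0"
 proof (rule field_le_epsilon)
  fix e :: real assume "e > 0"
  then show "norm (B.EE (\<Theta> ?x)) <= 0 + e" using bound[of "e / 2"] by simp
 qed
 then show ?thesis by simp
qed

text \<open>Between distinct positions at least one direction is not an edge; the other direction
  follows by taking adjoints.\<close>

lemma offdiag:
 assumes ab: "same_cp (S k) a b" "lb (S k) a ~= lb (S k) b" and j: "j < 2*n"
 shows "B.PP j*\<Theta> (A.emb k (mu a b))*B.PP j = 0"
proof -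
 have "B.EE (\<Theta> (A.emb k (mu a b))) = 0"
 proof (cases "(lb (S k) b, lb (S k) a)\<in>ed n")
  case True
  then have n: "(lb (S k) a, lb (S k) b) \<notin> ed n" using ab ed_antisym by auto
  have ba: "same_cp (S k) b a" using ab same_cp_sym by blast
  have "\<Theta> (A.emb k (mu a b)) = st (\<Theta> (A.emb k (mu b a)))"
   using A.embD(4)[OF mu_bal[OF ba]] ThD(4)[OF A.emb_limB[OF mu_bal[OF ba]]] by simp
  moreover have "B.EE (st X) = st (B.EE X)" for X by (simp add: B.EE_def st_sum st_mult projD(1)[OF B.PP_proj] mult.assoc)
  ultimately show ?thesis using offdiag_aux[OF ba n] by simp
 qed (rule offdiag_aux[OF ab(1)])
 then have "B.PP j*B.EE (\<Theta> (A.emb k (mu a b))) = 0" by simp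
 moreover have "B.PP j*B.EE X = B.PP j*X*B.PP j" for X
 proof -
  have "B.PP j*B.EE X = (\<Sum>i<2*n. if i = j then B.PP j*X*B.PP j else 0)"
   unfolding B.EE_def sum_distrib_left using projD(2)[OF B.PP_proj] B.PP_orth
   by (intro sum.cong refl) (auto simp flip: mult.assoc)
  then show ?thesis using j by simp
 qed
 ultimately show ?thesis by simp
qed

text \<open>One cycle \<open>ob\<close> is chosen in the summand. The projections
  \<open>B.PP j\<close>, cut by the image of position \<open>i\<close> and transported to the corner
  of \<open>ob 0\<close>, satisfy \<open>cycle_projections\<close>: \<open>edge\<close> comes from
  \<open>limA_corner\<close> and \<open>distinct\<close> from \<open>offdiag\<close>. On the piece
  \<open>E c\<close> the isomorphism moves positions by \<open>\<sigma> c\<close>.\<close>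

lemma local_structure:
 assumes s: "s\<in>cp (S k) ` {..<sz (S k)}"
 obtains oo C E \<sigma> where "oo < sz (S k)" "cp (S k) oo = s" "finite (C :: (nat \<times> nat) set)"
  "!!c. c\<in>C ==> aut n (\<sigma> c)" "!!c. c\<in>C ==> proj (E c)" "!!c. c\<in>C ==> E c\<in>B.seqs"
  "!!c d. c\<in>C ==> d\<in>C ==> c ~= d ==> E c*E d = 0" "(\<Sum>c\<in>C. E c) = \<Theta> (A.emb k (mu oo oo))"
  "!!c a. c\<in>C ==> a < sz (S k) ==> cp (S k) a = s ==>
   B.PP (\<sigma> c (lb (S k) a))*(\<Theta> (A.emb k (mu a oo))*E c) = \<Theta> (A.emb k (mu a oo))*E c"
proof -
 have n1: "n >= 1" "n >= 3" using A.n3 by auto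
 have "EX v. v < sz (S k) & cp (S k) v = s & lb (S k) v = i" if "i < 2*n" for i
  using s A.stage[of k] that unfolding stage_def by blast
 then obtain ob where o: "!!i. i < 2*n ==> ob i < sz (S k) & cp (S k) (ob i) = s & lb (S k) (ob i) = i" by metis
 define ok where "ok a <-> a < sz (S k) & cp (S k) a = s" for a
 have oko: "ok (ob i)" if "i < 2*n" for i using o[OF that] by (simp add: ok_def)
 define e where "e a b = \<Theta> (A.emb k (mu a b))" for a b
 have sc: "same_cp (S k) a b" if "ok a" "ok b" for a b using that by (auto simp: ok_def same_cp_def)
 have mB: "mu a b\<in>bal (S k)" if "ok a" "ok b" for a b by (rule mu_bal[OF sc[OF that]])
 have ee: "e a b*e c d = (if b = c then e a d else 0)" if "ok a" "ok b" "ok c" "ok d" for a b c d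
 proof -
  have "e a b*e c d = \<Theta> (A.emb k (mu a b*mu c d))" using mB that by (simp add: e_def A.embD A.emb_limB flip: ThD)
  then show ?thesis by (simp add: e_def mu_mult_mu A.embD ThD)
 qed
 have eea: "e a b*(e c d*y) = (if b = c then e a d*y else 0)" if "ok a" "ok b" "ok c" "ok d" for a b c d y
  using ee[OF that] by (simp flip: mult.assoc)
 have se: "st (e a b) = e b a" if "ok a" "ok b" for a b
  using A.embD(4)[OF mB[OF that]] ThD(4)[OF A.emb_limB[OF mB[OF that]]] by (simp add: e_def)
 have eB: "e a b\<in>B.limB" if "ok a" "ok b" for a b unfolding e_def by (intro ThB A.emb_limB mB that)
 have eS: "e a b\<in>B.seqs" if "ok a" "ok b" for a b by (rule B.limB_seqs[OF eB[OF that]])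
 have comm: "B.PP j*e a b = e a b*B.PP j" if "ok a" "ok b" "lb (S k) a = lb (S k) b" "j < 2*n" for a b j unfolding e_def
 proof (rule diag_commute)
  have "lb (S k) a < 2*n" using that A.stage[of k] by (auto simp: ok_def stage_def)
  then have "(lb (S k) a, lb (S k) a)\<in>ed n" by (simp add: ed_iff)
  then show "mu a b\<in>dal n (S k)" "st (mu a b)\<in>dal n (S k)" using that by (auto intro!: mu_dal sc)
 qed (rule that)
 have corner: "B.PP i*e a b*B.PP j = 0" if "ok a" "ok b" "(lb (S k) b, lb (S k) a)\<in>ed n" "(j, i) \<notin> ed n" for a b i j
  unfolding e_def using that by (intro B.limA_corner ThA A.emb_limA mu_dal sc)
 have off: "B.PP j*e a b*B.PP j = 0" if "ok a" "ok b" "lb (S k) a ~= lb (S k) b" "j < 2*n" for a b j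
  unfolding e_def using that by (intro offdiag sc)
 define Q where "Q i j = e (ob 0) (ob i)*B.PP j*e (ob i) (ob 0)" for i j
 have l0: "0 < 2*n" using n1 by simp
 note ok0 = oko[OF l0]
 have QQ: "Q i' j'*Q i j = e (ob 0) (ob i')*(B.PP j'*e (ob i') (ob i)*B.PP j)*e (ob i) (ob 0)"
  if "i < 2*n" "i' < 2*n" for i i' j j' using eea[OF oko[OF that(2)] ok0 ok0 oko[OF that(1)]] by (simp add: Q_def mult.assoc)
 have PPe: "B.PP j'*e (ob i) (ob i)*B.PP j = (if j = j' then e (ob i) (ob i)*B.PP j else 0)" if "i < 2*n" "j' < 2*n" for i j j'
  using comm[OF oko[OF that(1)] oko[OF that(1)] refl that(2)] projD(2)[OF B.PP_proj] B.PP_orth by (auto simp: mult.assoc)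
 have Qz: "Q i j*Q i j' = 0" if "i < 2*n" "j ~= j'" for i j j'
 proof (cases "j < 2*n")
  case True
  then show ?thesis unfolding QQ[OF that(1,1)] PPe[OF that(1) True] using that by simp
 next
  case False
  \<comment> \<open>The positions of a stage are below 2 n, so a projection with a larger index is
    zero.\<close>
  have "B.PP j = cls (%_. 0)" unfolding B.PP_def
  proof (intro arg_cong[where f=cls] ext cm_eqI)
   fix m v w show "ent (pl (S' m) j) v w = ent 0 v w" using False B.stage[of m] by (auto simp: pl_def ent_idm stage_def)
  qed
  then show ?thesis by (simp add: Q_def cls_simps)
 qed
 interpret Q: cycle_projections n Q "e (ob 0) (ob 0)"
 proof
  show "n >= 3" by fact
  fix i j :: nat assume ij: "i < 2*n" "j < 2*n"
  have "Q i j*Q i j = e (ob 0) (ob i)*(e (ob i) (ob i)*B.PP j)*e (ob i) (ob 0)" unfolding QQ[OF ij(1,1)] PPe[OF ij] by simp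
  also have "... = Q i j" using eea[OF ok0 oko[OF ij(1)] oko[OF ij(1)] oko[OF ij(1)]] by (simp add: Q_def)
  finally have "Q i j*Q i j = Q i j" .
  then show "proj (Q i j)" unfolding proj_def
   using se ok0 oko[OF ij(1)] by (simp add: Q_def st_mult projD(1)[OF B.PP_proj] mult.assoc)
 next
  fix i j k' :: nat assume "i < 2*n" "j ~= k'" then show "Q i j*Q i k' = 0" by (rule Qz)
 next
  fix i assume i: "i < 2*n"
  have "(\<Sum>j<2*n. Q i j) = e (ob 0) (ob i)*((\<Sum>j<2*n. B.PP j)*e (ob i) (ob 0))"
   by (simp add: Q_def sum_distrib_left sum_distrib_right mult.assoc)
  then show "(\<Sum>j<2*n. Q i j) = e (ob 0) (ob 0)"
   using B.sum_PP(1)[OF eS[OF oko[OF i] ok0]] ee[OF ok0 oko[OF i] oko[OF i] ok0] by simp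
 next
  fix i i' j j' :: nat assume "(i, i')\<in>ed n" "j < 2*n" "j' < 2*n" "(j, j') \<notin> ed n"
  moreover from this have i: "i < 2*n" "i' < 2*n" by (auto simp: ed_iff)
  ultimately show "Q i' j'*Q i j = 0"
   unfolding QQ[OF i] using corner[OF oko[OF i(2)] oko[OF i(1)]] o[OF i(1)] o[OF i(2)] by simp
 next
  fix i i' j :: nat assume i: "i < 2*n" "i' < 2*n" "j < 2*n" "i ~= i'"
  then show "Q i' j*Q i j = 0"
   unfolding QQ[OF i(1,2)] using off[OF oko[OF i(2)] oko[OF i(1)] _ i(3)] o[OF i(1)] o[OF i(2)] by simp
 qed
 have "\<exists>\<sigma>. aut n \<sigma> & \<sigma> 0 = fst c & \<sigma> 1 = snd c" if "c\<in>Q.turns" for c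
 proof -
  from that have t: "nbr n (fst c) (snd c)" "even (fst c)" by (auto simp: Q.turns_def)
  from aut_ex[OF t n1(1)] show ?thesis by auto
 qed
 then obtain \<sigma> where \<sigma>: "!!c. c\<in>Q.turns ==> aut n (\<sigma> c) & \<sigma> c 0 = fst c & \<sigma> c 1 = snd c" by metis
 \<comment> \<open>\<open>a\<close> may be any index with the position of \<open>ob i\<close>; the
   unit between the two is diagonal and commutes with \<open>B.PP j\<close>.\<close>
 have eQ: "e a (ob 0)*Q i j = B.PP j*e a (ob 0)" if "ok a" "lb (S k) a = i" "i < 2*n" "j < 2*n" for a i j
 proof -
  have "e a (ob 0)*Q i j = (e a (ob 0)*e (ob 0) (ob i))*B.PP j*e (ob i) (ob 0)" by (simp add: Q_def mult.assoc)
  also have "e a (ob 0)*e (ob 0) (ob i) = e a (ob i)" using ee that oko by simp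
  also have "e a (ob i)*B.PP j = B.PP j*e a (ob i)" using comm[of a "ob i" j] that oko o by simp
  finally show ?thesis using ee that oko by (simp add: mult.assoc)
 qed
 show thesis
 proof (rule that[of "ob 0" Q.turns \<sigma> "%c. Q.E (fst c) (snd c)"])
  show "ob 0 < sz (S k)" "cp (S k) (ob 0) = s" using o[OF l0] by auto
  show "finite Q.turns" by (rule Q.finite_turns)
  show "(\<Sum>c\<in>Q.turns. Q.E (fst c) (snd c)) = \<Theta> (A.emb k (mu (ob 0) (ob 0)))"
   using Q.E_sum by (simp add: case_prod_unfold e_def)
  fix c assume c: "c\<in>Q.turns"
  then have lt: "fst c < 2*n" "snd c < 2*n" using Q.turnsD[of "fst c" "snd c"] by auto
  show "aut n (\<sigma> c)" using \<sigma>[OF c] by simp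
  show "proj (Q.E (fst c) (snd c))" by (rule Q.E_proj[OF lt])
  have "1 < 2*n" using n1 by simp
  then show "Q.E (fst c) (snd c)\<in>B.seqs"
   unfolding Q.E_def Q_def using eS oko by (intro ssubD[OF B.ssub_seqs] B.PP_seqs) auto
  {
   fix d assume d: "d\<in>Q.turns" "c ~= d"
   then have "fst d < 2*n" "snd d < 2*n" using Q.turnsD[of "fst d" "snd d"] by auto
   then show "Q.E (fst c) (snd c)*Q.E (fst d) (snd d) = 0" using Q.E_orth lt d by (simp add: prod_eq_iff)
  }
  fix a assume a: "a < sz (S k)" "cp (S k) a = s"
  then have i: "lb (S k) a < 2*n" using A.stage[of k] by (auto simp: stage_def)
  let ?i = "lb (S k) a"
  have le: "Q ?i (\<sigma> c ?i)*Q.E (fst c) (snd c) = Q.E (fst c) (snd c)"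
   using Q.E_le[of "\<sigma> c" ?i] \<sigma>[OF c] c i by simp
  have "B.PP (\<sigma> c ?i)*(e a (ob 0)*Q.E (fst c) (snd c)) = e a (ob 0)*Q ?i (\<sigma> c ?i)*Q.E (fst c) (snd c)"
   using eQ[of a ?i "\<sigma> c ?i"] a i aut_less[of n "\<sigma> c" ?i] \<sigma>[OF c] by (simp add: ok_def mult.assoc)
  also have "... = e a (ob 0)*Q.E (fst c) (snd c)" by (simp add: mult.assoc le)
  finally show "B.PP (\<sigma> c ?i)*(\<Theta> (A.emb k (mu a (ob 0)))*Q.E (fst c) (snd c)) = \<Theta> (A.emb k (mu a (ob 0)))*Q.E (fst c) (snd c)"
   by (simp add: e_def)
 qed
qed

end

section \<open>Exact rigid embeddings from approximate ones\<close>

lemma norm_mult3_le: "norm (x*y*z) <= norm x*norm y*norm (z :: 'a :: real_normed_algebra)"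
 by (meson norm_mult_ineq mult_right_mono norm_ge_zero order_trans)

lemma norm_sum_bound:
 assumes "!!i. i\<in>I ==> norm (f i) <= B" shows "norm (sum f I) <= real (card I)*B"
 using sum_norm_le[of I f "%_. B"] assms by simp

lemma ent_range_idm: "finite J ==> i\<in>J ==> mu a i*idm J*mu j b = (if i = j then mu a b else 0)"
 by (auto simp: mu_sandwich ent_idm)

text \<open>
 Given matrices \<open>x d a\<close> which behave up to \<open>\<delta>\<close> like the columns of matrix units of type \<open>d\<close>, with
 source projections close to \<open>g d\<close>: split the nearby projections into vectors, apply the \<open>x d a\<close>, and
 orthonormalize all resulting vectors at once by polar decomposition.
\<close>

lemma assemble:
 fixes n :: nat and S T :: stage and D :: "nat set" and src oo :: "nat => nat" and \<sigma> :: "nat => nat => nat"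
  and g :: "nat => cm" and x :: "nat => nat => cm" and y :: "nat => nat => cm" and \<delta> :: real
 defines "DA \<equiv> {(d, a). d\<in>D & a < sz S & cp S a = src d}"
 defines "M \<equiv> real (card DA)"
 assumes fin: "finite D" and src: "!!d. d\<in>D ==> src d\<in>cp S ` {..<sz S}" and aut: "!!d. d\<in>D ==> aut n (\<sigma> d)"
  and g: "!!d. d\<in>D ==> spt (%v w. same_cp T v w & lb T v = oo d & lb T w = oo d) (g d)" "!!d. d\<in>D ==> st (g d) = g d"
   "!!d. d\<in>D ==> norm (g d*g d - g d) <= \<delta>"
  and x: "!!d a. (d, a)\<in>DA ==> spt (%v w. same_cp T v w & lb T v = \<sigma> d (lb S a) & lb T w = oo d) (x d a)"
   "!!d a d' a'. (d, a)\<in>DA ==> (d', a')\<in>DA ==> norm (st (x d a)*x d' a' - (if d = d' & a = a' then g d else 0)) <= \<delta>"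
   "!!d a. (d, a)\<in>DA ==> norm (x d a) <= 2" "!!d a. (d, a)\<in>DA ==> norm (x d a*g d - x d a) <= \<delta>"
  and y: "!!a b. same_cp S a b ==> norm ((\<Sum>d\<in>{d\<in>D. src d = cp S a}. x d a*st (x d b)) - y a b) <= \<delta>"
   "!!a. a < sz S ==> norm (y a a) > 3*M*(10*\<delta>*M\<^sup>2 + 9*\<delta>) + \<delta>"
  and \<delta>: "\<delta> <= 1/8" "5*\<delta>*M\<^sup>2 <= 1/2"
 obtains \<phi> where "nf n S T \<phi>"
  "!!a b. same_cp S a b ==> norm (\<phi> (mu a b) - y a b) <= 3*M*(10*\<delta>*M\<^sup>2 + 9*\<delta>) + \<delta>"
proof -
 have finDA: "finite DA" unfolding DA_def by (rule finite_subset[of _ "D \<times> {..<sz S}"]) (use fin in auto)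
 have DAD: "d\<in>D" "a < sz S" "cp S a = src d" if "(d, a)\<in>DA" for d a using that by (auto simp: DA_def)
 have "EX p. proj p & norm (p - g d) <= 4*\<delta> & spt (%v w. same_cp T v w & lb T v = oo d & lb T w = oo d) p" if d: "d\<in>D" for d
 proof -
  have 1: "g d*pl T (oo d) = g d" unfolding pl_def by (rule mult_idm) (auto intro!: spt_mono[OF g(1)[OF d]] simp: same_cp_def)
  have 2: "spt (%v w. same_cp T v w & lb T v = oo d & lb T w = oo d) (pl T (oo d))"
   unfolding pl_def by (rule spt_mono[OF spt_idm]) (auto simp: same_cp_def)
  have 3: "proj (pl T (oo d))" by (simp add: pl_def proj_idm)
  obtain q where "proj q" "norm (q - g d) <= 4*\<delta>" "spt (%v w. same_cp T v w & lb T v = oo d & lb T w = oo d) q"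
   by (rule projection_near[OF 3 1 g(2)[OF d] g(3)[OF d] \<delta>(1) g(1)[OF d] 2]) (auto simp: same_cp_def)
  then show ?thesis by blast
 qed
 then have "\<forall>d\<in>D. EX p. proj p & norm (p - g d) <= 4*\<delta> & spt (%v w. same_cp T v w & lb T v = oo d & lb T w = oo d) p"
  by blast
 from bchoice[OF this] obtain p where p: "!!d. d\<in>D ==> proj (p d)" "!!d. d\<in>D ==> norm (p d - g d) <= 4*\<delta>"
  "!!d. d\<in>D ==> spt (%v w. same_cp T v w & lb T v = oo d & lb T w = oo d) (p d)" by blast
 let ?C = "%d. {v. v < sz T & lb T v = oo d}"
 have "EX q. onf (fst q) (fst (snd q)) (?C d) & p d = range_proj (fst q) (fst (snd q)) &
   (\<forall>i\<in>fst q. spt (%a b. cp T a = snd (snd q) i & b = 0) (fst (snd q) i))" if d: "d\<in>D" for d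
 proof -
  have s: "spt (%a b. a\<in>?C d & b\<in>?C d & cp T a = cp T b) (p d)"
   using p(3)[OF d] by (rule spt_mono) (auto simp: same_cp_def)
  have "\<exists>I f t. onf I f (?C d) & p d = range_proj I f & (\<forall>i\<in>I. spt (%a b. cp T a = t i & b = 0) (f i))"
   by (rule proj_eq_range_proj[OF finite_class p(1)[OF d] s], intro exI conjI ballI, assumption, assumption, blast)
  then obtain I f t where "onf I f (?C d)" "p d = range_proj I f" "\<forall>i\<in>I. spt (%a b. cp T a = t i & b = 0) (f i)"
   by auto
  then show ?thesis by (intro exI[of _ "(I, f, t)"]) simp
 qed
 then have "\<forall>d\<in>D. EX q. onf (fst q) (fst (snd q)) (?C d) & p d = range_proj (fst q) (fst (snd q)) &
   (\<forall>i\<in>fst q. spt (%a b. cp T a = snd (snd q) i & b = 0) (fst (snd q) i))" by blast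
 from bchoice[OF this] obtain q where q: "\<forall>d\<in>D. onf (fst (q d)) (fst (snd (q d))) (?C d) &
   p d = range_proj (fst (q d)) (fst (snd (q d))) &
   (\<forall>i\<in>fst (q d). spt (%a b. cp T a = snd (snd (q d)) i & b = 0) (fst (snd (q d)) i))" by blast
 define I where "I d = fst (q d)" for d
 define f where "f d = fst (snd (q d))" for d
 define t where "t d = snd (snd (q d))" for d
 have If: "!!d. d\<in>D ==> onf (I d) (f d) (?C d)" "!!d. d\<in>D ==> p d = range_proj (I d) (f d)"
  "!!d i. d\<in>D ==> i\<in>I d ==> spt (%a b. cp T a = t d i & b = 0) (f d i)" using q unfolding I_def f_def t_def by auto
 have finI: "finite (I d)" if "d\<in>D" for d using onfD(1)[OF If(1)[OF that]] .
 \<comment> \<open>A slot number for each triple of type, basis vector and source index, so that all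
   columns fit into one matrix \<open>X\<close>.\<close>
 define ix where "ix d i a = prod_encode (prod_encode (d, i), a)" for d i a
 have ix_eq: "ix d i a = ix d' i' a' <-> d = d' & i = i' & a = a'" for d i a d' i' a' by (simp add: ix_def)
 \<comment> \<open>\<open>V d a\<close> sends the slot of \<open>(d, i, a)\<close> to the basis
   vector \<open>f d i\<close>. Different \<open>V d a\<close> use different slots and each has
   range projection \<open>p d\<close> (\<open>VsV\<close>), so their source projections add up to
   \<open>J\<close>.\<close>
 define V where "V d a = (\<Sum>i\<in>I d. f d i*mu 0 (ix d i a))" for d a
 define IX where "IX = (\<Union>(d, a)\<in>DA. (%i. ix d i a) ` I d)"
 have finIX: "finite IX" unfolding IX_def using finDA finI DAD by auto
 define J where "J = idm IX"
 have VV: "st (V d a)*V d b = (\<Sum>i\<in>I d. mu (ix d i a) (ix d i b))" if d: "d\<in>D" for d a b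
 proof -
  have "st (V d a)*V d b = (\<Sum>i\<in>I d. \<Sum>j\<in>I d. mu (ix d i a) 0*(st (f d i)*f d j)*mu 0 (ix d j b))"
   by (simp add: V_def st_sum st_mult sum_product mult.assoc)
  also have "... = (\<Sum>i\<in>I d. \<Sum>j\<in>I d. if i = j then mu (ix d i a) (ix d i b) else 0)"
   by (intro sum.cong refl) (auto simp: onfD(4)[OF If(1)[OF d]] mu_mult_mu)
  finally show ?thesis using finI[OF d] by simp
 qed
 have pV: "p d*V d a = V d a" if d: "d\<in>D" for d a unfolding V_def sum_distrib_left If(2)[OF d]
  by (intro sum.cong refl) (simp add: range_proj_mult[OF If(1)[OF d]] flip: mult.assoc)
 have VsV: "V d a*st (V d' a') = (if d = d' & a = a' then p d else 0)" if "d\<in>D" "d'\<in>D" for d a d' a'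
 proof -
  have "V d a*st (V d' a') = (\<Sum>i\<in>I d. \<Sum>j\<in>I d'. f d i*(mu 0 (ix d i a)*mu (ix d' j a') 0)*st (f d' j))"
   by (simp add: V_def st_sum st_mult sum_product mult.assoc)
  also have "... = (\<Sum>i\<in>I d. \<Sum>j\<in>I d'. if d = d' & a = a' & i = j then f d i*st (f d i) else 0)"
   by (intro sum.cong refl) (auto simp: mu_mult_mu ix_eq onfD(5)[OF If(1)[OF that(2)]])
  also have "... = (if d = d' & a = a' then p d else 0)"
   using finI[OF that(1)] If(2)[OF that(1)] by (cases "d = d' & a = a'") (auto simp: range_proj_def)
  finally show ?thesis .
 qed
 have nV: "norm (V d a) <= 1" if "d\<in>D" for d a
  using partial_isometry_norm_le[of "st (V d a)"] VsV[OF that that, of a a] p(1)[OF that] by simp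
 have Jsum: "J = (\<Sum>(d, a)\<in>DA. st (V d a)*V d a)"
 proof -
  have "J = (\<Sum>q\<in>DA. idm ((%i. ix (fst q) i (snd q)) ` I (fst q)))" unfolding J_def IX_def case_prod_unfold
   by (rule sum_idm[symmetric]) (use finDA finI DAD in "auto simp: ix_eq")
  also have "... = (\<Sum>(d, a)\<in>DA. st (V d a)*V d a)"
  proof (intro sum.cong refl, clarsimp)
   fix d a assume "(d, a)\<in>DA"
   then show "idm ((%i. ix d i a) ` I d) = st (V d a)*V d a"
    unfolding idm_def by (subst sum.reindex) (auto simp: inj_on_def ix_eq VV DAD(1))
  qed
  finally show ?thesis .
 qed
 have VJ: "V d a*J = V d a" if da: "(d, a)\<in>DA" for d a
 proof -
  have "V d a*J = (\<Sum>i\<in>I d. f d i*(mu 0 (ix d i a)*J))" by (simp add: V_def sum_distrib_right mult.assoc)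
  also have "... = V d a" unfolding V_def
  proof (intro sum.cong refl)
   fix i assume "i\<in>I d"
   then have "ix d i a\<in>IX" using da by (auto simp: IX_def)
   then have "mu 0 (ix d i a)*J = mu 0 (ix d i a)" unfolding J_def by (intro mult_idm finIX spt_mu) auto
   then show "f d i*(mu 0 (ix d i a)*J) = f d i*mu 0 (ix d i a)" by simp
  qed
  finally show ?thesis .
 qed
 define X where "X = (\<Sum>(d, a)\<in>DA. x d a*V d a)"
 have XJ: "X*J = X" unfolding X_def sum_distrib_right by (intro sum.cong refl) (auto simp: mult.assoc VJ)
 \<comment> \<open>There are M^2 products of columns. Each is within \<delta> of \<open>g d\<close>
   or 0, and \<open>g d\<close> is within 4 \<delta> of \<open>p d\<close>.\<close>
 have XX: "norm (st X*X - J) <= 5*\<delta>*M\<^sup>2"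
 proof -
  let ?z = "%q r. st (x (fst q) (snd q))*x (fst r) (snd r) - (if q = r then p (fst q) else 0)"
  have "st X*X = (\<Sum>q\<in>DA. \<Sum>r\<in>DA. st (V (fst q) (snd q))*(st (x (fst q) (snd q))*x (fst r) (snd r))*V (fst r) (snd r))"
   unfolding X_def st_sum sum_product by (intro sum.cong refl) (auto simp: case_prod_unfold st_mult mult.assoc)
  moreover have "J = (\<Sum>q\<in>DA. \<Sum>r\<in>DA. if q = r then st (V (fst q) (snd q))*p (fst q)*V (fst q) (snd q) else 0)"
   unfolding Jsum using finDA DAD by (auto simp: mult.assoc pV intro!: sum.cong)
  ultimately have "st X*X - J = (\<Sum>q\<in>DA. \<Sum>r\<in>DA. st (V (fst q) (snd q))*?z q r*V (fst r) (snd r))"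
   by (simp add: right_diff_distrib left_diff_distrib flip: sum_subtractf) (intro sum.cong refl, auto)
  also have "norm ... <= M*(M*(5*\<delta>))" unfolding M_def
  proof (intro norm_sum_bound)
   fix q r assume qr: "q\<in>DA" "r\<in>DA"
   obtain d a d' a' where q: "q = (d, a)" "r = (d', a')" by (cases q, cases r)
   have in1: "d\<in>D" "d'\<in>D" using qr q DAD by auto
   have "norm (?z q r) <= 5*\<delta>"
   proof (cases "q = r")
    case True
    have "?z q r = (st (x d a)*x d a - g d) - (p d - g d)" using True q by simp
    then have "norm (?z q r) <= norm (st (x d a)*x d a - g d) + norm (p d - g d)" by (metis norm_triangle_ineq4)
    then show ?thesis using x(2)[of d a d a] qr q p(2)[OF in1(1)] by simp
   next
    case False
    have "0 <= \<delta>" using g(3)[OF in1(1)] norm_ge_zero order_trans by blast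
    then show ?thesis using x(2)[of d a d' a'] qr q False by auto
   qed
   moreover have "norm (st (V d a)*?z q r*V d' a') <= norm (st (V d a))*norm (?z q r)*norm (V d' a')" by (rule norm_mult3_le)
   moreover have "... <= 1*norm (?z q r)*1" using nV in1 by (intro mult_mono) auto
   ultimately show "norm (st (V (fst q) (snd q))*?z q r*V (fst r) (snd r)) <= 5*\<delta>" using q by simp
  qed
  finally show ?thesis by (simp add: power2_eq_square mult_ac)
 qed
 obtain N where N: "bnd N X" using bnd_ex by blast
 obtain U Y where U: "st U*U = J" "norm (U - X) <= 2*(5*\<delta>*M\<^sup>2)" and
  "Y 0 = X" "!!n. Y (Suc n) = nstep (Y n)" "Y \<longlonglongrightarrow> U"
  using polar_part[OF _ XJ XX \<delta>(2) N] proj_idm[of IX] unfolding J_def by auto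
 note P = nstep_limit_induct[OF this(3-5)]
 \<comment> \<open>A slot determines the summand and the position of its column. This pattern
   satisfies the closure condition of \<open>spt_nstep\<close>, so orthonormalization respects
   it.\<close>
 define \<kappa> where "\<kappa> v k <-> v < sz T & (EX d i a. k = ix d i a & (d, a)\<in>DA & i\<in>I d & cp T v = t d i & lb T v = \<sigma> d (lb S a))" for v k
 have sV: "spt (%v k. v < sz T & (\<exists>i\<in>I d. k = ix d i a & cp T v = t d i)) (V d a)" if d: "d\<in>D" for d a
  unfolding V_def
 proof (rule spt_sum)
  fix i assume i: "i\<in>I d"
  have s: "spt (%v b. v < sz T & cp T v = t d i) (f d i)" using onfD(3)[OF If(1)[OF d] i] If(3)[OF d i] by (auto simp: spt_def)
  show "spt (%v k. v < sz T & (\<exists>i\<in>I d. k = ix d i a & cp T v = t d i)) (f d i*mu 0 (ix d i a))"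
   by (rule spt_mult[OF s spt_mu[of "%b k. k = ix d i a"]]) (use i in auto)
 qed
 have sX: "spt \<kappa> X" unfolding X_def
 proof (rule spt_sum, clarsimp)
  fix d a assume da: "(d, a)\<in>DA"
  show "spt \<kappa> (x d a*V d a)"
   by (rule spt_mult[OF x(1)[OF da] sV[OF DAD(1)[OF da]]]) (use da in \<open>auto simp: \<kappa>_def same_cp_def\<close>)
 qed
 have sU: "spt \<kappa> U"
 proof (rule P[where P = "spt \<kappa>", OF sX])
  fix Y assume "spt \<kappa> Y" then show "spt \<kappa> (nstep Y)" by (rule spt_nstep) (auto simp: \<kappa>_def ix_eq)
 qed (rule spt_lim)
 define R where "R = prod_encode ` (SIGMA d:D. I d)"
 \<comment> \<open>If \<open>r\<close> codes \<open>(d, i)\<close>, then the slot of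
   \<open>(d, i, a)\<close> codes \<open>(r, a)\<close>, and \<open>F r\<close> takes the index
   \<open>a\<close> to the column of \<open>U\<close> in this slot.\<close>
 define F where "F r = (\<Sum>a\<in>{a. a < sz S & cp S a = src (fst (prod_decode r))}. U*mu (prod_encode (r, a)) a)" for r
 define tg where "tg r = t (fst (prod_decode r)) (snd (prod_decode r))" for r
 define \<phi> where "\<phi> z = (\<Sum>r\<in>R. F r*z*st (F r))" for z
 have finR: "finite R" unfolding R_def using fin finI by auto
 have RE: "EX d i. r = prod_encode (d, i) & d\<in>D & i\<in>I d" if "r\<in>R" for r using that by (auto simp: R_def)
 have Fcol: "F (prod_encode (d, i))*mu a b = (if a < sz S & cp S a = src d then U*mu (ix d i a) b else 0)" for d i a b
 proof -
  have "F (prod_encode (d, i))*mu a b = (\<Sum>c\<in>{c. c < sz S & cp S c = src d}. if c = a then U*mu (ix d i a) b else 0)"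
   unfolding F_def sum_distrib_right by (intro sum.cong refl) (auto simp: mult.assoc mu_mult_mu ix_def)
  then show ?thesis by auto
 qed
 have \<phi>mu: "\<phi> (mu a b) = (\<Sum>d\<in>{d\<in>D. src d = cp S a}. (U*st (V d a))*st (U*st (V d b)))" if ab: "same_cp S a b" for a b
 proof -
  have lt: "a < sz S" "b < sz S" "cp S b = cp S a" using ab by (auto simp: same_cp_def)
  have "\<phi> (mu a b) = (\<Sum>q\<in>(SIGMA d:D. I d). F (prod_encode q)*mu a b*st (F (prod_encode q)))"
   unfolding \<phi>_def R_def by (subst sum.reindex) (auto simp: inj_on_def prod_encode_eq)
  also have "... = (\<Sum>d\<in>D. \<Sum>i\<in>I d. F (prod_encode (d, i))*mu a b*st (F (prod_encode (d, i))))"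
   using fin finI by (subst sum.Sigma) (auto simp: case_prod_unfold)
  also have "... = (\<Sum>d\<in>D. if src d = cp S a then U*(st (V d a)*V d b)*st U else 0)"
  proof (intro sum.cong refl)
   fix d assume d: "d\<in>D"
   have "F (prod_encode (d, i))*mu a b*st (F (prod_encode (d, i))) = 
     (if src d = cp S a then U*mu (ix d i a) (ix d i b)*st U else 0)" for i
   proof -
    have "F (prod_encode (d, i))*mu a b*st (F (prod_encode (d, i))) = (F (prod_encode (d, i))*mu a b)*st (F (prod_encode (d, i))*mu b b)"
     by (simp add: st_mult mult.assoc mu_mult_mu_assoc)
    also have "... = (if src d = cp S a then U*mu (ix d i a) (ix d i b)*st U else 0)"
     unfolding Fcol using lt by (auto simp: st_mult mult.assoc mu_mult_mu_assoc)
    finally show ?thesis .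
   qed
   then show "(\<Sum>i\<in>I d. F (prod_encode (d, i))*mu a b*st (F (prod_encode (d, i)))) =
     (if src d = cp S a then U*(st (V d a)*V d b)*st U else 0)"
    using VV[OF d] by (simp add: sum_distrib_left sum_distrib_right)
  qed
  also have "... = (\<Sum>d\<in>{d\<in>D. src d = cp S a}. U*(st (V d a)*V d b)*st U)" using fin by (simp add: sum.inter_filter)
  finally show ?thesis by (simp add: st_mult mult.assoc)
 qed
 have nU: "norm U <= 1" by (rule partial_isometry_norm_le) (simp add: U(1) J_def proj_idm)
 have M0: "0 <= M" by (simp add: M_def)
 have close: "norm (\<phi> (mu a b) - y a b) <= 3*M*(10*\<delta>*M\<^sup>2 + 9*\<delta>) + \<delta>" if ab: "same_cp S a b" for a b
 proof -
  have lt: "a < sz S" "b < sz S" "cp S b = cp S a" using ab by (auto simp: same_cp_def)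
  \<comment> \<open>The error of one column: 10 \<delta> M^2 from the polar decomposition, 8
    \<delta> from replacing \<open>g d\<close> by \<open>p d\<close> next to \<open>x d a\<close> of
    norm at most 2, and \<delta> from \<open>x d a*g d\<close>. A product of two columns costs three
    times this, as the other factor has norm 1 or 2.\<close>
  let ?D = "{d\<in>D. src d = cp S a}" and ?\<eta> = "10*\<delta>*M\<^sup>2 + 9*\<delta>"
  have u: "norm (U*st (V d c) - x d c) <= ?\<eta>" "norm (U*st (V d c)) <= 1" if dc: "(d, c)\<in>DA" for d c
  proof -
   note d = DAD(1)[OF dc]
   have Xs: "X*st (V d c) = x d c*p d"
   proof -
    have "X*st (V d c) = (\<Sum>q\<in>DA. if q = (d, c) then x d c*p d else 0)" unfolding X_def sum_distrib_right
     by (intro sum.cong refl) (auto simp: case_prod_unfold mult.assoc VsV DAD(1) d split: if_splits)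
    then show ?thesis using dc finDA by simp
   qed
   have "U*st (V d c) - x d c = (U - X)*st (V d c) + x d c*(p d - g d) + (x d c*g d - x d c)"
    using Xs by (simp add: left_diff_distrib right_diff_distrib)
   also have "norm ... <= norm (U - X)*norm (st (V d c)) + norm (x d c)*norm (p d - g d) + norm (x d c*g d - x d c)"
    by (intro norm_triangle_mono norm_mult_ineq order_refl)
   also have "... <= (2*(5*\<delta>*M\<^sup>2))*1 + 2*(4*\<delta>) + \<delta>"
    using U(2) nV[OF d] x(3,4)[OF dc] p(2)[OF d] order_trans[OF norm_ge_zero XX]
    by (intro add_mono mult_mono) (auto intro: order_trans[OF norm_ge_zero])
   finally show "norm (U*st (V d c) - x d c) <= ?\<eta>" by simp
   have "norm (U*st (V d c)) <= norm U*norm (st (V d c))" by (rule norm_mult_ineq)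
   also have "... <= 1*1" using nU nV[OF d] by (intro mult_mono) auto
   finally show "norm (U*st (V d c)) <= 1" by simp
  qed
  have D1: "(d, a)\<in>DA" "(d, b)\<in>DA" if "d\<in>?D" for d using that lt by (auto simp: DA_def)
  have "norm ((\<Sum>d\<in>?D. (U*st (V d a))*st (U*st (V d b)) - x d a*st (x d b))) <= real (card ?D)*(3*?\<eta>)"
  proof (rule norm_sum_bound)
   fix d assume d: "d\<in>?D"
   let ?u = "U*st (V d a)" and ?v = "U*st (V d b)"
   have "?u*st ?v - x d a*st (x d b) = ?u*st (?v - x d b) + (?u - x d a)*st (x d b)"
    by (simp add: st_diff left_diff_distrib right_diff_distrib)
   also have "norm ... <= norm ?u*norm (st (?v - x d b)) + norm (?u - x d a)*norm (st (x d b))"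
    by (intro norm_triangle_mono norm_mult_ineq)
   also have "... <= 1*?\<eta> + ?\<eta>*2" using u[OF D1(1)[OF d]] u[OF D1(2)[OF d]] x(3)[OF D1(2)[OF d]]
    by (intro add_mono mult_mono) (auto intro: order_trans[OF norm_ge_zero])
   finally show "norm (?u*st ?v - x d a*st (x d b)) <= 3*?\<eta>" by simp
  qed
  also have "... <= M*(3*?\<eta>)"
  proof (cases "?D = {}")
   case False
   then obtain d where d: "d\<in>?D" by blast
   have "0 <= ?\<eta>" using u(1)[OF D1(1)[OF d]] norm_ge_zero order_trans by blast
   moreover have "card ?D <= card DA" by (rule card_inj_on_le[of "%d. (d, a)"]) (use D1 finDA in "auto simp: inj_on_def")
   ultimately show ?thesis unfolding M_def by (intro mult_right_mono) auto
  next
   case True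
   have "0 <= \<delta>" using y(1)[OF ab] norm_ge_zero order_trans by blast
   then have "0 <= M*(3*?\<eta>)" using M0 by simp
   then show ?thesis using True by (simp only: card.empty of_nat_0 mult_zero_left)
  qed
  finally have 1: "norm (\<phi> (mu a b) - (\<Sum>d\<in>?D. x d a*st (x d b))) <= M*(3*?\<eta>)"
   by (simp add: \<phi>mu[OF ab] sum_subtractf)
  have "norm (\<phi> (mu a b) - y a b) <= norm (\<phi> (mu a b) - (\<Sum>d\<in>?D. x d a*st (x d b))) +
    norm ((\<Sum>d\<in>?D. x d a*st (x d b)) - y a b)"
   using norm_triangle_ineq[of "\<phi> (mu a b) - (\<Sum>d\<in>?D. x d a*st (x d b))" "(\<Sum>d\<in>?D. x d a*st (x d b)) - y a b"] by simp
  then show ?thesis using 1 y(1)[OF ab] by (simp add: mult.assoc mult.left_commute)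
 qed
 have "nfd n S T \<phi> R F (%r. src (fst (prod_decode r))) tg (%r. \<sigma> (fst (prod_decode r)))" unfolding nfd_def
 proof (intro conjI ballI allI impI finR)
  fix r assume "r\<in>R"
  then obtain d i where r: "r = prod_encode (d, i)" "d\<in>D" "i\<in>I d" using RE by blast
  show "aut n (\<sigma> (fst (prod_decode r)))" "src (fst (prod_decode r))\<in>cp S ` {..<sz S}" using r aut src by auto
  show "spt (%v a. a < sz S & v < sz T & cp S a = src (fst (prod_decode r)) & cp T v = tg r &
    lb T v = \<sigma> (fst (prod_decode r)) (lb S a)) (F r)" unfolding F_def
  proof (rule spt_sum)
   fix a assume a: "a\<in>{a. a < sz S & cp S a = src (fst (prod_decode r))}"
   show "spt (%v a. a < sz S & v < sz T & cp S a = src (fst (prod_decode r)) & cp T v = tg r &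
     lb T v = \<sigma> (fst (prod_decode r)) (lb S a)) (U*mu (prod_encode (r, a)) a)"
    by (rule spt_mult[OF sU spt_mu[of "%k b. k = prod_encode (r, a) & b = a"]])
     (use a r in \<open>auto simp: \<kappa>_def ix_def prod_encode_eq tg_def\<close>)
  qed
  fix q assume "q\<in>R"
  then obtain d' i' where q: "q = prod_encode (d', i')" "d'\<in>D" "i'\<in>I d'" using RE by blast
  let ?A = "%d. {a. a < sz S & cp S a = src d}"
  have "st (F r)*F q = (\<Sum>a\<in>?A d. \<Sum>b\<in>?A d'. mu a (ix d i a)*(st U*U)*mu (ix d' i' b) b)"
   using r q by (simp add: F_def st_sum st_mult sum_product mult.assoc ix_def)
  also have "... = (\<Sum>a\<in>?A d. \<Sum>b\<in>?A d'. if r = q & a = b then mu a a else 0)"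
  proof (intro sum.cong refl)
   fix a b assume "a\<in>?A d" "b\<in>?A d'"
   then have i: "ix d i a\<in>IX" using r by (force simp: IX_def DA_def)
   show "mu a (ix d i a)*(st U*U)*mu (ix d' i' b) b = (if r = q & a = b then mu a a else 0)"
    unfolding U(1) J_def ent_range_idm[OF finIX i] using r q by (auto simp: ix_eq)
  qed
  also have "... = (if r = q then zc S (src d) else 0)" using r q by (cases "r = q") (auto simp: zc_def idm_def prod_encode_eq)
  finally show "st (F r)*F q = (if r = q then zc S (src (fst (prod_decode r))) else 0)" using r by auto
 next
  fix a assume a: "a < sz S"
  then have aa: "same_cp S a a" by (simp add: same_cp_def)
  \<comment> \<open>If no compression started in the summand of \<open>a\<close>, then
    \<open>\<phi> (mu a a)\<close> would vanish, although \<open>y a a\<close> is larger than the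
    approximation error.\<close>
  show "\<exists>r\<in>R. src (fst (prod_decode r)) = cp S a"
  proof (rule ccontr)
   assume c: "~ ?thesis"
   have "F r*mu a a = 0" if rR: "r\<in>R" for r
   proof -
    obtain d i where r: "r = prod_encode (d, i)" "d\<in>D" "i\<in>I d" using RE[OF rR] by blast
    then have "src d ~= cp S a" using c rR by auto
    then show ?thesis using r Fcol[of d i a a] by auto
   qed
   then have "\<phi> (mu a a) = 0" by (simp add: \<phi>_def)
   then show False using close[OF aa] y(2)[OF a] by simp
  qed
 qed (simp add: \<phi>_def)
 then show thesis using close by (intro that[of \<phi>] nfI)
qed

lemma eventually_close:
 assumes "bd u" "bd v" "cls u = cls v" "e > 0" shows "EVT l. norm (u l - v l) < e"
proof -
 have "norm (cls (%l. u l - v l)) = 0" by (simp add: assms(3) flip: cls_simps(2)[OF assms(1,2)])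
 then show ?thesis using norm_cls_less[OF bd_diff[OF assms(1,2)], of e] assms(4) by simp
qed

text \<open>For an element of \<open>limB\<close> the single entries of a representative carry
  information: from some index on they stay close to the images of one approximant at a fixed
  stage.\<close>

lemma (in tower) emb_representative:
 assumes y: "bd y" "!!k. y k\<in>bal (S k)" "cls y\<in>limB" and e: "e > 0" shows "EVT l. norm (emb l (y l) - cls y) < e"
proof -
 obtain K z where z: "z\<in>bal (S K)" "norm (cls y - emb K z) < e / 2" using limB_approx[OF y(3), of "e / 2"] e by auto
 have "cls y - emb K z = cls (%l. y l - eseq K z l)" by (simp add: emb_def cls_simps y eseq_bd z)
 then have "EVT l. norm (y l - eseq K z l) < e / 2"
  using norm_cls_less[OF bd_diff[OF y(1) eseq_bd[OF z(1)]], of "e / 2"] z by simp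
 then have "EVT l. norm (y l - eseq K z l) < e / 2 & K <= l" by (intro eventually_conj eventually_ge_at_top)
 then show ?thesis
 proof eventually_elim
  fix l assume l: "norm (y l - eseq K z l) < e / 2 & K <= l"
  then have q: "eseq K z l = incl \<iota> K l z" "incl \<iota> K l z\<in>bal (S l)" using incl_facts(2) z by (auto simp: eseq_def)
  have "norm (emb l (y l) - emb K z) = norm (emb l (y l - incl \<iota> K l z))"
   using l q y(2)[of l] z(1) by (simp add: embD emb_incl)
  also have "... < e / 2" using l q y(2)[of l] by (simp add: norm_emb ssubD[OF ssub_bal])
  finally show "norm (emb l (y l) - cls y) < e"
   using z(2) norm_triangle_ineq[of "emb l (y l) - emb K z" "emb K z - cls y"] by (simp add: norm_minus_commute)
 qed
qed

context tower_iso
begin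

lemma swap: "tower_iso n S' \<iota>' S \<iota> \<Psi> \<Theta>" by unfold_locales (fact Ps Th PsB ThB PsA ThA ThPs PsTh)+

lemma Th_norm: "X\<in>A.limB ==> norm (\<Theta> X) = norm X"
 using A.limB_contractive[OF Th] B.limB_contractive[OF Ps ThB] PsTh by (metis order_antisym)

lemma Ps_norm: "Y\<in>B.limB ==> norm (\<Psi> Y) = norm Y" using Th_norm[OF PsB] ThPs by simp

text \<open>The pieces of \<open>local_structure\<close> for all source summands are numbered by
  \<open>D\<close>. They satisfy in the limit exactly the relations that \<open>assemble\<close>
  needs approximately. Compressing representatives to the prescribed positions makes the supports
  exact, and at a late index the finitely many norm relations hold up to \<delta>.\<close>

lemma approx_nf:
 assumes e: "e > 0"
 obtains l \<phi> where "l >= L" "nf n (S k) (S' l) \<phi>"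
  "!!a b. same_cp (S k) a b ==> norm (B.emb l (\<phi> (mu a b)) - \<Theta> (A.emb k (mu a b))) < e"
proof -
 define CS where "CS = cp (S k) ` {..<sz (S k)}"
 define LS where "LS s oo C E \<sigma> <-> oo < sz (S k) & cp (S k) oo = s & finite (C :: (nat \<times> nat) set) &
  (\<forall>c\<in>C. aut n (\<sigma> c) & proj (E c) & E c\<in>B.seqs & (\<forall>d\<in>C. c ~= d --> E c*E d = 0) &
   (\<forall>a<sz (S k). cp (S k) a = s --> B.PP (\<sigma> c (lb (S k) a))*(\<Theta> (A.emb k (mu a oo))*E c) = \<Theta> (A.emb k (mu a oo))*E c)) &
  (\<Sum>c\<in>C. E c) = \<Theta> (A.emb k (mu oo oo))" for s oo C E \<sigma>
 have "\<exists>oo C E \<sigma>. LS s oo C E \<sigma>" if "s\<in>CS" for s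
 proof (rule local_structure[OF that[unfolded CS_def]])
  fix oo C E \<sigma>
  assume a: "oo < sz (S k)" "cp (S k) oo = s" "finite (C :: (nat \<times> nat) set)"
   "!!c. c\<in>C ==> aut n (\<sigma> c)" "!!c. c\<in>C ==> proj (E c)" "!!c. c\<in>C ==> E c\<in>B.seqs"
   "!!c d. c\<in>C ==> d\<in>C ==> c ~= d ==> E c*E d = 0" "(\<Sum>c\<in>C. E c) = \<Theta> (A.emb k (mu oo oo))"
   "!!c a. c\<in>C ==> a < sz (S k) ==> cp (S k) a = s ==>
    B.PP (\<sigma> c (lb (S k) a))*(\<Theta> (A.emb k (mu a oo))*E c) = \<Theta> (A.emb k (mu a oo))*E c"
  have "LS s oo C E \<sigma>" unfolding LS_def by (intro conjI ballI allI impI) ((rule a, assumption+) | rule a)+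
  then show "\<exists>oo C E \<sigma>. LS s oo C E \<sigma>" by blast
 qed
 then have "ALL s. \<exists>oo C E \<sigma>. s\<in>CS --> LS s oo C E \<sigma>" by blast
 then obtain oo C E \<sigma> where LS: "!!s. s\<in>CS ==> LS s (oo s) (C s) (E s) (\<sigma> s)" by metis
 define src where "src d = fst (prod_decode d)" for d
 define cc where "cc d = prod_decode (snd (prod_decode d))" for d
 define D where "D = (%(s, c). prod_encode (s, prod_encode c)) ` (SIGMA s:CS. C s)"
 have dD: "src d\<in>CS" "cc d\<in>C (src d)" if "d\<in>D" for d using that by (auto simp: D_def src_def cc_def)
 have dinj: "d = d'" if "src d = src d'" "cc d = cc d'" for d d'
 proof -
  have "snd (prod_decode d) = snd (prod_decode d')" using arg_cong[OF that(2), of prod_encode] by (simp add: cc_def)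
  then have "prod_decode d = prod_decode d'" using that(1) by (simp add: src_def prod_eq_iff)
  then show ?thesis by fastforce
 qed
 have finD: "finite D" unfolding D_def using LS by (intro finite_imageI finite_SigmaI) (auto simp: CS_def LS_def)
 define od where "od d = oo (src d)" for d
 define sg where "sg d = \<sigma> (src d) (cc d)" for d
 define Ed where "Ed d = E (src d) (cc d)" for d
 define lo where "lo d = sg d (lb (S k) (od d))" for d
 note LSd = LS[OF dD(1), unfolded LS_def]
 have F: "od d < sz (S k)" "cp (S k) (od d) = src d" "aut n (sg d)" "proj (Ed d)" "Ed d\<in>B.seqs" if "d\<in>D" for d
  using LSd[OF that] dD(2)[OF that] by (auto simp: od_def sg_def Ed_def)
 have FP: "B.PP (sg d (lb (S k) a))*(\<Theta> (A.emb k (mu a (od d)))*Ed d) = \<Theta> (A.emb k (mu a (od d)))*Ed d"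
  if "d\<in>D" "a < sz (S k)" "cp (S k) a = src d" for d a
  using LSd[OF that(1)] dD(2)[OF that(1)] that by (auto simp: od_def sg_def Ed_def)
 have Eo: "Ed d*Ed d' = (if d = d' then Ed d else 0)" if "d\<in>D" "d'\<in>D" "src d = src d'" for d d'
 proof (cases "d = d'")
  case False
  then have "cc d ~= cc d'" using dinj that by blast
  then show ?thesis using False LSd[OF that(1)] dD(2)[OF that(1)] dD(2)[OF that(2)] that(3) by (simp add: Ed_def)
 qed (use projD(2)[OF F(4)[OF that(1)]] in simp)
 have Esum: "(\<Sum>d\<in>{d\<in>D. src d = s}. h d) = (\<Sum>c\<in>C s. h (prod_encode (s, prod_encode c)))" if "s\<in>CS" for h :: "nat => lmat" and s
 proof -
  have "{d\<in>D. src d = s} = (%c. prod_encode (s, prod_encode c)) ` C s" using that by (auto simp: D_def src_def)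
  then show ?thesis by (simp add: sum.reindex inj_on_def)
 qed
 have Etot: "(\<Sum>d\<in>{d\<in>D. src d = s}. Ed d) = \<Theta> (A.emb k (mu (oo s) (oo s)))" if "s\<in>CS" for s
  unfolding Esum[OF that] using LS[OF that] by (simp add: LS_def Ed_def src_def cc_def)
 define eu where "eu a b = \<Theta> (A.emb k (mu a b))" for a b
 define ok where "ok a <-> a < sz (S k)" for a
 have mB: "mu a b\<in>bal (S k)" if "ok a" "ok b" "cp (S k) a = cp (S k) b" for a b
  using that by (intro mu_bal) (auto simp: ok_def same_cp_def)
 have ee: "eu a b*eu c d = (if b = c then eu a d else 0)"
  if "ok a" "ok b" "ok c" "ok d" "cp (S k) a = cp (S k) b" "cp (S k) c = cp (S k) d" for a b c d
 proof -
  have "eu a b*eu c d = \<Theta> (A.emb k (mu a b*mu c d))" using mB that by (simp add: eu_def A.embD A.emb_limB flip: ThD)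
  then show ?thesis by (simp add: eu_def mu_mult_mu A.embD ThD)
 qed
 have se: "st (eu a b) = eu b a" if "ok a" "ok b" "cp (S k) a = cp (S k) b" for a b
  using A.embD(4)[OF mB[OF that]] ThD(4)[OF A.emb_limB[OF mB[OF that]]] by (simp add: eu_def)
 have eB: "eu a b\<in>B.limB" if "ok a" "ok b" "cp (S k) a = cp (S k) b" for a b
  unfolding eu_def by (intro ThB A.emb_limB mB that)
 have okod: "ok (od d)" "cp (S k) (od d) = src d" if "d\<in>D" for d using F(1,2)[OF that] by (auto simp: ok_def)
 have IE: "eu (od d) (od d)*Ed d = Ed d" if d: "d\<in>D" for d
 proof -
  have "eu (od d) (od d) = (\<Sum>d'\<in>{d'\<in>D. src d' = src d}. Ed d')" using Etot[OF dD(1)[OF d]] by (simp add: eu_def od_def)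
  then have "eu (od d) (od d)*Ed d = (\<Sum>d'\<in>{d'\<in>D. src d' = src d}. if d' = d then Ed d else 0)"
   unfolding sum_distrib_right by (simp add: sum_distrib_right) (intro sum.cong refl, use Eo d in auto)
  then show ?thesis using d finD by simp
 qed
 \<comment> \<open>The transport of the piece \<open>Ed d\<close> to the index \<open>a\<close>: the
   column of the image matrix units that belongs to the piece \<open>d\<close>.\<close>
 define Tm where "Tm d a = eu a (od d)*Ed d" for d a
 define DA where "DA = {(d, a). d\<in>D & a < sz (S k) & cp (S k) a = src d}"
 have DAD: "d\<in>D" "ok a" "cp (S k) a = src d" if "(d, a)\<in>DA" for d a using that by (auto simp: DA_def ok_def)
 have finDA: "finite DA" unfolding DA_def by (rule finite_subset[of _ "D \<times> {..<sz (S k)}"]) (use finD in auto)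
 have PE: "B.PP (lo d)*Ed d = Ed d" "Ed d*B.PP (lo d) = Ed d" if d: "d\<in>D" for d
 proof -
  show 1: "B.PP (lo d)*Ed d = Ed d" using FP[OF d F(1,2)[OF d]] IE[OF d] by (simp add: lo_def eu_def)
  show "Ed d*B.PP (lo d) = Ed d"
   using arg_cong[OF 1, of st] projD(1)[OF F(4)[OF d]] projD(1)[OF B.PP_proj] by (simp add: st_mult)
 qed
 have PT: "B.PP (sg d (lb (S k) a))*Tm d a*B.PP (lo d) = Tm d a" if da: "(d, a)\<in>DA" for d a
  using FP[of d a] da PE(2)[OF DAD(1)[OF da]] by (simp add: DA_def Tm_def eu_def mult.assoc)
 have TT: "st (Tm d a)*Tm d' a' = (if d = d' & a = a' then Ed d else 0)" if da: "(d, a)\<in>DA" "(d', a')\<in>DA" for d a d' a'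
 proof -
  note x = DAD[OF da(1)] DAD[OF da(2)] okod[OF DAD(1)[OF da(1)]] okod[OF DAD(1)[OF da(2)]]
  have "st (Tm d a)*Tm d' a' = Ed d*(eu (od d) a*eu a' (od d'))*Ed d'"
   using x se projD(1)[OF F(4)] by (simp add: Tm_def st_mult mult.assoc)
  also have "... = (if a = a' then Ed d*(eu (od d) (od d')*Ed d') else 0)"
   using x ee[of "od d" a a' "od d'"] by (simp add: mult.assoc)
  also have "... = (if d = d' & a = a' then Ed d else 0)"
  proof (cases "a = a'")
   case True
   then have s: "src d = src d'" using x by simp
   then show ?thesis using True IE[OF x(4)] Eo[OF x(1,4) s] by (simp add: od_def)
  qed simp
  finally show ?thesis .
 qed
 have Tsum: "(\<Sum>d\<in>{d\<in>D. src d = cp (S k) a}. Tm d a*st (Tm d b)) = eu a b" if ab: "same_cp (S k) a b" for a b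
 proof -
  let ?s = "cp (S k) a"
  have lt: "ok a" "ok b" "cp (S k) b = ?s" "?s\<in>CS" using ab by (auto simp: same_cp_def ok_def CS_def)
  have oo: "ok (oo ?s)" "cp (S k) (oo ?s) = ?s" using LS[OF lt(4)] by (auto simp: LS_def ok_def)
  have "(\<Sum>d\<in>{d\<in>D. src d = ?s}. Tm d a*st (Tm d b)) = (\<Sum>d\<in>{d\<in>D. src d = ?s}. eu a (oo ?s)*Ed d*eu (oo ?s) b)"
  proof (intro sum.cong refl)
   fix d assume "d\<in>{d\<in>D. src d = ?s}"
   then have d: "d\<in>D" "src d = ?s" by auto
   have EE: "Ed d*(Ed d*z) = Ed d*z" for z using projD(2)[OF F(4)[OF d(1)]] by (simp flip: mult.assoc)
   show "Tm d a*st (Tm d b) = eu a (oo ?s)*Ed d*eu (oo ?s) b"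
    using d lt oo se[of b "oo ?s"] projD(1)[OF F(4)[OF d(1)]] by (simp add: Tm_def od_def st_mult mult.assoc EE)
  qed
  also have "... = eu a (oo ?s)*eu (oo ?s) (oo ?s)*eu (oo ?s) b"
   using Etot[OF lt(4)] by (simp add: eu_def sum_distrib_left[symmetric] sum_distrib_right[symmetric])
  also have "... = eu a b" using ee lt oo by simp
  finally show ?thesis .
 qed
 have TS: "Tm d a\<in>B.seqs" if da: "(d, a)\<in>DA" for d a unfolding Tm_def
  by (rule ssubD(3)[OF B.ssub_seqs B.limB_seqs[OF eB]])
   (use DAD[OF da] okod[OF DAD(1)[OF da]] F(5)[OF DAD(1)[OF da]] in auto)
 have "EX z. d\<in>D --> Ed d = cls z & bd z & (ALL k. z k\<in>bal (S' k))" for d using F(5)[of d] by (metis B.seqsE)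
 then obtain z where z: "!!d. d\<in>D ==> Ed d = cls (z d) & bd (z d) & (ALL k. z d k\<in>bal (S' k))" by metis
 have "EX w. (d, a)\<in>DA --> Tm d a = cls w & bd w & (ALL k. w k\<in>bal (S' k))" for d a using TS[of d a] by (metis B.seqsE)
 then obtain w where w: "!!d a. (d, a)\<in>DA ==> Tm d a = cls (w d a) & bd (w d a) & (ALL k. w d a k\<in>bal (S' k))" by metis
 have "EX y. same_cp (S k) a b --> eu a b = cls y & bd y & (ALL k. y k\<in>bal (S' k))" for a b
  using B.limB_seqs[OF eB, of a b] unfolding ok_def same_cp_def by (metis B.seqsE)
 then obtain y where y: "!!a b. same_cp (S k) a b ==> eu a b = cls (y a b) & bd (y a b) & (ALL k. y a b k\<in>bal (S' k))" by metis
 \<comment> \<open>Taking the self-adjoint part and compressing to position \<open>lo d\<close> does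
   not change the class, since \<open>Ed d\<close> is self-adjoint and absorbed by
   \<open>B.PP (lo d)\<close>.\<close>
 define hz where "hz d l = (1/2) *\<^sub>R (z d l + st (z d l))" for d l
 define g where "g d l = pl (S' l) (lo d)*hz d l*pl (S' l) (lo d)" for d l
 define x where "x d a l = pl (S' l) (sg d (lb (S k) a))*w d a l*pl (S' l) (lo d)" for d a l
 have pls: "spt (%v w. same_cp (S' l) v w & lb (S' l) v = i & lb (S' l) w = j) (pl (S' l) i*q*pl (S' l) j)"
  if "q\<in>bal (S' l)" for i j q l using that by (auto simp: spt_def bal_def ent_pl_mult_pl same_cp_def)
 have gc: "bd (g d)" "cls (g d) = Ed d" "st (g d l) = g d l" 
  "spt (%v w. same_cp (S' l) v w & lb (S' l) v = lo d & lb (S' l) w = lo d) (g d l)" if d: "d\<in>D" for d l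
 proof -
  note zd = z[OF d]
  have hz: "hz d = (%l. csc (of_real (1/2)) (z d l + st (z d l)))" by (rule ext) (simp only: hz_def csc_real)
  have b: "bd (%l. z d l + st (z d l))" using zd by (intro bd_add bd_st) auto
  have h: "bd (hz d)" unfolding hz by (rule bd_csc[OF b])
  show "bd (g d)" unfolding g_def by (intro bd_mult B.bd_pl h)
  have "cls (hz d) = csc (of_real (1/2)) (cls (z d) + st (cls (z d)))"
   unfolding hz cls_simps(4)[OF b, symmetric] using zd bd_st[of "z d"] by (simp only: cls_simps)
  also have "... = Ed d" using zd projD(1)[OF F(4)[OF d]] by (metis csc_real scaleR_half_double)
  finally have c: "cls (hz d) = Ed d" .
  have "cls (g d) = B.PP (lo d)*cls (hz d)*B.PP (lo d)"
   unfolding g_def B.PP_def using h by (simp add: cls_simps B.bd_pl bd_mult)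
  then show "cls (g d) = Ed d" using c PE[OF d] by simp
  have "st (hz d l) = hz d l" by (simp add: hz_def st_scaleR st_add)
  then show "st (g d l) = g d l" using projD(1)[OF proj_idm] by (simp add: g_def st_mult pl_def mult.assoc)
  have "hz d l\<in>bal (S' l)" unfolding hz_def using zd by (intro ssubD[OF ssub_bal]) auto
  then show "spt (%v w. same_cp (S' l) v w & lb (S' l) v = lo d & lb (S' l) w = lo d) (g d l)" unfolding g_def by (rule pls)
 qed
 have xc: "bd (x d a)" "cls (x d a) = Tm d a"
  "spt (%v w. same_cp (S' l) v w & lb (S' l) v = sg d (lb (S k) a) & lb (S' l) w = lo d) (x d a l)" if da: "(d, a)\<in>DA" for d a l
 proof -
  note wd = w[OF da]
  show "bd (x d a)" unfolding x_def using wd by (intro bd_mult B.bd_pl) auto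
  have "cls (x d a) = B.PP (sg d (lb (S k) a))*cls (w d a)*B.PP (lo d)"
   unfolding x_def B.PP_def using wd by (simp add: cls_simps B.bd_pl bd_mult)
  then show "cls (x d a) = Tm d a" using wd PT[OF da] by simp
  show "spt (%v w. same_cp (S' l) v w & lb (S' l) v = sg d (lb (S k) a) & lb (S' l) w = lo d) (x d a l)"
   unfolding x_def using wd by (intro pls) auto
 qed
 define M where "M = real (card DA)"
 \<comment> \<open>\<open>\<delta>*K\<close> is the error bound of \<open>assemble\<close>. The
   first two terms of \<delta> are required there; the third bounds the error by \<epsilon>. As
   \<epsilon> is at most e / 2, two such errors fit into \<open>e\<close>; as it is at most 1/4, the
   entries \<open>y a a l\<close> have norm above 3/4, more than the error.\<close>
 define K where "K = 3*M*(10*M\<^sup>2 + 9) + 1"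
 define \<epsilon> where "\<epsilon> = min (e / 2) (1/4)"
 define \<delta> where "\<delta> = min (1/8) (min (1 / (10*(M\<^sup>2 + 1))) (\<epsilon> / K))"
 have M0: "M >= 0" by (simp add: M_def)
 have K: "K >= 1" using M0 by (simp add: K_def)
 have \<epsilon>: "\<epsilon> > 0" using e by (simp add: \<epsilon>_def)
 have M2: "M\<^sup>2 + 1 > 0" by (simp add: add_nonneg_pos)
 have \<delta>: "\<delta> > 0" "\<delta> <= 1/8" "5*\<delta>*M\<^sup>2 <= 1/2" "\<delta>*K <= \<epsilon>"
 proof -
  show d0: "\<delta> > 0" using \<epsilon> K M2 by (auto simp: \<delta>_def)
  show "\<delta> <= 1/8" unfolding \<delta>_def by (rule min.cobounded1)
  have "\<delta> <= 1 / (10*(M\<^sup>2 + 1))" by (simp add: \<delta>_def)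
  then have "\<delta>*(10*(M\<^sup>2 + 1)) <= 1" using M2 by (simp add: pos_le_divide_eq)
  then show "5*\<delta>*M\<^sup>2 <= 1/2" using d0 by (simp add: algebra_simps)
  have "\<delta> <= \<epsilon> / K" by (simp add: \<delta>_def)
  then show "\<delta>*K <= \<epsilon>" using K by (simp add: pos_le_divide_eq)
 qed
 have bound: "3*M*(10*\<delta>*M\<^sup>2 + 9*\<delta>) + \<delta> = \<delta>*K" by (simp add: K_def algebra_simps)
 have ev1: "EVT l. \<forall>d\<in>D. norm (g d l*g d l - g d l) < \<delta>"
 proof (rule eventually_ball_finite[OF finD], rule ballI)
  fix d assume d: "d\<in>D"
  show "EVT l. norm (g d l*g d l - g d l) < \<delta>"
   using gc[OF d] projD(2)[OF F(4)[OF d]] by (intro eventually_close bd_mult \<delta>) (simp_all flip: cls_simps)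
 qed
 have ev2: "EVT l. \<forall>q\<in>DA. \<forall>r\<in>DA. norm (st (x (fst q) (snd q) l)*x (fst r) (snd r) l - (if q = r then g (fst q) l else 0)) < \<delta>"
 proof (intro eventually_ball_finite[OF finDA] ballI)
  fix q r assume qr: "q\<in>DA" "r\<in>DA"
  then have i: "(fst q, snd q)\<in>DA" "(fst r, snd r)\<in>DA" by auto
  have t: "cls (%l. st (x (fst q) (snd q) l)*x (fst r) (snd r) l) = (if q = r then Ed (fst q) else 0)"
   using xc[OF i(1)] xc[OF i(2)] TT[OF i] by (auto simp: bd_st prod_eq_iff simp flip: cls_simps)
  have t2: "bd (%l. if q = r then g (fst q) l else 0)" "cls (%l. if q = r then g (fst q) l else 0) = (if q = r then Ed (fst q) else 0)"
   using gc(1,2)[OF DAD(1)[OF i(1)]] by (cases "q = r"; simp add: bd_zero cls_simps)+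
  show "EVT l. norm (st (x (fst q) (snd q) l)*x (fst r) (snd r) l - (if q = r then g (fst q) l else 0)) < \<delta>"
   by (rule eventually_close[of "%l. st (x (fst q) (snd q) l)*x (fst r) (snd r) l"])
    (use xc[OF i(1)] xc[OF i(2)] t t2 \<delta> in \<open>auto intro!: bd_mult bd_st\<close>)
 qed
 have ev3: "EVT l. \<forall>q\<in>DA. norm (x (fst q) (snd q) l) < 2 & norm (x (fst q) (snd q) l*g (fst q) l - x (fst q) (snd q) l) < \<delta>"
 proof (intro eventually_ball_finite[OF finDA] ballI eventually_conj)
  fix q assume "q\<in>DA"
  then have i: "(fst q, snd q)\<in>DA" by auto
  have "proj (st (Tm (fst q) (snd q))*Tm (fst q) (snd q))" using TT[OF i i] F(4)[OF DAD(1)[OF i]] by simp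
  from partial_isometry_norm_le[OF this]
  show "EVT l. norm (x (fst q) (snd q) l) < 2" using xc[OF i] by (intro norm_cls_less) auto
  have "Tm (fst q) (snd q)*Ed (fst q) = Tm (fst q) (snd q)"
   using projD(2)[OF F(4)[OF DAD(1)[OF i]]] by (simp add: Tm_def mult.assoc)
  then show "EVT l. norm (x (fst q) (snd q) l*g (fst q) l - x (fst q) (snd q) l) < \<delta>"
   using xc[OF i] gc[OF DAD(1)[OF i]] by (intro eventually_close bd_mult \<delta>) (simp_all flip: cls_simps)
 qed
 define AB where "AB = {(a, b). same_cp (S k) a b}"
 have finAB: "finite AB" by (rule finite_subset[of _ "{..<sz (S k)} \<times> {..<sz (S k)}"]) (auto simp: AB_def same_cp_def)
 have ev4: "EVT l. \<forall>q\<in>AB.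
   norm ((\<Sum>d\<in>{d\<in>D. src d = cp (S k) (fst q)}. x d (fst q) l*st (x d (snd q) l)) - y (fst q) (snd q) l) < \<delta> &
   norm (B.emb l (y (fst q) (snd q) l) - cls (y (fst q) (snd q))) < \<epsilon>"
 proof (intro eventually_ball_finite[OF finAB] ballI eventually_conj)
  fix q assume "q\<in>AB"
  then obtain a b where q: "q = (a, b)" and ab: "same_cp (S k) a b" by (auto simp: AB_def)
  note yy = y[OF ab]
  let ?D = "{d\<in>D. src d = cp (S k) a}"
  have i: "(d, a)\<in>DA" "(d, b)\<in>DA" if "d\<in>?D" for d using that ab by (auto simp: DA_def same_cp_def)
  have b: "bd (%l. x d a l*st (x d b l))" if "d\<in>?D" for d using xc(1)[OF i(1)[OF that]] xc(1)[OF i(2)[OF that]] by (intro bd_mult bd_st)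
  have "(\<Sum>d\<in>?D. cls (%l. x d a l*st (x d b l))) = (\<Sum>d\<in>?D. Tm d a*st (Tm d b))"
   using xc i by (intro sum.cong refl) (simp add: bd_st flip: cls_simps)
  then have s: "cls (%l. \<Sum>d\<in>?D. x d a l*st (x d b l)) = cls (y a b)" "bd (%l. \<Sum>d\<in>?D. x d a l*st (x d b l))"
   using B.sum_cls[of ?D "%d l. x d a l*st (x d b l)"] b finD Tsum[OF ab] yy by auto
  show "EVT l. norm ((\<Sum>d\<in>{d\<in>D. src d = cp (S k) (fst q)}. x d (fst q) l*st (x d (snd q) l)) - y (fst q) (snd q) l) < \<delta>"
   using eventually_close[OF s(2) _ s(1) \<delta>(1)] yy q by simp
  have "eu a b\<in>B.limB" using ab by (intro eB) (auto simp: ok_def same_cp_def)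
  then show "EVT l. norm (B.emb l (y (fst q) (snd q) l) - cls (y (fst q) (snd q))) < \<epsilon>"
   using yy q \<epsilon> by (intro B.emb_representative) auto
 qed
 have "EVT l. l >= L" by simp
 from eventually_happens'[OF sequentially_bot eventually_conj[OF this eventually_conj[OF ev1 eventually_conj[OF ev2 eventually_conj[OF ev3 ev4]]]]]
 obtain l where l0: "l >= L" and l1: "\<forall>d\<in>D. norm (g d l*g d l - g d l) < \<delta>"
  and l2: "\<forall>q\<in>DA. \<forall>r\<in>DA. norm (st (x (fst q) (snd q) l)*x (fst r) (snd r) l - (if q = r then g (fst q) l else 0)) < \<delta>"
  and l3: "\<forall>q\<in>DA. norm (x (fst q) (snd q) l) < 2 & norm (x (fst q) (snd q) l*g (fst q) l - x (fst q) (snd q) l) < \<delta>"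
  and l4: "\<forall>q\<in>AB. norm ((\<Sum>d\<in>{d\<in>D. src d = cp (S k) (fst q)}. x d (fst q) l*st (x d (snd q) l)) - y (fst q) (snd q) l) < \<delta> &
   norm (B.emb l (y (fst q) (snd q) l) - cls (y (fst q) (snd q))) < \<epsilon>" by auto
 have l: "l >= L" "!!d. d\<in>D ==> norm (g d l*g d l - g d l) < \<delta>"
  "!!d a d' a'. (d, a)\<in>DA ==> (d', a')\<in>DA ==> norm (st (x d a l)*x d' a' l - (if d = d' & a = a' then g d l else 0)) < \<delta>"
  "!!d a. (d, a)\<in>DA ==> norm (x d a l) < 2" "!!d a. (d, a)\<in>DA ==> norm (x d a l*g d l - x d a l) < \<delta>"
  "!!a b. same_cp (S k) a b ==> norm ((\<Sum>d\<in>{d\<in>D. src d = cp (S k) a}. x d a l*st (x d b l)) - y a b l) < \<delta>"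
  "!!a b. same_cp (S k) a b ==> norm (B.emb l (y a b l) - cls (y a b)) < \<epsilon>"
 proof -
  fix d a d' a' assume "(d, a)\<in>DA" "(d', a')\<in>DA"
  from bspec[OF bspec[OF l2 this(1)] this(2)]
  show "norm (st (x d a l)*x d' a' l - (if d = d' & a = a' then g d l else 0)) < \<delta>" by auto
 next
  fix d a assume "(d, a)\<in>DA"
  from bspec[OF l3 this] show "norm (x d a l) < 2" "norm (x d a l*g d l - x d a l) < \<delta>" by auto
 next
  fix a b assume "same_cp (S k) a b"
  then have "(a, b)\<in>AB" by (simp add: AB_def)
  from bspec[OF l4 this] show "norm ((\<Sum>d\<in>{d\<in>D. src d = cp (S k) a}. x d a l*st (x d b l)) - y a b l) < \<delta>"
   "norm (B.emb l (y a b l) - cls (y a b)) < \<epsilon>" by auto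
 qed (use l0 l1 in auto)
 have yl: "norm (y a a l) > 3*M*(10*\<delta>*M\<^sup>2 + 9*\<delta>) + \<delta>" if a: "a < sz (S k)" for a
 proof -
  have aa: "same_cp (S k) a a" using a by (simp add: same_cp_def)
  have "norm (cls (y a a)) = norm (mu a a)" using y[OF aa] Th_norm[OF A.emb_limB[OF mu_bal[OF aa]]] A.norm_emb[OF mu_bal[OF aa]] by (simp add: eu_def)
  then have "1 < norm (B.emb l (y a a l)) + \<epsilon>"
   using l(7)[OF aa] norm_triangle_ineq2[of "cls (y a a)" "B.emb l (y a a l)"] by (simp add: norm_minus_commute)
  moreover have "norm (B.emb l (y a a l)) = norm (y a a l)" using y[OF aa] by (intro B.norm_emb) auto
  moreover have "\<epsilon> <= 1/4" by (simp add: \<epsilon>_def)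
  ultimately show ?thesis using \<delta>(4) unfolding bound by simp
 qed
 obtain \<phi> where \<phi>: "nf n (S k) (S' l) \<phi>"
  "!!a b. same_cp (S k) a b ==> norm (\<phi> (mu a b) - y a b l) <= 3*M*(10*\<delta>*M\<^sup>2 + 9*\<delta>) + \<delta>"
 proof (rule assemble[of D src "S k" n sg "S' l" lo "%d. g d l" \<delta> "%d a. x d a l" "%a b. y a b l", folded DA_def, folded M_def])
  show "finite D" by (rule finD)
  show "src d\<in>cp (S k) ` {..<sz (S k)}" if "d\<in>D" for d using dD(1)[OF that] by (simp add: CS_def)
  show "aut n (sg d)" if "d\<in>D" for d using F(3)[OF that] .
  show "\<delta> <= 1/8" "5*\<delta>*M\<^sup>2 <= 1/2" using \<delta> by auto
  show "norm (y a a l) > 3*M*(10*\<delta>*M\<^sup>2 + 9*\<delta>) + \<delta>" if "a < sz (S k)" for a using yl[OF that] .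
  show "norm (st (x d a l)*x d' a' l - (if d = d' & a = a' then g d l else 0)) <= \<delta>" if "(d, a)\<in>DA" "(d', a')\<in>DA" for d a d' a'
   using l(3)[OF that] by simp
  show "norm (x d a l) <= 2" "norm (x d a l*g d l - x d a l) <= \<delta>" if "(d, a)\<in>DA" for d a
   using l(4,5)[OF that] by auto
  show "norm ((\<Sum>d\<in>{d\<in>D. src d = cp (S k) a}. x d a l*st (x d b l)) - y a b l) <= \<delta>" if "same_cp (S k) a b" for a b
   using l(6)[OF that] by simp
  show "norm (g d l*g d l - g d l) <= \<delta>" if "d\<in>D" for d using l(2)[OF that] by simp
  show "st (g d l) = g d l" "spt (%v w. same_cp (S' l) v w & lb (S' l) v = lo d & lb (S' l) w = lo d) (g d l)" if "d\<in>D" for d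
   using gc(3,4)[OF that] by auto
  show "spt (%v w. same_cp (S' l) v w & lb (S' l) v = sg d (lb (S k) a) & lb (S' l) w = lo d) (x d a l)" if "(d, a)\<in>DA" for d a
   using xc(3)[OF that] .
  fix \<phi> assume "nf n (S k) (S' l) \<phi>"
   "!!a b. same_cp (S k) a b ==> norm (\<phi> (mu a b) - y a b l) <= 3*M*(10*\<delta>*M\<^sup>2 + 9*\<delta>) + \<delta>"
  then show thesis by (rule that)
 qed
 show thesis
 proof (rule that[OF l(1) \<phi>(1)])
  fix a b assume ab: "same_cp (S k) a b"
  obtain R F' src' tgt' sg' where f: "nfd n (S k) (S' l) \<phi> R F' src' tgt' sg'" using \<phi>(1) by (auto simp: nf_def)
  have b: "\<phi> (mu a b)\<in>bal (S' l)" "y a b l\<in>bal (S' l)" using nf_bal[OF f mu_bal[OF ab]] y[OF ab] by auto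
  have "norm (B.emb l (\<phi> (mu a b)) - B.emb l (y a b l)) = norm (\<phi> (mu a b) - y a b l)"
   using b by (simp add: B.norm_emb ssubD[OF ssub_bal] flip: B.embD)
  also have "... <= \<epsilon>" using \<phi>(2)[OF ab] \<delta>(4) unfolding bound by simp
  finally have "norm (B.emb l (\<phi> (mu a b)) - \<Theta> (A.emb k (mu a b))) < \<epsilon> + \<epsilon>"
   using l(7)[OF ab] y[OF ab] norm_triangle_ineq[of "B.emb l (\<phi> (mu a b)) - B.emb l (y a b l)" "B.emb l (y a b l) - \<Theta> (A.emb k (mu a b))"]
   by (simp add: eu_def)
  then show "norm (B.emb l (\<phi> (mu a b)) - \<Theta> (A.emb k (mu a b))) < e" by (simp add: \<epsilon>_def split: if_splits)
 qed
qed

end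

section \<open>The intertwining diagram\<close>

lemma one_proj: "proj (one T)" by (simp add: one_def proj_idm)

lemma dun_bal: "dun T u ==> u\<in>bal T" by (auto simp: dun_def bal_def same_class_def elim: spt_mono)

lemma dun_mult: "dun T u ==> dun T v ==> dun T (u*v)"
proof -
 assume u: "dun T u" and v: "dun T v"
 have "spt (same_class T) (u*v)" by (rule spt_mult[of "same_class T" _ "same_class T"])
   (use u v in "auto simp: dun_def same_class_def same_cp_def")
 moreover have "st (u*v)*(u*v) = st v*((st u*u)*v)" by (simp add: st_mult mult.assoc)
 moreover have "u*v*st (u*v) = u*((v*st v)*st u)" by (simp add: st_mult mult.assoc)
 ultimately show ?thesis using u v one_unit[OF dun_bal[OF v]] one_unit[OF ssubD(5)[OF ssub_bal dun_bal[OF u]]]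
  by (simp add: dun_def)
qed

lemma dun_st: "dun T u ==> dun T (st u)"
 using spt_st[of "same_class T" u] by (auto simp: dun_def same_class_def same_cp_def elim!: spt_mono)

lemma dun_one: "dun T (one T)"
 using projD[OF one_proj] by (auto simp: dun_def) (auto simp: one_def same_class_def same_cp_def intro!: spt_mono[OF spt_idm])

text \<open>A block unitary of \<open>S\<close> is mapped to a block unitary of \<open>T\<close> after adding the complement of the image of the unit.\<close>

lemma nf_extend_unitary:
 assumes "nf n S T \<psi>" "dun S w"
 obtains w' where "dun T w'" "!!x. x\<in>bal S ==> st w'*\<psi> (w*x*st w)*w' = \<psi> x"
proof -
 obtain R F src tgt sg where f: "nfd n S T \<psi> R F src tgt sg" using assms(1) by (auto simp: nf_def)
 note h = shomD[OF nf_shom[OF f] ssub_bal]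
 note b = nf_bal[OF f]
 have w: "w\<in>bal S" "st w*w = one S" "w*st w = one S" using assms(2) dun_bal by (auto simp: dun_def)
 have sw: "st w\<in>bal S" using w by (intro ssubD[OF ssub_bal])
 define P where "P = \<psi> (one S)"
 have P: "P\<in>bal T" "st P = P" "P*P = P"
  using b[OF one_bal] projD[OF one_proj] h(4)[OF one_bal] h(2)[OF one_bal one_bal] unfolding P_def by auto
 have Pw: "P*\<psi> x = \<psi> x" "\<psi> x*P = \<psi> x" if "x\<in>bal S" for x
  using h(2)[OF one_bal that] h(2)[OF that one_bal] one_unit[OF that] by (auto simp: P_def)
 have ww: "st (\<psi> w)*\<psi> w = P" "\<psi> w*st (\<psi> w) = P"
  using h(2)[OF sw w(1)] h(2)[OF w(1) sw] h(4)[OF w(1)] w by (auto simp: P_def)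
 define w' where "w' = \<psi> w + (one T - P)"
 have o: "one T*P = P" "P*one T = P" "one T*\<psi> w = \<psi> w" "\<psi> w*one T = \<psi> w"
  "one T*st (\<psi> w) = st (\<psi> w)" "st (\<psi> w)*one T = st (\<psi> w)" "one T*one T = one T" "st (one T) = one T"
  using one_unit[OF P(1)] one_unit[OF b[OF w(1)]] one_unit[OF ssubD(5)[OF ssub_bal b[OF w(1)]]] projD[OF one_proj] by auto
 have Ps: "P*st (\<psi> w) = st (\<psi> w)" "st (\<psi> w)*P = st (\<psi> w)" using Pw[OF sw] h(4)[OF w(1)] by auto
 have sc: "spt (same_class T) P" "spt (same_class T) (\<psi> w)" "spt (same_class T) (one T)"
  unfolding P_def using nf_same_class[OF f] dun_one assms(2) by (auto simp: dun_def)
 have "dun T w'" unfolding dun_def w'_def by (intro conjI spt_add spt_diff sc)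
   (simp_all add: st_add st_diff P o Ps Pw[OF w(1)] ww distrib_left distrib_right left_diff_distrib right_diff_distrib)
 moreover have "st w'*\<psi> (w*x*st w)*w' = \<psi> x" if x: "x\<in>bal S" for x
 proof -
  have e: "\<psi> (w*x*st w) = \<psi> w*\<psi> x*st (\<psi> w)" using x w by (simp add: h ssubD[OF ssub_bal])
  have "st w'*\<psi> w = P" "st (\<psi> w)*w' = P"
   by (simp_all add: w'_def st_add st_diff P o Ps Pw[OF w(1)] ww distrib_left distrib_right left_diff_distrib right_diff_distrib)
  moreover have "st w'*\<psi> (w*x*st w)*w' = (st w'*\<psi> w)*\<psi> x*(st (\<psi> w)*w')"
   unfolding e by (simp only: mult.assoc)
  ultimately show ?thesis using Pw[OF x] by simp
 qed
 ultimately show thesis by (rule that)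
qed

context tower_iso
begin

text \<open>The maps of the diagram drift away from \<open>\<Theta>\<close>, because every step
  corrects by a unitary. The invariant is closeness of a diagonally conjugate map.\<close>

definition good :: "nat => nat => (cm => cm) => bool" where
 "good k l \<phi> <-> nf n (S k) (S' l) \<phi> & (\<exists>\<phi>0 w. nf n (S k) (S' l) \<phi>0 & dun (S' l) w &
  (\<forall>x\<in>bal (S k). \<phi> x = w*\<phi>0 x*st w) &
  (ALL a b. same_cp (S k) a b --> norm (B.emb l (\<phi>0 (mu a b)) - \<Theta> (A.emb k (mu a b))) < 1/16))"

lemma good_ex: "\<exists>l\<ge>L. \<exists>\<phi>. good k l \<phi>"
proof -
 obtain l \<phi> where l: "l >= L" "nf n (S k) (S' l) \<phi>"
  "!!a b. same_cp (S k) a b ==> norm (B.emb l (\<phi> (mu a b)) - \<Theta> (A.emb k (mu a b))) < 1/16"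
  using approx_nf[of "1/16" L k] by auto
 obtain R F src tgt sg where f: "nfd n (S k) (S' l) \<phi> R F src tgt sg" using l(2) by (auto simp: nf_def)
 have "one (S' l)*\<phi> x*st (one (S' l)) = \<phi> x" if "x\<in>bal (S k)" for x
  using one_unit[OF nf_bal[OF f that]] projD(1)[OF one_proj] by simp
 then have "good k l \<phi>" unfolding good_def using l dun_one by (intro conjI exI[of _ \<phi>] exI[of _ "one (S' l)"]) auto
 then show ?thesis using l(1) by blast
qed

text \<open>A normal form \<open>\<psi>0\<close> close to \<open>\<Psi>\<close> makes the composite
  with \<open>\<phi>0\<close> close to the inclusion, and \<open>nf_unique\<close> provides a
  unitary \<open>u\<close> turning it into the inclusion. Since \<phi> is \<open>\<phi>0\<close>
  conjugated by \<open>w\<close>, the unitary is pushed through \<open>\<psi>0\<close> as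
  \<open>w'\<close>, and \<open>v\<close> undoes it before applying \<open>u\<close>.\<close>

lemma step:
 assumes g: "good k l \<phi>"
 shows "\<exists>m>M. \<exists>\<psi>. tower_iso.good n S' \<iota>' S \<iota> \<Psi> l m \<psi> & (\<forall>x\<in>bal (S k). \<psi> (\<phi> x) = incl \<iota> k m x)"
proof -
 interpret R: tower_iso n S' \<iota>' S \<iota> \<Psi> \<Theta> by (rule swap)
 obtain \<phi>0 w where 0: "nf n (S k) (S' l) \<phi>0" "dun (S' l) w" "!!x. x\<in>bal (S k) ==> \<phi> x = w*\<phi>0 x*st w"
  "!!a b. same_cp (S k) a b ==> norm (B.emb l (\<phi>0 (mu a b)) - \<Theta> (A.emb k (mu a b))) < 1/16"
  using g unfolding good_def by blast
 obtain R0 F src tgt sg where f: "nfd n (S k) (S' l) \<phi>0 R0 F src tgt sg" using 0(1) by (auto simp: nf_def)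
 define N where "N = real (sz (S' l))"
 \<comment> \<open>\<open>\<phi>0 (mu a b)\<close> is a combination of at most N^2 matrix units with
   coefficients of modulus at most 1, so closeness \<open>e\<close> on matrix units gives 1/16 on
   it. With the 1/16 of \<open>good\<close> the total stays below the 1/4 of
   \<open>nf_unique\<close>.\<close>
 define e where "e = 1 / (16*(N\<^sup>2 + 1))"
 have N2: "N\<^sup>2 + 1 > 0" by (simp add: add_nonneg_pos)
 have e: "e > 0" "N*(N*e) <= 1/16" using N2 by (auto simp: e_def power2_eq_square)
 obtain m \<psi>0 where m: "m >= Suc (max M k)" "nf n (S' l) (S m) \<psi>0"
  "!!a b. same_cp (S' l) a b ==> norm (A.emb m (\<psi>0 (mu a b)) - \<Psi> (B.emb l (mu a b))) < e"
  using R.approx_nf[OF e(1)] by metis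
 have "1*(1/16*1) <= (1/16 :: real)" "e <= 1/16" using N2 by (auto simp: e_def)
 obtain R1 F1 src1 tgt1 sg1 where f1: "nfd n (S' l) (S m) \<psi>0 R1 F1 src1 tgt1 sg1" using m(2) by (auto simp: nf_def)
 have Mm: "M < m" "k <= m" using m(1) by auto
 have close: "norm (\<psi>0 (\<phi>0 (mu a b)) - incl \<iota> k m (mu a b)) <= 1/4" if ab: "same_cp (S k) a b" for a b
 proof -
  let ?z = "\<phi>0 (mu a b)"
  have mb: "mu a b\<in>bal (S k)" by (rule mu_bal[OF ab])
  have z: "?z\<in>bal (S' l)" by (rule nf_bal[OF f mb])
  have "norm ?z = 1" using nf_norm[OF f mb] by simp
  then have ez: "cmod (ent ?z u v) <= 1" for u v using ent_le_norm[of ?z u v] by simp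
  define h where "h q = A.emb m (\<psi>0 q) - \<Psi> (B.emb l q)" for q
  have hz: "h ?z = (\<Sum>u<sz (S' l). \<Sum>v<sz (S' l). if cp (S' l) u = cp (S' l) v then csc (ent ?z u v) (h (mu u v)) else 0)"
  proof -
   have lin: "h (p + q) = h p + h q" "h (csc c p) = csc c (h p)" if "p\<in>bal (S' l)" "q\<in>bal (S' l)" for p q c
    using that unfolding h_def
    by (simp_all add: shomD[OF nf_shom[OF f1] ssub_bal] A.embD B.embD nf_bal[OF f1] R.ThD B.emb_limB csc_diff_right)
   have h0: "h 0 = 0" unfolding h_def by (simp add: shomD(8)[OF nf_shom[OF f1] ssub_bal] A.embD(8) B.embD(8) R.ThD(8))
   have hsum: "h (sum q I) = (\<Sum>i\<in>I. h (q i)) & sum q I\<in>bal (S' l)" if "!!i. i\<in>I ==> q i\<in>bal (S' l)" for q :: "nat => cm" and I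
    using that by (induction I rule: infinite_finite_induct) (auto simp: h0 lin ssubD[OF ssub_bal])
   let ?t = "%u v. if cp (S' l) u = cp (S' l) v then csc (ent ?z u v) (mu u v) else 0"
   have tB: "?t u v\<in>bal (S' l)" if "u < sz (S' l)" "v < sz (S' l)" for u v
    using that by (auto intro!: ssubD[OF ssub_bal] mu_bal simp: same_cp_def)
   have "h ?z = h (\<Sum>u<sz (S' l). \<Sum>v<sz (S' l). ?t u v)" using bal_expand[OF z] by simp
   also have "... = (\<Sum>u<sz (S' l). \<Sum>v<sz (S' l). h (?t u v))"
   proof -
    have r: "h (\<Sum>v<sz (S' l). ?t u v) = (\<Sum>v<sz (S' l). h (?t u v)) & (\<Sum>v<sz (S' l). ?t u v)\<in>bal (S' l)"
     if "u\<in>{..<sz (S' l)}" for u by (rule hsum) (use tB that in "simp only: lessThan_iff")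
    have "h (\<Sum>u<sz (S' l). \<Sum>v<sz (S' l). ?t u v) = (\<Sum>u<sz (S' l). h (\<Sum>v<sz (S' l). ?t u v))"
     by (rule hsum[THEN conjunct1]) (use r in blast)
    also have "... = (\<Sum>u<sz (S' l). \<Sum>v<sz (S' l). h (?t u v))" by (rule sum.cong[OF refl]) (use r in blast)
    finally show ?thesis .
   qed
   also have "... = (\<Sum>u<sz (S' l). \<Sum>v<sz (S' l). if cp (S' l) u = cp (S' l) v then csc (ent ?z u v) (h (mu u v)) else 0)"
    by (intro sum.cong refl) (auto simp: h0 same_cp_def intro!: lin(2) mu_bal)
   finally show ?thesis .
  qed
  have "norm (h ?z) <= real (card {..<sz (S' l)})*(real (card {..<sz (S' l)})*e)" unfolding hz
  proof (intro norm_sum_bound)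
   fix u v assume uv: "u\<in>{..<sz (S' l)}" "v\<in>{..<sz (S' l)}"
   show "norm (if cp (S' l) u = cp (S' l) v then csc (ent ?z u v) (h (mu u v)) else 0) <= e"
   proof (cases "cp (S' l) u = cp (S' l) v")
    case True
    then have "norm (h (mu u v)) <= e" using m(3)[of u v] uv by (simp add: h_def same_cp_def)
    then have "cmod (ent ?z u v)*norm (h (mu u v)) <= 1*e" using ez by (intro mult_mono) auto
    then show ?thesis using True by (simp add: norm_csc)
   qed (use e in simp)
  qed
  also have "... <= 1/16" using e(2) by (simp add: N_def)
  finally have 1: "norm (h ?z) <= 1/16" .
  have eB: "A.emb k (mu a b)\<in>A.limB" "B.emb l ?z\<in>B.limB" using A.emb_limB[OF mb] B.emb_limB[OF z] by auto
  have "\<Psi> (B.emb l ?z) - A.emb k (mu a b) = \<Psi> (B.emb l ?z - \<Theta> (A.emb k (mu a b)))"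
   using eB ThB by (simp add: R.ThD PsTh)
  then have 2: "norm (\<Psi> (B.emb l ?z) - A.emb k (mu a b)) <= 1/16"
   using Ps_norm[of "B.emb l ?z - \<Theta> (A.emb k (mu a b))"] 0(4)[OF ab] eB ThB ssubD(8)[OF B.ssub_limB] by simp
  have pz: "\<psi>0 ?z\<in>bal (S m)" "incl \<iota> k m (mu a b)\<in>bal (S m)"
   using nf_bal[OF f1 z] A.incl_facts(2)[OF Mm(2) mb] by auto
  have "norm (\<psi>0 ?z - incl \<iota> k m (mu a b)) = norm (A.emb m (\<psi>0 ?z) - A.emb k (mu a b))"
   using pz by (simp add: A.emb_incl[OF Mm(2) mb, symmetric] A.norm_emb ssubD[OF ssub_bal] flip: A.embD)
  also have "... = norm (h ?z + (\<Psi> (B.emb l ?z) - A.emb k (mu a b)))" by (simp add: h_def)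
  also have "... <= 1/16 + 1/16" using 1 2 by (meson add_mono norm_triangle_ineq order_trans)
  finally show ?thesis by simp
 qed
 have nfc: "nf n (S k) (S m) (%x. \<psi>0 (\<phi>0 x))" by (rule nf_comp[OF 0(1) m(2)])
 have n2: "n >= 2" using A.n3 by simp
 obtain u where u: "dun (S m) u" "!!x. x\<in>bal (S k) ==> incl \<iota> k m x = u*\<psi>0 (\<phi>0 x)*st u"
  using nf_unique[OF A.stage n2 nfc A.nf_incl[OF Mm(2)] close] by blast
 obtain w' where w': "dun (S m) w'" "!!x. x\<in>bal (S' l) ==> st w'*\<psi>0 (w*x*st w)*w' = \<psi>0 x"
  using nf_extend_unitary[OF m(2) 0(2)] by blast
 define v where "v = u*st w'"
 have v: "dun (S m) v" unfolding v_def by (intro dun_mult u dun_st w')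
 have "R.good l m (%x. v*\<psi>0 x*st v)" unfolding R.good_def
 proof (intro conjI exI[of _ \<psi>0] exI[of _ v] allI impI ballI refl)
  show "nf n (S' l) (S m) (%x. v*\<psi>0 x*st v)" by (rule nf_conj'[OF m(2) v])
  fix a b assume "same_cp (S' l) a b"
  then show "norm (A.emb m (\<psi>0 (mu a b)) - \<Psi> (B.emb l (mu a b))) < 1/16"
   using m(3) \<open>e <= 1/16\<close> by (meson less_le_trans)
 qed (fact m v)+
 moreover have "v*\<psi>0 (\<phi> x)*st v = incl \<iota> k m x" if x: "x\<in>bal (S k)" for x
 proof -
  have "v*\<psi>0 (\<phi> x)*st v = u*(st w'*\<psi>0 (w*\<phi>0 x*st w)*w')*st u"
   by (simp add: v_def 0(3)[OF x] st_mult mult.assoc)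
  then show ?thesis using w'(2)[OF nf_bal[OF f x]] u(2)[OF x] by simp
 qed
 ultimately show ?thesis using Mm(1) by blast
qed

theorem intertwining:
 obtains M l :: "nat => nat" and \<phi> \<psi> where "M 0 = 0" "strict_mono M" "strict_mono l"
  "!!i. nf n (S (M i)) (S' (l i)) (\<phi> i)" "!!i. nf n (S' (l i)) (S (M (Suc i))) (\<psi> i)"
  "!!i x. x\<in>bal (S (M i)) ==> \<psi> i (\<phi> i x) = incl \<iota> (M i) (M (Suc i)) x"
  "!!i y. y\<in>bal (S' (l i)) ==> \<phi> (Suc i) (\<psi> i y) = incl \<iota>' (l i) (l (Suc i)) y"
proof -
 interpret R: tower_iso n S' \<iota>' S \<iota> \<Psi> \<Theta> by (rule swap)
 \<comment> \<open>A state is a stage of each tower with a good map between them, starting at stage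
   0 of the first. The map back is hidden in the step relation \<open>Q\<close> and chosen
   afterwards.\<close>
 define P where "P i p <-> good (fst p) (fst (snd p)) (snd (snd p)) & (i = 0 --> fst p = 0)" for i :: nat and p :: "nat \<times> nat \<times> (cm => cm)"
 define Q where "Q i p p' <-> fst p < fst p' & fst (snd p) < fst (snd p') &
   (\<exists>\<psi>. nf n (S' (fst (snd p))) (S (fst p')) \<psi> &
    (\<forall>x\<in>bal (S (fst p)). \<psi> (snd (snd p) x) = incl \<iota> (fst p) (fst p') x) &
    (\<forall>y\<in>bal (S' (fst (snd p))). snd (snd p') (\<psi> y) = incl \<iota>' (fst (snd p)) (fst (snd p')) y))"
  for i :: nat and p p' :: "nat \<times> nat \<times> (cm => cm)"
 have "EX p. P 0 p" using good_ex[of 0 0] by (auto simp: P_def)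
 moreover have "EX p'. P (Suc i) p' & Q i p p'" if "P i p" for i p
 proof -
  obtain k l \<phi> where p: "p = (k, l, \<phi>)" by (cases p)
  have g: "good k l \<phi>" using that by (simp add: P_def p)
  obtain m \<psi> where m: "m > k" "R.good l m \<psi>" "\<forall>x\<in>bal (S k). \<psi> (\<phi> x) = incl \<iota> k m x" using step[OF g] by blast
  obtain l' \<phi>' where l: "l' > l" "good m l' \<phi>'" "\<forall>y\<in>bal (S' l). \<phi>' (\<psi> y) = incl \<iota>' l l' y" using R.step[OF m(2)] by blast
  have "nf n (S' l) (S m) \<psi>" using m(2) by (simp add: R.good_def)
  then show ?thesis using m l by (intro exI[of _ "(m, l', \<phi>')"]) (auto simp: P_def Q_def p)
 qed
 ultimately obtain f where f: "!!i. P i (f i)" "!!i. Q i (f i) (f (Suc i))" using dependent_nat_choice[of P Q] by blast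
 define M where "M i = fst (f i)" for i
 define l where "l i = fst (snd (f i))" for i
 define \<phi> where "\<phi> i = snd (snd (f i))" for i
 have "ALL i. \<exists>\<psi>. nf n (S' (l i)) (S (M (Suc i))) \<psi> &
   (\<forall>x\<in>bal (S (M i)). \<psi> (\<phi> i x) = incl \<iota> (M i) (M (Suc i)) x) &
   (\<forall>y\<in>bal (S' (l i)). \<phi> (Suc i) (\<psi> y) = incl \<iota>' (l i) (l (Suc i)) y)"
  using f(2) unfolding Q_def M_def l_def \<phi>_def by blast
 then obtain \<psi> where \<psi>: "!!i. nf n (S' (l i)) (S (M (Suc i))) (\<psi> i)"
   "!!i x. x\<in>bal (S (M i)) ==> \<psi> i (\<phi> i x) = incl \<iota> (M i) (M (Suc i)) x"
   "!!i y. y\<in>bal (S' (l i)) ==> \<phi> (Suc i) (\<psi> i y) = incl \<iota>' (l i) (l (Suc i)) y" by metis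
 have "M 0 = 0" using f(1)[of 0] by (simp add: P_def M_def)
 moreover have "strict_mono M" "strict_mono l" using f(2) by (auto simp: strict_mono_Suc_iff M_def l_def Q_def)
 moreover have "nf n (S (M i)) (S' (l i)) (\<phi> i)" for i using f(1)[of i] by (simp add: P_def good_def M_def l_def \<phi>_def)
 ultimately show thesis using \<psi> by (intro that[of M l \<phi> \<psi>])
qed

end

section \<open>Concrete matrices\<close>

definition toc :: "complex mat => cm" where "toc X = mk (dim_row X) (%i j. X $$ (i, j))"
definition frc :: "nat => cm => complex mat" where "frc N x = mat N N (%(i, j). ent x i j)"

lemma frc_carrier [simp]: "frc N x\<in>carrier_mat N N" by (simp add: frc_def)

lemma ent_toc: "X\<in>carrier_mat N N ==> ent (toc X) i j = (if i < N & j < N then X $$ (i, j) else 0)"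
 by (auto simp: toc_def ent_mk)

lemma bnd_toc: "X\<in>carrier_mat N N ==> bnd N (toc X)" by (auto simp: bnd_def ent_toc)

lemma toc_frc: "bnd N x ==> toc (frc N x) = x" by (rule cm_eqI) (auto simp: ent_toc[of _ N] frc_def bndD)

lemma frc_toc: "X\<in>carrier_mat N N ==> frc N (toc X) = X" by (rule eq_matI) (auto simp: frc_def ent_toc)

lemma toc_inject: "X\<in>carrier_mat N N ==> Y\<in>carrier_mat N N ==> toc X = toc Y <-> X = Y" by (metis frc_toc)

lemma mat_adjoint_carrier: "X\<in>carrier_mat N N ==> mat_adjoint X\<in>carrier_mat N N" by (auto simp: mat_adjoint_def)

lemma toc_add:
 assumes "X\<in>carrier_mat N N" "Y\<in>carrier_mat N N" shows "toc (X + Y) = toc X + toc Y"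
 using assms by (auto intro!: cm_eqI simp: ent_toc[of _ N] ent_add)

lemma toc_smult: "X\<in>carrier_mat N N ==> toc (c \<cdot>\<^sub>m X) = csc c (toc X)"
 by (auto intro!: cm_eqI simp: ent_toc[of _ N] ent_csc)

lemma toc_mult:
 assumes "X\<in>carrier_mat N N" "Y\<in>carrier_mat N N" shows "toc (X*Y) = toc X*toc Y"
proof (rule cm_eqI)
 fix i j
 have "X*Y\<in>carrier_mat N N" using assms by simp
 then show "ent (toc (X*Y)) i j = ent (toc X*toc Y) i j"
  using assms by (auto simp: ent_mult[of N] bnd_toc ent_toc[of _ N] scalar_prod_def intro!: sum.cong)
qed

lemma toc_adj: "X\<in>carrier_mat N N ==> toc (mat_adjoint X) = st (toc X)"
proof (rule cm_eqI)
 fix i j assume X: "X\<in>carrier_mat N N"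
 then show "ent (toc (mat_adjoint X)) i j = ent (st (toc X)) i j"
  by (auto simp: ent_toc[of _ N] ent_st mat_adjoint_def mat_of_rows_def)
qed

lemmas toc_ops = toc_add toc_mult toc_smult toc_adj

lemma toc_zero: "toc (0\<^sub>m N N) = 0" by (rule cm_eqI) (auto simp: ent_toc[of _ N])

lemma toc_one: "toc (1\<^sub>m N) = idm {..<N}" by (rule cm_eqI) (auto simp: ent_toc[of _ N] ent_idm)

lemma toc_munit: "i < N ==> k < N ==> toc (munit N i k) = mu i k" by (rule cm_eqI) (auto simp: ent_toc[of _ N] munit_def ent_mu)

lemma L2_set_mult_vec:
 assumes X: "X\<in>carrier_mat N N" and v: "v\<in>carrier_vec N"
 shows "L2_set (%i. cmod ((X *\<^sub>v v) $ i)) {..<N} <= norm (toc X)*L2_set (%i. cmod (v $ i)) {..<N}"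
proof (cases "N = 0")
 case False
 let ?y = "mk N (%i j. if j = 0 then v $ i else 0)"
 have col: "fr z = L2_set (%i. cmod (f i)) {..<N}"
  if "bnd N z" "!!i j. i < N ==> j < N ==> ent z i j = (if j = 0 then f i else 0)" for z f
 proof -
  have "(fr z)\<^sup>2 = (\<Sum>i<N. \<Sum>j<N. if j = 0 then (cmod (f i))\<^sup>2 else 0)"
   unfolding fr_sq[OF that(1)] by (intro sum.cong refl) (auto simp: that(2))
  also have "... = (\<Sum>i<N. (cmod (f i))\<^sup>2)" by simp
  finally show ?thesis by (simp add: L2_set_def real_sqrt_unique)
 qed
 have y: "bnd N ?y" by (rule bnd_mk)
 have "fr ?y = L2_set (%i. cmod (v $ i)) {..<N}" by (rule col[OF y]) (simp add: ent_mk)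
 moreover have "fr (toc X*?y) = L2_set (%i. cmod ((X *\<^sub>v v) $ i)) {..<N}"
 proof (rule col[OF bnd_mult[OF bnd_toc[OF X] y]])
  fix i j assume ij: "i < N" "j < N"
  show "ent (toc X*?y) i j = (if j = 0 then (X *\<^sub>v v) $ i else 0)"
   using X v ij by (auto simp: ent_mult[of N] y ent_mk ent_toc[of _ N] scalar_prod_def atLeast0LessThan)
 qed
 ultimately show ?thesis using fr_mult_norm[of "toc X" ?y] by simp
qed simp

text \<open>A matrix acts on the columns of \<open>y\<close> separately, so adding the squared
  vector estimates over all columns bounds the Frobenius norm of the product. Conversely a vector is
  a matrix with one column.\<close>

lemma op_norm_toc: assumes X: "X\<in>carrier_mat N N" shows "op_norm X = norm (toc X)"
proof -
 let ?L = "%v :: complex vec. L2_set (%i. cmod (v $ i)) {..<N}"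
 define U where "U = {v\<in>carrier_vec N. ?L v <= 1}"
 have on: "op_norm X = (SUP v\<in>U. ?L (X *\<^sub>v v))"
  unfolding op_norm_def U_def using X by (intro arg_cong[where f=Sup] image_cong) auto
 have U0: "0\<^sub>v N\<in>U" by (simp add: U_def L2_set_def)
 have le: "?L (X *\<^sub>v v) <= norm (toc X)" if "v\<in>U" for v
 proof -
  have "?L (X *\<^sub>v v) <= norm (toc X)*?L v" using that by (intro L2_set_mult_vec[OF X]) (simp add: U_def)
  also have "... <= norm (toc X)*1" using that by (intro mult_left_mono) (auto simp: U_def)
  finally show ?thesis by simp
 qed
 have bdd: "bdd_above ((%v. ?L (X *\<^sub>v v)) ` U)" using le by (auto intro!: bdd_aboveI2)
 define c where "c = (SUP v\<in>U. ?L (X *\<^sub>v v))"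
 have up: "?L (X *\<^sub>v v) <= c" if "v\<in>U" for v unfolding c_def by (rule cSUP_upper[OF that bdd])
 have c0: "c >= 0" using up[OF U0] by (rule order_trans[rotated]) simp
 have c: "?L (X *\<^sub>v v) <= c*?L v" if v: "v\<in>carrier_vec N" for v
 proof (cases "?L v = 0")
  case True
  then show ?thesis using L2_set_mult_vec[OF X v] by simp
 next
  case False
  define r where "r = ?L v"
  have r: "r > 0" using False unfolding r_def by (simp add: less_le)
  have sc: "?L (complex_of_real s \<cdot>\<^sub>v u) = s*?L u" if "s >= 0" "u\<in>carrier_vec N" for s u
  proof -
   have "?L (complex_of_real s \<cdot>\<^sub>v u) = L2_set (%i. s*cmod (u $ i)) {..<N}"
    using that by (intro L2_set_cong) (auto simp: norm_mult)
   then show ?thesis using that by (simp add: L2_set_right_distrib)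
  qed
  have "complex_of_real (1 / r) \<cdot>\<^sub>v v\<in>U" using sc[of "1 / r" v] v r unfolding U_def by (auto simp: r_def)
  from up[OF this] have "(1 / r)*?L (X *\<^sub>v v) <= c"
   using sc[of "1 / r" "X *\<^sub>v v"] X v r mult_mat_vec[OF X v] by auto
  then show ?thesis using r by (simp add: field_simps r_def)
 qed
 have "norm (toc X) <= c"
 proof (rule norm_cm_least)
  fix y assume y: "fr y <= 1"
  obtain M0 where "bnd M0 y" using bnd_ex by blast
  then obtain M where M: "bnd M y" "N <= M" using bnd_mono[of M0 y "max M0 N"] by auto
  have bX: "bnd M (toc X)" using bnd_mono[OF bnd_toc[OF X] M(2)] .
  define v where "v j = vec N (%i. ent y i j)" for j
  have xy: "ent (toc X*y) i j = (if i < N then (X *\<^sub>v v j) $ i else 0)" for i j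
   using X by (auto simp: ent_mult[of N] bnd_toc[OF X] ent_toc[OF X] v_def scalar_prod_def atLeast0LessThan)
  have "(fr (toc X*y))\<^sup>2 = (\<Sum>j<M. \<Sum>i<M. (cmod (ent (toc X*y) i j))\<^sup>2)"
   unfolding fr_sq[OF bnd_mult[OF bX M(1)]] by (rule sum.swap)
  also have "... <= (\<Sum>j<M. c\<^sup>2*(\<Sum>i<M. (cmod (ent y i j))\<^sup>2))"
  proof (rule sum_mono)
   fix j
   have "(\<Sum>i<M. (cmod (ent (toc X*y) i j))\<^sup>2) = (\<Sum>i<N. (cmod ((X *\<^sub>v v j) $ i))\<^sup>2)"
    using M(2) by (intro sum.mono_neutral_cong_right) (auto simp: xy)
   also have "... = (?L (X *\<^sub>v v j))\<^sup>2" by (simp add: L2_set_def sum_nonneg)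
   also have "... <= (c*?L (v j))\<^sup>2" using c[of "v j"] by (intro power_mono) (auto simp: v_def)
   also have "... = c\<^sup>2*(\<Sum>i<N. (cmod (ent y i j))\<^sup>2)"
    by (simp add: L2_set_def sum_nonneg power_mult_distrib v_def)
   also have "... <= c\<^sup>2*(\<Sum>i<M. (cmod (ent y i j))\<^sup>2)" using M(2) by (intro mult_left_mono sum_mono2) auto
   finally show "(\<Sum>i<M. (cmod (ent (toc X*y) i j))\<^sup>2) <= c\<^sup>2*(\<Sum>i<M. (cmod (ent y i j))\<^sup>2)" .
  qed
  also have "... = c\<^sup>2*(fr y)\<^sup>2" unfolding fr_sq[OF M(1)] by (simp add: sum_distrib_left) (rule sum.swap)
  also have "... <= c\<^sup>2*1" using y by (intro mult_left_mono) (auto simp: power_le_one)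
  finally show "fr (toc X*y) <= c" using c0 by simp
 qed
 moreover have "c <= norm (toc X)" unfolding c_def using U0 le by (intro cSUP_least) auto
 ultimately show ?thesis by (simp add: on c_def)
qed

text \<open>In rank one every column is a multiple of a fixed nonzero column, since two independent
  columns would raise the rank.\<close>

lemma rank_eq_1_iff:
 assumes A: "A\<in>carrier_mat N N"
 shows "vec_space.rank N (A :: complex mat) = 1 <-> A ~= 0\<^sub>m N N & (EX f g. \<forall>i<N. \<forall>j<N. A $$ (i, j) = f i*g j)"
proof -
 interpret vec_space "TYPE(complex)" N .
 have nz: "\<exists>j<N. col A j ~= 0\<^sub>v N" if "A ~= 0\<^sub>m N N"
 proof (rule ccontr)
  assume "~ (\<exists>j<N. col A j ~= 0\<^sub>v N)"
  then have "A $$ (i, j) = 0" if "i < N" "j < N" for i j using A that by (metis carrier_matD col_def index_vec index_zero_vec(1))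
  then have "A = 0\<^sub>m N N" using A by (intro eq_matI) auto
  with that show False ..
 qed
 have colin: "col A j\<in>set (cols A)" if "j < N" for j using A that by (auto simp: cols_def)
 have colc: "col A j\<in>carrier_vec N" for j using A by auto
 have dep: "EX w. w\<in>carrier_vec (length vs) & w ~= 0\<^sub>v (length vs) & (\<forall>i<N. (\<Sum>k<length vs. (vs ! k) $ i*w $ k) = 0)"
  if "lin_dep (set vs)" "distinct vs" "set vs <= carrier_vec N" for vs
 proof -
  let ?B = "mat_of_cols N vs"
  have cB: "cols ?B = vs" using that by simp
  have "lin_dep (set (cols ?B))" "distinct (cols ?B)" using that cB by auto
  then obtain w where w: "w\<in>carrier_vec (length vs)" "w ~= 0\<^sub>v (length vs)" "?B *\<^sub>v w = 0\<^sub>v N"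
   using lin_depE[of ?B "length vs"] mat_of_cols_carrier(1) by auto
  have "(\<Sum>k<length vs. (vs ! k) $ i*w $ k) = 0" if i: "i < N" for i
  proof -
   have "(?B *\<^sub>v w) $ i = (\<Sum>k<length vs. (vs ! k) $ i*w $ k)"
    using i w(1) by (auto simp: scalar_prod_def mat_of_cols_def intro!: sum.cong)
   then show ?thesis using w(3) i by simp
  qed
  with w show ?thesis by blast
 qed
 show ?thesis
 proof
  assume r: "rank A = 1"
  then have A0: "A ~= 0\<^sub>m N N" using rank_0I[of N] by auto
  then obtain j0 where j0: "j0 < N" "col A j0 ~= 0\<^sub>v N" using nz by blast
  have "EX c. \<forall>i<N. A $$ (i, j) = A $$ (i, j0)*c" if j: "j < N" for j
  proof (cases "col A j = col A j0")
   case True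
   then have "A $$ (i, j) = A $$ (i, j0)*1" if "i < N" for i
    using A j that by (metis carrier_matD col_def index_vec mult.right_neutral)
   then show ?thesis by blast
  next
   case False
   have "lin_dep {col A j0, col A j}"
   proof (rule ccontr)
    assume "~ ?thesis"
    then have "card {col A j0, col A j} <= rank A" using rank_ge_card_indpt[OF A, of "{col A j0, col A j}"] colin j j0 by auto
    then show False using r False by simp
   qed
   then obtain w where w: "w\<in>carrier_vec 2" "w ~= 0\<^sub>v 2" "\<forall>i<N. (\<Sum>k<2. ([col A j0, col A j] ! k) $ i*w $ k) = 0"
    using dep[of "[col A j0, col A j]"] False colc by (auto simp: numeral_2_eq_2)
   have e: "A $$ (i, j0)*w $ 0 + A $$ (i, j)*w $ 1 = 0" if "i < N" for i using w(3) that A j j0 by (auto simp: numeral_2_eq_2)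
   have "w $ 1 ~= 0"
   proof
    assume w1: "w $ 1 = 0"
    obtain i where "i < N" "A $$ (i, j0) ~= 0"
     using j0 A colc[of j0] by (metis carrier_matD carrier_vecD col_def eq_vecI index_vec index_zero_vec)
    then have "w $ 0 = 0" using e[of i] w1 by simp
    then have "w = 0\<^sub>v 2" using w(1) w1 by (intro eq_vecI) (auto simp: less_2_cases_iff)
    then show False using w(2) by simp
   qed
   then have "A $$ (i, j) = A $$ (i, j0)*(- w $ 0 / w $ 1)" if "i < N" for i
    using e[OF that] by (simp add: field_simps eq_neg_iff_add_eq_0)
   then show ?thesis by blast
  qed
  then obtain g where "!!j. j < N ==> \<forall>i<N. A $$ (i, j) = A $$ (i, j0)*g j" by metis
  then show "A ~= 0\<^sub>m N N & (EX f g. \<forall>i<N. \<forall>j<N. A $$ (i, j) = f i*g j)"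
   using A0 by (intro conjI exI[of _ "%i. A $$ (i, j0)"] exI[of _ g]) auto
 next
  assume a: "A ~= 0\<^sub>m N N & (EX f g. \<forall>i<N. \<forall>j<N. A $$ (i, j) = f i*g j)"
  then obtain f g where fg: "!!i j. i < N ==> j < N ==> A $$ (i, j) = f i*g j" by auto
  have "rank A <= 1" by (rule rank_le_1_product_entries[OF A, of f g]) (use A fg in auto)
  moreover obtain j0 where j0: "j0 < N" "col A j0 ~= 0\<^sub>v N" using nz a by blast
  have "~ lin_dep {col A j0}"
  proof
   assume "lin_dep {col A j0}"
   then obtain w where w: "w\<in>carrier_vec 1" "w ~= 0\<^sub>v 1" "\<forall>i<N. col A j0 $ i*w $ 0 = 0"
    using dep[of "[col A j0]"] colc by auto
   then have "w $ 0 ~= 0" by (metis carrier_vecD eq_vecI index_zero_vec less_one)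
   then have "col A j0 = 0\<^sub>v N" using w(3) carrier_vecD[OF colc[of j0]] by (intro eq_vecI) (auto simp del: dim_col)
   with j0 show False by simp
  qed
  then have "rank A >= 1" using rank_ge_card_indpt[OF A, of "{col A j0}"] colin j0 by simp
  ultimately show "rank A = 1" by simp
 qed
qed

text \<open>\<open>w\<close> is a nonzero column \<open>j\<close> of the projection divided by its
  length; the squared length is the diagonal entry at \<open>j\<close>. Rank one determines the
  other entries from row and column \<open>j\<close>.\<close>

lemma rank_one_projection:
 assumes X: "X\<in>carrier_mat N N" "vec_space.rank N X = 1" and p: "proj (toc X)"
 obtains w where "spt (%v j. v < N & j = 0) w" "st w*w = mu 0 0" "toc X = w*st w"
proof -
 let ?x = "toc X"
 obtain f g where fg: "!!i j. i < N ==> j < N ==> X $$ (i, j) = f i*g j" and "X ~= 0\<^sub>m N N"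
  using X rank_eq_1_iff[OF X(1)] by metis
 then have "?x ~= 0" using toc_inject[OF X(1), of "0\<^sub>m N N"] by (simp add: toc_zero)
 then obtain i j where ij: "ent ?x i j ~= 0" by (metis cm_eqI ent_zero)
 have b: "bnd N ?x" by (rule bnd_toc[OF X(1)])
 have ji: "ent ?x j i = cnj (ent ?x i j)" using arg_cong[OF projD(1)[OF p], of "%x. ent x j i"] by (simp add: ent_st)
 define d where "d = (\<Sum>k<N. (cmod (ent ?x k j))\<^sup>2)"
 have dj: "ent ?x j j = of_real d"
 proof -
  have "ent ?x j j = ent (st ?x*?x) j j" using projD[OF p] by simp
  also have "... = (\<Sum>k<N. of_real ((cmod (ent ?x k j))\<^sup>2))"
   by (simp add: ent_mult[of N] b ent_st complex_norm_square mult.commute del: of_real_power)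
  finally show ?thesis by (simp add: d_def)
 qed
 have iN: "i < N" "j < N" using ij b by (auto simp: bnd_def)
 have "(cmod (ent ?x i j))\<^sup>2 <= d" unfolding d_def using iN by (intro member_le_sum) auto
 then have d: "d > 0" using ij by (smt (verit) zero_less_power zero_less_norm_iff)
 define w where "w = csc (of_real (1 / sqrt d)) (?x*mu j 0)"
 have dd: "complex_of_real (1 / sqrt d)*complex_of_real (1 / sqrt d) = 1 / of_real d" using d by (simp flip: of_real_mult)
 have "st w*w = csc (1 / of_real d) (mu 0 j*(st ?x*?x)*mu j 0)"
  using dd by (simp add: w_def st_csc st_mult csc_mult_left csc_mult_right csc_csc mult.assoc)
 then have 1: "st w*w = mu 0 0" using d by (simp add: projD[OF p] mu_sandwich csc_csc dj)
 have "w*st w = csc (1 / of_real d) (?x*mu j j*?x)"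
  using dd by (simp add: w_def st_csc st_mult csc_mult_left csc_mult_right csc_csc mult.assoc projD(1)[OF p] mu_mult_mu_assoc)
 then have e: "ent (w*st w) r c = ent ?x r j*ent ?x j c / of_real d" for r c
  by (simp add: ent_csc ent_mult[of N] b ent_mult_mu if_distrib[of "%x. x*_"] iN cong: if_cong)
 have "ent (w*st w) r c = ent ?x r c" for r c
 proof (cases "r < N & c < N")
  case True
  then have "ent ?x r c*ent ?x j j = ent ?x r j*ent ?x j c" using iN by (simp add: ent_toc[OF X(1)] fg)
  then show ?thesis using d by (simp add: e dj field_simps)
 next
  case False
  then show ?thesis by (auto simp: e bndD[OF b])
 qed
 then have 2: "?x = w*st w" by (intro cm_eqI) simp
 have "spt (%v k. v < N & k = 0) w" using b by (auto simp: w_def spt_def ent_csc ent_mult_mu bnd_def split: if_splits)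
 then show thesis using 1 2 that by blast
qed

section \<open>Lists of cycle digraphs as stages\<close>

definition rep :: "nat => digraph list => stage => bool" where
 "rep n Gs S <-> stage n S & sz S = sum_list (map fst Gs) &
  dsum_alg Gs = {X\<in>carrier_mat (sz S) (sz S). toc X\<in>dal n S}"

lemma toc_dal_iff:
 assumes "X\<in>carrier_mat (sz S) (sz S)" shows "toc X\<in>dal n S <->
  (\<forall>i<sz S. \<forall>j<sz S. X $$ (i, j) ~= 0 --> cp S i = cp S j & (lb S j, lb S i)\<in>ed n)"
 by (auto simp: dal_def spt_def ent_toc[OF assms] same_cp_def)

lemma digraph_alg_iff:
 "digraph_alg G = {X\<in>carrier_mat (fst G) (fst G). \<forall>i<fst G. \<forall>j<fst G. X $$ (i, j) ~= 0 --> (j, i)\<in>snd G}"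
proof -
 have "EX c. X = mat (fst G) (fst G) (%(i, k). if (k, i)\<in>snd G then c i k else 0)"
  if "X\<in>carrier_mat (fst G) (fst G)" "\<forall>i<fst G. \<forall>j<fst G. X $$ (i, j) ~= 0 --> (j, i)\<in>snd G" for X :: "complex mat"
  using that by (intro exI[of _ "%i k. X $$ (i, k)"] eq_matI) auto
 then show ?thesis by (auto simp: digraph_alg_def split: if_splits)
qed

text \<open>The label of a vertex is the vertex of the cycle that corresponds to its class. By
  transitivity an edge between classes is an edge between all their members.\<close>

lemma cycle_digraph_labels:
 assumes "is_cycle_digraph n G"
 obtains lab where "!!u. u < fst G ==> lab u < 2*n" "!!j. j < 2*n ==> \<exists>u<fst G. lab u = j"
  "!!u v. u < fst G ==> v < fst G ==> (u, v)\<in>snd G <-> (lab u, lab v)\<in>ed n"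
proof -
 define R where "R = snd G \<inter> (snd G)\<inverse>"
 have rf: "!!u. u < fst G ==> (u, u)\<in>snd G" and tr: "trans (snd G)"
  using assms by (auto simp: is_cycle_digraph_def tr_digraph_def preorder_on_def refl_on_def)
 obtain f where f: "bij_betw f (reduced_verts G) {..<2*n}"
  "!!V W. V\<in>reduced_verts G ==> W\<in>reduced_verts G ==> (V, W)\<in>reduced_edges G <-> (f V, f W)\<in>ed n"
  using assms unfolding is_cycle_digraph_def by (auto simp: ed_def cycle_graph_def)
 have cl: "R `` {u}\<in>reduced_verts G" if "u < fst G" for u using that by (auto simp: reduced_verts_def R_def intro: quotientI)
 show thesis
 proof (rule that[of "%u. f (R `` {u})"])
  show "f (R `` {u}) < 2*n" if "u < fst G" for u using cl[OF that] f(1) by (auto simp: bij_betw_def)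
  show "\<exists>u<fst G. f (R `` {u}) = j" if j: "j < 2*n" for j
  proof -
   obtain V where V: "V\<in>reduced_verts G" "f V = j" using f(1) j by (auto simp: bij_betw_def) (metis imageE lessThan_iff)
   then obtain u where "u < fst G" "V = R `` {u}" by (auto simp: reduced_verts_def R_def elim!: quotientE)
   then show ?thesis using V by auto
  qed
  fix u v assume uv: "u < fst G" "v < fst G"
  have "(R `` {u}, R `` {v})\<in>reduced_edges G <-> (u, v)\<in>snd G"
  proof
   assume "(R `` {u}, R `` {v})\<in>reduced_edges G"
   then obtain a b where "(u, a)\<in>snd G" "(a, b)\<in>snd G" "(b, v)\<in>snd G" by (auto simp: reduced_edges_def R_def)
   then show "(u, v)\<in>snd G" using tr by (meson transD)
  next
   assume "(u, v)\<in>snd G"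
   then show "(R `` {u}, R `` {v})\<in>reduced_edges G" using cl uv rf by (auto simp: reduced_edges_def) (auto simp: R_def)
  qed
  then show "(u, v)\<in>snd G <-> (f (R `` {u}), f (R `` {v}))\<in>ed n" using f(2)[OF cl cl] uv by simp
 qed
qed

text \<open>Every digraph of the list becomes a summand: the first gets number 0, and the numbers of
  the others are raised by one.\<close>

lemma rep_ex:
 assumes "!!G. G\<in>set Gs ==> is_cycle_digraph n G" shows "\<exists>S. rep n Gs S" using assms
proof (induction Gs)
 case Nil
 have "dsum_alg [] = {X\<in>carrier_mat 0 0. toc X\<in>dal n (0, %_. 0, %_. 0)}" by (auto simp: dsum_alg_def toc_zero dal_def)
 then show ?case by (auto simp: rep_def stage_def)
next
 case (Cons G Gs)
 then obtain S where S: "rep n Gs S" by auto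
 obtain lab where lab: "!!u. u < fst G ==> lab u < 2*n" "!!j. j < 2*n ==> \<exists>u<fst G. lab u = j"
  "!!u v. u < fst G ==> v < fst G ==> (u, v)\<in>snd G <-> (lab u, lab v)\<in>ed n"
  using cycle_digraph_labels[of n G] Cons.prems by auto
 define N where "N = fst G"
 define M where "M = sz S"
 define T where "T = (N + M, %u. if u < N then 0 else Suc (cp S (u - N)), %u. if u < N then lab u else lb S (u - N))"
 have st: "stage n S" and M: "M = sum_list (map fst Gs)"
  and al: "dsum_alg Gs = {X\<in>carrier_mat M M. toc X\<in>dal n S}" using S by (auto simp: rep_def M_def)
 have T: "sz T = N + M" "!!u. cp T u = (if u < N then 0 else Suc (cp S (u - N)))"
  "!!u. lb T u = (if u < N then lab u else lb S (u - N))" by (auto simp: T_def)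
 have "stage n T" unfolding stage_def T
 proof (intro conjI allI impI)
  fix u assume u: "u < N + M"
  show "(if u < N then lab u else lb S (u - N)) < 2*n" using lab(1) st u by (auto simp: stage_def N_def M_def)
  fix j assume j: "j < 2*n"
  show "\<exists>v<N + M. (if v < N then 0 else Suc (cp S (v - N))) = (if u < N then 0 else Suc (cp S (u - N))) &
    (if v < N then lab v else lb S (v - N)) = j"
  proof (cases "u < N")
   case True
   then obtain v where "v < N" "lab v = j" using lab(2)[OF j] by (auto simp: N_def)
   then show ?thesis using True by (intro exI[of _ v]) auto
  next
   case False
   then have "u - N < sz S" using u by (simp add: M_def)
   then obtain v where "v < M" "cp S v = cp S (u - N)" "lb S v = j" using st j unfolding stage_def M_def by metis
   then show ?thesis using False by (intro exI[of _ "N + v"]) auto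
  qed
 qed
 moreover have "dsum_alg (G # Gs) = {X\<in>carrier_mat (N + M) (N + M). toc X\<in>dal n T}"
 proof (intro equalityI subsetI)
  fix X assume "X\<in>dsum_alg (G # Gs)"
  then obtain A As where A: "A\<in>digraph_alg G" "list_all2 (%X G. X\<in>digraph_alg G) As Gs" "X = diag_block_mat (A # As)"
   by (auto simp: dsum_alg_def list_all2_Cons2)
  define B where "B = diag_block_mat As"
  have B: "B\<in>dsum_alg Gs" using A by (auto simp: dsum_alg_def B_def)
  then have Bc: "B\<in>carrier_mat M M" "toc B\<in>dal n S" using al by auto
  have Ac: "A\<in>carrier_mat N N" "\<forall>i<N. \<forall>j<N. A $$ (i, j) ~= 0 --> (j, i)\<in>snd G"
   using A(1) by (auto simp: digraph_alg_iff N_def)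
  have X: "X = four_block_mat A (0\<^sub>m N M) (0\<^sub>m M N) B" using Ac Bc A(3) by (simp add: B_def)
  have Xc: "X\<in>carrier_mat (N + M) (N + M)" using Ac Bc by (simp add: X)
  have "toc X\<in>dal n T"
  proof (subst toc_dal_iff, use Xc T in simp, intro allI impI)
   fix i j assume ij: "i < sz T" "j < sz T" "X $$ (i, j) ~= 0"
   then show "cp T i = cp T j & (lb T j, lb T i)\<in>ed n"
    using Ac Bc lab(3)[of j i] Bc(2)[unfolded toc_dal_iff[OF Bc(1)[unfolded M_def]]]
    by (auto simp: X T M_def N_def split: if_splits)
  qed
  with Xc show "X\<in>{X\<in>carrier_mat (N + M) (N + M). toc X\<in>dal n T}" by simp
 next
  fix X assume "X\<in>{X\<in>carrier_mat (N + M) (N + M). toc X\<in>dal n T}"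
  then have Xc: "X\<in>carrier_mat (N + M) (N + M)" and Xd: "toc X\<in>dal n T" by auto
  have Xe: "cp T i = cp T j & (lb T j, lb T i)\<in>ed n" if "i < N + M" "j < N + M" "X $$ (i, j) ~= 0" for i j
   using Xd toc_dal_iff[of X T n] Xc T(1) that by auto
  define A where "A = mat N N (%(i, j). X $$ (i, j))"
  define B where "B = mat M M (%(i, j). X $$ (i + N, j + N))"
  have "(j, i)\<in>snd G" if "i < N" "j < N" "X $$ (i, j) ~= 0" for i j
   using Xe[of i j] lab(3)[of j i] that by (simp add: T N_def)
  then have A: "A\<in>digraph_alg G" unfolding digraph_alg_iff A_def by (auto simp: N_def)
  have Bc: "B\<in>carrier_mat (sz S) (sz S)" by (simp add: B_def M_def)
  have "cp S i = cp S j & (lb S j, lb S i)\<in>ed n" if "i < M" "j < M" "B $$ (i, j) ~= 0" for i j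
   using Xe[of "i + N" "j + N"] that by (auto simp: B_def T)
  then have "toc B\<in>dal n S" unfolding toc_dal_iff[OF Bc] by (simp add: M_def)
  then have "B\<in>dsum_alg Gs" using al Bc by (simp add: M_def)
  then obtain As where As: "B = diag_block_mat As" "list_all2 (%X G. X\<in>digraph_alg G) As Gs" by (auto simp: dsum_alg_def)
  have z: "X $$ (i, j) = 0" if "i < N + M" "j < N + M" "i < N <-> ~ j < N" for i j
   using Xe[OF that(1,2)] that(3) by (cases "X $$ (i, j) = 0") (auto simp: T split: if_splits)
  have "X = four_block_mat A (0\<^sub>m N M) (0\<^sub>m M N) B" using Xc z by (intro eq_matI) (auto simp: A_def B_def not_less)
  then have "X = diag_block_mat (A # As)" by (simp add: Let_def A_def B_def flip: As(1))
  then show "X\<in>dsum_alg (G # Gs)" using A As by (auto simp: dsum_alg_def intro!: exI[of _ "A # As"])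
 qed
 ultimately show ?case using M T(1) by (intro exI[of _ T]) (auto simp: rep_def N_def)
qed

definition CS :: "nat => stage" where "CS n = (2*n, %_. 0, %i. i)"

lemma CS_simps [simp]: "sz (CS n) = 2*n" "cp (CS n) u = 0" "lb (CS n) u = u" by (auto simp: CS_def)

lemma rep_cycle: "rep n [cycle_graph n] (CS n)"
proof -
 have "X\<in>digraph_alg (cycle_graph n) <-> X\<in>carrier_mat (2*n) (2*n) & toc X\<in>dal n (CS n)" for X
  using toc_dal_iff[of X "CS n" n] by (auto simp: digraph_alg_iff) (auto simp: cycle_graph_def ed_def)
 then show ?thesis unfolding rep_def dsum_alg_single by (auto simp: stage_def) (auto simp: cycle_graph_def)
qed

lemma bal_span:
 assumes "0\<in>T" "!!x y. x\<in>T ==> y\<in>T ==> x + y\<in>T" "!!c x. x\<in>T ==> csc c x\<in>T"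
  "!!a b. same_cp S a b ==> mu a b\<in>T" shows "bal S <= T"
proof
 fix x assume x: "x\<in>bal S"
 have sm: "sum f A\<in>T" if "!!a. a\<in>A ==> f a\<in>T" for f and A :: "nat set"
  using that by (induction A rule: infinite_finite_induct) (auto intro: assms)
 show "x\<in>T" by (subst bal_expand[OF x]) (auto intro!: sm assms simp: same_cp_def)
qed

text \<open>Walking around the cycle from the position of \<open>a\<close>, every step is a matrix
  unit of \<open>dal\<close> or the adjoint of one; the products reach all positions and all indices
  of the summand.\<close>

lemma dal_generates:
 assumes S: "stage n S" and n: "n >= 1" and T: "ssub T" "dal n S <= T" shows "bal S <= T"
proof
 have mu: "same_cp S a b ==> lb S b = (lb S a + d) mod (2*n) ==> mu a b\<in>T" for a b d
 proof (induction d arbitrary: b)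
  case 0
  then have "lb S a < 2*n" using S by (auto simp: stage_def same_cp_def)
  then have "mu a b\<in>dal n S" using 0 by (intro mu_dal) (auto simp: ed_iff)
  then show ?case using T by blast
 next
  case (Suc d)
  have "(lb S a + d) mod (2*n) < 2*n" using n by simp
  then obtain c where c: "c < sz S" "cp S c = cp S a" "lb S c = (lb S a + d) mod (2*n)"
   using S[unfolded stage_def, THEN conjunct2, rule_format, of a] Suc.prems(1) by (auto simp: same_cp_def)
  have ac: "same_cp S a c" "same_cp S c b" using c Suc.prems(1) by (auto simp: same_cp_def)
  have "mu a c\<in>T" by (rule Suc.IH[OF ac(1) c(3)])
  have "lb S b = Suc (lb S c) mod (2*n)" using Suc.prems(2) c(3) by (simp add: mod_Suc_eq)
  then have "nbr n (lb S c) (lb S b)" using nbr_Suc[OF n, of "lb S c"] c(3) n by simp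
  then have "mu c b\<in>dal n S | mu b c\<in>dal n S"
   using mu_dal[OF ac(2), of n] mu_dal[OF same_cp_sym[OF ac(2)], of n] by (auto simp: nbr_def)
  then have "mu c b\<in>T" using T ssubD(5)[OF T(1), of "mu b c"] by auto
  then have "mu a c*mu c b\<in>T" using \<open>mu a c\<in>T\<close> by (intro ssubD(3)[OF T(1)])
  then show ?case by (simp add: mu_mult_mu)
 qed
 have muT: "mu a b\<in>T" if "same_cp S a b" for a b
 \<comment> \<open>The number of steps from the position of \<open>a\<close> to that of
   \<open>b\<close>, increased by 2 n so that no subtraction is truncated.\<close>
 proof (rule mu[OF that, of "lb S b + (2*n - lb S a)"])
  have "lb S a < 2*n" "lb S b < 2*n" using S that by (auto simp: stage_def same_cp_def)
  moreover from this have "lb S a + (lb S b + (2*n - lb S a)) = lb S b + 2*n" by linarith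
  ultimately show "lb S b = (lb S a + (lb S b + (2*n - lb S a))) mod (2*n)" by simp
 qed
 show "!!x. x\<in>bal S ==> x\<in>T" using bal_span[of T S] muT ssubD[OF T(1)] by blast
qed

lemma shom_agree:
 assumes B: "ssub B" and h: "shom B \<Phi>" "shom B \<Psi>" shows "ssub {x\<in>B. \<Phi> x = \<Psi> x}"
 unfolding ssub_def using shomD[OF h(1) B] shomD[OF h(2) B] ssubD[OF B] by auto

text \<open>The elements on which two star homomorphisms agree form a star-subalgebra.\<close>

lemma hom_unique:
 assumes S: "stage n S" and n: "n >= 1" and h: "shom (bal S) \<Phi>" "shom (bal S) \<Psi>"
  and eq: "!!x. x\<in>dal n S ==> \<Phi> x = \<Psi> x" and x: "x\<in>bal S" shows "\<Phi> x = \<Psi> x"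
 using dal_generates[OF S n shom_agree[OF ssub_bal h]] eq dal_bal[of _ n S] x by blast

lemma rep_cstar:
 assumes r: "rep n Gs S" and n: "n >= 1"
 shows "dsum_cstar Gs = (mat_alg (sz S))\<lparr>car := {X\<in>carrier_mat (sz S) (sz S). toc X\<in>bal S}\<rparr>"
proof -
 let ?N = "sz S" and ?B = "{X\<in>carrier_mat (sz S) (sz S). toc X\<in>bal S}"
 have st: "stage n S" and N: "sum_list (map fst Gs) = ?N"
  and al: "dsum_alg Gs = {X\<in>carrier_mat ?N ?N. toc X\<in>dal n S}" using r by (auto simp: rep_def)
 have "\<Inter>{T. star_subalg (mat_alg ?N) T & dsum_alg Gs <= T} = ?B"
 proof (intro equalityI Inter_greatest Inter_lower, goal_cases)
  case 1
  have "0\<^sub>m ?N ?N\<in>?B" using ssubD(1)[OF ssub_bal] by (simp add: toc_zero)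
  moreover have "X + Y\<in>?B & X*Y\<in>?B" "c \<cdot>\<^sub>m X\<in>?B" "mat_adjoint X\<in>?B" if "X\<in>?B" "Y\<in>?B" for X Y c
   using that by (auto simp: toc_ops[of _ ?N] mat_adjoint_carrier intro!: ssubD[OF ssub_bal])
  ultimately have "star_subalg (mat_alg ?N) ?B"
   unfolding star_subalg_def mat_alg_def star_alg.simps by (intro conjI ballI allI) blast+
  then show ?case using al by (auto intro: dal_bal)
 next
  case (2 T)
  then have T: "T <= carrier_mat ?N ?N" "T ~= {}" "!!X Y. X\<in>T ==> Y\<in>T ==> X + Y\<in>T & X*Y\<in>T"
   "!!X c. X\<in>T ==> c \<cdot>\<^sub>m X\<in>T" "!!X. X\<in>T ==> mat_adjoint X\<in>T" "dsum_alg Gs <= T"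
   by (auto simp: star_subalg_def mat_alg_def)
  have "ssub (toc ` T)" unfolding ssub_def
  proof (intro conjI ballI allI)
   obtain X where X: "X\<in>T" using T(2) by blast
   then have "toc (0 \<cdot>\<^sub>m X) = 0" using T(1) by (subst toc_smult[of X ?N]) auto
   then show "0\<in>toc ` T" using T(4)[OF X] by (metis imageI)
   fix x c assume "x\<in>toc ` T"
   then obtain X where X: "X\<in>T" "x = toc X" by blast
   then have Xc: "X\<in>carrier_mat ?N ?N" using T(1) by blast
   show "csc c x\<in>toc ` T" "st x\<in>toc ` T" unfolding X(2) using toc_ops(3,4)[OF Xc] T(4,5)[OF X(1)] by (metis imageI)+
   fix y assume "y\<in>toc ` T"
   then obtain Y where Y: "Y\<in>T" "y = toc Y" by blast
   then have Yc: "Y\<in>carrier_mat ?N ?N" using T(1) by blast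
   show "x + y\<in>toc ` T" "x*y\<in>toc ` T"
    unfolding X(2) Y(2) using toc_ops(1,2)[OF Xc Yc] T(3)[OF X(1) Y(1)] by (metis imageI)+
  qed
  moreover have "dal n S <= toc ` T"
  proof
   fix x assume x: "x\<in>dal n S"
   then have "toc (frc ?N x) = x" by (intro toc_frc bnd_bal dal_bal)
   then show "x\<in>toc ` T" using T(6) al x by (intro image_eqI[of _ _ "frc ?N x"]) auto
  qed
  ultimately have "bal S <= toc ` T" by (rule dal_generates[OF st n])
  then show ?case using T(1) toc_inject by (smt (verit) image_iff mem_Collect_eq subset_iff)
 qed
 then show ?thesis by (simp add: dsum_cstar_def gen_star_def dsum_amb_def N mat_alg_def)
qed

text \<open>Embeddings seen through their extensions: by \<open>embedding_iff\<close> the embeddings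
  are the restrictions of such maps. Injectivity refers to \<open>dal\<close>, as it does in
  \<open>embedding\<close>.\<close>

definition cemb :: "nat => stage => stage => (cm => cm) => bool" where
 "cemb n S T \<Phi> <-> shom (bal S) \<Phi> & \<Phi> ` bal S <= bal T & \<Phi> ` dal n S <= dal n T & inj_on \<Phi> (dal n S)"

context
 fixes n :: nat and Gs Hs :: "digraph list" and S T :: stage
 assumes n: "n >= 1" and S: "rep n Gs S" and T: "rep n Hs T"
begin

lemma rep_stage: "stage n S" "stage n T" using S T by (auto simp: rep_def)

lemma rep_alg: "X\<in>dsum_alg Gs <-> X\<in>carrier_mat (sz S) (sz S) & toc X\<in>dal n S" using S by (auto simp: rep_def)

lemma rep_frc: "x\<in>dal n S ==> frc (sz S) x\<in>dsum_alg Gs" "x\<in>bal S ==> toc (frc (sz S) x) = x"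
 "x\<in>bal S ==> frc (sz S) x\<in>car (dsum_cstar Gs)" by (auto simp: rep_alg toc_frc[OF bnd_bal] dal_bal rep_cstar[OF S n])

lemma star_hom_shom:
 assumes "star_hom (dsum_cstar Gs) (dsum_cstar Hs) \<phi>"
 shows "shom (bal S) (%x. toc (\<phi> (frc (sz S) x)))" "x\<in>bal S ==> toc (\<phi> (frc (sz S) x))\<in>bal T"
  "X\<in>car (dsum_cstar Gs) ==> \<phi> X = frc (sz T) (toc (\<phi> (frc (sz S) (toc X))))"
proof -
 let ?B = "car (dsum_cstar Gs)"
 have B: "X\<in>?B <-> X\<in>carrier_mat (sz S) (sz S) & toc X\<in>bal S" for X by (simp add: rep_cstar[OF S n])
 have im: "\<phi> X\<in>carrier_mat (sz T) (sz T)" "toc (\<phi> X)\<in>bal T" if "X\<in>?B" for X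
  using assms that by (auto simp: star_hom_def alg_hom_def rep_cstar[OF T n])
 have h: "\<phi> (X + Y) = \<phi> X + \<phi> Y" "\<phi> (X*Y) = \<phi> X*\<phi> Y" if "X\<in>?B" "Y\<in>?B" for X Y
  using assms that by (auto simp: star_hom_def alg_hom_def rep_cstar[OF T n] rep_cstar[OF S n] mat_alg_def)
 have h': "\<phi> (c \<cdot>\<^sub>m X) = c \<cdot>\<^sub>m \<phi> X" "\<phi> (mat_adjoint X) = mat_adjoint (\<phi> X)" if "X\<in>?B" for X c
  using assms that by (auto simp: star_hom_def alg_hom_def rep_cstar[OF T n] rep_cstar[OF S n] mat_alg_def)
 show "x\<in>bal S ==> toc (\<phi> (frc (sz S) x))\<in>bal T" using im(2)[OF rep_frc(3)] .
 show "X\<in>?B ==> \<phi> X = frc (sz T) (toc (\<phi> (frc (sz S) (toc X))))"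
  using im(1)[of X] by (simp add: B frc_toc[of X] frc_toc[of "\<phi> X" "sz T"])
 have f: "frc (sz S) (x + y) = frc (sz S) x + frc (sz S) y" "frc (sz S) (x*y) = frc (sz S) x*frc (sz S) y"
  "frc (sz S) (csc c x) = c \<cdot>\<^sub>m frc (sz S) x" "frc (sz S) (st x) = mat_adjoint (frc (sz S) x)"
  if "x\<in>bal S" "y\<in>bal S" for x y c by (rule toc_inject[THEN iffD1, of _ "sz S"];
    use that ssubD[OF ssub_bal[of S]] in \<open>simp add: toc_ops[of _ "sz S"] rep_frc mat_adjoint_carrier mult_carrier_mat[of _ "sz S" "sz S" _ "sz S"]\<close>)+
 show "shom (bal S) (%x. toc (\<phi> (frc (sz S) x)))" unfolding shom_def
  by (intro conjI ballI allI; simp add: f h h' rep_frc im toc_ops[of _ "sz T"])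
qed

lemma shom_star_hom:
 assumes h: "shom (bal S) \<Phi>" and im: "\<Phi> ` bal S <= bal T"
 shows "star_hom (dsum_cstar Gs) (dsum_cstar Hs) (%X. frc (sz T) (\<Phi> (toc X)))"
proof -
 have b: "bnd (sz T) (\<Phi> x)" if "x\<in>bal S" for x using bnd_bal im that by blast
 have t: "toc (frc (sz T) (\<Phi> x)) = \<Phi> x" if "x\<in>bal S" for x by (rule toc_frc[OF b[OF that]])
 have key: "frc (sz T) (\<Phi> (toc Z)) = Y" if "Y\<in>carrier_mat (sz T) (sz T)" "toc Z\<in>bal S" "toc Y = \<Phi> (toc Z)" for Y Z
  using that frc_toc by metis
 have "frc (sz T) (\<Phi> (toc (X + Y))) = frc (sz T) (\<Phi> (toc X)) + frc (sz T) (\<Phi> (toc Y))"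
  "frc (sz T) (\<Phi> (toc (X*Y))) = frc (sz T) (\<Phi> (toc X))*frc (sz T) (\<Phi> (toc Y))"
  "frc (sz T) (\<Phi> (toc (c \<cdot>\<^sub>m X))) = c \<cdot>\<^sub>m frc (sz T) (\<Phi> (toc X))"
  "frc (sz T) (\<Phi> (toc (mat_adjoint X))) = mat_adjoint (frc (sz T) (\<Phi> (toc X)))"
  if "X\<in>carrier_mat (sz S) (sz S)" "toc X\<in>bal S" "Y\<in>carrier_mat (sz S) (sz S)" "toc Y\<in>bal S" for X Y c
  by (rule key; use that ssubD[OF ssub_bal[of S]] in \<open>simp add: toc_ops[of _ "sz T"] toc_ops[of _ "sz S"] t shomD[OF h ssub_bal]
   mat_adjoint_carrier mult_carrier_mat[of _ "sz T" "sz T" _ "sz T"]\<close>)+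
 then show ?thesis unfolding star_hom_def alg_hom_def rep_cstar[OF S n] rep_cstar[OF T n] mat_alg_def using t im by auto
qed

lemma embedding_iff:
 "embedding Gs Hs \<phi> <-> (\<exists>\<Phi>. cemb n S T \<Phi> & (\<forall>X\<in>dsum_alg Gs. \<phi> X = frc (sz T) (\<Phi> (toc X))))"
proof
 assume "embedding Gs Hs \<phi>"
 then obtain \<Psi> where e: "\<phi> ` dsum_alg Gs <= dsum_alg Hs" "star_hom (dsum_cstar Gs) (dsum_cstar Hs) \<Psi>"
  "!!X. X\<in>dsum_alg Gs ==> \<Psi> X = \<phi> X" "inj_on \<phi> (dsum_alg Gs)" by (auto simp: embedding_def star_extendible_def)
 note s = star_hom_shom[OF e(2)]
 let ?\<Phi> = "%x. toc (\<Psi> (frc (sz S) x))"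
 have sub: "X\<in>dsum_alg Gs ==> X\<in>car (dsum_cstar Gs)" for X by (auto simp: rep_alg rep_cstar[OF S n] dal_bal)
 have H: "\<phi> X\<in>carrier_mat (sz T) (sz T) & toc (\<phi> X)\<in>dal n T" if "X\<in>dsum_alg Gs" for X
  using e(1) that T by (auto simp: rep_def)
 have "inj_on ?\<Phi> (dal n S)"
 proof (rule inj_onI)
  fix x y assume xy: "x\<in>dal n S" "y\<in>dal n S" "?\<Phi> x = ?\<Phi> y"
  note m = rep_frc(1)[OF xy(1)] rep_frc(1)[OF xy(2)]
  have "\<phi> (frc (sz S) x) = \<phi> (frc (sz S) y)"
   using xy(3) e(3)[OF m(1)] e(3)[OF m(2)] H[OF m(1)] H[OF m(2)] toc_inject by metis
  then have "frc (sz S) x = frc (sz S) y" using e(4) m by (auto dest: inj_onD)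
  then show "x = y" using rep_frc(2) dal_bal xy by metis
 qed
 moreover have "?\<Phi> ` dal n S <= dal n T" using e(3) H rep_frc(1) by auto
 ultimately have "cemb n S T ?\<Phi>" using s(1,2) by (auto simp: cemb_def)
 moreover have "\<phi> X = frc (sz T) (?\<Phi> (toc X))" if "X\<in>dsum_alg Gs" for X
  using s(3)[OF sub[OF that]] e(3)[OF that] by simp
 ultimately show "\<exists>\<Phi>. cemb n S T \<Phi> & (\<forall>X\<in>dsum_alg Gs. \<phi> X = frc (sz T) (\<Phi> (toc X)))"
  by (intro exI[of _ ?\<Phi>]) auto
next
 assume "\<exists>\<Phi>. cemb n S T \<Phi> & (\<forall>X\<in>dsum_alg Gs. \<phi> X = frc (sz T) (\<Phi> (toc X)))"
 then obtain \<Phi> where c: "cemb n S T \<Phi>" and e: "!!X. X\<in>dsum_alg Gs ==> \<phi> X = frc (sz T) (\<Phi> (toc X))" by blast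
 have t: "toc (frc (sz T) (\<Phi> x)) = \<Phi> x" if "x\<in>bal S" for x
  using c that by (intro toc_frc bnd_bal) (auto simp: cemb_def)
 have "\<phi> ` dsum_alg Gs <= dsum_alg Hs"
 proof
  fix Y assume "Y\<in>\<phi> ` dsum_alg Gs"
  then obtain X where X: "toc X\<in>dal n S" "Y = frc (sz T) (\<Phi> (toc X))" by (auto simp: e rep_alg)
  then have "toc Y\<in>dal n T" using c t[OF dal_bal[OF X(1)]] by (auto simp: cemb_def)
  then show "Y\<in>dsum_alg Hs" using T X(2) by (auto simp: rep_def)
 qed
 moreover have "inj_on \<phi> (dsum_alg Gs)"
 proof (rule inj_onI)
  fix X Y assume XY: "X\<in>dsum_alg Gs" "Y\<in>dsum_alg Gs" "\<phi> X = \<phi> Y"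
  then have d: "toc X\<in>dal n S" "toc Y\<in>dal n S" by (auto simp: rep_alg)
  have "\<Phi> (toc X) = \<Phi> (toc Y)" using XY(3) t[OF dal_bal[OF d(1)]] t[OF dal_bal[OF d(2)]] e[OF XY(1)] e[OF XY(2)] by metis
  then have "toc X = toc Y" using c d by (auto simp: cemb_def dest: inj_onD)
  then show "X = Y" using XY toc_inject by (auto simp: rep_alg)
 qed
 ultimately show "embedding Gs Hs \<phi>" unfolding embedding_def star_extendible_def
  using shom_star_hom[of \<Phi>] c e by (auto simp: cemb_def)
qed

end

section \<open>Proper and rigid embeddings in terms of isometries and normal forms\<close>

lemma dal_same_class:
 assumes "stage n T" shows "x\<in>dal n T & st x\<in>dal n T <-> spt (same_class T) x"
proof
 assume a: "x\<in>dal n T & st x\<in>dal n T"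
 show "spt (same_class T) x"
 proof (rule sptI)
  fix i j assume e: "ent x i j ~= 0"
  then have "same_cp T i j" "(lb T j, lb T i)\<in>ed n" using a by (auto simp: dal_def spt_def)
  moreover have "ent (st x) j i ~= 0" using e by (simp add: ent_st)
  then have "(lb T i, lb T j)\<in>ed n" using a by (auto simp: dal_def spt_def)
  ultimately show "same_class T i j" using ed_antisym[of "lb T i" "lb T j"] by (auto simp: same_class_def)
 qed
next
 assume "spt (same_class T) x"
 then show "x\<in>dal n T & st x\<in>dal n T"
  using assms by (auto simp: dal_def spt_def ent_st same_class_def same_cp_def stage_def ed_iff)
qed

lemma nf_cemb: assumes "nf n S T \<Phi>" shows "cemb n S T \<Phi>"
proof -
 obtain R F src tgt sg where f: "nfd n S T \<Phi> R F src tgt sg" using assms by (auto simp: nf_def)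
 have "inj_on \<Phi> (bal S)"
 proof (rule inj_onI)
  fix x y assume xy: "x\<in>bal S" "y\<in>bal S" "\<Phi> x = \<Phi> y"
  then have "norm (x - y) = norm (\<Phi> x - \<Phi> y)"
   using nf_norm[OF f, of "x - y"] ssubD(8)[OF ssub_bal] shomD(7)[OF nf_shom[OF f] ssub_bal] by simp
  then show "x = y" using xy by simp
 qed
 moreover have "dal n S <= bal S" by (rule subsetI) (rule dal_bal)
 ultimately have "inj_on \<Phi> (dal n S)" by (rule inj_on_subset)
 then show ?thesis unfolding cemb_def using nf_shom[OF f] nf_bal[OF f] nf_dal[OF f] by auto
qed

text \<open>The isometry \<open>W\<close> of a proper embedding, which acts as x to W x W*: one
  cycle of the summand \<open>t\<close>, turned by \<open>\<sigma>\<close>, spanned by the columns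
  of \<open>W\<close>.\<close>

definition pw :: "nat => stage => cm => nat => (nat => nat) => bool" where
 "pw n T W t \<sigma> <-> aut n \<sigma> & spt (%v i. i < 2*n & v < sz T & cp T v = t & lb T v = \<sigma> i) W &
  st W*W = idm {..<2*n}"

lemma zc_CS [simp]: "zc (CS n) 0 = idm {..<2*n}" by (simp add: zc_def lessThan_def)

lemma pw_nfd:
 assumes "pw n T W t \<sigma>" "n >= 1" shows "nfd n (CS n) T (%x. W*x*st W) {0} (%_. W) (%_. 0) (%_. t) (%_. \<sigma>)"
proof -
 have "0\<in>cp (CS n) ` {..<sz (CS n)}" using assms(2) by (auto intro!: image_eqI[of _ _ 0])
 then show ?thesis using assms(1) by (auto simp: nfd_def pw_def)
qed

lemma ent_outer:
 assumes "spt (%_ j. j = 0) x" "spt (%_ j. j = 0) y" shows "ent (x*st y) a b = ent x a 0*cnj (ent y b 0)"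
 using assms by (subst ent_mult_gen[of 1]) (auto simp: spt_def ent_st)

lemma mu_CS: "i < 2*n ==> k < 2*n ==> mu i k\<in>bal (CS n)" "(k, i)\<in>ed n ==> mu i k\<in>dal n (CS n)"
 using ed_iff[of k i n] by (auto intro!: mu_bal mu_dal simp: same_cp_def)

text \<open>The image of the first diagonal unit is w0 w0* for a unit vector \<open>w0\<close>, and
  the other matrix units move it to vectors \<open>w i\<close>. The images of the diagonal units are
  diagonal, so each \<open>w i\<close> lies in one class, at position \<open>\<sigma> i\<close>. If
  two positions agreed, the image of the matrix unit between them would be diagonal and would make
  two of the projections equivalent.\<close>

lemma proper_emb_imp:
 assumes n: "n >= 1" and T: "rep n Hs T" and p: "proper_emb n Hs \<eta>"
 obtains W t \<sigma> where "pw n T W t \<sigma>" "!!X. X\<in>dsum_alg [cycle_graph n] ==> \<eta> X = frc (sz T) (W*toc X*st W)"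
proof -
 have stT: "stage n T" using T by (simp add: rep_def)
 obtain \<Phi> where c: "cemb n (CS n) T \<Phi>" and \<eta>: "!!X. X\<in>dsum_alg [cycle_graph n] ==> \<eta> X = frc (sz T) (\<Phi> (toc X))"
  using p embedding_iff[OF n rep_cycle T] unfolding proper_emb_def by auto
 have h: "shom (bal (CS n)) \<Phi>" and hb: "!!x. x\<in>bal (CS n) ==> \<Phi> x\<in>bal T"
  and hd: "!!x. x\<in>dal n (CS n) ==> \<Phi> x\<in>dal n T" and inj: "inj_on \<Phi> (dal n (CS n))"
  using c by (auto simp: cemb_def)
 note hD = shomD[OF h ssub_bal]
 define E where "E i k = \<Phi> (mu i k)" for i k
 have EE: "E i k*E l m = (if k = l then E i m else 0)" if "i < 2*n" "k < 2*n" "l < 2*n" "m < 2*n" for i k l m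
  using hD(2)[OF mu_CS(1) mu_CS(1), of i k l m] hD(8) that by (auto simp: E_def mu_mult_mu)
 have Est: "st (E i k) = E k i" if "i < 2*n" "k < 2*n" for i k using hD(4)[OF mu_CS(1), of i k] that by (simp add: E_def)
 have Eb: "E i k\<in>bal T" if "i < 2*n" "k < 2*n" for i k using hb mu_CS(1) that by (simp add: E_def)
 have refl: "(i, i)\<in>ed n" if "i < 2*n" for i using that by (simp add: ed_iff)
 have E0: "E i i ~= 0" if "i < 2*n" for i
 proof
  assume "E i i = 0"
  then have "\<Phi> (mu i i) = \<Phi> 0" by (simp add: E_def hD(8))
  moreover have "0\<in>dal n (CS n)" by (simp add: dal_def)
  ultimately have "mu i i = 0" using inj_onD[OF inj _ mu_CS(2)[OF refl[OF that]]] by blast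
  then show False by simp
 qed
 have \<eta>E: "\<eta> (munit (2*n) i i) = frc (sz T) (E i i)" if "i < 2*n" for i
 proof -
  have "munit (2*n) i i\<in>dsum_alg [cycle_graph n]"
   using rep_alg[OF n rep_cycle rep_cycle, of "munit (2*n) i i"] toc_munit[OF that that] mu_CS(2)[OF refl[OF that]]
   by (auto simp: munit_def)
  then show ?thesis using \<eta> toc_munit[OF that that] by (simp add: E_def)
 qed
 have tE: "toc (frc (sz T) (E i k)) = E i k" if "i < 2*n" "k < 2*n" for i k using Eb[OF that] by (intro toc_frc bnd_bal)
 have z: "0 < 2*n" using n by simp
 have "vec_space.rank (sz T) (frc (sz T) (E 0 0)) = 1" using p T z \<eta>E[OF z] unfolding proper_emb_def rep_def by metis
 moreover have "proj (toc (frc (sz T) (E 0 0)))" using z by (simp add: tE proj_def Est EE)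
 ultimately obtain w0 where w0: "spt (%v j. v < sz T & j = 0) w0" "st w0*w0 = mu 0 0" "E 0 0 = w0*st w0"
  using rank_one_projection[OF frc_carrier] tE[OF z z] by metis
 define w where "w i = E i 0*w0" for i
 have wst: "w i*st (w k) = E i k" if "i < 2*n" "k < 2*n" for i k
 proof -
  have "w i*st (w k) = E i 0*E 0 0*E 0 k" using that by (simp add: w_def st_mult Est w0(3) mult.assoc)
  then show ?thesis using that by (simp add: EE)
 qed
 have stw: "st (w i)*w k = (if i = k then mu 0 0 else 0)" if "i < 2*n" "k < 2*n" for i k
 proof -
  have "st (w i)*w k = st w0*(E 0 i*E k 0)*w0" using that by (simp add: w_def st_mult Est mult.assoc)
  also have "... = (if i = k then (st w0*w0)*(st w0*w0) else 0)" using that by (simp add: EE w0(3) mult.assoc)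
  finally show ?thesis by (simp add: w0(2) mu_mult_mu)
 qed
 have ws: "spt (%v j. v < sz T & j = 0) (w i)" if "i < 2*n" for i
  unfolding w_def by (rule spt_mult[OF balD[OF Eb[OF that z]] w0(1)]) (auto simp: same_cp_def)
 have ws0: "spt (%_ j. j = 0) (w i)" if "i < 2*n" for i using ws[OF that] by (rule spt_mono) auto
 have wz: "ent (w i) a j = 0" if "i < 2*n" "j ~= 0" for i a j using sptD[OF ws0[OF that(1)], of a j] that(2) by blast
 have wmu: "w i*mu 0 0 = w i" if "i < 2*n" for i by (rule cm_eqI) (simp add: ent_mult_mu wz that)
 have "EX v. ent (w i) v 0 ~= 0" if i: "i < 2*n" for i
 proof (rule ccontr)
  assume "~ ?thesis"
  then have "ent (w i) a j = 0" for a j using wz[OF i, of j] by (cases "j = 0") auto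
  then have "w i = 0" by (intro cm_eqI) simp
  then show False using wst[OF i i] E0[OF i] by simp
 qed
 then obtain v where v: "!!i. i < 2*n ==> ent (w i) (v i) 0 ~= 0" by metis
 have entE: "ent (E i k) a b = ent (w i) a 0*cnj (ent (w k) b 0)" if "i < 2*n" "k < 2*n" for i k a b
  using ent_outer[OF ws0 ws0] wst that by simp
 have cl: "same_class T a (v i)" if "ent (w i) a 0 ~= 0" "i < 2*n" for a i
 proof -
  have "spt (same_class T) (E i i)"
   using hd[OF mu_CS(2)[OF refl[OF that(2)]]] dal_same_class[OF stT, of "E i i"] that(2) by (simp add: E_def Est[unfolded E_def])
  then show ?thesis using that v[OF that(2)] entE[OF that(2,2)] by (auto simp: spt_def)
 qed
 define \<sigma> where "\<sigma> i = lb T (v i)" for i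
 have ee: "same_cp T (v i) (v k)" "(\<sigma> k, \<sigma> i)\<in>ed n" if "(k, i)\<in>ed n" for i k
 proof -
  have ik: "i < 2*n" "k < 2*n" using that by (auto simp: ed_iff)
  have "E i k\<in>dal n T" unfolding E_def using hd mu_CS(2)[OF that] by blast
  moreover have "ent (E i k) (v i) (v k) ~= 0" using entE ik v by simp
  ultimately show "same_cp T (v i) (v k)" "(\<sigma> k, \<sigma> i)\<in>ed n" by (auto simp: dal_def spt_def \<sigma>_def)
 qed
 \<comment> \<open>Adjacent vectors lie in the same summand; the cycle is connected.\<close>
 have cpv: "cp T (v i) = cp T (v 0)" if "i < 2*n" for i using that
 proof (induction i)
  case (Suc i)
  then have "nbr n i (Suc i)" using nbr_Suc[OF n, of i] by simp
  then have "cp T (v i) = cp T (v (Suc i))" using ee(1)[of i "Suc i"] ee(1)[of "Suc i" i] by (auto simp: nbr_def same_cp_def)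
  then show ?case using Suc by simp
 qed simp
 have "\<sigma> i ~= \<sigma> k" if ik: "i < 2*n" "k < 2*n" "i ~= k" for i k
 proof
  assume e: "\<sigma> i = \<sigma> k"
  have "spt (same_class T) (E k i)"
  proof (rule sptI)
   fix a b assume "ent (E k i) a b ~= 0"
   then have "same_class T a (v k)" "same_class T b (v i)" using entE[OF ik(2,1)] cl ik by auto
   then show "same_class T a b" using e cpv[OF ik(1)] cpv[OF ik(2)] by (auto simp: same_class_def same_cp_def \<sigma>_def)
  qed
  then have d: "E k i\<in>dal n T" "E i k\<in>dal n T" using dal_same_class[OF stT, of "E k i"] Est[OF ik(2,1)] by auto
  let ?V = "frc (sz T) (E k i)"
  have a: "mat_adjoint ?V = frc (sz T) (E i k)"
   by (rule toc_inject[THEN iffD1, of _ "sz T"]) (auto simp: mat_adjoint_carrier toc_adj[of _ "sz T"] tE ik Est)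
  have "mat_adjoint ?V*?V = frc (sz T) (E i i)" "?V*mat_adjoint ?V = frc (sz T) (E k k)"
   unfolding a by (rule toc_inject[THEN iffD1, of _ "sz T"];
    simp add: toc_mult[of _ "sz T"] tE ik EE mult_carrier_mat[of _ "sz T" "sz T" _ "sz T"])+
  moreover have "?V\<in>dsum_alg Hs" "mat_adjoint ?V\<in>dsum_alg Hs" unfolding a using d by (auto intro!: rep_frc(1)[OF n T T])
  ultimately have "proj_equiv Hs (\<eta> (munit (2*n) i i)) (\<eta> (munit (2*n) k k))"
   unfolding proj_equiv_def \<eta>E[OF ik(1)] \<eta>E[OF ik(2)] by blast
  then show False using p ik by (auto simp: proper_emb_def)
 qed
 then have "inj_on \<sigma> {..<2*n}" by (auto simp: inj_on_def)
 moreover have \<sigma>l: "\<sigma> ` {..<2*n} <= {..<2*n}" using ee(2)[OF refl] by (auto simp: ed_iff)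
 ultimately have "bij_betw \<sigma> {..<2*n} {..<2*n}" by (simp add: bij_betw_def endo_inj_surj)
 then have aut: "aut n \<sigma>" using ee(2) by (simp add: aut_def)
 define W where "W = (\<Sum>i<2*n. w i*mu 0 i)"
 have Wmu: "W*mu i k = w i*mu 0 k" if "i < 2*n" for i k
 proof -
  have "W*mu i k = (\<Sum>j<2*n. if j = i then w j*mu 0 k else 0)"
   unfolding W_def sum_distrib_right by (intro sum.cong refl) (auto simp: mult.assoc mu_mult_mu)
  then show ?thesis using that by simp
 qed
 have WmuW: "W*mu i k*st W = E i k" if "i < 2*n" "k < 2*n" for i k
 proof -
  have "W*mu i k*st W = W*mu i 0*st (W*mu k 0)" by (simp add: st_mult mult.assoc mu_mult_mu_assoc)
  then show ?thesis using Wmu wmu wst that by simp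
 qed
 have "st W*W = (\<Sum>i<2*n. \<Sum>k<2*n. mu i 0*(st (w i)*w k)*mu 0 k)"
  by (simp add: W_def st_sum st_mult sum_product mult.assoc)
 also have "... = (\<Sum>i<2*n. \<Sum>k<2*n. if k = i then mu i i else 0)" by (intro sum.cong refl) (auto simp: stw mu_mult_mu)
 finally have WW: "st W*W = idm {..<2*n}" by (simp add: idm_def)
 have "spt (%u i. i < 2*n & u < sz T & cp T u = cp T (v 0) & lb T u = \<sigma> i) W" unfolding W_def
 proof (rule spt_sum)
  fix i assume "i\<in>{..<2*n}"
  then have i: "i < 2*n" by simp
  show "spt (%u i. i < 2*n & u < sz T & cp T u = cp T (v 0) & lb T u = \<sigma> i) (w i*mu 0 i)"
   using cl[OF _ i] i cpv[OF i] by (auto simp: spt_def ent_mult_mu same_class_def same_cp_def \<sigma>_def split: if_splits)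
 qed
 then have pw: "pw n T W (cp T (v 0)) \<sigma>" using aut WW by (simp add: pw_def)
 have hW: "shom (bal (CS n)) (%x. W*x*st W)" by (rule nf_shom[OF pw_nfd[OF pw n]])
 have "bal (CS n) <= {x\<in>bal (CS n). \<Phi> x = W*x*st W}"
  by (rule bal_span) (use ssubD[OF shom_agree[OF ssub_bal h hW]] WmuW mu_CS(1) in \<open>auto simp: same_cp_def E_def\<close>)
 then have "\<Phi> (toc X) = W*toc X*st W" if "X\<in>dsum_alg [cycle_graph n]" for X
  using that rep_alg[OF n rep_cycle rep_cycle, of X] dal_bal by blast
 then show thesis using that[OF pw] \<eta> by simp
qed

text \<open>The projections sit at pairwise different positions, and a diagonal element cannot move
  a projection to another position.\<close>

lemma proper_embI:
 assumes n: "n >= 1" and T: "rep n Hs T" and pw: "pw n T W t \<sigma>"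
  and \<eta>: "!!X. X\<in>dsum_alg [cycle_graph n] ==> \<eta> X = frc (sz T) (W*toc X*st W)" shows "proper_emb n Hs \<eta>"
proof -
 have stT: "stage n T" using T by (simp add: rep_def)
 note nf = pw_nfd[OF pw n]
 have WW: "st W*W = idm {..<2*n}" and Ws: "spt (%v i. i < 2*n & v < sz T & cp T v = t & lb T v = \<sigma> i) W"
  and aut: "aut n \<sigma>" using pw by (auto simp: pw_def)
 define E where "E i = W*mu i i*st W" for i
 have md: "munit (2*n) i i\<in>dsum_alg [cycle_graph n]" if "i < 2*n" for i
  using rep_alg[OF n rep_cycle rep_cycle, of "munit (2*n) i i"] toc_munit[OF that that] mu_CS(2)[of i i n] that
  by (auto simp: munit_def ed_iff)
 have \<eta>E: "\<eta> (munit (2*n) i i) = frc (sz T) (E i)" if "i < 2*n" for i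
  using \<eta>[OF md[OF that]] toc_munit[OF that that] by (simp add: E_def)
 have tE: "toc (frc (sz T) (E i)) = E i" if "i < 2*n" for i
  unfolding E_def using nf_bal[OF nf mu_CS(1)[OF that that]] by (intro toc_frc bnd_bal)
 have idmu: "idm {..<2*n}*mu i i = mu i i" if "i < 2*n" for i using that by (intro idm_mult spt_mu) auto
 have E0: "E i ~= 0" if "i < 2*n" for i
 proof
  assume "E i = 0"
  then have "(st W*W)*mu i i*(st W*W) = 0" by (simp add: E_def) (metis mult.assoc mult_zero_left mult_zero_right)
  then have "mu i i*idm {..<2*n} = 0" by (simp add: WW idmu that)
  moreover have "mu i i*idm {..<2*n} = mu i i" using that by (intro mult_idm spt_mu) auto
  ultimately show False by simp
 qed
 have EE: "E i*E i = E i" if "i < 2*n" for i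
 proof -
  have "E i*E i = W*(mu i i*((st W*W)*mu i i))*st W" by (simp add: E_def mult.assoc)
  then show ?thesis by (simp add: WW idmu that mu_mult_mu E_def)
 qed
 have rank: "vec_space.rank (sz T) (frc (sz T) (E i)) = 1" if i: "i < 2*n" for i
 proof (subst rank_eq_1_iff[OF frc_carrier], intro conjI)
  show "frc (sz T) (E i) ~= 0\<^sub>m (sz T) (sz T)" using tE[OF i] E0[OF i] toc_zero by auto
  have "E i = (W*mu i 0)*st (W*mu i 0)" by (simp add: E_def st_mult mult.assoc mu_mult_mu_assoc)
  moreover have "spt (%_ j. j = 0) (W*mu i 0)" by (auto simp: spt_def ent_mult_mu)
  ultimately have "ent (E i) a b = ent W a i*cnj (ent W b i)" for a b by (simp add: ent_outer ent_mult_mu)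
  then show "EX f g. \<forall>a<sz T. \<forall>b<sz T. frc (sz T) (E i) $$ (a, b) = f a*g b"
   by (intro exI[of _ "%a. ent W a i"] exI[of _ "%b. cnj (ent W b i)"]) (auto simp: frc_def)
 qed
 have Es: "spt (%a b. lb T a = \<sigma> i & lb T b = \<sigma> i) (E i)" if "i < 2*n" for i
 proof -
  have 1: "spt (%v j. j = i & lb T v = \<sigma> i) (W*mu i i)" using Ws by (auto simp: spt_def ent_mult_mu)
  have 2: "spt (%j v. lb T v = \<sigma> j) (st W)" by (rule spt_mono[OF spt_st[OF Ws]]) auto
  show ?thesis unfolding E_def by (rule spt_mult[OF 1 2]) auto
 qed
 have "~ proj_equiv Hs (\<eta> (munit (2*n) i i)) (\<eta> (munit (2*n) k k))" if ik: "i < 2*n" "k < 2*n" "i ~= k" for i k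
 proof
  assume "proj_equiv Hs (\<eta> (munit (2*n) i i)) (\<eta> (munit (2*n) k k))"
  then obtain V where V: "V\<in>dsum_alg Hs" "mat_adjoint V\<in>dsum_alg Hs" "mat_adjoint V*V = frc (sz T) (E i)"
   "V*mat_adjoint V = frc (sz T) (E k)" unfolding proj_equiv_def \<eta>E[OF ik(1)] \<eta>E[OF ik(2)] by blast
  have Vc: "V\<in>carrier_mat (sz T) (sz T)" "toc V\<in>dal n T" "st (toc V)\<in>dal n T"
   using V(1,2) rep_alg[OF n T T] toc_adj[of V "sz T"] by auto
  have vs: "spt (same_class T) (toc V)" using dal_same_class[OF stT] Vc by blast
  have v: "st (toc V)*toc V = E i" "toc V*st (toc V) = E k" using arg_cong[OF V(3), of toc] arg_cong[OF V(4), of toc] Vc ik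
   by (auto simp: toc_mult[of _ "sz T"] toc_adj[of _ "sz T"] mat_adjoint_carrier tE)
  have "E k = E k*E k" by (simp add: EE ik)
  also have "... = toc V*E i*st (toc V)" by (simp add: mult.assoc flip: v)
  finally have Ek: "E k = toc V*E i*st (toc V)" .
  have s1: "spt (%a b. lb T a = \<sigma> i) (toc V*E i)" by (rule spt_mult[OF vs Es[OF ik(1)]]) (auto simp: same_class_def)
  have s2: "spt (%a b. lb T a = \<sigma> i) (E k)" unfolding Ek by (rule spt_mult[OF s1, of "%_ _. True"]) (auto simp: spt_def)
  have "ent (E k) a b = 0" for a b using sptD[OF s2, of a b] sptD[OF Es[OF ik(2)], of a b] aut_inj[OF aut ik(1,2)] ik(3) by auto
  then have "E k = 0" by (intro cm_eqI) simp
  then show False using E0 ik by simp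
 qed
 moreover have "embedding [cycle_graph n] Hs \<eta>" using embedding_iff[OF n rep_cycle T] nf_cemb[OF nfI[OF nf]] \<eta> by blast
 ultimately show ?thesis unfolding proper_emb_def using rank \<eta>E T by (auto simp: rep_def)
qed

lemma toc_foldr:
 assumes "!!\<theta>. \<theta>\<in>set \<theta>s ==> \<theta> x\<in>carrier_mat N N"
 shows "foldr (%\<theta> y. \<theta> x + y) \<theta>s (0\<^sub>m N N)\<in>carrier_mat N N &
  toc (foldr (%\<theta> y. \<theta> x + y) \<theta>s (0\<^sub>m N N)) = (\<Sum>r<length \<theta>s. toc ((\<theta>s ! r) x))"
proof -
 have "foldr (%\<theta> y. \<theta> x + y) \<theta>s (0\<^sub>m N N)\<in>carrier_mat N N &
  toc (foldr (%\<theta> y. \<theta> x + y) \<theta>s (0\<^sub>m N N)) = sum_list (map (%\<theta>. toc (\<theta> x)) \<theta>s)"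
  using assms by (induction \<theta>s) (auto simp: toc_zero toc_add[of _ N])
 then show ?thesis by (simp add: sum_list_sum_nth atLeast0LessThan)
qed

text \<open>For a proper embedding with isometry \<open>W\<close> into the summand \<open>t\<close>,
  only the compressions \<open>F r\<close> starting in \<open>t\<close> contribute. The isometries F
  r W have orthogonal ranges and give proper summands.\<close>

lemma rigid_of_nf:
 assumes n: "n >= 1" and S: "rep n Gs S" and T: "rep n Hs T" and nf: "nf n S T \<Phi>"
  and \<phi>: "!!X. X\<in>dsum_alg Gs ==> \<phi> X = frc (sz T) (\<Phi> (toc X))" shows "rigid n Gs Hs \<phi>"
 unfolding rigid_def
proof (intro conjI allI impI)
 show "embedding Gs Hs \<phi>" using embedding_iff[OF n S T] nf_cemb[OF nf] \<phi> by blast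
 obtain R F src tgt sg where f: "nfd n S T \<Phi> R F src tgt sg" using nf by (auto simp: nf_def)
 fix \<eta> assume "proper_emb n Gs \<eta>"
 then obtain W t \<sigma> where pw: "pw n S W t \<sigma>"
  and \<eta>: "!!X. X\<in>dsum_alg [cycle_graph n] ==> \<eta> X = frc (sz S) (W*toc X*st W)"
  using proper_emb_imp[OF n S] by metis
 note g = pw_nfd[OF pw n]
 have WW: "st W*W = idm {..<2*n}" and Ws: "spt (%v i. i < 2*n & v < sz S & cp S v = t & lb S v = \<sigma> i) W"
  and aut: "aut n \<sigma>" using pw by (auto simp: pw_def)
 have nfc: "nf n (CS n) T (%x. \<Phi> (W*x*st W))" by (rule nf_comp[OF nfI[OF g] nf])
 have \<phi>\<eta>: "(\<phi> \<circ> \<eta>) X = frc (sz T) (\<Phi> (W*toc X*st W))" if X: "X\<in>dsum_alg [cycle_graph n]" for X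
 proof -
  have d: "W*toc X*st W\<in>dal n S" using nf_dal[OF g] X rep_alg[OF n rep_cycle rep_cycle] by blast
  show ?thesis using \<phi>[OF rep_frc(1)[OF n S S d]] rep_frc(2)[OF n S S dal_bal[OF d]] \<eta>[OF X] by simp
 qed
 define R' where "R' = {r\<in>R. src r = t}"
 define rs where "rs = sorted_list_of_set R'"
 have R': "finite R'" "set rs = R'" "distinct rs" using nfdD(1)[OF f] by (auto simp: R'_def rs_def)
 have rsR: "rs ! s\<in>R" "src (rs ! s) = t" if "s < length rs" for s using nth_mem[OF that] R'(2) by (auto simp: R'_def)
 define U where "U r = F r*W" for r
 have UU: "st (U r)*U q = (if r = q then idm {..<2*n} else 0)" if "r\<in>R'" "q\<in>R'" for r q
 proof -
  have "zc S t*W = W" unfolding zc_def by (rule idm_mult) (auto intro!: spt_mono[OF Ws])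
  moreover have "st (U r)*U q = st W*(st (F r)*(F q*W))" by (simp add: U_def st_mult mult.assoc)
  ultimately show ?thesis using that by (simp add: F_mid[OF f] R'_def WW)
 qed
 have pwU: "pw n T (U r) (tgt r) (%i. sg r (\<sigma> i))" if r: "r\<in>R'" for r
 proof -
  have rR: "r\<in>R" using r by (simp add: R'_def)
  have "spt (%v i. i < 2*n & v < sz T & cp T v = tgt r & lb T v = sg r (\<sigma> i)) (U r)"
   unfolding U_def by (rule spt_mult[OF nfdD(4)[OF f rR] Ws]) auto
  then show ?thesis using UU[OF r r] aut_comp[OF nfdD(2)[OF f rR] aut] by (simp add: pw_def)
 qed
 have sum: "\<Phi> (W*x*st W) = (\<Sum>r\<in>R'. U r*x*st (U r))" if x: "x\<in>bal (CS n)" for x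
 proof -
  have "F r*(W*x*st W)*st (F r) = (if src r = t then U r*x*st (U r) else 0)" if r: "r\<in>R" for r
  proof (cases "src r = t")
   case False
   have "F r*W = 0" by (rule spt_mult_0[OF nfdD(4)[OF f r] Ws]) (use False in auto)
   then have "F r*(W*x*st W)*st (F r) = 0" by (simp flip: mult.assoc)
   then show ?thesis using False by simp
  qed (simp add: U_def st_mult mult.assoc)
  then have "\<Phi> (W*x*st W) = (\<Sum>r\<in>R. if src r = t then U r*x*st (U r) else 0)"
   using nfdD(8)[OF f nf_bal[OF g x]] by simp
  then show ?thesis using nfdD(1)[OF f] by (simp add: R'_def sum.inter_filter)
 qed
 define \<theta> where "\<theta> r X = frc (sz T) (U r*toc X*st (U r))" for r X
 have t\<theta>: "toc (\<theta> r X) = U r*toc X*st (U r)" if "r\<in>R'" "toc X\<in>bal (CS n)" for r X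
  unfolding \<theta>_def using nf_bal[OF pw_nfd[OF pwU[OF that(1)] n] that(2)] by (intro toc_frc bnd_bal)
 have one: "toc (1\<^sub>m (2*n))\<in>bal (CS n)" using one_bal[of "CS n"] by (simp add: toc_one one_def)
 have N: "sum_list (map fst Hs) = sz T" using T by (simp add: rep_def)
 show "rigid_cycle_emb n Hs (\<phi> \<circ> \<eta>)" unfolding rigid_cycle_emb_def N Let_def
 proof (intro conjI exI[of _ "map \<theta> rs"] ballI allI impI)
  show "embedding [cycle_graph n] Hs (\<phi> \<circ> \<eta>)"
   using embedding_iff[OF n rep_cycle T] nf_cemb[OF nfc] \<phi>\<eta> by blast
  show "proper_emb n Hs \<theta>'" if "\<theta>'\<in>set (map \<theta> rs)" for \<theta>'
   using that R' proper_embI[OF n T pwU] by (auto simp: \<theta>_def)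
  show "(map \<theta> rs ! s) (1\<^sub>m (2*n))*(map \<theta> rs ! q) (1\<^sub>m (2*n)) = 0\<^sub>m (sz T) (sz T)"
   if "s < length (map \<theta> rs)" "q < length (map \<theta> rs)" "s ~= q" for s q
  proof (rule toc_inject[THEN iffD1, of _ "sz T"])
   have m: "rs ! s\<in>R'" "rs ! q\<in>R'" "rs ! s ~= rs ! q" using that R' by (auto simp: nth_eq_iff_index_eq)
   let ?I = "toc (1\<^sub>m (2*n))"
   have "toc (\<theta> (rs ! s) (1\<^sub>m (2*n))*\<theta> (rs ! q) (1\<^sub>m (2*n))) = U (rs ! s)*?I*(st (U (rs ! s))*U (rs ! q))*?I*st (U (rs ! q))"
    using m by (subst toc_mult[of _ "sz T"]) (simp_all add: t\<theta> one mult.assoc, simp_all add: \<theta>_def)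
   then show "toc ((map \<theta> rs ! s) (1\<^sub>m (2*n))*(map \<theta> rs ! q) (1\<^sub>m (2*n))) = toc (0\<^sub>m (sz T) (sz T))"
    using that m by (simp add: UU toc_zero)
  qed (use that in \<open>auto simp: \<theta>_def intro!: mult_carrier_mat[of _ "sz T" "sz T" _ "sz T"]\<close>)
  show "(\<phi> \<circ> \<eta>) X = foldr (%\<theta> y. \<theta> X + y) (map \<theta> rs) (0\<^sub>m (sz T) (sz T))"
   if X: "X\<in>dsum_alg [cycle_graph n]" for X
  proof -
   have xb: "toc X\<in>bal (CS n)" using X rep_alg[OF n rep_cycle rep_cycle] dal_bal by blast
   note fl = toc_foldr[of "map \<theta> rs" X "sz T"]
   have c: "\<theta>' X\<in>carrier_mat (sz T) (sz T)" if "\<theta>'\<in>set (map \<theta> rs)" for \<theta>' using that by (auto simp: \<theta>_def)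
   have "(\<Sum>r<length (map \<theta> rs). toc ((map \<theta> rs ! r) X)) = (\<Sum>r<length rs. U (rs ! r)*toc X*st (U (rs ! r)))"
    using R'(2) xb by (intro sum.cong) (auto simp: t\<theta>)
   also have "... = (\<Sum>r\<in>R'. U r*toc X*st (U r))" using R'(2,3) by (intro sum.reindex_bij_betw bij_betw_nth) auto
   finally have "(\<Sum>r<length (map \<theta> rs). toc ((map \<theta> rs ! r) X)) = \<Phi> (W*toc X*st W)" using sum[OF xb] by simp
   moreover obtain R2 F2 src2 tgt2 sg2 where "nfd n (CS n) T (%x. \<Phi> (W*x*st W)) R2 F2 src2 tgt2 sg2"
    using nfc by (auto simp: nf_def)
   then have "toc ((\<phi> \<circ> \<eta>) X) = \<Phi> (W*toc X*st W)"
    unfolding \<phi>\<eta>[OF X] using nf_bal xb by (intro toc_frc bnd_bal) blast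
   moreover have "(\<phi> \<circ> \<eta>) X\<in>carrier_mat (sz T) (sz T)" using \<phi>\<eta>[OF X] by simp
   ultimately show ?thesis using fl c toc_inject by metis
  qed
 qed
qed

text \<open>The proper summands of the composite come from isometries \<open>U r\<close>, whose
  ranges are orthogonal because the images of the identity are. The resulting formula holds on
  \<open>dal\<close> and extends to \<open>bal\<close> by \<open>hom_unique\<close>.\<close>

lemma rigid_cycle_nf:
 assumes n: "n >= 1" and S: "rep n Gs S" and T: "rep n Hs T" and c: "cemb n S T \<Phi>"
  and \<phi>: "!!X. X\<in>dsum_alg Gs ==> \<phi> X = frc (sz T) (\<Phi> (toc X))" and rig: "rigid n Gs Hs \<phi>"
  and pw: "pw n S W t \<sigma>"
 obtains R F tgt sg where "nfd n (CS n) T (%x. \<Phi> (W*x*st W)) R F (%_. 0) tgt sg"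
proof -
 note g = pw_nfd[OF pw n]
 have h: "shom (bal S) \<Phi>" and inj: "inj_on \<Phi> (dal n S)" and hb: "!!x. x\<in>bal S ==> \<Phi> x\<in>bal T"
  using c by (auto simp: cemb_def)
 define \<eta> where "\<eta> X = frc (sz S) (W*toc X*st W)" for X
 have "proper_emb n Gs \<eta>" by (rule proper_embI[OF n S pw]) (simp add: \<eta>_def)
 then have rc: "rigid_cycle_emb n Hs (\<phi> \<circ> \<eta>)" using rig by (simp add: rigid_def)
 have N: "sum_list (map fst Hs) = sz T" using T by (simp add: rep_def)
 obtain \<theta>s where th: "\<forall>\<theta>\<in>set \<theta>s. proper_emb n Hs \<theta>"
  and orth: "!!s t. s < length \<theta>s ==> t < length \<theta>s ==> s ~= t ==>
   (\<theta>s ! s) (1\<^sub>m (2*n))*(\<theta>s ! t) (1\<^sub>m (2*n)) = 0\<^sub>m (sz T) (sz T)"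
  and sm: "!!X. X\<in>dsum_alg [cycle_graph n] ==> (\<phi> \<circ> \<eta>) X = foldr (%\<theta> y. \<theta> X + y) \<theta>s (0\<^sub>m (sz T) (sz T))"
  using rc unfolding rigid_cycle_emb_def N Let_def by blast
 define m where "m = length \<theta>s"
 have "ALL r. \<exists>W t \<sigma>. r < m --> pw n T W t \<sigma> & (\<forall>X\<in>dsum_alg [cycle_graph n]. (\<theta>s ! r) X = frc (sz T) (W*toc X*st W))"
  using proper_emb_imp[OF n T] th m_def nth_mem by metis
 then obtain U tg sg where U: "!!r. r < m ==> pw n T (U r) (tg r) (sg r)"
  "!!r X. r < m ==> X\<in>dsum_alg [cycle_graph n] ==> (\<theta>s ! r) X = frc (sz T) (U r*toc X*st (U r))" by metis
 note gU = pw_nfd[OF U(1) n]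
 have C: "X\<in>dsum_alg [cycle_graph n] <-> X\<in>carrier_mat (2*n) (2*n) & toc X\<in>dal n (CS n)" for X
  using rep_alg[OF n rep_cycle rep_cycle, of X] by simp
 have tU: "toc (frc (sz T) (U r*x*st (U r))) = U r*x*st (U r)" if "r < m" "x\<in>bal (CS n)" for r x
  using nf_bal[OF gU[OF that(1)] that(2)] by (intro toc_frc bnd_bal)
 have WWU: "st (U r)*U r = idm {..<2*n}" "U r*idm {..<2*n} = U r" if "r < m" for r
  using U(1)[OF that] by (auto simp: pw_def intro!: mult_idm elim!: spt_mono)
 have iU: "idm {..<2*n}*st (U r) = st (U r)" if "r < m" for r using WWU(2)[OF that] by (metis projD(1) proj_idm st_mult)
 have one: "toc (1\<^sub>m (2*n))\<in>bal (CS n)" "1\<^sub>m (2*n)\<in>dsum_alg [cycle_graph n]"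
  using one_bal[of "CS n"] by (auto simp: toc_one one_def C dal_def spt_def ent_idm same_cp_def ed_iff split: if_splits)
 have UU: "st (U r)*U q = 0" if "r < m" "q < m" "r ~= q" for r q
 proof -
  have "U r*st (U r)*(U q*st (U q)) = 0"
   using arg_cong[OF orth[OF that[unfolded m_def]], of toc] tU[OF that(1) one(1)] tU[OF that(2) one(1)] that
   by (simp add: U(2) one toc_mult[of _ "sz T"] toc_zero toc_one WWU)
  then have "(st (U r)*U r)*(st (U r)*U q)*(st (U q)*U q) = 0" by (metis (no_types) mult.assoc mult_zero_left mult_zero_right)
  then show ?thesis using that iU[OF that(1)] WWU(2)[OF that(2)] WWU(1) by (simp add: mult.assoc) (metis mult.assoc)
 qed
 have eq: "\<Phi> (W*x*st W) = (\<Sum>r<m. U r*x*st (U r))" if x: "x\<in>dal n (CS n)" for x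
 proof -
  let ?X = "frc (2*n) x"
  have X: "?X\<in>dsum_alg [cycle_graph n]" "toc ?X = x" using x rep_frc[OF n rep_cycle rep_cycle, of x] dal_bal[OF x] by auto
  have d: "W*x*st W\<in>dal n S" using nf_dal[OF g x] .
  have "(\<phi> \<circ> \<eta>) ?X = frc (sz T) (\<Phi> (W*x*st W))"
   using \<phi>[OF rep_frc(1)[OF n S S d]] rep_frc(2)[OF n S S dal_bal[OF d]] X by (simp add: \<eta>_def)
  then have "toc ((\<phi> \<circ> \<eta>) ?X) = \<Phi> (W*x*st W)" using hb[OF dal_bal[OF d]] by (simp add: toc_frc bnd_bal)
  moreover have "\<theta> ?X\<in>carrier_mat (sz T) (sz T)" if "\<theta>\<in>set \<theta>s" for \<theta>
   using that U(2)[OF _ X(1)] by (auto simp: in_set_conv_nth m_def)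
  then have "toc ((\<phi> \<circ> \<eta>) ?X) = (\<Sum>r<m. toc ((\<theta>s ! r) ?X))"
   using toc_foldr[of \<theta>s ?X "sz T"] sm[OF X(1)] by (simp add: m_def)
  moreover have "... = (\<Sum>r<m. U r*x*st (U r))" using X dal_bal[OF x] by (intro sum.cong) (auto simp: U(2) tU)
  ultimately show ?thesis by simp
 qed
 \<comment> \<open>An empty sum would be the zero map, against injectivity.\<close>
 have "m ~= 0"
 proof
  assume m: "m = 0"
  have d: "mu 0 0\<in>dal n (CS n)" using n by (intro mu_CS) (auto simp: ed_iff)
  have z: "0\<in>dal n (CS n)" "0\<in>dal n S" by (auto simp: dal_def)
  have "\<Phi> (W*mu 0 0*st W) = \<Phi> 0" using eq[OF d] eq[OF z(1)] m by simp
  then have "W*mu 0 0*st W = 0" using inj_onD[OF inj _ nf_dal[OF g d] z(2)] by blast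
  moreover have "norm (W*mu 0 0*st W) = norm (mu 0 0)" by (rule nf_norm[OF g dal_bal[OF d]])
  ultimately show False by simp
 qed
 have nfU: "nfd n (CS n) T (%x. \<Sum>r<m. U r*x*st (U r)) {..<m} U (%_. 0) tg sg"
  unfolding nfd_def using nfdD(3)[OF g] \<open>m ~= 0\<close> by (auto simp: U(1)[unfolded pw_def] UU WWU)
 have hW: "shom (bal (CS n)) (%x. \<Phi> (W*x*st W))" using nf_shom[OF g] nf_bal[OF g] h unfolding shom_def by simp
 have "\<Phi> (W*x*st W) = (\<Sum>r<m. U r*x*st (U r))" if "x\<in>bal (CS n)" for x
  by (rule hom_unique[OF rep_stage(1)[OF n rep_cycle T] n hW nf_shom[OF nfU] eq that])
 then have "nfd n (CS n) T (%x. \<Phi> (W*x*st W)) {..<m} U (%_. 0) tg sg" using nfU unfolding nfd_def by auto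
 then show thesis by (rule that)
qed

text \<open>Rigidity speaks about single cycles only. One cycle is chosen in each summand, and
  \<open>rigid_cycle_nf\<close> gives compressions for it. The other indices of a class are attached
  by the images \<open>D a\<close> of the matrix units joining them to the chosen index; these are
  diagonal, so the positions are unchanged.\<close>

lemma nf_of_rigid:
 assumes n: "n >= 1" and S: "rep n Gs S" and T: "rep n Hs T" and c: "cemb n S T \<Phi>"
  and \<phi>: "!!X. X\<in>dsum_alg Gs ==> \<phi> X = frc (sz T) (\<Phi> (toc X))" and rig: "rigid n Gs Hs \<phi>"
 shows "nf n S T \<Phi>"
proof -
 have stS: "stage n S" and stT: "stage n T" using S T by (auto simp: rep_def)
 have h: "shom (bal S) \<Phi>" and hb: "!!x. x\<in>bal S ==> \<Phi> x\<in>bal T" and hd: "!!x. x\<in>dal n S ==> \<Phi> x\<in>dal n T"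
  using c by (auto simp: cemb_def)
 note hD = shomD[OF h ssub_bal]
 let ?I = "cp S ` {..<sz S}"
 have "ALL t j. EX v. t\<in>?I --> j < 2*n --> v < sz S & cp S v = t & lb S v = j" using stS by (auto simp: stage_def)
 then obtain p where p: "!!t j. t\<in>?I ==> j < 2*n ==> p t j < sz S & cp S (p t j) = t & lb S (p t j) = j" by metis
 define W where "W t = (\<Sum>j<2*n. mu (p t j) j)" for t
 have Wmu: "W t*mu j k = mu (p t j) k" if "j < 2*n" for t j k
 proof -
  have "W t*mu j k = (\<Sum>i<2*n. if i = j then mu (p t j) k else 0)"
   unfolding W_def sum_distrib_right by (intro sum.cong refl) (auto simp: mu_mult_mu)
  then show ?thesis using that by simp
 qed
 have WmuW: "W t*mu j k*st (W t) = mu (p t j) (p t k)" if "j < 2*n" "k < 2*n" for t j k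
 proof -
  have "W t*mu j k*st (W t) = (W t*mu j 0)*st (W t*mu k 0)" by (simp add: st_mult mult.assoc mu_mult_mu_assoc)
  then show ?thesis using that by (simp add: Wmu mu_mult_mu)
 qed
 have pw: "pw n S (W t) t (%i. i)" if t: "t\<in>?I" for t
 proof -
  have "st (W t)*W t = (\<Sum>i<2*n. \<Sum>k<2*n. if k = i then mu i i else 0)" unfolding W_def st_sum sum_product
  proof (intro sum.cong refl)
   fix i k assume "i\<in>{..<2*n}" "k\<in>{..<2*n}"
   then have "p t i = p t k <-> i = k" using p[OF t] by (metis lessThan_iff)
   then show "st (mu (p t i) i)*mu (p t k) k = (if k = i then mu i i else 0)" by (auto simp: mu_mult_mu)
  qed
  then have "st (W t)*W t = idm {..<2*n}" by (simp add: idm_def)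
  moreover have "spt (%v i. i < 2*n & v < sz S & cp S v = t & lb S v = i) (W t)"
   unfolding W_def using p[OF t] by (intro spt_sum spt_mu) auto
  ultimately show ?thesis by (simp add: pw_def aut_id)
 qed
 have "ALL t. \<exists>R F tgt sg. t\<in>?I --> nfd n (CS n) T (%x. \<Phi> (W t*x*st (W t))) R F (%_. 0) tgt sg"
  using rigid_cycle_nf[OF n S T c \<phi> rig pw] by metis
 then obtain R F tg sg where nfd: "!!t. t\<in>?I ==> nfd n (CS n) T (%x. \<Phi> (W t*x*st (W t))) (R t) (F t) (%_. 0) (tg t) (sg t)"
  by metis
 have lbS: "lb S a < 2*n" if "a < sz S" for a using stS that by (auto simp: stage_def)
 define q where "q a = p (cp S a) (lb S a)" for a
 have q: "q a < sz S" "cp S (q a) = cp S a" "lb S (q a) = lb S a" if "a < sz S" for a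
  using p[of "cp S a" "lb S a"] lbS[OF that] that by (auto simp: q_def)
 define D where "D a = \<Phi> (mu a (q a))" for a
 have mq: "mu a (q b)\<in>bal S" "mu (q b) a\<in>bal S" "mu (q a) (q b)\<in>bal S" if "a < sz S" "b < sz S" "cp S a = cp S b" for a b
  using q that by (auto intro!: mu_bal simp: same_cp_def)
 have DD: "st (D a)*D b = (if a = b then \<Phi> (mu (q a) (q a)) else 0)" if "a < sz S" "b < sz S" for a b
  using hD(2)[OF mq(2) mq(1), of a a b b] hD(4)[OF mq(1), of a a] hD(8) that by (auto simp: D_def mu_mult_mu)
 have \<Phi>q: "\<Phi> (mu (q a) (q b)) = (\<Sum>r\<in>R t. F t r*mu (lb S a) (lb S b)*st (F t r))"
  if "a < sz S" "b < sz S" "cp S a = t" "cp S b = t" for a b t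
  using nfdD(8)[OF nfd mu_CS(1)[OF lbS lbS], of t a b] WmuW[of "lb S a" "lb S b" t] that lbS by (auto simp: q_def)
 \<comment> \<open>The compression of the chosen cycle extended to the whole summand:
   \<open>a\<close> is sent to the vector of its representative and then moved by
   \<open>D a\<close>.\<close>
 define V where "V t r = (\<Sum>a | a < sz S & cp S a = t. D a*(F t r*mu (lb S a) a))" for t r
 have FzF: "st (F t r)*(F t s*(mu (lb S a) b*x)) = (if r = s then mu (lb S a) b*x else 0)"
  if "t\<in>?I" "r\<in>R t" "s\<in>R t" "a < sz S" for t r s a b x
 proof -
  have "idm {..<2*n}*mu (lb S a) b = mu (lb S a) b" using lbS[OF that(4)] by (intro idm_mult spt_mu) auto
  then show ?thesis using F_mid[OF nfd[OF that(1)] that(2,3), of "mu (lb S a) b*x"] by (simp flip: mult.assoc)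
 qed
 have FDF: "st (F t r)*(\<Phi> (mu (q a) (q a))*(F t s*mu (lb S a) a)) = (if r = s then mu (lb S a) a else 0)"
  if t: "t\<in>?I" and rs: "r\<in>R t" "s\<in>R t" and a: "a < sz S" "cp S a = t" for t r s a
 proof -
  let ?m = "mu (lb S a) (lb S a)"
  have fin: "finite (R t)" by (rule nfdD(1)[OF nfd[OF t]])
  have m: "mu (lb S a) a = ?m*mu (lb S a) a" by (simp add: mu_mult_mu)
  have "st (F t k)*(F t s*mu (lb S a) a) = (if k = s then mu (lb S a) a else 0)" if "k\<in>R t" for k
   using FzF[OF t that rs(2) a(1), of a "mu a a"] by (simp add: mu_mult_mu)
  then have "st (F t r)*(\<Phi> (mu (q a) (q a))*(F t s*mu (lb S a) a))
    = (\<Sum>k\<in>R t. if k = s then st (F t r)*(F t k*(?m*mu (lb S a) a)) else 0)"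
   unfolding \<Phi>q[OF a(1) a(1) a(2) a(2)] sum_distrib_left sum_distrib_right
   by (intro sum.cong refl) (auto simp: mult.assoc)
  also have "... = st (F t r)*(F t s*(?m*mu (lb S a) a))" using fin rs by simp
  finally show ?thesis using FzF[OF t rs a(1), of a "mu a a"] by (simp add: mu_mult_mu)
 qed
 have VV: "st (V t r)*V t' s = (if t = t' & r = s then zc S t else 0)"
  if "t\<in>?I" "t'\<in>?I" "r\<in>R t" "s\<in>R t'" for t t' r s
 proof -
  have "st (V t r)*V t' s = (\<Sum>a | a < sz S & cp S a = t. \<Sum>b | b < sz S & cp S b = t'.
    mu a (lb S a)*(st (F t r)*((st (D a)*D b)*(F t' s*mu (lb S b) b))))"
   unfolding V_def st_sum sum_product by (simp add: st_mult mult.assoc)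
  also have "... = (\<Sum>a | a < sz S & cp S a = t. \<Sum>b | b < sz S & cp S b = t'. if b = a then if t = t' & r = s then mu a a else 0 else 0)"
  proof (intro sum.cong refl)
   fix a b assume ab: "a\<in>{a. a < sz S & cp S a = t}" "b\<in>{b. b < sz S & cp S b = t'}"
   show "mu a (lb S a)*(st (F t r)*((st (D a)*D b)*(F t' s*mu (lb S b) b))) = (if b = a then if t = t' & r = s then mu a a else 0 else 0)"
   proof (cases "b = a")
    case True
    then show ?thesis using ab that FDF[of t r s a] by (auto simp: DD mu_mult_mu)
   qed (use ab in "auto simp: DD")
  qed
  also have "... = (\<Sum>a | a < sz S & cp S a = t. if t = t' & r = s then mu a a else 0)" by (intro sum.cong refl) auto
  finally show ?thesis by (cases "t = t'"; cases "r = s") (simp_all add: zc_def idm_def)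
 qed
 have Vmu: "V t r*mu b c = (if cp S b = t then D b*(F t r*mu (lb S b) c) else 0)" if "b < sz S" for t r b c
 proof -
  have "V t r*mu b c = (\<Sum>a | a < sz S & cp S a = t. if a = b then D b*(F t r*mu (lb S b) c) else 0)"
   unfolding V_def sum_distrib_right by (intro sum.cong refl) (auto simp: mult.assoc mu_mult_mu)
  then show ?thesis using that by simp
 qed
 define P where "P = prod_encode ` (SIGMA t:?I. R t)"
 define f where "f k = fst (prod_decode k)" for k
 define g where "g k = snd (prod_decode k)" for k
 have P: "f k\<in>?I" "g k\<in>R (f k)" if "k\<in>P" for k using that by (auto simp: P_def f_def g_def)
 have finP: "finite P" unfolding P_def using nfdD(1)[OF nfd] by (intro finite_imageI finite_SigmaI) auto
 have fg: "k = l <-> f k = f l & g k = g l" for k l unfolding f_def g_def by (metis prod.expand prod_decode_inverse)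
 have sumP: "(\<Sum>k\<in>P. H (f k) (g k)) = (\<Sum>t\<in>?I. \<Sum>r\<in>R t. H t r)" for H :: "nat => nat => cm"
  unfolding P_def f_def g_def using nfdD(1)[OF nfd] by (subst sum.reindex) (auto simp: inj_on_def sum.Sigma case_prod_unfold)
 define \<Psi> where "\<Psi> x = (\<Sum>k\<in>P. V (f k) (g k)*x*st (V (f k) (g k)))" for x
 have mu_eq: "\<Phi> (mu b c) = \<Psi> (mu b c)" if "same_cp S b c" for b c
 proof -
  have bc: "b < sz S" "c < sz S" "cp S b = cp S c" using that by (auto simp: same_cp_def)
  let ?t = "cp S b"
  have Veq: "V t r*mu b c*st (V t r) = (if t = ?t then D b*(F t r*mu (lb S b) (lb S c)*st (F t r))*st (D c) else 0)" for t r
  proof -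
   have "V t r*mu b c*st (V t r) = (V t r*mu b 0)*st (V t r*mu c 0)" by (simp add: st_mult mult.assoc mu_mult_mu_assoc)
   then show ?thesis using bc by (simp add: Vmu st_mult mult.assoc mu_mult_mu_assoc)
  qed
  have "\<Psi> (mu b c) = (\<Sum>t\<in>?I. if t = ?t then \<Sum>r\<in>R t. D b*(F t r*mu (lb S b) (lb S c)*st (F t r))*st (D c) else 0)"
   unfolding \<Psi>_def sumP[of "%t r. V t r*mu b c*st (V t r)"] by (intro sum.cong refl) (simp add: Veq)
  also have "... = D b*\<Phi> (mu (q b) (q c))*st (D c)"
   using bc by (simp add: \<Phi>q[OF bc(1,2) refl] sum_distrib_left sum_distrib_right)
  also have "... = \<Phi> (mu b (q b)*mu (q b) (q c)*mu (q c) c)"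
   using mq[of b b] mq[of c c] mq[of b c] bc hD(4)[of "mu c (q c)"] by (simp add: D_def hD(2) ssubD(3)[OF ssub_bal])
  finally show ?thesis by (simp add: mu_mult_mu)
 qed
 have "bal S <= {x\<in>bal S. \<Phi> x = \<Psi> x}"
 proof (rule bal_span)
  show "!!a b. same_cp S a b ==> mu a b\<in>{x\<in>bal S. \<Phi> x = \<Psi> x}" using mu_eq mu_bal by simp
  have \<Psi>: "\<Psi> 0 = 0" "\<Psi> (x + y) = \<Psi> x + \<Psi> y" "\<Psi> (csc e x) = csc e (\<Psi> x)" for x y e
   by (simp_all add: \<Psi>_def distrib_left distrib_right sum.distrib csc_mult_left csc_mult_right csc_sum)
  show "0\<in>{x\<in>bal S. \<Phi> x = \<Psi> x}"
   "!!x y. x\<in>{x\<in>bal S. \<Phi> x = \<Psi> x} ==> y\<in>{x\<in>bal S. \<Phi> x = \<Psi> x} ==> x + y\<in>{x\<in>bal S. \<Phi> x = \<Psi> x}"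
   "!!e x. x\<in>{x\<in>bal S. \<Phi> x = \<Psi> x} ==> csc e x\<in>{x\<in>bal S. \<Phi> x = \<Psi> x}"
   by (auto simp: \<Psi> hD(8) hD(1,3) intro: ssubD[OF ssub_bal])
 qed
 then have \<Phi>eq: "\<Phi> x = \<Psi> x" if "x\<in>bal S" for x using that by blast
 have Ds: "spt (same_class T) (D a)" if "a < sz S" for a
 proof -
  have "spt (same_class S) (mu a (q a))" using q[OF that] that by (intro spt_mu) (auto simp: same_class_def same_cp_def)
  then have "mu a (q a)\<in>dal n S" "st (mu a (q a))\<in>dal n S" using dal_same_class[OF stS] by blast+
  then have "D a\<in>dal n T" "st (D a)\<in>dal n T" using hd[of "mu a (q a)"] hd[of "mu (q a) a"] hD(4)[OF dal_bal, of "mu a (q a)" n] by (simp_all add: D_def)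
  then show ?thesis using dal_same_class[OF stT] by blast
 qed
 have Vs: "spt (%v a. a < sz S & v < sz T & cp S a = t & cp T v = tg t r & lb T v = sg t r (lb S a)) (V t r)"
  if t: "t\<in>?I" "r\<in>R t" for t r unfolding V_def
 proof (rule spt_sum)
  fix a assume "a\<in>{a. a < sz S & cp S a = t}"
  then have a: "a < sz S" "cp S a = t" by auto
  have 1: "spt (%v b. b = a & v < sz T & cp T v = tg t r & lb T v = sg t r (lb S a)) (F t r*mu (lb S a) a)"
   using nfdD(4)[OF nfd[OF t(1)] t(2)] by (auto simp: spt_def ent_mult_mu split: if_splits)
  show "spt (%v a. a < sz S & v < sz T & cp S a = t & cp T v = tg t r & lb T v = sg t r (lb S a)) (D a*(F t r*mu (lb S a) a))"
   by (rule spt_mult[OF Ds[OF a(1)] 1]) (use a in "auto simp: same_class_def same_cp_def")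
 qed
 have "nfd n S T \<Phi> P (%k. V (f k) (g k)) f (%k. tg (f k) (g k)) (%k. sg (f k) (g k))" unfolding nfd_def
 proof (intro conjI ballI allI impI)
  show "finite P" by (rule finP)
  fix k assume k: "k\<in>P"
  show "aut n (sg (f k) (g k))" "f k\<in>?I" using nfdD(2)[OF nfd] P[OF k] by auto
  show "spt (%v a. a < sz S & v < sz T & cp S a = f k & cp T v = tg (f k) (g k) & lb T v = sg (f k) (g k) (lb S a)) (V (f k) (g k))"
   using Vs P[OF k] by blast
  fix l assume l: "l\<in>P"
  show "st (V (f k) (g k))*V (f l) (g l) = (if k = l then zc S (f k) else 0)"
   using VV[OF P(1)[OF k] P(1)[OF l] P(2)[OF k] P(2)[OF l]] fg[of k l] by simp
 next
  fix a assume a: "a < sz S"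
  then have t: "cp S a\<in>?I" by simp
  have "0 < sz (CS n)" using n by simp
  then obtain r where "r\<in>R (cp S a)" using nfdD(7)[OF nfd[OF t]] by blast
  then have "prod_encode (cp S a, r)\<in>P" using t by (auto simp: P_def)
  then show "\<exists>k\<in>P. f k = cp S a" by (intro bexI[of _ "prod_encode (cp S a, r)"]) (auto simp: f_def)
 qed (use \<Phi>eq in \<open>simp add: \<Psi>_def\<close>)
 then show ?thesis by (rule nfI)
qed

section \<open>Direct limits of concrete towers\<close>

lemma ndist_toc:
 assumes "X\<in>carrier_mat N N" "Y\<in>carrier_mat N N"
 shows "ndist (mat_alg N\<lparr>car := C\<rparr>) X Y = norm (toc X - toc Y)"
 using assms by (simp add: ndist_def mat_alg_def op_norm_toc[of _ N] toc_add[of _ N] toc_smult[of _ N])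

locale mtower =
 fixes n :: nat and G :: "nat => digraph list" and \<iota> :: "nat => complex mat => complex mat" and S :: "nat => stage"
 assumes n3': "n >= 3" and rigid_tower: "rigid_tower n G \<iota>" and rep: "!!k. rep n (G k) (S k)"
begin

definition inc :: "nat => cm => cm" where "inc k x = toc (\<iota> k (frc (sz (S k)) x))"

lemma n1: "n >= 1" using n3' by simp

lemma star_hom_iota: "star_hom (dsum_cstar (G k)) (dsum_cstar (G (Suc k))) (\<iota> k)"
 using rigid_tower by (simp add: rigid_tower_def)

lemmas inc_hom = star_hom_shom[OF n1 rep rep star_hom_iota, folded inc_def]

text \<open>Rigidity describes \<open>\<iota> k\<close> on the cycle sum. There \<open>inc k\<close>
  agrees with an extension from \<open>embedding_iff\<close>, so it is itself a \<open>cemb\<close>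
  and \<open>nf_of_rigid\<close> applies.\<close>

lemma inc_nf: "nf n (S k) (S (Suc k)) (inc k)"
proof -
 note r = rep_frc[OF n1 rep rep]
 have rig: "rigid n (G k) (G (Suc k)) (\<iota> k)" using rigid_tower by (simp add: rigid_tower_def)
 then obtain \<Phi> where c: "cemb n (S k) (S (Suc k)) \<Phi>" "!!X. X\<in>dsum_alg (G k) ==> \<iota> k X = frc (sz (S (Suc k))) (\<Phi> (toc X))"
  using embedding_iff[OF n1 rep rep] unfolding rigid_def by metis
 have e: "inc k x = \<Phi> x" if x: "x\<in>dal n (S k)" for x
 proof -
  have "\<Phi> x\<in>bal (S (Suc k))" using c(1) dal_bal[OF x] by (auto simp: cemb_def)
  then show ?thesis using c(2)[OF r(1)[OF x]] r(2)[OF dal_bal[OF x]] by (simp add: inc_def toc_frc bnd_bal)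
 qed
 have "cemb n (S k) (S (Suc k)) (inc k)" using c(1) inc_hom(1,2) e unfolding cemb_def by (auto simp: inj_on_def)
 moreover have "\<iota> k X = frc (sz (S (Suc k))) (inc k (toc X))" if "X\<in>dsum_alg (G k)" for X
  using c(2)[OF that] e[of "toc X"] that rep_alg[OF n1 rep rep] by simp
 ultimately show ?thesis using nf_of_rigid[OF n1 rep rep _ _ rig] by blast
qed

sublocale tower n S inc using n3' rep inc_nf by unfold_locales (auto simp: rep_def)

abbreviation "B \<equiv> %k. dsum_cstar (G k)"

lemma B: "B k = (mat_alg (sz (S k)))\<lparr>car := {X\<in>carrier_mat (sz (S k)) (sz (S k)). toc X\<in>bal (S k)}\<rparr>"
 by (rule rep_cstar[OF rep n1])

lemma B_car: "X\<in>car (B k) <-> X\<in>carrier_mat (sz (S k)) (sz (S k)) & toc X\<in>bal (S k)" by (simp add: B)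

lemma B_ops: "add (B k) = (+)" "mul (B k) = (*)" "scl (B k) = (\<cdot>\<^sub>m)" "adj (B k) = mat_adjoint"
 "X\<in>car (B k) ==> nrm (B k) X = norm (toc X)"
 "X\<in>car (B k) ==> Y\<in>car (B k) ==> ndist (B k) X Y = norm (toc X - toc Y)"
proof -
 show "add (B k) = (+)" "mul (B k) = (*)" "scl (B k) = (\<cdot>\<^sub>m)" "adj (B k) = mat_adjoint"
  "X\<in>car (B k) ==> nrm (B k) X = norm (toc X)" by (simp_all add: B mat_alg_def op_norm_toc[of _ "sz (S k)"])
 show "X\<in>car (B k) ==> Y\<in>car (B k) ==> ndist (B k) X Y = norm (toc X - toc Y)"
  using ndist_toc[of X "sz (S k)" Y] by (simp add: B_car) (simp add: B)
qed

lemma B_closed: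
 "X\<in>car (B k) ==> Y\<in>car (B k) ==> X + Y\<in>car (B k) & toc (X + Y) = toc X + toc Y"
 "X\<in>car (B k) ==> Y\<in>car (B k) ==> X*Y\<in>car (B k) & toc (X*Y) = toc X*toc Y"
 "X\<in>car (B k) ==> c \<cdot>\<^sub>m X\<in>car (B k) & toc (c \<cdot>\<^sub>m X) = csc c (toc X)"
 "X\<in>car (B k) ==> mat_adjoint X\<in>car (B k) & toc (mat_adjoint X) = st (toc X)"
 by (auto simp: B_car toc_ops[of _ "sz (S k)"] mat_adjoint_carrier mult_carrier_mat[of _ "sz (S k)" "sz (S k)" _ "sz (S k)"]
   intro!: ssubD[OF ssub_bal])

lemma incl_toc:
 assumes "k <= m" "X\<in>car (B k)" shows "incl \<iota> k m X\<in>car (B m) & toc (incl \<iota> k m X) = incl inc k m (toc X)"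
 using assms(1)
proof (induction m rule: dec_induct)
 case (step m)
 have "\<iota> m Y\<in>car (B (Suc m)) & toc (\<iota> m Y) = inc m (toc Y)" if Y: "Y\<in>car (B m)" for Y
 proof -
  have "\<iota> m Y\<in>car (B (Suc m))" using star_hom_iota[of m] Y by (auto simp: star_hom_def alg_hom_def)
  moreover have "inc m (toc Y)\<in>bal (S (Suc m))" using inc_hom(2) Y by (simp add: B_car)
  ultimately show ?thesis using inc_hom(3)[OF Y] by (metis toc_frc bnd_bal)
 qed
 then show ?case using step by (simp add: incl_Suc)
qed (use assms in simp)

abbreviation "tc x \<equiv> %k. toc (x k)"

text \<open>The coset of concrete sequences belonging to a class of \<open>lmat\<close>. It is
  injective on \<open>seqs\<close>, and operations, norm and closures are transported along
  it.\<close>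

definition co :: "lmat => (nat => complex mat) set" where "co Z = {x\<in>bdd_seqs B. cls (tc x) = Z}"

lemma bdd_seqs_iff: "x\<in>bdd_seqs B <-> (ALL k. x k\<in>car (B k)) & bd (tc x)"
proof -
 have "bdd_above (range (%k. nrm (B k) (x k))) <-> bd (tc x)" if "ALL k. x k\<in>car (B k)"
  using that by (auto simp: B_ops bd_def bdd_above_def)
 then show ?thesis by (auto simp: bdd_seqs_def)
qed

lemma seqs_bdd: "x\<in>bdd_seqs B ==> cls (tc x)\<in>seqs" by (rule seqsI) (auto simp: bdd_seqs_iff B_car)

lemma bdd_of_bal:
 assumes "bd y" "!!k. y k\<in>bal (S k)" shows "(%k. frc (sz (S k)) (y k))\<in>bdd_seqs B" "tc (%k. frc (sz (S k)) (y k)) = y"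
proof -
 show *: "tc (%k. frc (sz (S k)) (y k)) = y" using assms(2) by (auto simp: toc_frc bnd_bal)
 show "(%k. frc (sz (S k)) (y k))\<in>bdd_seqs B" using assms by (auto simp: bdd_seqs_iff*B_car toc_frc bnd_bal)
qed

lemma co_nonempty: "Z\<in>seqs ==> EX x. x\<in>co Z" using bdd_of_bal by (elim seqsE) (auto simp: co_def intro!: exI)

lemma coD: "x\<in>co Z ==> x\<in>bdd_seqs B & cls (tc x) = Z" by (simp add: co_def)

text \<open>Only eventual entries count. The sequence in \<open>lim_emb\<close> has early entries
  outside the stages, so a condition at every index would not cover it.\<close>

lemma null_coset_ev:
 assumes "EVT k. x k\<in>car (B k) & toc (x k) = y k" "bd y" shows "null_coset B x = co (cls y)"
proof -
 have "(%k. ndist (B k) (z k) (x k)) \<longlonglongrightarrow> 0 <-> cls (tc z) = cls y" if z: "z\<in>bdd_seqs B" for z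
 proof -
  have "EVT k. ndist (B k) (z k) (x k) = norm (toc (z k) - y k)"
   using assms(1) by eventually_elim (use z in "auto simp: bdd_seqs_iff B_ops")
  then have "(%k. ndist (B k) (z k) (x k)) \<longlonglongrightarrow> 0 <-> (%k. norm (toc (z k) - y k)) \<longlonglongrightarrow> 0" by (rule tendsto_cong)
  then show ?thesis using z assms(2) by (simp add: bdd_seqs_iff cls_eq_iff tendsto_norm_zero_iff)
 qed
 then show ?thesis by (auto simp: null_coset_def co_def)
qed

lemma null_coset_all:
 "(!!k. x k\<in>car (B k)) ==> (!!k. toc (x k) = y k) ==> bd y ==> null_coset B x = co (cls y)" by (rule null_coset_ev) auto

lemma null_coset_co: "x\<in>bdd_seqs B ==> null_coset B x = co (cls (tc x))" by (rule null_coset_all) (auto simp: bdd_seqs_iff)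

lemma inj_co: "Z\<in>seqs ==> co Z = co W ==> Z = W" using co_nonempty[of Z] coD by blast

abbreviation "Q \<equiv> seq_quotient B"

lemma Q_car: "car Q = co ` seqs"
proof -
 have "null_coset B ` bdd_seqs B = co ` seqs"
 proof (intro equalityI subsetI)
  fix X assume "X\<in>co ` seqs"
  then obtain Z where Z: "Z\<in>seqs" "X = co Z" by blast
  moreover obtain x where "x\<in>co Z" using co_nonempty[OF Z(1)] by blast
  ultimately show "X\<in>null_coset B ` bdd_seqs B" using null_coset_co coD by blast
 qed (auto simp: null_coset_co seqs_bdd)
 then show ?thesis by (simp add: seq_quotient_def)
qed

lemma Q_ops:
 assumes Z: "Z\<in>seqs" and W: "W\<in>seqs" shows "add Q (co Z) (co W) = co (Z + W)" "mul Q (co Z) (co W) = co (Z*W)"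
  "scl Q c (co Z) = co (csc c Z)" "adj Q (co Z) = co (st Z)"
proof -
 have ne: "co Z ~= {}" "co W ~= {}" using co_nonempty Z W by blast+
 have xD: "bd (tc x) & (ALL k. x k\<in>car (B k)) & cls (tc x) = V" if "x\<in>co V" for x V
  using that by (auto simp: co_def bdd_seqs_iff)
 have "null_coset B (%k. x k + y k) = co (Z + W)" "null_coset B (%k. x k*y k) = co (Z*W)" if "x\<in>co Z" "y\<in>co W" for x y
 proof -
  have e: "toc (x k + y k) = toc (x k) + toc (y k)" "toc (x k*y k) = toc (x k)*toc (y k)" for k
   using xD[OF that(1)] xD[OF that(2)] B_closed(1,2) by blast+
  show "null_coset B (%k. x k + y k) = co (Z + W)" "null_coset B (%k. x k*y k) = co (Z*W)"
  using xD[OF that(1)] xD[OF that(2)] null_coset_all[of "%k. x k + y k" "%k. toc (x k) + toc (y k)"]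
   null_coset_all[of "%k. x k*y k" "%k. toc (x k)*toc (y k)"]
   by (simp_all add: e B_closed bd_add bd_mult cls_simps(1,3)[of "tc x" "tc y", symmetric])
 qed
 then show "add Q (co Z) (co W) = co (Z + W)" "mul Q (co Z) (co W) = co (Z*W)" using ne by (auto simp: seq_quotient_def B_ops)
 have "null_coset B (%k. c \<cdot>\<^sub>m x k) = co (csc c Z)" "null_coset B (%k. mat_adjoint (x k)) = co (st Z)"
  if "x\<in>co Z" for x
 proof -
  have e: "toc (c \<cdot>\<^sub>m x k) = csc c (toc (x k))" "toc (mat_adjoint (x k)) = st (toc (x k))" for k
   using xD[OF that] B_closed(3,4) by blast+
  show "null_coset B (%k. c \<cdot>\<^sub>m x k) = co (csc c Z)" "null_coset B (%k. mat_adjoint (x k)) = co (st Z)"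
  using xD[OF that] null_coset_all[of "%k. c \<cdot>\<^sub>m x k" "%k. csc c (toc (x k))"]
   null_coset_all[of "%k. mat_adjoint (x k)" "%k. st (toc (x k))"]
   by (simp_all add: e B_closed bd_csc bd_st cls_simps(4,5)[of "tc x", symmetric])
 qed
 then show "scl Q c (co Z) = co (csc c Z)" "adj Q (co Z) = co (st Z)" using ne by (auto simp: seq_quotient_def B_ops)
qed

text \<open>The supremum over any representative is at least the limit superior. Replacing by 0 the
  finitely many entries whose norm reaches \<open>norm Z + e\<close> gives a representative with
  supremum at most \<open>norm Z + e\<close>.\<close>

lemma Q_nrm: assumes Z: "Z\<in>seqs" shows "nrm Q (co Z) = norm Z"
proof -
 have Q: "nrm Q (co Z) = (INF x\<in>co Z. SUP k. nrm (B k) (x k))" by (simp add: seq_quotient_def)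
 have sup: "(SUP k. nrm (B k) (x k)) = (SUP k. norm (toc (x k)))" "bdd_above (range (%k. norm (toc (x k))))" if "x\<in>bdd_seqs B" for x
  using that by (auto simp: bdd_seqs_iff B_ops bd_def bdd_above_def)
 have lower: "norm Z <= (SUP k. nrm (B k) (x k))" if "x\<in>co Z" for x
 proof -
  have b: "x\<in>bdd_seqs B" "cls (tc x) = Z" using coD[OF that] by auto
  have "norm (toc (x k)) <= (SUP k. norm (toc (x k)))" for k by (rule cSUP_upper[OF UNIV_I sup(2)[OF b(1)]])
  then have "norm (cls (tc x)) <= (SUP k. norm (toc (x k)))" by (intro norm_cls_le always_eventually allI)
  then show ?thesis using sup(1)[OF b(1)] b(2) by simp
 qed
 have ne: "co Z ~= {}" using co_nonempty[OF Z] by blast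
 have "nrm Q (co Z) <= norm Z"
 proof (rule field_le_epsilon)
  fix e :: real assume e: "e > 0"
  obtain y where y: "Z = cls y" "bd y" "!!k. y k\<in>bal (S k)" using Z by (metis seqsE)
  define y' where "y' k = (if norm (y k) < norm Z + e then y k else 0)" for k
  have b: "y' k\<in>bal (S k)" "norm (y' k) <= norm Z + e" for k
   using y(3) ssubD(1)[OF ssub_bal] e norm_ge_zero[of Z] by (auto simp: y'_def add_nonneg_nonneg)
  have bd: "bd y'" using b(2) by (rule bdI)
  have "Z = cls y'" unfolding y(1)
   by (rule cls_cong_ev[OF y(2) bd]) (use norm_cls_less[OF y(2), of "norm Z + e"] e y(1) in \<open>auto simp: y'_def elim: eventually_mono\<close>)
  then have x: "(%k. frc (sz (S k)) (y' k))\<in>co Z" (is "?x\<in>_") using bdd_of_bal[OF bd b(1)] by (simp add: co_def)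
  have "nrm Q (co Z) <= (SUP k. nrm (B k) (?x k))"
   unfolding Q by (rule cINF_lower[OF _ x]) (use lower in "auto intro!: bdd_belowI2")
  also have "... <= norm Z + e" unfolding sup(1)[OF bdd_of_bal(1)[OF bd b(1)]] fun_cong[OF bdd_of_bal(2)[OF bd b(1)]]
   using b(2) by (intro cSUP_least) auto
  finally show "nrm Q (co Z) <= norm Z + e" .
 qed
 moreover have "norm Z <= nrm Q (co Z)" unfolding Q using ne lower by (intro cINF_greatest) auto
 ultimately show ?thesis by simp
qed

lemma Q_ndist: "Z\<in>seqs ==> W\<in>seqs ==> ndist Q (co Z) (co W) = norm (Z - W)"
 using ssubD[OF ssub_seqs] by (simp add: ndist_def Q_ops(1)[of Z] Q_ops(3)[of W] Q_nrm)

lemma lim_emb_co: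
 assumes a: "a\<in>car (B K)" shows "lim_emb B \<iota> K a = co (emb K (toc a))" unfolding lim_emb_def emb_def
 by (rule null_coset_ev)
  (use a incl_toc[OF _ a] in "auto simp: B_car eseq_def not_less intro!: eseq_bd incl_facts eventually_sequentiallyI[of K]")

lemma toc_image: "toc ` car (B K) = bal (S K)" "toc ` dsum_alg (G K) = dal n (S K)" "dsum_alg (G K) <= car (B K)"
proof -
 note r = rep_frc[OF n1 rep rep, of _ K] rep_alg[OF n1 rep rep, of _ K]
 show "dsum_alg (G K) <= car (B K)" by (rule subsetI) (simp add: B_car r(4) dal_bal[of _ n])
 show "toc ` dsum_alg (G K) = dal n (S K)"
 proof (intro equalityI subsetI)
  fix x assume x: "x\<in>dal n (S K)"
  then show "x\<in>toc ` dsum_alg (G K)" using r(1)[OF x] r(2)[OF dal_bal[OF x]] by (metis imageI)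
 qed (auto simp: r(4))
 show "toc ` car (B K) = bal (S K)"
 proof (intro equalityI subsetI)
  fix x assume "x\<in>bal (S K)"
  then show "x\<in>toc ` car (B K)" using r(2,3)[of x] by (metis imageI)
 qed (auto simp: B_car)
qed

lemma lim_emb_image:
 assumes "D <= car (B K)" shows "lim_emb B \<iota> K ` D = (%a. co (emb K a)) ` toc ` D"
 unfolding image_image by (rule image_cong[OF refl]) (use assms lim_emb_co in blast)

lemma nclosure_lim:
 assumes D: "!!K. D K <= bal (S K)" and L: "!!Z. Z\<in>L ==> Z\<in>seqs" and lD: "!!Z. Z\<in>lim_of D ==> Z\<in>L"
 shows "nclosure (Q\<lparr>car := co ` L\<rparr>) (\<Union>K. (%a. co (emb K a)) ` D K) = co ` lim_of D"
proof -
 define U where "U = (\<Union>K. (%a. co (emb K a)) ` D K)"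
 define P where "P X <-> (\<forall>e>0. \<exists>s\<in>U. ndist (Q\<lparr>car := co ` L\<rparr>) X s < e)" for X
 have "P (co Z) <-> Z\<in>lim_of D" if Z: "Z\<in>seqs" for Z
 proof -
  have "ndist (Q\<lparr>car := co ` L\<rparr>) (co Z) (co (emb K a)) = norm (Z - emb K a)" if "a\<in>D K" for K a
   using Q_ndist[OF Z emb_seqs, of a K] that D by (auto simp: ndist_def)
  then show ?thesis using Z by (auto simp: lim_of_def P_def U_def)
 qed
 then have "{X\<in>co ` L. P X} = co ` lim_of D" using L lD by blast
 then show ?thesis by (simp add: nclosure_def P_def U_def)
qed

lemma tower_cstar_eq: "tower_cstar G \<iota> = Q\<lparr>car := co ` limB\<rparr>"
proof -
 have "Q = Q\<lparr>car := co ` seqs\<rparr>" by (simp flip: Q_car)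
 then have "nclosure Q (\<Union>K. lim_emb B \<iota> K ` car (B K)) = co ` limB"
  unfolding limB_def lim_emb_image[OF order_refl] toc_image
  by (metis nclosure_lim[of "%K. bal (S K)" seqs] limB_def limB_seqs order_refl)
 then show ?thesis by (simp add: tower_cstar_def cstar_limit_def)
qed

lemma tower_limit_eq: "tower_limit G \<iota> = co ` limA"
proof -
 have "dal n (S K) <= bal (S K)" for K by (rule subsetI) (rule dal_bal)
 then show ?thesis unfolding tower_limit_def lim_emb_image[OF toc_image(3)] toc_image tower_cstar_eq
  by (subst nclosure_lim) (use limB_seqs limA_limB in "auto simp: limA_def")
qed

lemma M_ops:
 assumes Z: "Z\<in>limB" and W: "W\<in>limB"
 shows "add (tower_cstar G \<iota>) (co Z) (co W) = co (Z + W)" "mul (tower_cstar G \<iota>) (co Z) (co W) = co (Z*W)"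
  "ndist (tower_cstar G \<iota>) (co Z) (co W) = norm (Z - W)"
 using Q_ops[OF limB_seqs[OF Z] limB_seqs[OF W]] Q_ndist[OF limB_seqs[OF Z] limB_seqs[OF W]]
 by (auto simp: tower_cstar_eq ndist_def)

lemma M_ops1:
 assumes Z: "Z\<in>limB"
 shows "scl (tower_cstar G \<iota>) c (co Z) = co (csc c Z)" "adj (tower_cstar G \<iota>) (co Z) = co (st Z)"
 using Q_ops(3,4)[OF limB_seqs[OF Z] limB_seqs[OF Z]] by (auto simp: tower_cstar_eq)

lemma M_car: "car (tower_cstar G \<iota>) = co ` limB" by (simp add: tower_cstar_eq)

lemma inj_on_co: "inj_on co limB" using inj_co limB_seqs by (auto simp: inj_on_def)

text \<open>A closed star-subalgebra containing the limit of the cycle sums contains every embedded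
  cycle sum, hence by \<open>dal_generates\<close> every embedded block algebra, hence the closure
  of their union.\<close>

lemma gen_cstar_tower: "gen_cstar (tower_cstar G \<iota>) (tower_limit G \<iota>) = tower_cstar G \<iota>"
proof -
 let ?M = "tower_cstar G \<iota>"
 have "\<Inter>{T. star_subalg ?M T & nclosure ?M T <= T & tower_limit G \<iota> <= T} = co ` limB"
 proof (intro equalityI Inter_greatest Inter_lower, goal_cases)
  case 1
  have "star_subalg ?M (co ` limB)"
   using emb_limB ssubD(1)[OF ssub_limB] limB_ops by (auto simp: star_subalg_def M_car M_ops M_ops1)
  moreover have "nclosure ?M (co ` limB) <= co ` limB" by (auto simp: nclosure_def M_car)
  moreover have "tower_limit G \<iota> <= co ` limB" using limA_limB by (auto simp: tower_limit_eq)
  ultimately show ?case by simp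
 next
  case (2 T)
  then have T: "star_subalg ?M T" "nclosure ?M T <= T" "co ` limA <= T" by (auto simp: tower_limit_eq)
  have emb: "co (emb K x)\<in>T" if x: "x\<in>bal (S K)" for K x
  proof -
   let ?T = "{x\<in>bal (S K). co (emb K x)\<in>T}"
   have zT: "co 0\<in>T" using T(3) emb_limA[of 0 0] embD(8) by (auto simp: dal_def)
   have "x + y\<in>?T" "x*y\<in>?T" "csc c x\<in>?T" "st x\<in>?T" if "x\<in>?T" "y\<in>?T" for x y c
   proof -
    have xy: "x\<in>bal (S K)" "y\<in>bal (S K)" "co (emb K x)\<in>T" "co (emb K y)\<in>T" using that by auto
    have "add ?M (co (emb K x)) (co (emb K y))\<in>T" "mul ?M (co (emb K x)) (co (emb K y))\<in>T"
     "scl ?M c (co (emb K x))\<in>T" "adj ?M (co (emb K x))\<in>T" using T(1) xy unfolding star_subalg_def by blast+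
    then show "x + y\<in>?T" "x*y\<in>?T" "csc c x\<in>?T" "st x\<in>?T"
     using xy by (simp_all add: M_ops M_ops1 emb_limB embD ssubD[OF ssub_bal])
   qed
   then have "ssub ?T" using zT embD(8) ssubD(1)[OF ssub_bal] by (auto simp: ssub_def)
   moreover have "dal n (S K) <= ?T" using T(3) emb_limA dal_bal by blast
   ultimately have "bal (S K) <= ?T" by (rule dal_generates[OF stage n1])
   then show ?thesis using x by blast
  qed
  show ?case
  proof
   fix X assume "X\<in>co ` limB"
   then obtain Z where Z: "Z\<in>limB" "X = co Z" by blast
   have "\<exists>s\<in>T. ndist ?M X s < e" if e: "e > 0" for e
   proof -
    obtain K a where a: "a\<in>bal (S K)" "norm (Z - emb K a) < e" using limB_approx[OF Z(1) e] by blast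
    then show ?thesis using emb[OF a(1)] M_ops(3)[OF Z(1) emb_limB[OF a(1)]] Z(2) by (intro bexI[of _ "co (emb K a)"]) auto
   qed
   then have "X\<in>nclosure ?M T" using Z by (auto simp: nclosure_def M_car)
   then show "X\<in>T" using T(2) by blast
  qed
 qed
 then show ?thesis by (simp add: gen_cstar_def tower_cstar_eq)
qed

end

text \<open>The limit algebra generates the whole C*-limit, so an isomorphism is one star
  isomorphism of the C*-limits that takes one limit algebra onto the other.\<close>

lemma star_ext_isomorphic_iff:
 assumes "mtower n G \<iota> S" "mtower n G' \<iota>' S'"
 shows "star_ext_isomorphic (tower_cstar G \<iota>) (tower_limit G \<iota>) (tower_cstar G' \<iota>') (tower_limit G' \<iota>') <->
  (\<exists>\<Xi>. shom (tower.limB S (mtower.inc \<iota> S)) \<Xi> &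
   bij_betw \<Xi> (tower.limB S (mtower.inc \<iota> S)) (tower.limB S' (mtower.inc \<iota>' S')) &
   \<Xi> ` tower.limA n S (mtower.inc \<iota> S) = tower.limA n S' (mtower.inc \<iota>' S'))"
proof -
 interpret A: mtower n G \<iota> S by fact
 interpret B: mtower n G' \<iota>' S' by fact
 let ?M = "tower_cstar G \<iota>" and ?M' = "tower_cstar G' \<iota>'"
 have AB: "Z\<in>A.limB" if "Z\<in>A.limA" for Z using A.limA_limB that .
 show ?thesis
 proof
  assume "star_ext_isomorphic ?M (tower_limit G \<iota>) ?M' (tower_limit G' \<iota>')"
  then obtain \<theta> \<Theta> where \<theta>: "bij_betw \<theta> (A.co ` A.limA) (B.co ` B.limA)"
   and \<Theta>: "star_hom ?M ?M' \<Theta>" "bij_betw \<Theta> (A.co ` A.limB) (B.co ` B.limB)" "!!x. x\<in>A.co ` A.limA ==> \<Theta> x = \<theta> x"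
   unfolding star_ext_isomorphic_def A.gen_cstar_tower B.gen_cstar_tower
    A.M_car B.M_car unfolding A.tower_limit_eq B.tower_limit_eq by blast
  define \<Xi> where "\<Xi> Z = inv_into B.limB B.co (\<Theta> (A.co Z))" for Z
  have \<Theta>c: "\<Theta> (A.co Z)\<in>B.co ` B.limB" if "Z\<in>A.limB" for Z using \<Theta>(2) that by (auto simp: bij_betw_def)
  have X: "\<Xi> Z\<in>B.limB" "B.co (\<Xi> Z) = \<Theta> (A.co Z)" if "Z\<in>A.limB" for Z
   using inv_into_into[OF \<Theta>c[OF that]] f_inv_into_f[OF \<Theta>c[OF that]] by (auto simp: \<Xi>_def)
  have eqI: "Y = W" if "B.co Y = B.co W" "Y\<in>B.limB" "W\<in>B.limB" for Y W using B.inj_on_co that by (auto dest: inj_onD)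
  have h: "\<Theta> (add ?M X Y) = add ?M' (\<Theta> X) (\<Theta> Y)" "\<Theta> (mul ?M X Y) = mul ?M' (\<Theta> X) (\<Theta> Y)"
   "\<Theta> (scl ?M c X) = scl ?M' c (\<Theta> X)" "\<Theta> (adj ?M X) = adj ?M' (\<Theta> X)"
   if "X\<in>car ?M" "Y\<in>car ?M" for X Y c using \<Theta>(1) that by (auto simp: star_hom_def alg_hom_def)
  have "shom A.limB \<Xi>" unfolding shom_def
  proof (intro conjI ballI allI; rule eqI)
   fix Z W c assume Z: "Z\<in>A.limB" and W: "W\<in>A.limB"
   have m: "A.co Z\<in>car ?M" "A.co W\<in>car ?M" using Z W by (auto simp: A.M_car)
   show "B.co (\<Xi> (Z + W)) = B.co (\<Xi> Z + \<Xi> W)" "B.co (\<Xi> (Z*W)) = B.co (\<Xi> Z*\<Xi> W)"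
    using h(1,2)[OF m] by (simp_all add: A.M_ops Z W X B.M_ops ssubD[OF A.ssub_limB] flip: X(2) B.M_ops(1,2))
  next
   fix Z c assume Z: "Z\<in>A.limB"
   then have m: "A.co Z\<in>car ?M" by (auto simp: A.M_car)
   show "B.co (\<Xi> (csc c Z)) = B.co (csc c (\<Xi> Z))" "B.co (\<Xi> (st Z)) = B.co (st (\<Xi> Z))"
    using h(3,4)[OF m m] by (simp_all add: A.M_ops1 Z X ssubD[OF A.ssub_limB] B.M_ops1 flip: X(2) B.M_ops1)
  qed (auto intro: X ssubD[OF A.ssub_limB] ssubD[OF B.ssub_limB])
  moreover have "bij_betw \<Xi> A.limB B.limB"
  proof -
   have "bij_betw A.co A.limB (A.co ` A.limB)" "bij_betw B.co B.limB (B.co ` B.limB)"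
    using A.inj_on_co B.inj_on_co by (auto simp: bij_betw_def)
   then have "bij_betw (inv_into B.limB B.co \<circ> (\<Theta> \<circ> A.co)) A.limB B.limB"
    using bij_betw_trans bij_betw_inv_into \<Theta>(2) by metis
   moreover have "\<Xi> = inv_into B.limB B.co \<circ> (\<Theta> \<circ> A.co)" by (auto simp: \<Xi>_def)
   ultimately show ?thesis by simp
  qed
  moreover have "\<Xi> ` A.limA = B.limA"
  proof -
   have "B.co ` (\<Xi> ` A.limA) = \<Theta> ` (A.co ` A.limA)" using X(2)[OF AB] by (auto simp: image_image)
   also have "... = B.co ` B.limA" using \<theta> \<Theta>(3) by (simp add: bij_betw_def)
   finally have e: "B.co ` (\<Xi> ` A.limA) = B.co ` B.limA" .
   have s: "\<Xi> ` A.limA <= B.limB" "B.limA <= B.limB" using X(1)[OF AB] B.limA_limB by auto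
   show ?thesis using inj_on_image_eq_iff[OF B.inj_on_co s] e by simp
  qed
  ultimately show "\<exists>\<Xi>. shom A.limB \<Xi> & bij_betw \<Xi> A.limB B.limB & \<Xi> ` A.limA = B.limA" by blast
 next
  assume "\<exists>\<Xi>. shom A.limB \<Xi> & bij_betw \<Xi> A.limB B.limB & \<Xi> ` A.limA = B.limA"
  then obtain \<Xi> where \<Xi>: "shom A.limB \<Xi>" "bij_betw \<Xi> A.limB B.limB" "\<Xi> ` A.limA = B.limA" by blast
  note xD = shomD[OF \<Xi>(1) A.ssub_limB]
  have xb: "\<Xi> Z\<in>B.limB" if "Z\<in>A.limB" for Z using \<Xi>(2) that by (auto simp: bij_betw_def)
  define \<Theta> where "\<Theta> X = B.co (\<Xi> (inv_into A.limB A.co X))" for X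
  have \<Theta>: "\<Theta> (A.co Z) = B.co (\<Xi> Z)" if "Z\<in>A.limB" for Z
   using inv_into_f_f[OF A.inj_on_co that] by (simp add: \<Theta>_def)
  have star: "star_hom ?M ?M' \<Theta>" unfolding star_hom_def alg_hom_def A.M_car B.M_car
   using xb by (auto simp: A.M_ops B.M_ops A.M_ops1 B.M_ops1 \<Theta> ssubD[OF A.ssub_limB] xD)
  have inj: "inj_on \<Theta> (A.co ` A.limB)"
  proof (rule inj_onI)
   fix X Y assume "X\<in>A.co ` A.limB" "Y\<in>A.co ` A.limB" "\<Theta> X = \<Theta> Y"
   then obtain Z W where ZW: "Z\<in>A.limB" "W\<in>A.limB" "X = A.co Z" "Y = A.co W" "B.co (\<Xi> Z) = B.co (\<Xi> W)"
    using \<Theta> by auto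
   then have "\<Xi> Z = \<Xi> W" using inj_onD[OF B.inj_on_co] xb by blast
   then show "X = Y" using \<Xi>(2) ZW by (auto simp: bij_betw_def dest: inj_onD)
  qed
  have im: "\<Theta> ` (A.co ` L) = B.co ` (\<Xi> ` L)" if "L <= A.limB" for L using that \<Theta> by (auto simp: image_image subset_iff)
  have LA: "A.limA <= A.limB" using AB by auto
  have "bij_betw \<Theta> (A.co ` A.limB) (B.co ` B.limB)" "bij_betw \<Theta> (A.co ` A.limA) (B.co ` B.limA)"
   using inj inj_on_subset[OF inj image_mono[OF LA]] im[OF order_refl] im[OF LA] \<Xi>(2,3) by (auto simp: bij_betw_def)
  moreover have "alg_hom ?M (A.co ` A.limA) ?M' (B.co ` B.limA) \<Theta>"
   using star im[OF LA] \<Xi>(3) LA unfolding alg_hom_def star_hom_def A.M_car by (simp add: subset_iff)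
  ultimately show "star_ext_isomorphic ?M (tower_limit G \<iota>) ?M' (tower_limit G' \<iota>')"
   unfolding star_ext_isomorphic_def A.gen_cstar_tower B.gen_cstar_tower
    A.M_car B.M_car unfolding A.tower_limit_eq B.tower_limit_eq using star by blast
 qed
qed

section \<open>From a commuting diagram to an isomorphism of the limits\<close>

locale two_towers = A: tower n S \<iota> + B: tower n S' \<iota>'
 for n :: nat and S S' :: "nat => stage" and \<iota> \<iota>' :: "nat => cm => cm"

lemma (in tower) limA_I:
 assumes "X\<in>seqs" "!!e. e > 0 ==> \<exists>K. \<exists>a\<in>dal n (S K). norm (X - emb K a) < e" shows "X\<in>limA"
 using assms by (auto simp: limA_def lim_of_def)

lemma (in tower) limB_I:
 assumes "X\<in>seqs" "!!e. e > 0 ==> \<exists>K. \<exists>a\<in>bal (S K). norm (X - emb K a) < e" shows "X\<in>limB"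
 using assms by (auto simp: limB_def lim_of_def)

lemma (in tower) cls_emb_eq:
 assumes "bd x" "a\<in>bal (S K)" "!!m. m >= L ==> x m = incl \<iota> K m a" shows "cls x = emb K a" unfolding emb_def
 by (rule cls_cong_ev[OF assms(1) eseq_bd[OF assms(2)]])
  (rule eventually_sequentiallyI[of "max K L"], use assms(3) in \<open>auto simp: eseq_def\<close>)

text \<open>
 A sequence representing an element of the limit is transported by reading it only at the
 indices \<open>c k\<close>: an element of the limit is determined by its entries along a subsequence.
\<close>

lemma (in two_towers) lim_map:
 fixes f :: "nat => cm => cm" and c d :: "nat => nat"
 assumes c: "mono c" "!!k. k <= Suc (c k)" and d: "strict_mono d" and h: "!!k. shom (bal (S (c k))) (f k)"
  and fb: "!!k x. x\<in>bal (S (c k)) ==> f k x\<in>bal (S' (d k))"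
  and fd: "!!k x. x\<in>dal n (S (c k)) ==> f k x\<in>dal n (S' (d k))"
  and nat: "!!k x. x\<in>bal (S (c k)) ==> f (Suc k) (incl \<iota> (c k) (c (Suc k)) x) = incl \<iota>' (d k) (d (Suc k)) (f k x)"
 obtains \<Xi> where "shom A.limB \<Xi>" "!!X. X\<in>A.limB ==> \<Xi> X\<in>B.limB" "!!X. X\<in>A.limA ==> \<Xi> X\<in>B.limA"
  "!!k a. a\<in>bal (S (c k)) ==> \<Xi> (A.emb (c k) a) = B.emb (d k) (f k a)" "!!X. X\<in>A.limB ==> norm (\<Xi> X) <= norm X"
proof -
 have cm: "c k <= c l" if "k <= l" for k l using c(1) that by (simp add: mono_def)
 have dm: "d k <= d l" if "k <= l" for k l using d that by (simp add: strict_mono_less_eq)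
 have nat': "f l (incl \<iota> (c k) (c l) x) = incl \<iota>' (d k) (d l) (f k x)" if "k <= l" "x\<in>bal (S (c k))" for k l x
  using that(1)
 proof (induction l rule: dec_induct)
  case (step l)
  have "incl \<iota> (c k) (c l) x\<in>bal (S (c l))" using A.incl_facts(2)[OF cm] step that by blast
  from nat[OF this] show ?case
   using step cm[OF step(1)] cm[of l "Suc l"] dm[OF step(1)] dm[of l "Suc l"] by (simp add: incl_trans)
 qed simp
 have "EX q. d q <= m & m < d (Suc q)" if "d 0 <= m" for m
 proof -
  define q where "q = (LEAST k. m < d (Suc k))"
  have ex: "m < d (Suc m)" using strict_mono_imp_increasing[OF d, of "Suc m"] by simp
  have "d q <= m"
  proof (cases q)
   case (Suc k)
   then have "~ m < d (Suc k)" using not_less_Least[of k "%k. m < d (Suc k)"] by (simp add: q_def)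
   then show ?thesis using Suc by simp
  qed (use that in simp)
  moreover have "m < d (Suc q)" unfolding q_def by (rule LeastI[of "%k. m < d (Suc k)", OF ex])
  ultimately show ?thesis by blast
 qed
 \<comment> \<open>\<open>d (q m)\<close> is the last of the chosen target stages that is not beyond
   \<open>m\<close>.\<close>
 then obtain q where q: "!!m. d 0 <= m ==> d (q m) <= m & m < d (Suc (q m))" by metis
 have d0: "d 0 <= m" if "d k <= m" for k m using dm[of 0 k] that by simp
 have qge: "k <= q m" if "d k <= m" for k m
 proof -
  have "d k < d (Suc (q m))" using q[OF d0[OF that]] that by linarith
  then show ?thesis using strict_mono_less[OF d] by simp
 qed
 \<comment> \<open>\<open>c (q m)\<close> tends to infinity with \<open>m\<close>, so eventual
   statements about source entries become eventual statements about target entries.\<close>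
 have ev: "EVT m. d 0 <= m & P (c (q m))" if P: "EVT m. P m" for P
 proof -
  obtain N where N: "\<forall>m\<ge>N. P m" using P unfolding eventually_sequentially by blast
  show ?thesis
  proof (rule eventually_sequentiallyI[of "d (Suc N)"])
   fix m assume m: "d (Suc N) <= m"
   then have "Suc N <= Suc (c (q m))" using qge[OF m] c(2) order_trans by blast
   then show "d 0 <= m & P (c (q m))" using N d0[OF m] by simp
  qed
 qed
 \<comment> \<open>The entry at stage \<open>m\<close>: the source entry at index
   \<open>c (q m)\<close> is mapped to stage \<open>d (q m)\<close> and included into stage
   \<open>m\<close>. Before stage \<open>d 0\<close> the entry is 0.\<close>
 define \<Gamma> where "\<Gamma> x m = (if d 0 <= m then incl \<iota>' (d (q m)) m (f (q m) (x (c (q m)))) else 0)" for x m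
 define g where "g m y = incl \<iota>' (d (q m)) m (f (q m) y)" for m y
 have \<Gamma>g: "\<Gamma> x m = (if d 0 <= m then g m (x (c (q m))) else 0)" for x m by (simp add: \<Gamma>_def g_def)
 have gb: "g m y\<in>bal (S' m)" if "d 0 <= m" "y\<in>bal (S (c (q m)))" for m y
  using B.incl_facts(2)[of "d (q m)" m] q[OF that(1)] fb[OF that(2)] by (simp add: g_def)
 have gh: "shom (bal (S (c (q m)))) (g m)" if "d 0 <= m" for m
  using B.incl_facts(1)[of "d (q m)" m] q[OF that] h[of "q m"] fb[of _ "q m"] unfolding shom_def g_def by simp
 have gn: "norm (g m y) <= norm y" if "d 0 <= m" "y\<in>bal (S (c (q m)))" for m y
  by (rule shom_bal_contractive[OF gh[OF that(1)] that(2)])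
 note gD = shomD[OF gh ssub_bal]
 define sb where "sb x <-> bd x & (ALL k. x k\<in>bal (S k))" for x
 have \<Gamma>b: "\<Gamma> x m\<in>bal (S' m)" if "sb x" for x m
  using that gb ssubD(1)[OF ssub_bal] by (simp add: \<Gamma>g sb_def)
 have \<Gamma>bd: "bd (\<Gamma> x)" if x: "sb x" for x
 proof -
  obtain C where C: "C >= 0" "!!k. norm (x k) <= C" using x bdE[of x] unfolding sb_def by blast
  have "norm (\<Gamma> x m) <= C" for m using gn[of m "x (c (q m))"] C x order_trans by (fastforce simp: \<Gamma>g sb_def)
  then show ?thesis by (rule bdI)
 qed
 have \<Gamma>cong: "cls (\<Gamma> x) = cls (\<Gamma> y)" if x: "sb x" and y: "sb y" and xy: "cls x = cls y" for x y
 proof (rule cls_eq_iff[OF \<Gamma>bd[OF x] \<Gamma>bd[OF y], THEN iffD2], rule tendstoI)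
  fix e :: real assume "e > 0"
  moreover have "(%k. x k - y k) \<longlonglongrightarrow> 0" using xy x y cls_eq_iff by (simp add: sb_def)
  ultimately have "EVT k. norm (x k - y k) < e" using tendstoD by fastforce
  then have "EVT m. d 0 <= m & norm (x (c (q m)) - y (c (q m))) < e" by (rule ev)
  then show "EVT m. dist (\<Gamma> x m - \<Gamma> y m) 0 < e"
  proof eventually_elim
   case (elim m)
   have b: "x (c (q m))\<in>bal (S (c (q m)))" "y (c (q m))\<in>bal (S (c (q m)))" using x y by (auto simp: sb_def)
   have "\<Gamma> x m - \<Gamma> y m = g m (x (c (q m)) - y (c (q m)))" using elim gD(7) b by (simp add: \<Gamma>g)
   then show ?case using gn[of m "x (c (q m)) - y (c (q m))"] elim b ssubD(8)[OF ssub_bal] by simp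
  qed
 qed
 define \<Xi> where "\<Xi> X = cls (\<Gamma> (SOME x. X = cls x & sb x))" for X
 have \<Xi>: "\<Xi> (cls x) = cls (\<Gamma> x)" if "sb x" for x
 proof -
  have "EX y. cls x = cls y & sb y" using that by blast
  then have "cls x = cls (SOME y. cls x = cls y & sb y) & sb (SOME y. cls x = cls y & sb y)" by (rule someI_ex)
  then show ?thesis unfolding \<Xi>_def using \<Gamma>cong[OF _ that] by metis
 qed
 have rep: "EX x. sb x & X = cls x" if "X\<in>A.seqs" for X using that by (auto simp: A.seqs_def sb_def)
 have sbo: "sb (%k. x k + y k)" "sb (%k. x k*y k)" "sb (%k. csc e (x k))" "sb (%k. st (x k))" if "sb x" "sb y" for x y e
  using that by (auto simp: sb_def bd_add bd_mult bd_csc bd_st intro: ssubD[OF ssub_bal])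
 have \<Gamma>ops: "\<Gamma> (%k. x k + y k) = (%m. \<Gamma> x m + \<Gamma> y m)" "\<Gamma> (%k. x k*y k) = (%m. \<Gamma> x m*\<Gamma> y m)"
  "\<Gamma> (%k. csc e (x k)) = (%m. csc e (\<Gamma> x m))" "\<Gamma> (%k. st (x k)) = (%m. st (\<Gamma> x m))" if "sb x" "sb y" for x y e
  using that gD(1-4) by (auto simp: fun_eq_iff \<Gamma>g sb_def)
 have hs: "shom A.seqs \<Xi>" unfolding shom_def
 proof (intro conjI ballI allI)
  fix X Y assume "X\<in>A.seqs" "Y\<in>A.seqs"
  then obtain x y where x: "sb x" "X = cls x" and y: "sb y" "Y = cls y" using rep by metis
  have b: "bd x" "bd y" "bd (\<Gamma> x)" "bd (\<Gamma> y)" using x y \<Gamma>bd by (auto simp: sb_def)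
  show "\<Xi> (X + Y) = \<Xi> X + \<Xi> Y" "\<Xi> (X*Y) = \<Xi> X*\<Xi> Y"
   using \<Xi>[OF sbo(1)[OF x(1) y(1)]] \<Xi>[OF sbo(2)[OF x(1) y(1)]] \<Gamma>ops(1,2)[OF x(1) y(1)]
   by (simp_all add: x y cls_simps b \<Xi>)
 next
  fix e X assume "X\<in>A.seqs"
  then obtain x where x: "sb x" "X = cls x" using rep by metis
  have b: "bd x" "bd (\<Gamma> x)" using x \<Gamma>bd by (auto simp: sb_def)
  show "\<Xi> (csc e X) = csc e (\<Xi> X)" using \<Xi>[OF sbo(3)[OF x(1) x(1)]] \<Gamma>ops(3)[OF x(1) x(1)] by (simp add: x cls_simps b \<Xi>)
  show "\<Xi> (st X) = st (\<Xi> X)" using \<Xi>[OF sbo(4)[OF x(1) x(1)]] \<Gamma>ops(4)[OF x(1) x(1)] by (simp add: x cls_simps b \<Xi>)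
 qed
 note xD = shomD[OF hs A.ssub_seqs]
 have nrm: "norm (\<Xi> X) <= norm X" if X: "X\<in>A.seqs" for X
 proof (rule field_le_epsilon)
  fix e :: real assume e: "e > 0"
  obtain x where x: "sb x" "X = cls x" using rep[OF X] by metis
  have "EVT k. norm (x k) < norm X + e" using x e norm_cls_less[of x "norm X + e"] by (simp add: sb_def)
  from ev[OF this] have "EVT m. norm (\<Gamma> x m) <= norm X + e"
  proof eventually_elim
   case (elim m)
   then show ?case using gn[of m "x (c (q m))"] x by (simp add: \<Gamma>g sb_def)
  qed
  then show "norm (\<Xi> X) <= norm X + e" using norm_cls_le \<Xi>[OF x(1)] x(2) by metis
 qed
 have emb: "\<Xi> (A.emb (c k) a) = B.emb (d k) (f k a)" if a: "a\<in>bal (S (c k))" for k a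
 proof -
  have sbe: "sb (A.eseq (c k) a)" using A.eseq_bal[OF a] A.eseq_bd[OF a] by (simp add: sb_def)
  have "cls (\<Gamma> (A.eseq (c k) a)) = B.emb (d k) (f k a)"
  proof (rule B.cls_emb_eq[OF \<Gamma>bd[OF sbe] fb[OF a], of "d k"])
   fix m assume m: "d k <= m"
   have kq: "k <= q m" by (rule qge[OF m])
   then have "A.eseq (c k) a (c (q m)) = incl \<iota> (c k) (c (q m)) a" using cm[OF kq] by (simp add: A.eseq_def)
   then have "\<Gamma> (A.eseq (c k) a) m = incl \<iota>' (d (q m)) m (incl \<iota>' (d k) (d (q m)) (f k a))"
    using d0[OF m] nat'[OF kq a] by (simp add: \<Gamma>_def)
   then show "\<Gamma> (A.eseq (c k) a) m = incl \<iota>' (d k) m (f k a)" using dm[OF kq] q[OF d0[OF m]] by (simp add: incl_trans)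
  qed
  then show ?thesis using \<Xi>[OF sbe] by (simp add: A.emb_def)
 qed
 have seqs: "\<Xi> X\<in>B.seqs" if X: "X\<in>A.seqs" for X
 proof -
  obtain x where x: "sb x" "X = cls x" using rep[OF X] by metis
  then show ?thesis using B.seqsI[OF \<Gamma>bd[OF x(1)] \<Gamma>b[OF x(1)]] \<Xi>[OF x(1)] by simp
 qed
 have approx: "norm (\<Xi> X - B.emb (d k) (f k a)) < e" if "X\<in>A.seqs" "a\<in>bal (S (c k))" "norm (X - A.emb (c k) a) < e" for X k a e
 proof -
  have s: "A.emb (c k) a\<in>A.seqs" by (rule A.emb_seqs[OF that(2)])
  have "norm (\<Xi> (X - A.emb (c k) a)) <= norm (X - A.emb (c k) a)" by (rule nrm) (rule ssubD(8)[OF A.ssub_seqs that(1) s])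
  then show ?thesis using xD(7)[OF that(1) s] emb[OF that(2)] that(3) by simp
 qed
 have late: "K <= c (Suc K)" for K using c(2)[of "Suc K"] by simp
 show thesis
 proof (rule that[of \<Xi>])
  show "shom A.limB \<Xi>" using hs A.limB_seqs unfolding shom_def by blast
  show "norm (\<Xi> X) <= norm X" if "X\<in>A.limB" for X using nrm A.limB_seqs that by blast
  show "\<Xi> (A.emb (c k) a) = B.emb (d k) (f k a)" if "a\<in>bal (S (c k))" for k a by (rule emb[OF that])
  show "\<Xi> X\<in>B.limB" if X: "X\<in>A.limB" for X
  proof (rule B.limB_I)
   show "\<Xi> X\<in>B.seqs" by (rule seqs[OF A.limB_seqs[OF X]])
   fix e :: real assume "e > 0"
   then obtain K a where a: "a\<in>bal (S K)" "norm (X - A.emb K a) < e" using A.limB_approx[OF X] by blast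
   let ?b = "incl \<iota> K (c (Suc K)) a"
   have b: "?b\<in>bal (S (c (Suc K)))" using A.incl_facts(2)[OF late a(1)] .
   show "\<exists>K. \<exists>a\<in>bal (S' K). norm (\<Xi> X - B.emb K a) < e"
    using approx[OF A.limB_seqs[OF X] b A.approx_later[OF a late]] fb[OF b] by blast
  qed
  show "\<Xi> X\<in>B.limA" if X: "X\<in>A.limA" for X
  proof (rule B.limA_I)
   have XB: "X\<in>A.seqs" using A.limB_seqs A.limA_limB X by blast
   show "\<Xi> X\<in>B.seqs" by (rule seqs[OF XB])
   fix e :: real assume "e > 0"
   then obtain K a where a: "a\<in>dal n (S K)" "norm (X - A.emb K a) < e" using A.limA_approx[OF X] by blast
   let ?b = "incl \<iota> K (c (Suc K)) a"
   have b: "?b\<in>dal n (S (c (Suc K)))" using A.incl_facts(3)[OF late a(1)] .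
   show "\<exists>K. \<exists>a\<in>dal n (S' K). norm (\<Xi> X - B.emb K a) < e"
    using approx[OF XB dal_bal[OF b] A.approx_later[OF dal_bal[OF a(1)] a(2) late]] fd[OF b] by blast
  qed
 qed
qed

lemma (in tower) limB_id:
 assumes h: "shom limB \<Theta>" and nrm: "!!X. X\<in>limB ==> norm (\<Theta> X) <= norm X"
  and c: "!!k. k <= Suc (c k)" and emb: "!!k a. a\<in>bal (S (c k)) ==> \<Theta> (emb (c k) a) = emb (c k) a" and X: "X\<in>limB"
 shows "\<Theta> X = X"
proof -
 have "norm (\<Theta> X - X) <= 0 + e" if e: "e > 0" for e
 proof -
  obtain K a0 where a0: "a0\<in>bal (S K)" "norm (X - emb K a0) < e / 2" using limB_approx[OF X, of "e / 2"] e by auto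
  have late: "K <= c (Suc K)" using c[of "Suc K"] by simp
  define a where "a = incl \<iota> K (c (Suc K)) a0"
  have a: "a\<in>bal (S (c (Suc K)))" "norm (X - emb (c (Suc K)) a) < e / 2"
   using incl_facts(2)[OF late a0(1)] approx_later[OF a0 late] by (auto simp: a_def)
  let ?E = "emb (c (Suc K)) a"
  have "norm (\<Theta> (X - ?E)) <= norm (X - ?E)" by (rule nrm) (rule ssubD(8)[OF ssub_limB X emb_limB[OF a(1)]])
  moreover have "\<Theta> (X - ?E) = \<Theta> X - ?E" using shomD(7)[OF h ssub_limB X emb_limB[OF a(1)]] emb[OF a(1)] by simp
  moreover have "\<Theta> X - X = (\<Theta> X - ?E) - (X - ?E)" by simp
  ultimately show ?thesis using a(2) norm_triangle_ineq4[of "\<Theta> X - ?E" "X - ?E"] by simp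
 qed
 then have "norm (\<Theta> X - X) <= 0" by (rule field_le_epsilon)
 then show ?thesis by simp
qed

text \<open>The squares commute on \<open>dal\<close> and hence, by \<open>hom_unique\<close>, on
  \<open>bal\<close>. \<open>lim_map\<close> turns both rows of maps into contractive homomorphisms
  of the limits. Their composites fix the embedded stages, which are dense.\<close>

lemma (in two_towers) limits_isomorphic:
 fixes M l :: "nat => nat" and \<Phi> \<Psi> :: "nat => cm => cm"
 assumes M: "M 0 = 0" "strict_mono (%k. M (Suc k))" and l: "strict_mono l"
  and \<Phi>: "!!k. cemb n (S (M k)) (S' (l k)) (\<Phi> k)" and \<Psi>: "!!k. cemb n (S' (l k)) (S (M (Suc k))) (\<Psi> k)"
  and \<Psi>\<Phi>: "!!k x. x\<in>dal n (S (M k)) ==> \<Psi> k (\<Phi> k x) = incl \<iota> (M k) (M (Suc k)) x"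
  and \<Phi>\<Psi>: "!!k y. y\<in>dal n (S' (l k)) ==> \<Phi> (Suc k) (\<Psi> k y) = incl \<iota>' (l k) (l (Suc k)) y"
 shows "\<exists>\<Xi>. shom A.limB \<Xi> & bij_betw \<Xi> A.limB B.limB & \<Xi> ` A.limA = B.limA"
proof -
 have n1: "n >= 1" using A.n3 by simp
 have f: "shom (bal (S (M k))) (\<Phi> k)" "x\<in>bal (S (M k)) ==> \<Phi> k x\<in>bal (S' (l k))"
  "x\<in>dal n (S (M k)) ==> \<Phi> k x\<in>dal n (S' (l k))" for k x using \<Phi>[of k] by (auto simp: cemb_def)
 have g: "shom (bal (S' (l k))) (\<Psi> k)" "y\<in>bal (S' (l k)) ==> \<Psi> k y\<in>bal (S (M (Suc k)))"
  "y\<in>dal n (S' (l k)) ==> \<Psi> k y\<in>dal n (S (M (Suc k)))" for k y using \<Psi>[of k] by (auto simp: cemb_def)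
 have M1: "M k <= M (Suc k)" for k using M strict_mono_less_eq[OF M(2), of "k - 1" k] by (cases k) auto
 \<comment> \<open>\<open>M\<close> increases strictly only from index 1 on, and M 0 = M 1 = 0 is
   possible; hence the successor.\<close>
 have Mk: "k <= Suc (M k)" for k using strict_mono_imp_increasing[OF M(2), of "k - 1"] by (cases k) auto
 have l1: "l k <= l (Suc k)" for k using l by (simp add: strict_mono_less_eq)
 have sh: "shom (bal (S (M k))) (%x. \<Psi> k (\<Phi> k x))" "shom (bal (S' (l k))) (%x. \<Phi> (Suc k) (\<Psi> k x))" for k
  using f(1)[of k] f(1)[of "Suc k"] g(1)[of k] f(2)[of _ k] g(2)[of _ k] unfolding shom_def by simp_all
 have gf: "\<Psi> k (\<Phi> k x) = incl \<iota> (M k) (M (Suc k)) x" if "x\<in>bal (S (M k))" for k x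
  by (rule hom_unique[OF A.stage n1 sh(1) A.incl_facts(1)[OF M1] \<Psi>\<Phi> that])
 have fg: "\<Phi> (Suc k) (\<Psi> k y) = incl \<iota>' (l k) (l (Suc k)) y" if "y\<in>bal (S' (l k))" for k y
  by (rule hom_unique[OF B.stage n1 sh(2) B.incl_facts(1)[OF l1] \<Phi>\<Psi> that])
 obtain \<Xi> where X: "shom A.limB \<Xi>" "!!X. X\<in>A.limB ==> \<Xi> X\<in>B.limB" "!!X. X\<in>A.limA ==> \<Xi> X\<in>B.limA"
  "!!k a. a\<in>bal (S (M k)) ==> \<Xi> (A.emb (M k) a) = B.emb (l k) (\<Phi> k a)"
  "!!X. X\<in>A.limB ==> norm (\<Xi> X) <= norm X"
 proof (rule lim_map[of M l \<Phi>])
  show "mono M" by (rule mono_iff_le_Suc[THEN iffD2]) (use M1 in auto)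
  show "\<Phi> (Suc k) (incl \<iota> (M k) (M (Suc k)) x) = incl \<iota>' (l k) (l (Suc k)) (\<Phi> k x)" if "x\<in>bal (S (M k))" for k x
   using gf[OF that] fg[OF f(2)[OF that]] by simp
 qed (use Mk l f in auto)
 interpret R: two_towers n S' S \<iota>' \<iota> by unfold_locales
 obtain \<Upsilon> where Y: "shom B.limB \<Upsilon>" "!!X. X\<in>B.limB ==> \<Upsilon> X\<in>A.limB" "!!X. X\<in>B.limA ==> \<Upsilon> X\<in>A.limA"
  "!!k a. a\<in>bal (S' (l k)) ==> \<Upsilon> (B.emb (l k) a) = A.emb (M (Suc k)) (\<Psi> k a)"
  "!!X. X\<in>B.limB ==> norm (\<Upsilon> X) <= norm X"
 proof (rule R.lim_map[of l "%k. M (Suc k)" \<Psi>])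
  show "mono l" using l by (rule strict_mono_mono)
  show "k <= Suc (l k)" for k using strict_mono_imp_increasing[OF l, of k] by simp
  show "\<Psi> (Suc k) (incl \<iota>' (l k) (l (Suc k)) x) = incl \<iota> (M (Suc k)) (M (Suc (Suc k))) (\<Psi> k x)" if "x\<in>bal (S' (l k))" for k x
   using fg[OF that] gf[OF g(2)[OF that]] by simp
 qed (use M(2) g in auto)
 have YX: "\<Upsilon> (\<Xi> Z) = Z" if "Z\<in>A.limB" for Z
 proof (rule A.limB_id[where \<Theta> = "%Z. \<Upsilon> (\<Xi> Z)", OF _ _ Mk _ that])
  show "shom A.limB (%Z. \<Upsilon> (\<Xi> Z))" using X(1,2) Y(1) unfolding shom_def by simp
  show "norm (\<Upsilon> (\<Xi> Z)) <= norm Z" if "Z\<in>A.limB" for Z using X(2,5)[OF that] Y(5) order_trans by blast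
  show "\<Upsilon> (\<Xi> (A.emb (M k) a)) = A.emb (M k) a" if "a\<in>bal (S (M k))" for k a
   using X(4)[OF that] Y(4)[OF f(2)[OF that]] gf[OF that] A.emb_incl[OF M1 that] by simp
 qed
 have lk: "k <= Suc (l (Suc k))" for k using strict_mono_imp_increasing[OF l, of "Suc k"] by simp
 have XY: "\<Xi> (\<Upsilon> Z) = Z" if "Z\<in>B.limB" for Z
 proof (rule B.limB_id[where \<Theta> = "%Z. \<Xi> (\<Upsilon> Z)" and c = l, OF _ _ _ _ that])
  show "k <= Suc (l k)" for k using strict_mono_imp_increasing[OF l, of k] by simp
  show "shom B.limB (%Z. \<Xi> (\<Upsilon> Z))" using Y(1,2) X(1) unfolding shom_def by simp
  show "norm (\<Xi> (\<Upsilon> Z)) <= norm Z" if "Z\<in>B.limB" for Z using Y(2,5)[OF that] X(5) order_trans by blast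
  show "\<Xi> (\<Upsilon> (B.emb (l k) a)) = B.emb (l k) a" if "a\<in>bal (S' (l k))" for k a
   using Y(4)[OF that] X(4)[OF g(2)[OF that]] fg[OF that] B.emb_incl[OF l1 that] by simp
 qed
 have "bij_betw \<Xi> A.limB B.limB" by (rule bij_betw_byWitness[where f' = \<Upsilon>]) (use X(2) Y(2) XY YX in auto)
 moreover have "\<Xi> ` A.limA = B.limA"
 proof (intro equalityI subsetI)
  fix Z assume Z: "Z\<in>B.limA"
  then show "Z\<in>\<Xi> ` A.limA" using XY[OF B.limA_limB[OF Z]] Y(3)[OF Z] by (metis imageI)
 qed (use X(3) in auto)
 ultimately show ?thesis using X(1) by blast
qed

lemma (in mtower) incl_alg:
 assumes "k <= m" "X\<in>dsum_alg (G k)"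
 shows "incl \<iota> k m X = frc (sz (S m)) (incl inc k m (toc X))" "toc X\<in>bal (S k)" "toc X\<in>dal n (S k)"
proof -
 have c: "X\<in>car (B k)" using toc_image(3) assms(2) by blast
 show "incl \<iota> k m X = frc (sz (S m)) (incl inc k m (toc X))" using incl_toc[OF assms(1) c] frc_toc by (metis B_car)
 show "toc X\<in>bal (S k)" "toc X\<in>dal n (S k)" using c assms(2) rep_alg[OF n1 rep rep] by (auto simp: B_car)
qed

lemma comp_eq:
 assumes n: "n >= 1" and S: "rep n Gs S" and T: "rep n Hs T" and c: "cemb n S T \<Phi>" "cemb n T U \<Psi>"
  and \<phi>: "!!X. X\<in>dsum_alg Gs ==> \<phi> X = frc (sz T) (\<Phi> (toc X))"
  and \<psi>: "!!X. X\<in>dsum_alg Hs ==> \<psi> X = frc (sz U) (\<Psi> (toc X))"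
  and eq: "!!X. X\<in>dsum_alg Gs ==> \<psi> (\<phi> X) = frc (sz U) (I (toc X))"
  and I: "!!x. x\<in>dal n S ==> I x\<in>bal U" and x: "x\<in>dal n S" shows "\<Psi> (\<Phi> x) = I x"
proof -
 let ?X = "frc (sz S) x"
 have X: "?X\<in>dsum_alg Gs" "toc ?X = x" using rep_frc[OF n S S] x dal_bal[OF x] by blast+
 have d: "\<Phi> x\<in>dal n T" using c(1) x by (auto simp: cemb_def)
 have "\<phi> ?X\<in>dsum_alg Hs" "toc (\<phi> ?X) = \<Phi> x"
  using \<phi>[OF X(1)] X(2) rep_frc[OF n T T] d dal_bal[OF d] by auto
 then have "frc (sz U) (\<Psi> (\<Phi> x)) = frc (sz U) (I x)" using \<psi> eq[OF X(1)] X(2) by metis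
 moreover have "\<Psi> (\<Phi> x)\<in>bal U" using c(2) dal_bal[OF d] by (auto simp: cemb_def)
 ultimately show ?thesis using I[OF x] toc_frc bnd_bal by metis
qed

theorem theorem3p3:
  fixes n :: nat
    and G G' :: "nat \<Rightarrow> digraph list"
    and \<iota> \<iota>' :: "nat \<Rightarrow> complex mat \<Rightarrow> complex mat"
  assumes "n \<ge> 3"
    and "rigid_tower n G \<iota>"
    and "rigid_tower n G' \<iota>'"
  shows "star_ext_isomorphic (tower_cstar G \<iota>) (tower_limit G \<iota>)
           (tower_cstar G' \<iota>') (tower_limit G' \<iota>') \<longleftrightarrow>
    (\<exists>(m :: nat \<Rightarrow> nat) (l :: nat \<Rightarrow> nat)
       (\<phi> :: nat \<Rightarrow> complex mat \<Rightarrow> complex mat) (\<psi> :: nat \<Rightarrow> complex mat \<Rightarrow> complex mat).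
       strict_mono m \<and> strict_mono l \<and>
       rigid n (G 0) (G' (l 0)) (\<phi> 0) \<and>
       (\<forall>k. rigid n (G' (l k)) (G (m k)) (\<psi> k)) \<and>
       (\<forall>k. rigid n (G (m k)) (G' (l (Suc k))) (\<phi> (Suc k))) \<and>
       (\<forall>x\<in>dsum_alg (G 0). \<psi> 0 (\<phi> 0 x) = incl \<iota> 0 (m 0) x) \<and>
       (\<forall>k. \<forall>x\<in>dsum_alg (G (m k)). \<psi> (Suc k) (\<phi> (Suc k) x) = incl \<iota> (m k) (m (Suc k)) x) \<and>
       (\<forall>k. \<forall>y\<in>dsum_alg (G' (l k)). \<phi> (Suc k) (\<psi> k y) = incl \<iota>' (l k) (l (Suc k)) y))"
    (is "?iso <-> ?diagram")
proof -
 have n1: "n >= 1" using assms(1) by simp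
 have "\<exists>S. rep n (G k) S" "\<exists>S. rep n (G' k) S" for k
  using assms(2,3) rep_ex[of "G k" n] rep_ex[of "G' k" n] by (auto simp: rigid_tower_def is_cycle_sum_def)
 then obtain S S' where rep: "!!k. rep n (G k) (S k)" and rep': "!!k. rep n (G' k) (S' k)" by metis
 interpret A: mtower n G \<iota> S using assms rep by unfold_locales
 interpret B: mtower n G' \<iota>' S' using assms rep' by unfold_locales
 have iso: "?iso <-> (\<exists>\<Xi>. shom A.limB \<Xi> & bij_betw \<Xi> A.limB B.limB & \<Xi> ` A.limA = B.limA)"
  by (rule star_ext_isomorphic_iff) unfold_locales
 note inclA = A.incl_alg and inclB = B.incl_alg
 show ?thesis
 proof
  assume ?iso
  then obtain \<Xi> where X: "shom A.limB \<Xi>" "bij_betw \<Xi> A.limB B.limB" "\<Xi> ` A.limA = B.limA" using iso by blast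
  define \<Upsilon> where "\<Upsilon> = inv_into A.limB \<Xi>"
  note xD = shomD[OF X(1) A.ssub_limB]
  have XB: "\<Xi> Z\<in>B.limB" if "Z\<in>A.limB" for Z using X(2) that by (auto simp: bij_betw_def)
  have YB: "\<Upsilon> Z\<in>A.limB" "\<Xi> (\<Upsilon> Z) = Z" if "Z\<in>B.limB" for Z
   using X(2) that by (auto simp: bij_betw_def \<Upsilon>_def inv_into_into f_inv_into_f)
  have YX: "\<Upsilon> (\<Xi> Z) = Z" if "Z\<in>A.limB" for Z using X(2) that by (auto simp: bij_betw_def \<Upsilon>_def)
  have "shom B.limB \<Upsilon>" unfolding shom_def
  proof (intro conjI ballI allI)
   fix Z W assume Z: "Z\<in>B.limB" and W: "W\<in>B.limB"
   note y = YB[OF Z] YB[OF W]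
   show "\<Upsilon> (Z + W) = \<Upsilon> Z + \<Upsilon> W" using YX[OF ssubD(2)[OF A.ssub_limB y(1,3)]] xD(1)[OF y(1,3)] y by simp
   show "\<Upsilon> (Z*W) = \<Upsilon> Z*\<Upsilon> W" using YX[OF ssubD(3)[OF A.ssub_limB y(1,3)]] xD(2)[OF y(1,3)] y by simp
  next
   fix c Z assume Z: "Z\<in>B.limB"
   note y = YB[OF Z]
   show "\<Upsilon> (csc c Z) = csc c (\<Upsilon> Z)" using YX[OF ssubD(4)[OF A.ssub_limB y(1)]] xD(3)[OF y(1)] y by simp
   show "\<Upsilon> (st Z) = st (\<Upsilon> Z)" using YX[OF ssubD(5)[OF A.ssub_limB y(1)]] xD(4)[OF y(1)] y by simp
  qed
  moreover have "\<Upsilon> Z\<in>A.limA" if "Z\<in>B.limA" for Z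
  proof -
   obtain W where "W\<in>A.limA" "Z = \<Xi> W" using X(3) \<open>Z\<in>B.limA\<close> by blast
   then show ?thesis using YX[OF A.limA_limB] by simp
  qed
  ultimately interpret tower_iso n S A.inc S' B.inc \<Xi> \<Upsilon> using X XB YB YX by unfold_locales auto
  obtain M l \<phi> \<psi> where M: "M 0 = 0" "strict_mono M" and l: "strict_mono l"
   and \<phi>: "!!i. nf n (S (M i)) (S' (l i)) (\<phi> i)" and \<psi>: "!!i. nf n (S' (l i)) (S (M (Suc i))) (\<psi> i)"
   and \<psi>\<phi>: "!!i x. x\<in>bal (S (M i)) ==> \<psi> i (\<phi> i x) = incl A.inc (M i) (M (Suc i)) x"
   and \<phi>\<psi>: "!!i y. y\<in>bal (S' (l i)) ==> \<phi> (Suc i) (\<psi> i y) = incl B.inc (l i) (l (Suc i)) y"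
   using intertwining by metis
  define \<phi>' where "\<phi>' i X = frc (sz (S' (l i))) (\<phi> i (toc X))" for i X
  define \<psi>' where "\<psi>' i X = frc (sz (S (M (Suc i)))) (\<psi> i (toc X))" for i X
  have t: "toc (\<phi>' i X) = \<phi> i (toc X)" if "toc X\<in>bal (S (M i))" for i X
   using nf_cemb[OF \<phi>, of i] that unfolding \<phi>'_def by (intro toc_frc bnd_bal) (auto simp: cemb_def)
  have t': "toc (\<psi>' i X) = \<psi> i (toc X)" if "toc X\<in>bal (S' (l i))" for i X
   using nf_cemb[OF \<psi>, of i] that unfolding \<psi>'_def by (intro toc_frc bnd_bal) (auto simp: cemb_def)
  have r: "rigid n (G (M i)) (G' (l i)) (\<phi>' i)" for i by (rule rigid_of_nf[OF n1 rep rep' \<phi>]) (simp add: \<phi>'_def)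
  have r': "rigid n (G' (l i)) (G (M (Suc i))) (\<psi>' i)" for i by (rule rigid_of_nf[OF n1 rep' rep \<psi>]) (simp add: \<psi>'_def)
  have Mm: "M i <= M (Suc i)" "l i <= l (Suc i)" for i using M l by (simp_all add: strict_mono_less_eq)
  have e: "\<psi>' i (\<phi>' i X) = incl \<iota> (M i) (M (Suc i)) X" if "X\<in>dsum_alg (G (M i))" for i X
   using inclA[OF Mm(1) that] t[of X i] \<psi>\<phi> by (simp add: \<psi>'_def)
  have e': "\<phi>' (Suc i) (\<psi>' i X) = incl \<iota>' (l i) (l (Suc i)) X" if "X\<in>dsum_alg (G' (l i))" for i X
   using inclB[OF Mm(2) that] t'[of X i] \<phi>\<psi> by (simp add: \<phi>'_def)
  have "strict_mono (%k. M (Suc k))" using M(2) by (simp add: strict_mono_def)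
  then show ?diagram using l r[of 0] r[of "Suc _"] r' e[of _ 0] e[of _ "Suc _"] e' M(1)
   by (intro exI[of _ "%k. M (Suc k)"] exI[of _ l] exI[of _ \<phi>'] exI[of _ \<psi>']) auto
 next
  assume ?diagram
  then obtain m l \<phi> \<psi> where m: "strict_mono m" and l: "strict_mono l"
   and r: "rigid n (G 0) (G' (l 0)) (\<phi> 0)" "!!k. rigid n (G (m k)) (G' (l (Suc k))) (\<phi> (Suc k))"
    "!!k. rigid n (G' (l k)) (G (m k)) (\<psi> k)"
   and e: "!!x. x\<in>dsum_alg (G 0) ==> \<psi> 0 (\<phi> 0 x) = incl \<iota> 0 (m 0) x"
    "!!k x. x\<in>dsum_alg (G (m k)) ==> \<psi> (Suc k) (\<phi> (Suc k) x) = incl \<iota> (m k) (m (Suc k)) x"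
    "!!k y. y\<in>dsum_alg (G' (l k)) ==> \<phi> (Suc k) (\<psi> k y) = incl \<iota>' (l k) (l (Suc k)) y" by blast
  \<comment> \<open>The diagram starts with a map on stage 0, so the sequence \<open>m\<close> is
    preceded by 0.\<close>
  define M where "M k = (case k of 0 => 0 | Suc i => m i)" for k
  have M [simp]: "M 0 = 0" "M (Suc i) = m i" for i by (auto simp: M_def)
  have rM: "rigid n (G (M k)) (G' (l k)) (\<phi> k)" for k using r(1,2) by (cases k) auto
  have eM: "\<psi> k (\<phi> k x) = incl \<iota> (M k) (M (Suc k)) x" if "x\<in>dsum_alg (G (M k))" for k x
   using e(1,2) that by (cases k) auto
  have "ALL k. \<exists>\<Phi>. cemb n (S (M k)) (S' (l k)) \<Phi> & (\<forall>X\<in>dsum_alg (G (M k)). \<phi> k X = frc (sz (S' (l k))) (\<Phi> (toc X)))"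
   using rM embedding_iff[OF n1 rep rep'] unfolding rigid_def by blast
  then obtain \<Phi> where \<Phi>: "!!k. cemb n (S (M k)) (S' (l k)) (\<Phi> k)"
   "!!k X. X\<in>dsum_alg (G (M k)) ==> \<phi> k X = frc (sz (S' (l k))) (\<Phi> k (toc X))" by metis
  have "ALL k. \<exists>\<Psi>. cemb n (S' (l k)) (S (M (Suc k))) \<Psi> & (\<forall>X\<in>dsum_alg (G' (l k)). \<psi> k X = frc (sz (S (M (Suc k)))) (\<Psi> (toc X)))"
   using r(3) embedding_iff[OF n1 rep' rep] unfolding rigid_def M by blast
  then obtain \<Psi> where \<Psi>: "!!k. cemb n (S' (l k)) (S (M (Suc k))) (\<Psi> k)"
   "!!k X. X\<in>dsum_alg (G' (l k)) ==> \<psi> k X = frc (sz (S (M (Suc k)))) (\<Psi> k (toc X))" by metis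
  have M1: "M k <= M (Suc k)" and l1: "l k <= l (Suc k)" for k using m l by (cases k; simp add: strict_mono_less_eq)+
  have "\<exists>\<Xi>. shom A.limB \<Xi> & bij_betw \<Xi> A.limB B.limB & \<Xi> ` A.limA = B.limA"
  proof (rule two_towers.limits_isomorphic[of n S S' A.inc B.inc M l \<Phi> \<Psi>])
   show "two_towers n S S' A.inc B.inc" by unfold_locales
   fix k
   show "\<Psi> k (\<Phi> k x) = incl A.inc (M k) (M (Suc k)) x" if "x\<in>dal n (S (M k))" for x
    by (rule comp_eq[OF n1 rep rep' \<Phi>(1) \<Psi>(1) \<Phi>(2) \<Psi>(2) _ A.incl_facts(2)[OF M1 dal_bal] that])
     (auto simp: eM inclA(1)[OF M1, simplified])
   show "\<Phi> (Suc k) (\<Psi> k y) = incl B.inc (l k) (l (Suc k)) y" if "y\<in>dal n (S' (l k))" for y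
    by (rule comp_eq[OF n1 rep' rep \<Psi>(1) \<Phi>(1) \<Psi>(2) \<Phi>(2) _ B.incl_facts(2)[OF l1 dal_bal] that])
     (auto simp: e(3) inclB(1)[OF l1])
  qed (use m l \<Phi>(1) \<Psi>(1) in auto)
  then show ?iso using iso by blast
 qed
qed

end
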